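(* Consider any work-conserving discrete-time single-server queue with nonpreemptive services, fed by $K$ independent batch Markovian arrival streams as described in the context, with $\rho=\sum_{k=1}^K\rho_k<1$ and in steady state. Then the mean waiting times $\mathrm{E}[W_k]$ of class $k$ customers ($k\in\mathcal{K}$) in steady state satisfy $$\begin{aligned} \sum_{k\in\mathcal{K}}\rho_k\mathrm{E}[W_k] ={}&\frac{\rho\sum_{k\in\mathcal{K}}\rho_k\mathrm{E}[\tilde H_k]}{1-\rho} +\frac{\sum_{k\in\mathcal{K}}\rho_k(\rho-\rho_k)}{2(1-\rho)} +\frac{\sum_{k\in\mathcal{K}}\rho_k\mathrm{E}[H_k]\left(\mathrm{E}[\tilde\Lambda_k]-\pi_k^{[\mathrm{on}]}\frac{\mathrm{E}[C_k\Lambda_k]}{\mathrm{E}[C_k]}\right)}{1-\rho}\\ &+\sum_{k\in\mathcal{K}}\pi_k^{[\mathrm{on}]}\rho_k\left(1+\frac{\rho_k}{1-\rho}\right)\left(1+\mathrm{E}[\tilde C_k]\right) -\sum_{k\in\mathcal{K}}\pi_k^{[\mathrm{on}]}\mathrm{E}[H_k]\,\mathrm{E}[\Lambda_k(\tilde C_k)]. \end{aligned}$$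
   Context: Conventions. $f^{(n)}$ denotes the $n$th derivative of $f(z)$ (scalar, vector or matrix) at $z=1-$. For a nonnegative integer random variable $F$, $\tilde F$ denotes its equilibrium version, $\Pr(\tilde F=n)=\Pr(F>n)/\mathrm{E}[F]$ ($n\ge 0$), so $\mathrm{E}[\tilde F]=\mathrm{E}[F(F-1)]/(2\mathrm{E}[F])$. $\mathcal{K}=\{1,\dots,K\}$. Arrivals. Time is slotted, and customers from the $k$th stream are called class $k$. The $K$ streams are mutually independent. Stream $k$ is governed by an irreducible Markov chain $\{S_{k,n}\}_{n\ge0}$ on $\{0,1,\dots,M_k\}$, $M_k\ge1$, with transition matrix $$\boldsymbol P_k=\begin{pmatrix}p_k&(1-p_k)\boldsymbol\alpha_k\\(\boldsymbol I_k-\boldsymbol T_k)\boldsymbol e_k&\boldsymbol T_k\end{pmatrix},$$ where $0\le p_k<1$, $\boldsymbol\alpha_k$ is a $1\times M_k$ probability vector, $\boldsymbol T_k$ is an $M_k\times M_k$ substochastic matrix, $\boldsymbol I_k$ is the identity, and $\boldsymbol e_k$ is the all-ones column vector of size $M_k$. The number $A_{k,n}$ of class $k$ customers arriving at slot $n\ge1$ depends only on $(S_{k,n-1},S_{k,n})$ (through a time-homogeneous conditional law), and $S_{k,n}=0\Leftrightarrow A_{k,n}=0$, $S_{k,n}\in\{1,\dots,M_k\}\Leftrightarrow A_{k,n}\ge1$. Put $a_{k,i,j}(z)=\mathrm{E}[z^{A_{k,n}}\mid S_{k,n-1}=i,S_{k,n}=j]$, and let $\boldsymbol\alpha_k(z)$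 and $\boldsymbol T_k(z)$ have entries $\alpha_{k,j}a_{k,0,j}(z)$ and $T_{k,i,j}a_{k,i,j}(z)$ ($i,j\in\{1,\dots,M_k\}$). Stream $k$ is active at slot $n$ if $S_{k,n}\ne0$ and idle otherwise. Service. Service times of class $k$ customers are i.i.d. positive-integer-valued random variables, distributed as $H_k$, independent of arrivals and of the other classes. With $B_n$ the total work (sum of service times) arriving at slot $n$, the total unfinished work satisfies $X_n=\max(X_{n-1}-1,0)+B_n$ (work conservation); thus $X_n$ is counted just after the arrivals of slot $n$ and, if $X_n>0$, one unit of work is served in slot $n$. The buffer is infinite. Nonpreemptive means that a service, once started, continues without interruption to completion. The order of services is independent of service times: deciding which waiting customer starts service does not use the service times of customers that have not started. The waiting time $W_k$ of a randomly chosen class $k$ customer is the number of slots from its arrival slot to the slot in which its service starts (zero if service starts in the arrival slot). Quantities. $C_k$ is the length of a randomly chosen active period of stream $k$ and $\Lambda_k$ the total number of class $k$ customers arriving in that active period; their joint generating function is $\mathrm{E}[z^{C_k}\omega^{\Lambda_k}]=z\boldsymbol\alpha_k(\omega)[\boldsymbol I_k-z\boldsymbol T_k(\omega)]^{-1}(\boldsymbol I_k-\boldsymbol T_k)\boldsymbol e_k$. In particular $\mathrm{E}[C_k]=\boldsymbol\alpha_k(\boldsymbol I_k-\boldsymbol T_k)^{-1}\boldsymbol e_k$ and $\mathrm{E}[\Lambda_k]=\boldsymbol\alpha_k^{(1)}\boldsymbol e_k+\boldsymbol\alpha_k(\boldsymbol I_k-\boldsymbol T_k)^{-1}\boldsymbol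 T_k^{(1)}\boldsymbol e_k$. $\Lambda_k(\tilde C_k)$ is the number of class $k$ customers arriving in the forward recurrence time $\tilde C_k$ of a randomly chosen active period, with $\mathrm{E}[z^{\Lambda_k(\tilde C_k)}]=\frac{1}{\mathrm{E}[C_k]}\boldsymbol\alpha_k(\boldsymbol I_k-\boldsymbol T_k)^{-1}(\boldsymbol I_k-\boldsymbol T_k(z))^{-1}(\boldsymbol I_k-\boldsymbol T_k)\boldsymbol e_k$. The stationary probability that stream $k$ is active is $\pi_k^{[\mathrm{on}]}=\mathrm{E}[C_k]/((1-p_k)^{-1}+\mathrm{E}[C_k])$; the arrival rate is $\lambda_k=\mathrm{E}[\Lambda_k]/((1-p_k)^{-1}+\mathrm{E}[C_k])$; $\rho_k=\lambda_k\mathrm{E}[H_k]$. *)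

theory Defs
  imports "HOL-Probability.Probability"
begin

section \<open>Expectations and equilibrium versions\<close>

text \<open>Expectations of counts are extended reals, so that no moment has to be assumed finite.\<close>

definition mean :: "'b measure \<Rightarrow> ('b \<Rightarrow> nat) \<Rightarrow> ereal" where
  "mean N F = enn2ereal (\<integral>\<^sup>+ x. of_nat (F x) \<partial>N)"

definition equilibrium :: "'b measure \<Rightarrow> ('b \<Rightarrow> nat) \<Rightarrow> nat measure" where
  "equilibrium N F = density (count_space UNIV)
     (\<lambda>n. emeasure N {x \<in> space N. n < F x} / (\<integral>\<^sup>+ x. of_nat (F x) \<partial>N))"

definition equilibrium_mean :: "'b measure \<Rightarrow> ('b \<Rightarrow> nat) \<Rightarrow> ereal" where
  "equilibrium_mean N F = mean (equilibrium N F) (\<lambda>n. n)"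


section \<open>Batch Markovian arrival streams\<close>

definition transition_matrix ::
  "nat \<Rightarrow> real \<Rightarrow> (nat \<Rightarrow> real) \<Rightarrow> (nat \<Rightarrow> nat \<Rightarrow> real) \<Rightarrow> nat \<Rightarrow> nat \<Rightarrow> real" where
  "transition_matrix m p \<alpha> T i j =
     (if i = 0 then (if j = 0 then p else (1 - p) * \<alpha> j)
      else (if j = 0 then 1 - (\<Sum>l = 1..m. T i l) else T i j))"

definition irreducible_on :: "nat \<Rightarrow> (nat \<Rightarrow> nat \<Rightarrow> real) \<Rightarrow> bool" where
  "irreducible_on m P \<longleftrightarrow>
     (\<forall>i \<le> m. \<forall>j \<le> m. (i, j) \<in> {(u, v). u \<le> m \<and> v \<le> m \<and> P u v > 0}\<^sup>*)"

definition stream_parameters ::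
  "nat \<Rightarrow> real \<Rightarrow> (nat \<Rightarrow> real) \<Rightarrow> (nat \<Rightarrow> nat \<Rightarrow> real) \<Rightarrow> bool" where
  "stream_parameters m p \<alpha> T \<longleftrightarrow>
     1 \<le> m \<and> 0 \<le> p \<and> p < 1 \<and>
     (\<forall>j \<in> {1..m}. 0 \<le> \<alpha> j) \<and> (\<Sum>j = 1..m. \<alpha> j) = 1 \<and>
     (\<forall>i \<in> {1..m}. \<forall>j \<in> {1..m}. 0 \<le> T i j) \<and>
     (\<forall>i \<in> {1..m}. (\<Sum>j = 1..m. T i j) \<le> 1) \<and>
     irreducible_on m (transition_matrix m p \<alpha> T)"

text \<open>
  \<open>a i j\<close> is the law of the batch size in a slot whose phase transition is from \<open>i\<close> to \<open>j\<close>.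
  The finite-dimensional laws below say that the phases form a time-homogeneous Markov chain
  with matrix \<open>P\<close> and that, given all phases, the batch sizes are independent with these laws.
\<close>

definition batch_markov_stream ::
  "'a measure \<Rightarrow> nat \<Rightarrow> (nat \<Rightarrow> nat \<Rightarrow> real) \<Rightarrow> (nat \<Rightarrow> nat \<Rightarrow> nat pmf)
     \<Rightarrow> (int \<Rightarrow> 'a \<Rightarrow> nat) \<Rightarrow> (int \<Rightarrow> 'a \<Rightarrow> nat) \<Rightarrow> bool" where
  "batch_markov_stream M m P a S A \<longleftrightarrow>
     (\<forall>n. S n \<in> measurable M (count_space UNIV)) \<and>
     (\<forall>n. A n \<in> measurable M (count_space UNIV)) \<and>
     (AE \<omega> in M. \<forall>n. S n \<omega> \<le> m \<and> (S n \<omega> = 0 \<longleftrightarrow> A n \<omega> = 0)) \<and>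
     (\<forall>n r s b. (\<forall>i \<le> r. s i \<le> m) \<longrightarrow>
        measure M {\<omega> \<in> space M. S n \<omega> = s 0 \<and>
           (\<forall>i \<in> {1..r}. S (n + int i) \<omega> = s i \<and> A (n + int i) \<omega> = b i)}
        = measure M {\<omega> \<in> space M. S n \<omega> = s 0} *
          (\<Prod>i = 1..r. P (s (i - 1)) (s i) * pmf (a (s (i - 1)) (s i)) (b i)))"


section \<open>Active periods\<close>

text \<open>
  In a stationary stream, a randomly chosen active period is seen by conditioning on an active
  period beginning in slot \<open>0\<close>, and a randomly chosen slot of a randomly chosen active period is
  seen by conditioning on the stream being active in slot \<open>0\<close>. The forward recurrence time counts
  the slots of the period strictly after the chosen one: it has value \<open>n\<close> with probability
  \<open>Pr(C > n) / E[C]\<close>.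
\<close>

definition active_period :: "'a measure \<Rightarrow> (int \<Rightarrow> 'a \<Rightarrow> nat) \<Rightarrow> 'a measure" where
  "active_period M S = uniform_measure M {\<omega> \<in> space M. S (-1) \<omega> = 0 \<and> S 0 \<omega> \<noteq> 0}"

definition period_length :: "(int \<Rightarrow> 'a \<Rightarrow> nat) \<Rightarrow> 'a \<Rightarrow> nat" where
  "period_length S \<omega> = (LEAST c. S (int c) \<omega> = 0)"

definition period_arrivals ::
  "(int \<Rightarrow> 'a \<Rightarrow> nat) \<Rightarrow> (int \<Rightarrow> 'a \<Rightarrow> nat) \<Rightarrow> 'a \<Rightarrow> nat" where
  "period_arrivals S A \<omega> = (\<Sum>i < period_length S \<omega>. A (int i) \<omega>)"

definition active_slot :: "'a measure \<Rightarrow> (int \<Rightarrow> 'a \<Rightarrow> nat) \<Rightarrow> 'a measure" where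
  "active_slot M S = uniform_measure M {\<omega> \<in> space M. S 0 \<omega> \<noteq> 0}"

definition forward_recurrence :: "(int \<Rightarrow> 'a \<Rightarrow> nat) \<Rightarrow> 'a \<Rightarrow> nat" where
  "forward_recurrence S \<omega> = (LEAST c. S (1 + int c) \<omega> = 0)"

definition forward_arrivals ::
  "(int \<Rightarrow> 'a \<Rightarrow> nat) \<Rightarrow> (int \<Rightarrow> 'a \<Rightarrow> nat) \<Rightarrow> 'a \<Rightarrow> nat" where
  "forward_arrivals S A \<omega> = (\<Sum>i = 1..forward_recurrence S \<omega>. A (int i) \<omega>)"


section \<open>The queue\<close>

text \<open>
  The \<open>i\<close>-th class \<open>k\<close> customer arriving in slot \<open>n\<close> exists if \<open>i < A k n \<omega>\<close>. It has service
  time \<open>h k n i \<omega>\<close> and waiting time \<open>W k n i \<omega>\<close>; a nonpreemptive service occupies the slots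
  from \<open>n + W k n i \<omega>\<close> up to \<open>n + W k n i \<omega> + h k n i \<omega> - 1\<close>.
\<close>

type_synonym 'k customer = "'k \<times> int \<times> nat"

fun present :: "('k \<Rightarrow> int \<Rightarrow> 'a \<Rightarrow> nat) \<Rightarrow> 'k customer \<Rightarrow> 'a \<Rightarrow> bool" where
  "present A (k, n, i) \<omega> \<longleftrightarrow> i < A k n \<omega>"

fun start_slot :: "('k \<Rightarrow> int \<Rightarrow> nat \<Rightarrow> 'a \<Rightarrow> nat) \<Rightarrow> 'k customer \<Rightarrow> 'a \<Rightarrow> int" where
  "start_slot W (k, n, i) \<omega> = n + int (W k n i \<omega>)"

fun service_time :: "('k \<Rightarrow> int \<Rightarrow> nat \<Rightarrow> 'a \<Rightarrow> nat) \<Rightarrow> 'k customer \<Rightarrow> 'a \<Rightarrow> nat" where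
  "service_time h (k, n, i) \<omega> = h k n i \<omega>"

definition in_service ::
  "('k \<Rightarrow> int \<Rightarrow> 'a \<Rightarrow> nat) \<Rightarrow> ('k \<Rightarrow> int \<Rightarrow> nat \<Rightarrow> 'a \<Rightarrow> nat) \<Rightarrow> ('k \<Rightarrow> int \<Rightarrow> nat \<Rightarrow> 'a \<Rightarrow> nat)
     \<Rightarrow> int \<Rightarrow> 'a \<Rightarrow> 'k customer set" where
  "in_service A h W t \<omega> = {c. present A c \<omega> \<and> start_slot W c \<omega> \<le> t \<and>
     t < start_slot W c \<omega> + int (service_time h c \<omega>)}"

text \<open>Pairs \<open>(c, j)\<close>, where the \<open>j\<close>-th unit of work of customer \<open>c\<close> has arrived by slot \<open>n\<close>
  and has not been served before slot \<open>n\<close>.\<close>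

definition unfinished ::
  "('k \<Rightarrow> int \<Rightarrow> 'a \<Rightarrow> nat) \<Rightarrow> ('k \<Rightarrow> int \<Rightarrow> nat \<Rightarrow> 'a \<Rightarrow> nat) \<Rightarrow> ('k \<Rightarrow> int \<Rightarrow> nat \<Rightarrow> 'a \<Rightarrow> nat)
     \<Rightarrow> int \<Rightarrow> 'a \<Rightarrow> ('k customer \<times> nat) set" where
  "unfinished A h W n \<omega> = {(c, j). present A c \<omega> \<and> fst (snd c) \<le> n \<and>
     j < service_time h c \<omega> \<and> n \<le> start_slot W c \<omega> + int j}"

definition work_arriving ::
  "('k::finite \<Rightarrow> int \<Rightarrow> 'a \<Rightarrow> nat) \<Rightarrow> ('k \<Rightarrow> int \<Rightarrow> nat \<Rightarrow> 'a \<Rightarrow> nat) \<Rightarrow> int \<Rightarrow> 'a \<Rightarrow> nat" where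
  "work_arriving A h n \<omega> = (\<Sum>k \<in> UNIV. \<Sum>i < A k n \<omega>. h k n i \<omega>)"

text \<open>Natural-number subtraction makes \<open>X - 1\<close> the \<open>max (X - 1) 0\<close> of the Lindley recursion.\<close>

definition work_conserving ::
  "'a measure \<Rightarrow> ('k::finite \<Rightarrow> int \<Rightarrow> 'a \<Rightarrow> nat) \<Rightarrow> ('k \<Rightarrow> int \<Rightarrow> nat \<Rightarrow> 'a \<Rightarrow> nat)
     \<Rightarrow> ('k \<Rightarrow> int \<Rightarrow> nat \<Rightarrow> 'a \<Rightarrow> nat) \<Rightarrow> bool" where
  "work_conserving M A h W \<longleftrightarrow>
     (AE \<omega> in M. \<forall>n. finite (unfinished A h W n \<omega>) \<and>
        card (unfinished A h W n \<omega>)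
        = (card (unfinished A h W (n - 1) \<omega>) - 1) + work_arriving A h n \<omega>)"

definition single_server ::
  "'a measure \<Rightarrow> ('k \<Rightarrow> int \<Rightarrow> 'a \<Rightarrow> nat) \<Rightarrow> ('k \<Rightarrow> int \<Rightarrow> nat \<Rightarrow> 'a \<Rightarrow> nat)
     \<Rightarrow> ('k \<Rightarrow> int \<Rightarrow> nat \<Rightarrow> 'a \<Rightarrow> nat) \<Rightarrow> bool" where
  "single_server M A h W \<longleftrightarrow>
     (AE \<omega> in M. \<forall>t. \<forall>c \<in> in_service A h W t \<omega>. \<forall>d \<in> in_service A h W t \<omega>. c = d)"

text \<open>
  \<open>F t\<close> is the information on which the decision in slot \<open>t\<close> may be based (it may include external
  randomization). It comprises the arrivals up to slot \<open>t\<close>, the service times of the customers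
  whose service started before \<open>t\<close>, and the decision in slot \<open>t\<close> itself. Given \<open>F t\<close>, the service
  times not yet taken up are independent and still have their original laws.
\<close>

definition started_before ::
  "('k \<Rightarrow> int \<Rightarrow> 'a \<Rightarrow> nat) \<Rightarrow> ('k \<Rightarrow> int \<Rightarrow> nat \<Rightarrow> 'a \<Rightarrow> nat) \<Rightarrow> int \<Rightarrow> 'k customer \<Rightarrow> 'a \<Rightarrow> bool" where
  "started_before A W t c \<omega> \<longleftrightarrow> present A c \<omega> \<and> start_slot W c \<omega> < t"

definition order_independent_of_services ::
  "'a measure \<Rightarrow> ('k \<Rightarrow> nat pmf) \<Rightarrow> ('k \<Rightarrow> int \<Rightarrow> 'a \<Rightarrow> nat) \<Rightarrow> ('k \<Rightarrow> int \<Rightarrow> 'a \<Rightarrow> nat)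
     \<Rightarrow> ('k \<Rightarrow> int \<Rightarrow> nat \<Rightarrow> 'a \<Rightarrow> nat) \<Rightarrow> ('k \<Rightarrow> int \<Rightarrow> nat \<Rightarrow> 'a \<Rightarrow> nat)
     \<Rightarrow> (int \<Rightarrow> 'a measure) \<Rightarrow> bool" where
  "order_independent_of_services M H S A h W F \<longleftrightarrow>
     filtration (space M) F \<and> (\<forall>t. subalgebra M (F t)) \<and>
     (\<forall>t k n. n \<le> t \<longrightarrow> S k n \<in> measurable (F t) (count_space UNIV)) \<and>
     (\<forall>t k n. n \<le> t \<longrightarrow> A k n \<in> measurable (F t) (count_space UNIV)) \<and>
     (\<forall>t c. {\<omega> \<in> space M. present A c \<omega> \<and> start_slot W c \<omega> = t} \<in> sets (F t)) \<and>
     (\<forall>t c x. {\<omega> \<in> space M. started_before A W t c \<omega> \<and> service_time h c \<omega> = x} \<in> sets (F t)) \<and>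
     (\<forall>t. \<forall>E \<in> sets (F t). \<forall>J x. finite J \<longrightarrow>
        (\<forall>\<omega> \<in> E. \<forall>c \<in> J. \<not> started_before A W t c \<omega>) \<longrightarrow>
        measure M {\<omega> \<in> E. \<forall>c \<in> J. service_time h c \<omega> = x c}
        = measure M E * (\<Prod>c \<in> J. pmf (H (fst c)) (x c)))"

text \<open>
  Steady state: the joint law of all phases, batch sizes, and service and waiting times of the
  customers present is invariant under shifts of time.
\<close>

datatype 'k observable = Phase 'k | Batch 'k | Service 'k nat | Waiting 'k nat

fun observe ::
  "('k \<Rightarrow> int \<Rightarrow> 'a \<Rightarrow> nat) \<Rightarrow> ('k \<Rightarrow> int \<Rightarrow> 'a \<Rightarrow> nat)
     \<Rightarrow> ('k \<Rightarrow> int \<Rightarrow> nat \<Rightarrow> 'a \<Rightarrow> nat) \<Rightarrow> ('k \<Rightarrow> int \<Rightarrow> nat \<Rightarrow> 'a \<Rightarrow> nat)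
     \<Rightarrow> 'k observable \<Rightarrow> int \<Rightarrow> 'a \<Rightarrow> nat" where
  "observe S A h W (Phase k) n \<omega> = S k n \<omega>"
| "observe S A h W (Batch k) n \<omega> = A k n \<omega>"
| "observe S A h W (Service k i) n \<omega> = (if i < A k n \<omega> then h k n i \<omega> else 0)"
| "observe S A h W (Waiting k i) n \<omega> = (if i < A k n \<omega> then W k n i \<omega> else 0)"

definition stationary_process :: "'a measure \<Rightarrow> ('i \<Rightarrow> int \<Rightarrow> 'a \<Rightarrow> nat) \<Rightarrow> bool" where
  "stationary_process M Y \<longleftrightarrow>
     (\<forall>q n. Y q n \<in> measurable M (count_space UNIV)) \<and>
     (\<forall>d. distr M (PiM UNIV (\<lambda>_. count_space UNIV)) (\<lambda>\<omega> (q, n). Y q (n + d) \<omega>)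
        = distr M (PiM UNIV (\<lambda>_. count_space UNIV)) (\<lambda>\<omega> (q, n). Y q n \<omega>))"

locale stationary_queue = prob_space M for M :: "'a measure" +
  fixes m :: "'k::finite \<Rightarrow> nat"
    and p :: "'k \<Rightarrow> real"
    and \<alpha> :: "'k \<Rightarrow> nat \<Rightarrow> real"
    and T :: "'k \<Rightarrow> nat \<Rightarrow> nat \<Rightarrow> real"
    and a :: "'k \<Rightarrow> nat \<Rightarrow> nat \<Rightarrow> nat pmf"
    and H :: "'k \<Rightarrow> nat pmf"
    and S A :: "'k \<Rightarrow> int \<Rightarrow> 'a \<Rightarrow> nat"
    and h W :: "'k \<Rightarrow> int \<Rightarrow> nat \<Rightarrow> 'a \<Rightarrow> nat"
    and F :: "int \<Rightarrow> 'a measure"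
  assumes stream_parameters: "stream_parameters (m k) (p k) (\<alpha> k) (T k)"
    and streams: "batch_markov_stream M (m k) (transition_matrix (m k) (p k) (\<alpha> k) (T k))
      (a k) (S k) (A k)"
    and streams_independent:
      "indep_vars (\<lambda>_. PiM UNIV (\<lambda>_. count_space UNIV)) (\<lambda>k \<omega> n. (S k n \<omega>, A k n \<omega>)) UNIV"
    and service_positive: "0 \<notin> set_pmf (H k)"
    and service_measurable: "h k n i \<in> measurable M (count_space UNIV)"
    and service_law: "distr M (count_space UNIV) (h k n i) = measure_pmf (H k)"
    and services_independent: "indep_vars (\<lambda>_. count_space UNIV) (service_time h) UNIV"
    and services_independent_of_arrivals:
      "indep_set
         (sets (vimage_algebra (space M) (\<lambda>\<omega> (k, n). (S k n \<omega>, A k n \<omega>))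
            (PiM UNIV (\<lambda>_. count_space UNIV))))
         (sets (vimage_algebra (space M) (\<lambda>\<omega> c. service_time h c \<omega>)
            (PiM UNIV (\<lambda>_. count_space UNIV))))"
    and single_server: "single_server M A h W"
    and work_conserving: "work_conserving M A h W"
    and order_independent: "order_independent_of_services M H S A h W F"
    and steady_state: "stationary_process M (observe S A h W)"

text \<open>Mean waiting time of a randomly chosen customer of a class: by stationarity, the mean total
  waiting time of the customers arriving in one slot, divided by their mean number.\<close>

definition mean_waiting_time ::
  "'a measure \<Rightarrow> (int \<Rightarrow> 'a \<Rightarrow> nat) \<Rightarrow> (int \<Rightarrow> nat \<Rightarrow> 'a \<Rightarrow> nat) \<Rightarrow> ereal" where
  "mean_waiting_time M A W = mean M (\<lambda>\<omega>. \<Sum>i < A 0 \<omega>. W 0 i \<omega>) / mean M (A 0)"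

text \<open>Here \<open>1 / (1 - p)\<close> is the mean length of an idle period.\<close>

definition active_probability :: "'a measure \<Rightarrow> real \<Rightarrow> (int \<Rightarrow> 'a \<Rightarrow> nat) \<Rightarrow> ereal" where
  "active_probability M p S =
     mean (active_period M S) (period_length S) /
     (ereal (1 / (1 - p)) + mean (active_period M S) (period_length S))"

definition arrival_rate ::
  "'a measure \<Rightarrow> real \<Rightarrow> (int \<Rightarrow> 'a \<Rightarrow> nat) \<Rightarrow> (int \<Rightarrow> 'a \<Rightarrow> nat) \<Rightarrow> ereal" where
  "arrival_rate M p S A =
     mean (active_period M S) (period_arrivals S A) /
     (ereal (1 / (1 - p)) + mean (active_period M S) (period_length S))"

definition load ::
  "'a measure \<Rightarrow> real \<Rightarrow> nat pmf \<Rightarrow> (int \<Rightarrow> 'a \<Rightarrow> nat) \<Rightarrow> (int \<Rightarrow> 'a \<Rightarrow> nat) \<Rightarrow> ereal" where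
  "load M p H S A = arrival_rate M p S A * mean (measure_pmf H) (\<lambda>x. x)"

end

theory Submission
  imports Defs
begin

text \<open>
  The mean unfinished work is computed in two ways, and the two results are equated.

  The first computation follows single customers. A unit of work that is served \<open>d\<close> slots after its
  arrival is found unfinished in \<open>d + 1\<close> slots. Since a service time is independent of the waiting
  time before it, the mean unfinished work is the sum over the classes of the mean service time times
  the mean total waiting time of the customers of one slot, plus a term that depends on the service
  times and the arrival rates only (\<open>mean_backlog_waiting\<close>). The former is the left-hand side of the
  formula, because the mean waiting time of a class is its mean total waiting time divided by its
  arrival rate.

  The second computation is a drift argument. The work of a class that arrives in a slot is driven by
  a finite Markov chain. The function \<open>excess\<close> of the phase solves the Poisson equation of this chain:
  work plus excess, minus the previous excess and the load, is an innovation, orthogonal to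
  everything that happened before and to the other streams. Hence the unfinished work plus all
  excesses (\<open>potential\<close>) changes in a slot by the sum of the innovations, plus the load, minus one if
  the server is busy. If it is not, all streams are idle, and as the excess of the idle phase is zero,
  so is the potential. The square of the potential is stationary; expanding its increment therefore
  gives \<open>2 * (1 - total_load)\<close> times the mean potential as the second moment of the increment
  (\<open>mean_potential_finite\<close>), to which the classes contribute separately
  (\<open>increment_second_moment\<close>). Truncated squares are used, as no moment of the unfinished work is known
  in advance.

  For this the unfinished work must be a function of the past, whereas the given process is merely
  some stationary solution of the Lindley recursion. The minimal solution, built from the infinite
  past, is a function of the past. Any stationary solution makes the server busy with probability
  \<open>total_load\<close>, so the two vanish in the same slots; the minimal one does vanish at some time in the
  past, since the load is below one; from there on they agree (\<open>AE_backlog_loynes\<close>).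

  The second moment of the innovations involves the mean time and the mean number of arrivals up to
  the next idle slot, weighted by the activity or the batch size of the present slot. Inversion
  between a random active slot and a random active period (\<open>Palm_inversion\<close>) turns these means into
  the moments of active periods in the formula.

  Second moments of service times and batches may be infinite. Then both sides of the formula are
  infinite: large batches make the mean unfinished work infinite (\<open>work_square_infinite\<close>), and a long
  service makes many later arrivals of its own class wait for long, whatever the order of service
  (\<open>mean_total_wait_infinite\<close>).
\<close>

section \<open>Measure-theoretic preliminaries\<close>

text \<open>Two finite measures that agree on an intersection-stable generator agree. In this form, it says
  that \<open>u\<close> and \<open>w\<close> have the same conditional expectation given the generated sigma-algebra; the Markov
  property and the independence of service times are proved in this way.\<close>

lemma nn_integral_eq_on_generated:
  fixes u w V :: "'b \<Rightarrow> ennreal"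
  assumes E: "Int_stable E" "E \<subseteq> sets N" "space N \<in> E"
    and u[measurable]: "u \<in> borel_measurable N" and w[measurable]: "w \<in> borel_measurable N"
    and fin: "(\<integral>\<^sup>+x. u x \<partial>N) \<noteq> \<infinity>"
    and eq: "\<And>D. D \<in> E \<Longrightarrow> (\<integral>\<^sup>+x. u x * indicator D x \<partial>N) = (\<integral>\<^sup>+x. w x * indicator D x \<partial>N)"
    and V: "V \<in> borel_measurable (sigma (space N) E)"
  shows "(\<integral>\<^sup>+x. V x * u x \<partial>N) = (\<integral>\<^sup>+x. V x * w x \<partial>N)"
proof -
  define G where "G = sigma (space N) E"
  have E_Pow: "E \<subseteq> Pow (space N)" using E(2) sets.sets_into_space by blast
  have sG: "sets G = sigma_sets (space N) E" "space G = space N"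
    using E_Pow by (auto simp: G_def)
  have sub: "subalgebra (density N f) G" for f
    unfolding subalgebra_def sG using E(2) by (auto intro!: sets.sigma_sets_subset)
  have "subalgebra N G"
    unfolding subalgebra_def sG using E(2) by (auto intro!: sets.sigma_sets_subset)
  then have VM[measurable]: "V \<in> borel_measurable N"
    using V unfolding G_def[symmetric] by (rule measurable_from_subalg)
  have "restr_to_subalg (density N u) G = restr_to_subalg (density N w) G"
  proof (rule measure_eqI_generator_eq[where E = E and \<Omega> = "space N" and A = "\<lambda>_. space N"])
    show "emeasure (restr_to_subalg (density N u) G) X = emeasure (restr_to_subalg (density N w) G) X"
      if "X \<in> E" for X
    proof -
      have "X \<in> sets G" "X \<in> sets N" using that E(2) by (auto simp: sG)
      then show ?thesis
        using eq[OF that] by (simp add: emeasure_restr_to_subalg[OF sub] emeasure_density)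
    qed
    show "emeasure (restr_to_subalg (density N u) G) (space N) \<noteq> \<infinity>" for i :: nat
    proof -
      have "space N \<in> sets G" using sets.top[of G] sG by simp
      have "(\<integral>\<^sup>+x. u x * indicator (space N) x \<partial>N) = (\<integral>\<^sup>+x. u x \<partial>N)"
        by (intro nn_integral_cong) auto
      then show ?thesis using fin \<open>space N \<in> sets G\<close>
        by (simp add: emeasure_restr_to_subalg[OF sub] emeasure_density)
    qed
  qed (use E E_Pow in \<open>auto simp: sets_restr_to_subalg[OF sub] sG\<close>)
  then have "(\<integral>\<^sup>+x. V x \<partial>restr_to_subalg (density N u) G) = (\<integral>\<^sup>+x. V x \<partial>restr_to_subalg (density N w) G)"
    by simp
  moreover have "(\<integral>\<^sup>+x. V x \<partial>restr_to_subalg (density N f) G) = (\<integral>\<^sup>+x. V x * f x \<partial>N)"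
    if [measurable]: "f \<in> borel_measurable N" for f
    using V unfolding G_def[symmetric]
    by (simp add: nn_integral_subalgebra2[OF sub] nn_integral_density mult.commute)
  ultimately show ?thesis by simp
qed

text \<open>The increment of a stationary sequence has mean zero as soon as it is integrable, even if the
  sequence itself is not: truncation makes the two means finite and equal.\<close>

lemma (in prob_space) expectation_stationary_increment:
  fixes Z Z' :: "'a \<Rightarrow> real"
  assumes [measurable]: "Z \<in> borel_measurable M" "Z' \<in> borel_measurable M"
    and same: "distr M borel Z' = distr M borel Z"
    and int: "integrable M (\<lambda>x. Z' x - Z x)"
  shows "expectation (\<lambda>x. Z' x - Z x) = 0"
proof -
  define cl where "cl L z = max (- real L) (min z (real L))" for L z
  have clm[measurable]: "cl L \<in> borel_measurable borel" for L
    unfolding cl_def by measurable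
  have "(\<lambda>L. expectation (\<lambda>x. cl L (Z' x) - cl L (Z x))) \<longlonglongrightarrow> expectation (\<lambda>x. Z' x - Z x)"
  proof (rule integral_dominated_convergence[where w = "\<lambda>x. \<bar>Z' x - Z x\<bar>"])
    show "AE x in M. (\<lambda>L. cl L (Z' x) - cl L (Z x)) \<longlonglongrightarrow> Z' x - Z x"
    proof (intro AE_I2 tendsto_eventually)
      fix x
      obtain n where n: "\<bar>Z' x\<bar> + \<bar>Z x\<bar> \<le> real n" using real_arch_simple by blast
      show "\<forall>\<^sub>F L in sequentially. cl L (Z' x) - cl L (Z x) = Z' x - Z x"
        using n by (intro eventually_sequentiallyI[of n]) (auto simp: cl_def)
    qed
  qed (use int in \<open>auto simp: cl_def\<close>)
  moreover have "expectation (\<lambda>x. cl L (Z' x) - cl L (Z x)) = 0" for L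
  proof -
    have b: "integrable M (\<lambda>x. cl L (Y x))" if [measurable]: "Y \<in> borel_measurable M" for Y
      by (rule integrable_const_bound[where B = "real L"]) (auto simp: cl_def)
    have "expectation (\<lambda>x. cl L (Y x)) = integral\<^sup>L (distr M borel Y) (cl L)"
      if [measurable]: "Y \<in> borel_measurable M" for Y
      by (simp add: integral_distr)
    then show ?thesis using same b by simp
  qed
  ultimately show ?thesis by (simp add: LIMSEQ_const_iff)
qed

lemma sum_lessThan_choose: "(\<Sum>n<c. n) = c choose 2"
  by (induction c) (auto simp: numeral_2_eq_2)

text \<open>The tail probability at \<open>n\<close>, weighted by \<open>n\<close> and summed over \<open>n\<close>, is the mean number of
  pairs below \<open>F\<close>.\<close>

lemma equilibrium_mean_eq:
  fixes F :: "'b \<Rightarrow> nat"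
  assumes [measurable]: "F \<in> measurable N (count_space UNIV)"
  shows "equilibrium_mean N F
    = enn2ereal ((\<integral>\<^sup>+x. of_nat (F x choose 2) \<partial>N) / (\<integral>\<^sup>+x. of_nat (F x) \<partial>N))"
proof -
  let ?m = "\<integral>\<^sup>+x. of_nat (F x) \<partial>N :: ennreal"
  have "(\<integral>\<^sup>+n. of_nat n \<partial>equilibrium N F)
      = (\<integral>\<^sup>+n. emeasure N {x \<in> space N. n < F x} / ?m * of_nat n \<partial>count_space UNIV)"
    unfolding equilibrium_def by (simp add: nn_integral_density)
  also have "\<dots> = (\<Sum>n. (emeasure N {x \<in> space N. n < F x} * of_nat n) / ?m)"
    by (simp add: nn_integral_count_space_nat ennreal_times_divide mult.commute)
  also have "\<dots> = (\<Sum>n. emeasure N {x \<in> space N. n < F x} * of_nat n) / ?m"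
    by (simp add: divide_ennreal_def)
  also have "(\<Sum>n. emeasure N {x \<in> space N. n < F x} * of_nat n)
      = (\<Sum>n. \<integral>\<^sup>+x. of_nat n * indicator {x \<in> space N. n < F x} x \<partial>N)"
    by (simp add: nn_integral_cmult_indicator mult.commute)
  also have "\<dots> = (\<integral>\<^sup>+x. (\<Sum>n. of_nat n * indicator {x \<in> space N. n < F x} x) \<partial>N)"
    by (rule nn_integral_suminf[symmetric]) measurable
  also have "\<dots> = (\<integral>\<^sup>+x. of_nat (F x choose 2) \<partial>N)"
  proof (rule nn_integral_cong)
    fix x assume x: "x \<in> space N"
    have "(\<Sum>n. of_nat n * indicator {x \<in> space N. n < F x} x :: ennreal)
        = (\<Sum>n<F x. of_nat n * indicator {x \<in> space N. n < F x} x)"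
      by (rule suminf_finite) auto
    also have "\<dots> = (\<Sum>n<F x. of_nat n)" using x by (intro sum.cong) auto
    also have "\<dots> = of_nat (F x choose 2)"
      by (simp flip: sum_lessThan_choose of_nat_sum)
    finally show "(\<Sum>n. of_nat n * indicator {x \<in> space N. n < F x} x :: ennreal) = of_nat (F x choose 2)" .
  qed
  finally show ?thesis unfolding equilibrium_mean_def mean_def by simp
qed

section \<open>The Lindley recursion\<close>

text \<open>The work found in slot \<open>n\<close> if the queue was empty before the last \<open>N\<close> slots.\<close>

fun lindley :: "(int \<Rightarrow> nat) \<Rightarrow> int \<Rightarrow> nat \<Rightarrow> nat" where
  "lindley b n 0 = 0"
| "lindley b n (Suc N) = (lindley b (n - 1) N - 1) + b n"

text \<open>Starting from an empty queue one slot earlier can only add work.\<close>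

lemma lindley_mono: "lindley b n N \<le> lindley b n (Suc N)"
proof (induction N arbitrary: n)
  case (Suc N)
  then have "lindley b (n - 1) N - 1 \<le> lindley b (n - 1) (Suc N) - 1" by (rule diff_le_mono)
  then show ?case by (subst (1 2) lindley.simps(2)) (rule add_right_mono)
qed simp

lemma lindley_le_solution:
  assumes "\<And>n. x n = (x (n - 1) - 1) + b n"
  shows "lindley b n N \<le> x n"
proof (induction N arbitrary: n)
  case (Suc N)
  then have "lindley b (n - 1) N - 1 \<le> x (n - 1) - 1" by (rule diff_le_mono)
  then show ?case by (subst assms) simp
qed simp

lemma lindley_shift: "lindley (\<lambda>i. b (i + d)) n N = lindley b (n + d) N"
proof (induction N arbitrary: n)
  case (Suc N)
  have e: "n - 1 + d = n + d - 1" by simp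
  show ?case by (simp only: lindley.simps Suc e)
qed simp

text \<open>The minimal solution of the recursion, started from an empty queue in the infinite past.\<close>

definition loynes :: "(int \<Rightarrow> nat) \<Rightarrow> int \<Rightarrow> nat" where
  "loynes b n = Sup (range (lindley b n))"

lemma loynes_shift: "loynes (\<lambda>i. b (i + d)) n = loynes b (n + d)"
  by (simp add: loynes_def lindley_shift cong: image_cong)

text \<open>Any solution bounds the iterates. As increasing sequences of natural numbers they are then
  eventually constant, so that the recursion passes to the limit.\<close>

lemma
  assumes x: "\<And>n. x n = (x (n - 1) - 1) + b n"
  shows loynes_le_solution: "loynes b n \<le> x n"
    and loynes_recursion: "loynes b n = (loynes b (n - 1) - 1) + b n"
proof -
  have bdd: "bdd_above (range (lindley b n))" for n
    using lindley_le_solution[of x b, OF x] by (auto intro!: bdd_aboveI[of _ "x n"])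
  show "loynes b n \<le> x n" for n
    unfolding loynes_def using lindley_le_solution[of x b, OF x] by (auto intro!: cSUP_least)
  have mono: "incseq (lindley b n)" for n using lindley_mono by (rule incseq_SucI)
  have "\<exists>N0. \<forall>N\<ge>N0. lindley b n N = loynes b n" for n
  proof -
    have "finite (range (lindley b n))"
      using bdd[of n] by (simp add: bdd_above_nat)
    then have "loynes b n \<in> range (lindley b n)"
      unfolding loynes_def by (simp add: cSup_eq_Max)
    then obtain N0 where N0: "loynes b n = lindley b n N0" by auto
    have "lindley b n N = loynes b n" if "N \<ge> N0" for N
      using incseqD[OF mono[of n] that] cSUP_upper[OF UNIV_I bdd[of n], of N]
      unfolding N0 loynes_def[symmetric] by (simp add: N0)
    then show ?thesis by blast
  qed
  then obtain N1 N2 where N: "\<And>N. N \<ge> N1 \<Longrightarrow> lindley b n N = loynes b n"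
    "\<And>N. N \<ge> N2 \<Longrightarrow> lindley b (n - 1) N = loynes b (n - 1)" by meson
  have "lindley b n (Suc (max N1 N2)) = loynes b n" by (rule N(1)) simp
  moreover have "lindley b (n - 1) (max N1 N2) = loynes b (n - 1)" by (rule N(2)) simp
  ultimately show "loynes b n = (loynes b (n - 1) - 1) + b n" by simp
qed

text \<open>Coupling: this is applied with a slot \<open>i\<close> in which both solutions vanish.\<close>

lemma lindley_solutions_agree:
  assumes x: "\<And>n. x n = (x (n - 1) - 1) + b n" and y: "\<And>n. y n = (y (n - 1) - 1) + b n"
    and "x i = y i" "i \<le> (n::int)"
  shows "x n = (y n :: nat)"
  using \<open>i \<le> n\<close>
proof (induction n rule: int_ge_induct)
  case (step j)
  then show ?case using x[of "j + 1"] y[of "j + 1"] by simp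
qed (rule \<open>x i = y i\<close>)

section \<open>Recurrence times along a path\<close>

text \<open>Here \<open>s\<close> is a sequence of phases and \<open>a\<close> a sequence of batch sizes. For \<open>n = -1\<close> the two
  functions below give the length and the arrivals of an active period beginning in slot \<open>0\<close>, and
  for \<open>n = 0\<close> the forward recurrence time and its arrivals.\<close>

definition recurrence_time :: "(int \<Rightarrow> nat) \<Rightarrow> int \<Rightarrow> nat" where
  "recurrence_time s n = (LEAST c. s (n + 1 + int c) = 0)"

definition recurrence_arrivals :: "(int \<Rightarrow> nat) \<Rightarrow> (int \<Rightarrow> nat) \<Rightarrow> int \<Rightarrow> nat" where
  "recurrence_arrivals s a n = (\<Sum>i = 1..recurrence_time s n. a (n + int i))"

definition stays_active :: "(int \<Rightarrow> nat) \<Rightarrow> int \<Rightarrow> nat \<Rightarrow> bool" where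
  "stays_active s n l \<longleftrightarrow> (\<forall>i \<in> {1..l}. s (n + int i) \<noteq> 0)"

lemma stays_active_0[simp]: "stays_active s n 0"
  by (simp add: stays_active_def)

lemma stays_active_Suc: "stays_active s n (Suc l) \<longleftrightarrow> stays_active s n l \<and> s (n + int (Suc l)) \<noteq> 0"
proof -
  have "{1..Suc l} = insert (Suc l) {1..l}" by auto
  then show ?thesis unfolding stays_active_def by (simp del: of_nat_Suc add: conj_commute)
qed

lemma stays_active_Suc': "stays_active s n (Suc l) \<longleftrightarrow> s (n + 1) \<noteq> 0 \<and> stays_active s (n + 1) l"
  by (induction l) (auto simp: stays_active_Suc add.assoc)

lemma period_length_eq: "period_length S \<omega> = recurrence_time (\<lambda>n. S n \<omega>) (- 1)"
  by (simp add: period_length_def recurrence_time_def)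

lemma forward_recurrence_eq: "forward_recurrence S \<omega> = recurrence_time (\<lambda>n. S n \<omega>) 0"
  by (simp add: forward_recurrence_def recurrence_time_def)

lemma forward_arrivals_eq: "forward_arrivals S A \<omega> = recurrence_arrivals (\<lambda>n. S n \<omega>) (\<lambda>n. A n \<omega>) 0"
  by (simp add: forward_arrivals_def recurrence_arrivals_def forward_recurrence_eq)

lemma period_arrivals_eq: "period_arrivals S A \<omega> = recurrence_arrivals (\<lambda>n. S n \<omega>) (\<lambda>n. A n \<omega>) (- 1)"
proof -
  have "(\<Sum>i<c. A (int i) \<omega>) = (\<Sum>i = 1..c. A (- 1 + int i) \<omega>)" for c
    by (induction c) simp_all
  then show ?thesis
    by (simp add: period_arrivals_def recurrence_arrivals_def period_length_eq)
qed

text \<open>Every slot is followed by an idle one; otherwise the value of \<open>LEAST\<close> is arbitrary.\<close>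

context
  fixes s a :: "int \<Rightarrow> nat"
  assumes hits: "\<And>n. \<exists>c. s (n + 1 + int c) = 0"
begin

lemma less_recurrence_time_iff: "l < recurrence_time s n \<longleftrightarrow> stays_active s n (Suc l)"
proof
  assume l: "l < recurrence_time s n"
  have "s (n + int i) \<noteq> 0" if "1 \<le> i" "i \<le> Suc l" for i
  proof -
    have "i - 1 < recurrence_time s n" using l that by simp
    then have "s (n + 1 + int (i - 1)) \<noteq> 0" unfolding recurrence_time_def by (rule not_less_Least)
    then show ?thesis using that by (simp add: of_nat_diff add.assoc)
  qed
  then show "stays_active s n (Suc l)" by (simp add: stays_active_def)
next
  assume st: "stays_active s n (Suc l)"
  have z: "s (n + 1 + int (recurrence_time s n)) = 0"
    unfolding recurrence_time_def using hits[of n] by (rule LeastI_ex)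
  show "l < recurrence_time s n"
  proof (rule ccontr)
    assume "\<not> l < recurrence_time s n"
    then have "Suc (recurrence_time s n) \<in> {1..Suc l}" by simp
    then have "s (n + int (Suc (recurrence_time s n))) \<noteq> 0"
      using st unfolding stays_active_def by blast
    then show False using z by (simp add: add.assoc)
  qed
qed

lemma recurrence_time_inactive: "s (n + 1) = 0 \<Longrightarrow> recurrence_time s n = 0"
  using less_recurrence_time_iff[of 0 n] by (simp add: stays_active_Suc')

lemma recurrence_time_active:
  assumes "s (n + 1) \<noteq> 0" shows "recurrence_time s n = Suc (recurrence_time s (n + 1))"
proof -
  have "l < recurrence_time s n \<longleftrightarrow> l < Suc (recurrence_time s (n + 1))" for l
    using assms less_recurrence_time_iff[of l n] less_recurrence_time_iff[of "l - 1" "n + 1"]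
    by (cases l) (auto simp: stays_active_Suc')
  then show ?thesis by (metis less_irrefl linorder_neqE_nat)
qed

lemma recurrence_arrivals_active:
  assumes "s (n + 1) \<noteq> 0"
  shows "recurrence_arrivals s a n = a (n + 1) + recurrence_arrivals s a (n + 1)"
proof -
  have "(\<Sum>i = 1..Suc c. a (n + int i)) = a (n + 1) + (\<Sum>i = 1..c. a (n + 1 + int i))" for c
    by (induction c) (simp_all add: add.assoc)
  then show ?thesis
    by (simp add: recurrence_arrivals_def recurrence_time_active[OF assms])
qed

lemma recurrence_time_eq_suminf:
  "ennreal (real (recurrence_time s n)) = (\<Sum>l. indicator {l. stays_active s n (Suc l)} l)"
proof -
  have "(\<Sum>l. indicator {l. stays_active s n (Suc l)} l :: ennreal)
      = (\<Sum>l<recurrence_time s n. indicator {l. stays_active s n (Suc l)} l)"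
    by (rule suminf_finite) (auto simp: less_recurrence_time_iff[symmetric])
  also have "\<dots> = (\<Sum>l<recurrence_time s n. 1)"
    by (rule sum.cong) (auto simp: less_recurrence_time_iff[symmetric])
  finally show ?thesis by (simp add: ennreal_of_nat_eq_real_of_nat)
qed

end

section \<open>Stationarity and the Markov property\<close>

definition path_space :: "('q \<times> int \<Rightarrow> nat) measure" where
  "path_space = PiM UNIV (\<lambda>_. count_space UNIV)"

definition time_shift :: "int \<Rightarrow> ('q \<times> int \<Rightarrow> nat) \<Rightarrow> 'q \<times> int \<Rightarrow> nat" where
  "time_shift d y = (\<lambda>(q, n). y (q, n + d))"

lemma measurable_path_space[measurable (raw)]: "(\<lambda>y. y i) \<in> measurable path_space (count_space UNIV)"
  unfolding path_space_def by measurable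

text \<open>The sample paths of a single stream.\<close>

definition stream_space :: "(int \<Rightarrow> nat \<times> nat) measure" where
  "stream_space = PiM UNIV (\<lambda>_. count_space UNIV)"

lemma measurable_stream_space[measurable]: "(\<lambda>z. z i) \<in> measurable stream_space (count_space UNIV)"
  unfolding stream_space_def by measurable

lemma space_stream_space[simp]: "space stream_space = UNIV"
  by (simp add: stream_space_def space_PiM)

lemma measurable_count_spaceI:
  fixes f :: "'b \<Rightarrow> 'c::countable"
  assumes "\<And>x. {\<omega> \<in> space N. f \<omega> = x} \<in> sets N"
  shows "f \<in> measurable N (count_space UNIV)"
  unfolding measurable_count_space_eq2_countable
  using assms by (auto simp: vimage_def Int_def conj_commute)

context stationary_queue
begin

abbreviation Ptr where "Ptr k \<equiv> transition_matrix (m k) (p k) (\<alpha> k) (T k)"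

lemma S_measurable[measurable]: "S k n \<in> measurable M (count_space UNIV)"
  and A_measurable[measurable]: "A k n \<in> measurable M (count_space UNIV)"
  using streams[of k] unfolding batch_markov_stream_def by auto

lemmas h_measurable[measurable] = service_measurable

lemma observe_measurable[measurable]: "observe S A h W q n \<in> measurable M (count_space UNIV)"
  using steady_state unfolding stationary_process_def by auto

definition sample_path :: "'a \<Rightarrow> 'k observable \<times> int \<Rightarrow> nat" where
  "sample_path \<omega> = (\<lambda>(q, n). observe S A h W q n \<omega>)"

lemma time_shift_sample_path [simp]:
  "time_shift d (sample_path \<omega>) (Phase k, n) = S k (n + d) \<omega>"
  "time_shift d (sample_path \<omega>) (Batch k, n) = A k (n + d) \<omega>"
  "time_shift d (sample_path \<omega>) (Service k i, n) = (if i < A k (n + d) \<omega> then h k (n + d) i \<omega> else 0)"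
  "time_shift d (sample_path \<omega>) (Waiting k i, n) = (if i < A k (n + d) \<omega> then W k (n + d) i \<omega> else 0)"
  by (simp_all add: time_shift_def sample_path_def)

lemma distr_time_shift:
  "distr M path_space (\<lambda>\<omega>. time_shift d (sample_path \<omega>)) = distr M path_space (\<lambda>\<omega>. time_shift 0 (sample_path \<omega>))"
proof -
  have *: "(\<lambda>\<omega>. time_shift d (sample_path \<omega>)) = (\<lambda>\<omega> (q, n). observe S A h W q (n + d) \<omega>)" for d
    by (auto simp: fun_eq_iff time_shift_def sample_path_def)
  show ?thesis
    unfolding * using steady_state unfolding stationary_process_def path_space_def by simp
qed

lemma time_shift_measurable[measurable]:
  "(\<lambda>\<omega>. time_shift d (sample_path \<omega>)) \<in> measurable M path_space"
proof -
  have "(\<lambda>\<omega>. time_shift d (sample_path \<omega>)) = (\<lambda>\<omega> i. observe S A h W (fst i) (snd i + d) \<omega>)"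
    by (auto simp: fun_eq_iff time_shift_def sample_path_def)
  then show ?thesis unfolding path_space_def
    by (auto intro!: measurable_PiM_single' simp: )
qed

text \<open>Stationarity concerns the law of the whole path. A quantity indexed by time is hence presented
  as a path functional \<open>\<phi>\<close> evaluated on a shifted path.\<close>

lemma nn_integral_stationary:
  assumes \<phi>: "\<phi> \<in> borel_measurable path_space"
    and "\<And>\<omega>. f \<omega> = \<phi> (time_shift d (sample_path \<omega>))" "\<And>\<omega>. g \<omega> = \<phi> (time_shift e (sample_path \<omega>))"
  shows "(\<integral>\<^sup>+\<omega>. f \<omega> \<partial>M) = (\<integral>\<^sup>+\<omega>. g \<omega> \<partial>M)"
  using assms nn_integral_distr[OF time_shift_measurable, of \<phi> d]
    nn_integral_distr[OF time_shift_measurable, of \<phi> e] distr_time_shift[of d] distr_time_shift[of e]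
  by simp

lemma distr_stationary:
  assumes \<phi>[measurable]: "\<phi> \<in> measurable path_space N"
    and f: "\<And>\<omega>. f \<omega> = \<phi> (time_shift d (sample_path \<omega>))" "\<And>\<omega>. g \<omega> = \<phi> (time_shift e (sample_path \<omega>))"
  shows "distr M N f = distr M N g"
proof -
  have "distr M N f = distr (distr M path_space (\<lambda>\<omega>. time_shift d (sample_path \<omega>))) N \<phi>"
    "distr M N g = distr (distr M path_space (\<lambda>\<omega>. time_shift e (sample_path \<omega>))) N \<phi>"
    by (auto simp: distr_distr comp_def f[abs_def])
  then show ?thesis using distr_time_shift[of d] distr_time_shift[of e] by simp
qed

lemma AE_streams: "AE \<omega> in M. \<forall>k n. S k n \<omega> \<le> m k \<and> (S k n \<omega> = 0 \<longleftrightarrow> A k n \<omega> = 0)"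
  unfolding AE_all_countable
proof (intro allI)
  fix k n
  have "AE \<omega> in M. \<forall>n. S k n \<omega> \<le> m k \<and> (S k n \<omega> = 0 \<longleftrightarrow> A k n \<omega> = 0)"
    using streams[of k] unfolding batch_markov_stream_def by auto
  then show "AE \<omega> in M. S k n \<omega> \<le> m k \<and> (S k n \<omega> = 0 \<longleftrightarrow> A k n \<omega> = 0)"
    by eventually_elim simp
qed

lemma AE_service_positive: "AE \<omega> in M. \<forall>k n i. 0 < h k n i \<omega>"
  unfolding AE_all_countable
proof (intro allI)
  fix k n i
  have "AE x in distr M (count_space UNIV) (h k n i). 0 < x"
    unfolding service_law using service_positive[of k] by (intro AE_pmfI) (metis neq0_conv)
  then show "AE \<omega> in M. 0 < h k n i \<omega>"
    by (subst (asm) AE_distr_iff) auto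
qed

subsection \<open>The past of a stream\<close>

definition stream_path :: "'k \<Rightarrow> 'a \<Rightarrow> int \<Rightarrow> nat \<times> nat" where
  "stream_path k \<omega> n = (S k n \<omega>, A k n \<omega>)"

lemma stream_path_measurable[measurable]: "stream_path k \<in> measurable M stream_space"
  unfolding stream_space_def
  by (rule measurable_PiM_single') (auto simp: stream_path_def)

definition service_events :: "'a set set" where
  "service_events = sets (vimage_algebra (space M) (\<lambda>\<omega> c. service_time h c \<omega>) (PiM UNIV (\<lambda>_. count_space UNIV)))"

definition arrival_events :: "'a set set" where
  "arrival_events = sets (vimage_algebra (space M) (\<lambda>\<omega> (k, n). (S k n \<omega>, A k n \<omega>)) (PiM UNIV (\<lambda>_. count_space UNIV)))"

lemma service_time_measurable[measurable]: "service_time h c \<in> measurable M (count_space UNIV)"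
proof (cases c)
  case (fields k n i)
  then have "service_time h c = h k n i" by (simp add: fun_eq_iff)
  then show ?thesis by simp
qed

lemma service_events_sets: "service_events \<subseteq> sets M"
  unfolding service_events_def
  by (rule sets_image_in_sets) (auto intro!: measurable_PiM_single')

text \<open>An event that restricts every stream separately is a single arrival event, so that the two
  independence assumptions can be combined.\<close>

lemma streams_and_services:
  assumes b: "\<And>k. b k \<in> sets stream_space" and D: "D \<in> service_events"
  shows "prob ((\<Inter>k. stream_path k -` b k \<inter> space M) \<inter> D)
    = (\<Prod>k \<in> UNIV. prob (stream_path k -` b k \<inter> space M)) * prob D"
proof -
  let ?X = "\<lambda>\<omega> (k, n). (S k n \<omega>, A k n \<omega>)" and ?PM = "PiM UNIV (\<lambda>_. count_space UNIV) :: ('k \<times> int \<Rightarrow> nat \<times> nat) measure"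
  define B where "B = (\<Inter>k. (\<lambda>y n. y (k, n)) -` b k \<inter> space ?PM)"
  have "B \<in> sets ?PM"
    unfolding B_def
  proof (rule sets.finite_INT)
    fix k
    have "(\<lambda>y n. y (k, n)) \<in> measurable ?PM stream_space"
      unfolding stream_space_def by (rule measurable_PiM_single') auto
    then show "(\<lambda>y n. y (k, n)) -` b k \<inter> space ?PM \<in> sets ?PM"
      using b[of k] by (rule measurable_sets)
  qed auto
  moreover have eq: "(\<Inter>k. stream_path k -` b k \<inter> space M) = ?X -` B \<inter> space M"
    by (auto simp: B_def space_PiM stream_path_def[abs_def])
  ultimately have arr: "(\<Inter>k. stream_path k -` b k \<inter> space M) \<in> arrival_events"
    unfolding arrival_events_def by (simp only: in_vimage_algebra)
  have "prob ((\<Inter>k. stream_path k -` b k \<inter> space M) \<inter> D)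
      = prob (\<Inter>k. stream_path k -` b k \<inter> space M) * prob D"
    using services_independent_of_arrivals arr D
    unfolding arrival_events_def service_events_def by (rule indep_setD)
  also have "prob (\<Inter>k. stream_path k -` b k \<inter> space M) = (\<Prod>k \<in> UNIV. prob (stream_path k -` b k \<inter> space M))"
  proof -
    have "indep_vars (\<lambda>_. stream_space) stream_path UNIV"
      using streams_independent unfolding stream_space_def stream_path_def[abs_def] .
    then show ?thesis using b by (intro indep_varsD_finite) auto
  qed
  finally show ?thesis .
qed

text \<open>\<open>history n r s b\<close> prescribes the phases of a stream in the slots \<open>n - r, \<dots>, n\<close> and the
  batch sizes in all of these slots but the first, counting backwards from \<open>n\<close>.\<close>

definition history :: "int \<Rightarrow> nat \<Rightarrow> (nat \<Rightarrow> nat) \<Rightarrow> (nat \<Rightarrow> nat) \<Rightarrow> (int \<Rightarrow> nat \<times> nat) set" where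
  "history n r s b = {z. (\<forall>i\<le>r. fst (z (n - int i)) = s i) \<and> (\<forall>i<r. snd (z (n - int i)) = b i)}"

lemma history_sets[measurable]: "history n r s b \<in> sets stream_space"
proof -
  have "Measurable.pred stream_space (\<lambda>z. (\<forall>i\<le>r. fst (z (n - int i)) = s i) \<and> (\<forall>i<r. snd (z (n - int i)) = b i))"
    by measurable
  then show ?thesis by (simp add: history_def pred_def)
qed

text \<open>Of two histories that end in the same slot, either one extends the other or they exclude each
  other.\<close>

lemma history_Int: "history n r s b \<inter> history n r' s' b' \<in> {history n r s b, history n r' s' b', {}}"
proof (cases "history n r s b \<inter> history n r' s' b' = {}")
  case False
  then obtain z where z: "z \<in> history n r s b" "z \<in> history n r' s' b'" by auto
  show ?thesis
  proof (cases "r \<le> r'")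
    case True
    have "history n r' s' b' \<subseteq> history n r s b"
      using z True unfolding history_def by auto
    then show ?thesis by auto
  next
    case False
    then have "history n r s b \<subseteq> history n r' s' b'"
      using z unfolding history_def by auto
    then show ?thesis by auto
  qed
qed simp

text \<open>Zero outside the phases \<open>0, \<dots>, m k\<close>, where the entries of the matrix have no meaning.\<close>

definition transition_law :: "'k \<Rightarrow> nat \<Rightarrow> nat \<Rightarrow> nat \<Rightarrow> real" where
  "transition_law k x j l = (if x \<le> m k \<and> j \<le> m k then Ptr k x j * pmf (a k x j) l else 0)"

abbreviation next_step :: "int \<Rightarrow> nat \<Rightarrow> nat \<Rightarrow> nat \<Rightarrow> (int \<Rightarrow> nat \<times> nat) set" where
  "next_step n x j l \<equiv> {z. fst (z n) = x \<and> z (n + 1) = (j, l)}"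

lemma stream_path_null:
  assumes "\<And>z. z \<in> e \<Longrightarrow> \<exists>n. \<not> fst (z n) \<le> m k"
  shows "prob (stream_path k -` e \<inter> space M) = 0"
proof -
  have "AE \<omega> in M. \<omega> \<notin> stream_path k -` e \<inter> space M"
    using AE_streams by eventually_elim (use assms in \<open>force simp: stream_path_def\<close>)
  then show ?thesis
    using measure_notin_sets by (cases "stream_path k -` e \<inter> space M \<in> sets M") (auto simp: prob_eq_0)
qed

text \<open>The finite-dimensional laws of the stream factorize over the slots; histories that leave the
  phase space are null.\<close>

lemma history_next_step:
  "prob (stream_path k -` (history n r s b \<inter> next_step n x j l) \<inter> space M)
    = prob (stream_path k -` (history n r s b \<inter> {z. fst (z n) = x}) \<inter> space M) * transition_law k x j l"
proof (cases "x = s 0")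
  case False
  then have e: "history n r s b \<inter> {z. fst (z n) = x} = {}"
    by (auto simp: history_def dest!: spec[of _ 0])
  then have "history n r s b \<inter> next_step n x j l = {}" by blast
  with e show ?thesis by simp
next
  case True
  have "fst (z n) = s 0" if "z \<in> history n r s b" for z
    using that by (auto simp: history_def dest!: spec[of _ 0])
  then have e: "history n r s b \<inter> {z. fst (z n) = x} = history n r s b"
    using True by auto
  show ?thesis
  proof (cases "(\<forall>i\<le>r. s i \<le> m k) \<and> j \<le> m k")
    case False
    have "prob (stream_path k -` (history n r s b \<inter> next_step n x j l) \<inter> space M) = 0"
    proof (rule stream_path_null)
      fix z assume z: "z \<in> history n r s b \<inter> next_step n x j l"
      from False consider i where "i \<le> r" "\<not> s i \<le> m k" | "\<not> j \<le> m k" by blast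
      then show "\<exists>n. \<not> fst (z n) \<le> m k"
      proof cases
        case 1
        then have "fst (z (n - int i)) = s i" using z by (simp add: history_def)
        with 1 show ?thesis by metis
      next
        case 2
        with z have "\<not> fst (z (n + 1)) \<le> m k" by simp
        then show ?thesis ..
      qed
    qed
    moreover have "prob (stream_path k -` (history n r s b \<inter> {z. fst (z n) = x}) \<inter> space M) = 0" if "j \<le> m k"
    proof (rule stream_path_null)
      fix z assume z: "z \<in> history n r s b \<inter> {z. fst (z n) = x}"
      from False that obtain i where "i \<le> r" "\<not> s i \<le> m k" by blast
      moreover then have "fst (z (n - int i)) = s i" using z by (simp add: history_def)
      ultimately show "\<exists>n. \<not> fst (z n) \<le> m k" by metis
    qed
    ultimately show ?thesis by (auto simp: transition_law_def)
  next
    case ok: True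
    \<comment> \<open>the same path counted forwards from the slot \<open>n - r\<close>, as in the definition of the stream\<close>
    define s' where "s' i = (if i \<le> r then s (r - i) else j)" for i
    define b' where "b' i = (if i \<le> r then b (r - i) else l)" for i
    have fdl: "prob {\<omega> \<in> space M. S k (n - int r) \<omega> = s' 0 \<and>
          (\<forall>i\<in>{1..q}. S k (n - int r + int i) \<omega> = s' i \<and> A k (n - int r + int i) \<omega> = b' i)}
        = prob {\<omega> \<in> space M. S k (n - int r) \<omega> = s' 0} *
          (\<Prod>i = 1..q. Ptr k (s' (i - 1)) (s' i) * pmf (a k (s' (i - 1)) (s' i)) (b' i))" if "q \<le> Suc r" for q
    proof -
      have "\<forall>i\<le>q. s' i \<le> m k" using ok that by (auto simp: s'_def)
      then show ?thesis using streams[of k] unfolding batch_markov_stream_def by blast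
    qed
    have hist: "stream_path k -` history n r s b \<inter> space M
        = {\<omega> \<in> space M. S k (n - int r) \<omega> = s' 0 \<and>
          (\<forall>i\<in>{1..r}. S k (n - int r + int i) \<omega> = s' i \<and> A k (n - int r + int i) \<omega> = b' i)}" (is "?L = ?R")
    proof (intro equalityI subsetI)
      fix \<omega> assume w: "\<omega> \<in> ?L"
      have 1: "S k (n - int i) \<omega> = s i" if "i \<le> r" for i
        using w that by (simp add: history_def stream_path_def)
      have 2: "A k (n - int i) \<omega> = b i" if "i < r" for i
        using w that by (simp add: history_def stream_path_def)
      have "S k (n - int r + int i) \<omega> = s' i \<and> A k (n - int r + int i) \<omega> = b' i" if "i \<in> {1..r}" for i
      proof -
        have e0: "n - int r + int i = n - int (r - i)" using that by (simp add: of_nat_diff)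
        show ?thesis
          unfolding e0 s'_def b'_def using 1[of "r - i"] 2[of "r - i"] that by (simp del: of_nat_diff)
      qed
      then show "\<omega> \<in> ?R" using w 1[of r] by (simp add: s'_def)
    next
      fix \<omega> assume w: "\<omega> \<in> ?R"
      have 0: "n - int i = n - int r + int (r - i)" if "i \<le> r" for i
        using that by (simp add: of_nat_diff)
      have "S k (n - int i) \<omega> = s i" if "i \<le> r" for i
      proof (cases "i = r")
        case True then show ?thesis using w by (simp add: s'_def)
      next
        case False
        then have "r - i \<in> {1..r}" using that by auto
        then have "S k (n - int r + int (r - i)) \<omega> = s' (r - i)" using w by blast
        then have "S k (n - int i) \<omega> = s' (r - i)" by (simp only: 0[OF that])
        then show ?thesis using that by (simp add: s'_def)
      qed
      moreover have "A k (n - int i) \<omega> = b i" if "i < r" for i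
      proof -
        have "r - i \<in> {1..r}" using that by auto
        then have "A k (n - int r + int (r - i)) \<omega> = b' (r - i)" using w by blast
        then have "A k (n - int i) \<omega> = b' (r - i)" by (simp only: 0[OF less_imp_le[OF that]])
        then show ?thesis using that by (simp add: b'_def)
      qed
      ultimately show "\<omega> \<in> ?L" using w by (simp add: history_def stream_path_def)
    qed
    have "stream_path k -` (history n r s b \<inter> next_step n x j l) \<inter> space M
        = (stream_path k -` history n r s b \<inter> space M) \<inter> {\<omega>. S k (n + 1) \<omega> = j \<and> A k (n + 1) \<omega> = l}"
    proof -
      have "history n r s b \<inter> next_step n x j l = history n r s b \<inter> {z. z (n + 1) = (j, l)}"
        using e by blast
      then show ?thesis by (auto simp: stream_path_def)
    qed
    also have "\<dots> = {\<omega> \<in> space M. S k (n - int r) \<omega> = s' 0 \<and>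
          (\<forall>i\<in>{1..Suc r}. S k (n - int r + int i) \<omega> = s' i \<and> A k (n - int r + int i) \<omega> = b' i)}"
    proof -
      have 1: "{1..Suc r} = insert (Suc r) {1..r}" by auto
      have 2: "n - int r + int (Suc r) = n + 1" by simp
      have 3: "s' (Suc r) = j" "b' (Suc r) = l" by (simp_all add: s'_def b'_def)
      show ?thesis unfolding hist 1 ball_simps 2 by (auto simp: 3)
    qed
    finally have "prob (stream_path k -` (history n r s b \<inter> next_step n x j l) \<inter> space M)
        = prob (stream_path k -` history n r s b \<inter> space M) * (Ptr k (s' r) (s' (Suc r)) * pmf (a k (s' r) (s' (Suc r))) (b' (Suc r)))"
      unfolding hist using fdl[of "Suc r"] fdl[of r] by (simp add: mult.assoc)
    moreover have "s' r = x" "s' (Suc r) = j" "b' (Suc r) = l" by (simp_all add: s'_def b'_def True)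
    ultimately show ?thesis
      unfolding e using ok True by (auto simp: transition_law_def)
  qed
qed

text \<open>With \<open>UNIV\<close> and the empty set the family is closed under intersection and generates a
  sigma-algebra on the whole space.\<close>

definition histories :: "int \<Rightarrow> (int \<Rightarrow> nat \<times> nat) set set" where
  "histories n = {history n r s b | r s b. True} \<union> {UNIV, {}}"

lemma histories_sets: "e \<in> histories n \<Longrightarrow> e \<in> sets stream_space"
  using sets.top[of stream_space] by (auto simp: histories_def)

lemma histories_Int:
  assumes "e \<in> histories n" "e' \<in> histories n" shows "e \<inter> e' \<in> histories n"
proof -
  consider "e \<in> {UNIV, {}}" | "e' \<in> {UNIV, {}}"
    | r s b r' s' b' where "e = history n r s b" "e' = history n r' s' b'"
    using assms unfolding histories_def by blast
  then show ?thesis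
  proof cases
    case 3
    have "history n q t c \<in> histories n" for q t c unfolding histories_def by blast
    moreover have "{} \<in> histories n" unfolding histories_def by blast
    ultimately show ?thesis using history_Int[of n r s b r' s' b'] 3 by (metis empty_iff insert_iff)
  qed (use assms in \<open>auto simp: histories_def\<close>)
qed

lemma histories_next_step:
  assumes "e \<in> histories n"
  shows "prob (stream_path k -` (e \<inter> next_step n x j l) \<inter> space M)
    = prob (stream_path k -` (e \<inter> {z. fst (z n) = x}) \<inter> space M) * transition_law k x j l"
proof -
  consider "e = {}" | r s b where "e = history n r s b" | "e = UNIV"
    using assms unfolding histories_def by blast
  then show ?thesis
  proof cases
    case 3
    have "history n 0 (\<lambda>_. x) (\<lambda>_. 0) = {z. fst (z n) = x}" by (auto simp: history_def)
    then have *: "UNIV \<inter> next_step n x j l = history n 0 (\<lambda>_. x) (\<lambda>_. 0) \<inter> next_step n x j l"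
      "UNIV \<inter> {z. fst (z n) = x} = history n 0 (\<lambda>_. x) (\<lambda>_. 0) \<inter> {z. fst (z n) = x}" by auto
    show ?thesis unfolding 3 * by (rule history_next_step)
  next
    case 2
    show ?thesis unfolding 2 by (rule history_next_step)
  qed simp
qed

text \<open>The past of stream \<open>k\<close>, enlarged by everything that is independent of this stream: the other
  streams and all service times.\<close>

definition past_events :: "'k \<Rightarrow> int \<Rightarrow> 'a set set" where
  "past_events k n = {(\<Inter>k'. stream_path k' -` b k' \<inter> space M) \<inter> D | b D.
     b k \<in> histories n \<and> (\<forall>k'. b k' \<in> sets stream_space) \<and> D \<in> service_events}"

definition past :: "'k \<Rightarrow> int \<Rightarrow> 'a measure" where
  "past k n = sigma (space M) (past_events k n)"

lemma past_events_sets: "past_events k n \<subseteq> sets M"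
proof
  fix G assume "G \<in> past_events k n"
  then obtain b D where G: "G = (\<Inter>k'. stream_path k' -` b k' \<inter> space M) \<inter> D"
    and b: "\<And>k'. b k' \<in> sets stream_space" and D: "D \<in> service_events"
    unfolding past_events_def by blast
  have "(\<Inter>k'. stream_path k' -` b k' \<inter> space M) \<in> sets M"
    using b by (intro sets.finite_INT) auto
  then show "G \<in> sets M" using D service_events_sets G by auto
qed

lemma space_past[simp]: "space (past k n) = space M"
  and sets_past: "sets (past k n) = sigma_sets (space M) (past_events k n)"
proof -
  have "past_events k n \<subseteq> Pow (space M)" using past_events_sets sets.sets_into_space by blast
  then show "space (past k n) = space M" "sets (past k n) = sigma_sets (space M) (past_events k n)"
    by (auto simp: past_def)
qed

lemma subalgebra_past: "subalgebra M (past k n)"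
  unfolding subalgebra_def sets_past using past_events_sets by (auto intro!: sets.sigma_sets_subset)

lemma past_measurable: "f \<in> measurable (past k n) N \<Longrightarrow> f \<in> measurable M N"
  using subalgebra_past by (rule measurable_from_subalg)

lemma past_eventsI:
  assumes "b k \<in> histories n" "\<And>k'. b k' \<in> sets stream_space" "D \<in> service_events"
  shows "(\<Inter>k'. stream_path k' -` b k' \<inter> space M) \<inter> D \<in> sets (past k n)"
  unfolding sets_past using assms by (intro sigma_sets.Basic) (auto simp: past_events_def)

lemma service_events_space: "space M \<in> service_events"
  unfolding service_events_def
  using sets.top[of "vimage_algebra (space M) (\<lambda>\<omega> c. service_time h c \<omega>) (PiM UNIV (\<lambda>_. count_space UNIV))"]
  by simp

lemma past_histories:
  assumes "e \<in> histories n" shows "stream_path k -` e \<inter> space M \<in> sets (past k n)"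
proof -
  have "(\<Inter>k'. stream_path k' -` (if k' = k then e else UNIV) \<inter> space M) \<inter> space M \<in> sets (past k n)"
    using assms histories_sets[OF assms] sets.top[of stream_space] service_events_space
    by (intro past_eventsI) auto
  also have "(\<Inter>k'. stream_path k' -` (if k' = k then e else UNIV) \<inter> space M) \<inter> space M
      = stream_path k -` e \<inter> space M" by (auto split: if_splits)
  finally show ?thesis .
qed

lemma
  assumes "i \<le> n" shows past_S: "S k i \<in> measurable (past k n) (count_space UNIV)"
    and past_A: "A k i \<in> measurable (past k n) (count_space UNIV)"
proof -
  obtain q where q: "i = n - int q" using assms zle_iff_zadd[of i n] by auto
  have *: "{\<omega> \<in> space M. S k i \<omega> = x \<and> A k i \<omega> = y} \<in> sets (past k n)" for x y
  proof -
    define F where "F = ({..Suc q} \<rightarrow>\<^sub>E (UNIV :: nat set)) \<times> ({..q} \<rightarrow>\<^sub>E (UNIV :: nat set))"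
    have cF: "countable F" unfolding F_def by (intro countable_SIGMA countable_PiE) auto
    have "{\<omega> \<in> space M. S k i \<omega> = x \<and> A k i \<omega> = y}
      = (\<Union>(s, b) \<in> {(s, b) \<in> F. s q = x \<and> b q = y}. stream_path k -` history n (Suc q) s b \<inter> space M)" (is "?L = ?R")
    proof (intro equalityI subsetI)
      fix \<omega> assume w: "\<omega> \<in> ?L"
      define s where "s = restrict (\<lambda>i. S k (n - int i) \<omega>) {..Suc q}"
      define b where "b = restrict (\<lambda>i. A k (n - int i) \<omega>) {..q}"
      have "(s, b) \<in> F" "s q = x" "b q = y" "\<omega> \<in> stream_path k -` history n (Suc q) s b \<inter> space M"
        using w q by (auto simp: F_def s_def b_def history_def stream_path_def)
      then show "\<omega> \<in> ?R" by blast
    qed (auto simp: q history_def stream_path_def)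
    also have "\<dots> \<in> sets (past k n)"
    proof -
      have hh: "history n (Suc q) s b \<in> histories n" for s b unfolding histories_def by blast
      show ?thesis
    proof (rule sets.countable_UN'[OF countable_subset[OF _ cF]])
      show "{(s, b) \<in> F. s q = x \<and> b q = y} \<subseteq> F" by auto
      show "(\<lambda>(s, b). stream_path k -` history n (Suc q) s b \<inter> space M) ` {(s, b) \<in> F. s q = x \<and> b q = y} \<subseteq> sets (past k n)"
        using hh by (auto intro!: past_histories)
    qed
    qed
    finally show ?thesis .
  qed
  show "S k i \<in> measurable (past k n) (count_space UNIV)"
  proof (rule measurable_count_spaceI)
    fix x
    have "{\<omega> \<in> space (past k n). S k i \<omega> = x} = (\<Union>y. {\<omega> \<in> space M. S k i \<omega> = x \<and> A k i \<omega> = y})" by auto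
    also have "\<dots> \<in> sets (past k n)" using * by blast
    finally show "{\<omega> \<in> space (past k n). S k i \<omega> = x} \<in> sets (past k n)" .
  qed
  show "A k i \<in> measurable (past k n) (count_space UNIV)"
  proof (rule measurable_count_spaceI)
    fix y
    have "{\<omega> \<in> space (past k n). A k i \<omega> = y} = (\<Union>x. {\<omega> \<in> space M. S k i \<omega> = x \<and> A k i \<omega> = y})" by auto
    also have "\<dots> \<in> sets (past k n)" using * by blast
    finally show "{\<omega> \<in> space (past k n). A k i \<omega> = y} \<in> sets (past k n)" .
  qed
qed

lemma
  assumes "k' \<noteq> k"
  shows past_other_S: "S k' i \<in> measurable (past k n) (count_space UNIV)"
    and past_other_A: "A k' i \<in> measurable (past k n) (count_space UNIV)"
proof -
  have *: "stream_path k' -` e \<inter> space M \<in> sets (past k n)" if e: "e \<in> sets stream_space" for e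
  proof -
    have "(\<Inter>k''. stream_path k'' -` (if k'' = k' then e else UNIV) \<inter> space M) \<inter> space M \<in> sets (past k n)"
      using e assms sets.top[of stream_space] service_events_space
      by (intro past_eventsI) (auto simp: histories_def)
    also have "(\<Inter>k''. stream_path k'' -` (if k'' = k' then e else UNIV) \<inter> space M) \<inter> space M
        = stream_path k' -` e \<inter> space M" by (auto split: if_splits)
    finally show ?thesis .
  qed
  have m: "Measurable.pred stream_space (\<lambda>z. fst (z i) = x)" "Measurable.pred stream_space (\<lambda>z. snd (z i) = x)" for x
    by measurable
  show "S k' i \<in> measurable (past k n) (count_space UNIV)"
    using *[of "{z. fst (z i) = _}"] m(1)
    by (intro measurable_count_spaceI) (simp add: pred_def vimage_def Int_def stream_path_def conj_commute)
  show "A k' i \<in> measurable (past k n) (count_space UNIV)"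
    using *[of "{z. snd (z i) = _}"] m(2)
    by (intro measurable_count_spaceI) (simp add: pred_def vimage_def Int_def stream_path_def conj_commute)
qed

lemma past_h: "h k' i' l \<in> measurable (past k n) (count_space UNIV)"
proof (rule measurable_count_spaceI)
  fix x
  have "{\<omega> \<in> space M. h k' i' l \<omega> = x} \<in> service_events"
  proof -
    let ?PM = "PiM UNIV (\<lambda>_. count_space UNIV) :: ('k customer \<Rightarrow> nat) measure"
    have "Measurable.pred ?PM (\<lambda>y. y (k', i', l) = x)" by measurable
    then have "(\<lambda>\<omega> c. service_time h c \<omega>) -` {y \<in> space ?PM. y (k', i', l) = x} \<inter> space M \<in> service_events"
      unfolding service_events_def by (intro in_vimage_algebra) (simp add: pred_def)
    also have "(\<lambda>\<omega> c. service_time h c \<omega>) -` {y \<in> space ?PM. y (k', i', l) = x} \<inter> space M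
        = {\<omega> \<in> space M. h k' i' l \<omega> = x}" by (auto simp: space_PiM)
    finally show ?thesis .
  qed
  then have "(\<Inter>k'. stream_path k' -` UNIV \<inter> space M) \<inter> {\<omega> \<in> space M. h k' i' l \<omega> = x} \<in> sets (past k n)"
    using sets.top[of stream_space] by (intro past_eventsI) (auto simp: histories_def)
  also have "(\<Inter>k'. stream_path k' -` UNIV \<inter> space M) \<inter> {\<omega> \<in> space M. h k' i' l \<omega> = x}
      = {\<omega> \<in> space M. h k' i' l \<omega> = x}" by auto
  finally show "{\<omega> \<in> space (past k n). h k' i' l \<omega> = x} \<in> sets (past k n)" by simp
qed

text \<open>On the generating events both sides are equal, because the stream is independent of the other
  streams and of the services, and by the law of the next step after a history.\<close>

lemma Markov_elementary:
  assumes V: "V \<in> borel_measurable (past k n)"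
  shows "(\<integral>\<^sup>+\<omega>. V \<omega> * indicator {\<omega>. S k n \<omega> = x \<and> S k (n + 1) \<omega> = j \<and> A k (n + 1) \<omega> = l} \<omega> \<partial>M)
    = (\<integral>\<^sup>+\<omega>. V \<omega> * (indicator {\<omega>. S k n \<omega> = x} \<omega> * ennreal (transition_law k x j l)) \<partial>M)"
proof (rule nn_integral_eq_on_generated[OF _ past_events_sets])
  show "Int_stable (past_events k n)"
  proof (rule Int_stableI)
    fix G G' assume "G \<in> past_events k n" "G' \<in> past_events k n"
    then obtain b D b' D' where G: "G = (\<Inter>k'. stream_path k' -` b k' \<inter> space M) \<inter> D"
      "b k \<in> histories n" "\<And>k'. b k' \<in> sets stream_space" "D \<in> service_events"
      and G': "G' = (\<Inter>k'. stream_path k' -` b' k' \<inter> space M) \<inter> D'"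
      "b' k \<in> histories n" "\<And>k'. b' k' \<in> sets stream_space" "D' \<in> service_events"
      unfolding past_events_def by blast
    have "G \<inter> G' = (\<Inter>k'. stream_path k' -` (b k' \<inter> b' k') \<inter> space M) \<inter> (D \<inter> D')"
      unfolding G(1) G'(1) by auto
    moreover have "D \<inter> D' \<in> service_events"
      using G(4) G'(4) unfolding service_events_def by (rule sets.Int)
    ultimately show "G \<inter> G' \<in> past_events k n"
      using histories_Int[OF G(2) G'(2)] G(3) G'(3) unfolding past_events_def
      by (intro CollectI exI[of _ "\<lambda>k'. b k' \<inter> b' k'"] exI[of _ "D \<inter> D'"]) auto
  qed
  have "(\<Inter>k'. stream_path k' -` UNIV \<inter> space M) \<inter> space M \<in> past_events k n"
    unfolding past_events_def using sets.top[of stream_space] service_events_space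
    by (intro CollectI exI[of _ "\<lambda>_. UNIV"] exI[of _ "space M"]) (auto simp: histories_def)
  then show "space M \<in> past_events k n" by simp
  show "(\<integral>\<^sup>+\<omega>. indicator {\<omega>. S k n \<omega> = x \<and> S k (n + 1) \<omega> = j \<and> A k (n + 1) \<omega> = l} \<omega> \<partial>M) \<noteq> \<infinity>"
  proof -
    have "(\<integral>\<^sup>+\<omega>. indicator {\<omega>. S k n \<omega> = x \<and> S k (n + 1) \<omega> = j \<and> A k (n + 1) \<omega> = l} \<omega> \<partial>M) \<le> (\<integral>\<^sup>+\<omega>. 1 \<partial>M)"
      by (intro nn_integral_mono) (auto split: split_indicator)
    then show ?thesis by (auto simp: emeasure_space_1 top_unique)
  qed
  fix G assume "G \<in> past_events k n"
  then obtain b D where G: "G = (\<Inter>k'. stream_path k' -` b k' \<inter> space M) \<inter> D"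
    and b: "b k \<in> histories n" "\<And>k'. b k' \<in> sets stream_space" and D: "D \<in> service_events"
    unfolding past_events_def by blast
  have prob_split: "prob ((stream_path k -` e \<inter> space M) \<inter> G)
      = prob (stream_path k -` (b k \<inter> e) \<inter> space M) * ((\<Prod>k' \<in> UNIV - {k}. prob (stream_path k' -` b k' \<inter> space M)) * prob D)"
    if [measurable]: "e \<in> sets stream_space" for e
  proof -
    have "(stream_path k -` e \<inter> space M) \<inter> G
        = (\<Inter>k'. stream_path k' -` (b(k := b k \<inter> e)) k' \<inter> space M) \<inter> D"
      unfolding G by (auto split: if_splits)
    moreover have "(b(k := b k \<inter> e)) k' \<in> sets stream_space" for k'
      using b(2) that by auto
    ultimately have "prob ((stream_path k -` e \<inter> space M) \<inter> G)
        = (\<Prod>k' \<in> UNIV. prob (stream_path k' -` (b(k := b k \<inter> e)) k' \<inter> space M)) * prob D"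
      using streams_and_services[OF _ D] by presburger
    also have "(\<Prod>k' \<in> UNIV. prob (stream_path k' -` (b(k := b k \<inter> e)) k' \<inter> space M))
        = prob (stream_path k -` (b k \<inter> e) \<inter> space M)
          * (\<Prod>k' \<in> UNIV - {k}. prob (stream_path k' -` (b(k := b k \<inter> e)) k' \<inter> space M))"
      by (subst prod.remove[of _ k]) auto
    also have "(\<Prod>k' \<in> UNIV - {k}. prob (stream_path k' -` (b(k := b k \<inter> e)) k' \<inter> space M))
        = (\<Prod>k' \<in> UNIV - {k}. prob (stream_path k' -` b k' \<inter> space M))" by (intro prod.cong) auto
    finally show ?thesis by (simp add: mult.assoc)
  qed
  have m: "next_step n x j l \<in> sets stream_space" "{z. fst (z n) = x} \<in> sets stream_space"
  proof -
    have "Measurable.pred stream_space (\<lambda>z. fst (z n) = x \<and> z (n + 1) = (j, l))"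
      "Measurable.pred stream_space (\<lambda>z. fst (z n) = x)" by measurable
    then show "next_step n x j l \<in> sets stream_space" "{z. fst (z n) = x} \<in> sets stream_space"
      by (simp_all add: pred_def)
  qed
  have GM: "G \<in> sets M" using \<open>G \<in> past_events k n\<close> past_events_sets by auto
  let ?E1 = "(stream_path k -` next_step n x j l \<inter> space M) \<inter> G"
  let ?E2 = "(stream_path k -` {z. fst (z n) = x} \<inter> space M) \<inter> G"
  have EM: "?E1 \<in> sets M" "?E2 \<in> sets M"
    using m GM measurable_sets[OF stream_path_measurable] by auto
  have tl: "0 \<le> transition_law k x j l"
  proof -
    have "0 \<le> Ptr k x j" if "x \<le> m k" "j \<le> m k"
      using stream_parameters[of k] that
      unfolding stream_parameters_def transition_matrix_def by auto
    then show ?thesis by (auto simp: transition_law_def)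
  qed
  have "(\<integral>\<^sup>+\<omega>. indicator {\<omega>. S k n \<omega> = x \<and> S k (n + 1) \<omega> = j \<and> A k (n + 1) \<omega> = l} \<omega> * indicator G \<omega> \<partial>M)
      = (\<integral>\<^sup>+\<omega>. indicator ?E1 \<omega> \<partial>M)"
    by (intro nn_integral_cong) (auto simp: stream_path_def split: split_indicator)
  also have "\<dots> = ennreal (prob ?E1)" using EM by (simp add: emeasure_eq_measure)
  also have "prob ?E1 = prob ?E2 * transition_law k x j l"
    using prob_split[OF m(1)] prob_split[OF m(2)] histories_next_step[OF b(1), of k x j l] by simp
  also have "ennreal (prob ?E2 * transition_law k x j l) = (\<integral>\<^sup>+\<omega>. indicator ?E2 \<omega> * ennreal (transition_law k x j l) \<partial>M)"
    using EM tl by (simp add: nn_integral_multc emeasure_eq_measure ennreal_mult')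
  also have "\<dots> = (\<integral>\<^sup>+\<omega>. indicator {\<omega>. S k n \<omega> = x} \<omega> * ennreal (transition_law k x j l) * indicator G \<omega> \<partial>M)"
    by (intro nn_integral_cong) (auto simp: stream_path_def split: split_indicator)
  finally show "(\<integral>\<^sup>+\<omega>. indicator {\<omega>. S k n \<omega> = x \<and> S k (n + 1) \<omega> = j \<and> A k (n + 1) \<omega> = l} \<omega> * indicator G \<omega> \<partial>M)
      = (\<integral>\<^sup>+\<omega>. indicator {\<omega>. S k n \<omega> = x} \<omega> * ennreal (transition_law k x j l) * indicator G \<omega> \<partial>M)" .
qed (use V in \<open>auto simp: past_def\<close>)

text \<open>One step of the joint chain of phases and batch sizes, as an operator on nonnegative functions.\<close>

definition step_operator :: "'k \<Rightarrow> (nat \<Rightarrow> nat \<Rightarrow> ennreal) \<Rightarrow> nat \<Rightarrow> ennreal" where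
  "step_operator k f x = (\<Sum>j\<le>m k. \<Sum>l. ennreal (transition_law k x j l) * f j l)"

lemma Markov_property:
  assumes V: "V \<in> borel_measurable (past k n)"
  shows "(\<integral>\<^sup>+\<omega>. V \<omega> * f (S k (n + 1) \<omega>) (A k (n + 1) \<omega>) \<partial>M) = (\<integral>\<^sup>+\<omega>. V \<omega> * step_operator k f (S k n \<omega>) \<partial>M)"
proof -
  note [measurable] = past_measurable[OF V]
  let ?I = "\<lambda>x j l \<omega>. indicator {\<omega>. S k n \<omega> = x \<and> S k (n + 1) \<omega> = j \<and> A k (n + 1) \<omega> = l} \<omega> :: ennreal"
  have [measurable]: "(\<lambda>\<omega>. ?I x j l \<omega>) \<in> borel_measurable M" for x j l
    unfolding indicator_def by measurable
  have [measurable]: "(\<lambda>\<omega>. indicator {\<omega>. S k n \<omega> = x} \<omega> :: ennreal) \<in> borel_measurable M" for x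
    unfolding indicator_def by measurable
  have "(\<integral>\<^sup>+\<omega>. V \<omega> * f (S k (n + 1) \<omega>) (A k (n + 1) \<omega>) \<partial>M)
      = (\<integral>\<^sup>+\<omega>. (\<Sum>x\<le>m k. \<Sum>j\<le>m k. \<Sum>l. (V \<omega> * ?I x j l \<omega>) * f j l) \<partial>M)"
  proof (rule nn_integral_cong_AE)
    show "AE \<omega> in M. V \<omega> * f (S k (n + 1) \<omega>) (A k (n + 1) \<omega>)
      = (\<Sum>x\<le>m k. \<Sum>j\<le>m k. \<Sum>l. (V \<omega> * ?I x j l \<omega>) * f j l)"
      using AE_streams
    proof eventually_elim
      case (elim \<omega>)
      have 1: "(\<Sum>l. (V \<omega> * ?I x j l \<omega>) * f j l)
          = (if S k n \<omega> = x \<and> S k (n + 1) \<omega> = j then V \<omega> * f j (A k (n + 1) \<omega>) else 0)" for x j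
        by (subst suminf_finite[of "{A k (n + 1) \<omega>}"]) auto
      have "(\<Sum>j\<le>m k. \<Sum>l. (V \<omega> * ?I x j l \<omega>) * f j l)
          = (if S k n \<omega> = x then V \<omega> * f (S k (n + 1) \<omega>) (A k (n + 1) \<omega>) else 0)" for x
        unfolding 1 using elim by (auto simp: sum.delta)
      then show ?case using elim by (simp add: sum.delta)
    qed
  qed
  also have "\<dots> = (\<Sum>x\<le>m k. \<Sum>j\<le>m k. \<Sum>l. (\<integral>\<^sup>+\<omega>. V \<omega> * ?I x j l \<omega> \<partial>M) * f j l)"
    by (simp add: nn_integral_sum nn_integral_suminf nn_integral_multc)
  also have "\<dots> = (\<Sum>x\<le>m k. \<Sum>j\<le>m k. \<Sum>l.
      (\<integral>\<^sup>+\<omega>. V \<omega> * (indicator {\<omega>. S k n \<omega> = x} \<omega> * ennreal (transition_law k x j l)) \<partial>M) * f j l)"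
    by (simp only: Markov_elementary[OF V])
  also have "\<dots> = (\<integral>\<^sup>+\<omega>. (\<Sum>x\<le>m k. \<Sum>j\<le>m k. \<Sum>l. V \<omega> * (indicator {\<omega>. S k n \<omega> = x} \<omega> * ennreal (transition_law k x j l)) * f j l) \<partial>M)"
    by (simp add: nn_integral_sum nn_integral_suminf nn_integral_multc)
  also have "\<dots> = (\<integral>\<^sup>+\<omega>. V \<omega> * step_operator k f (S k n \<omega>) \<partial>M)"
  proof (rule nn_integral_cong_AE)
    show "AE \<omega> in M. (\<Sum>x\<le>m k. \<Sum>j\<le>m k. \<Sum>l. V \<omega> * (indicator {\<omega>. S k n \<omega> = x} \<omega> * ennreal (transition_law k x j l)) * f j l)
      = V \<omega> * step_operator k f (S k n \<omega>)"
      using AE_streams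
    proof eventually_elim
      case (elim \<omega>)
      have "(\<Sum>j\<le>m k. \<Sum>l. V \<omega> * (indicator {\<omega>. S k n \<omega> = x} \<omega> * ennreal (transition_law k x j l)) * f j l)
        = (if S k n \<omega> = x then V \<omega> * step_operator k f x else 0)" for x
        unfolding step_operator_def
        by (auto simp: mult.assoc sum_distrib_left ennreal_suminf_cmult)
      then show ?case using elim by (simp add: sum.delta)
    qed
  qed
  finally show ?thesis .
qed

subsection \<open>Service times\<close>

text \<open>All arrivals, and the service times of all customers but one.\<close>

definition other_events :: "'k customer \<Rightarrow> 'a set set" where
  "other_events c = {G \<inter> D | G D. G \<in> arrival_events \<and>
     D \<in> sets (vimage_algebra (space M) (\<lambda>\<omega>. restrict (\<lambda>d. service_time h d \<omega>) (- {c})) (PiM (- {c}) (\<lambda>_. count_space UNIV)))}"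

definition others :: "'k customer \<Rightarrow> 'a measure" where
  "others c = sigma (space M) (other_events c)"

lemma arrival_events_sets: "arrival_events \<subseteq> sets M"
  unfolding arrival_events_def
  by (rule sets_image_in_sets) (auto intro!: measurable_PiM_single')

lemma other_events_sets: "other_events c \<subseteq> sets M"
proof -
  have "sets (vimage_algebra (space M) (\<lambda>\<omega>. restrict (\<lambda>d. service_time h d \<omega>) (- {c})) (PiM (- {c}) (\<lambda>_. count_space UNIV))) \<subseteq> sets M"
    by (rule sets_image_in_sets) (auto intro!: measurable_restrict)
  then show ?thesis using arrival_events_sets unfolding other_events_def by blast
qed

lemma space_others[simp]: "space (others c) = space M"
  and sets_others: "sets (others c) = sigma_sets (space M) (other_events c)"
proof -
  have "other_events c \<subseteq> Pow (space M)" using other_events_sets sets.sets_into_space by blast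
  then show "space (others c) = space M" "sets (others c) = sigma_sets (space M) (other_events c)"
    by (auto simp: others_def)
qed

lemma others_measurable: "f \<in> measurable (others c) N \<Longrightarrow> f \<in> measurable M N"
proof (rule measurable_from_subalg)
  show "subalgebra M (others c)"
    unfolding subalgebra_def sets_others by (simp add: sets.sigma_sets_subset other_events_sets)
qed

lemma others_arrivals: "G \<in> arrival_events \<Longrightarrow> G \<in> sets (others c)"
proof -
  let ?N = "vimage_algebra (space M) (\<lambda>\<omega>. restrict (\<lambda>d. service_time h d \<omega>) (- {c})) (PiM (- {c}) (\<lambda>_. count_space UNIV))"
  assume G: "G \<in> arrival_events"
  have "G \<inter> space ?N \<in> sets (others c)"
    unfolding sets_others using G sets.top[of ?N]
    by (intro sigma_sets.Basic) (auto simp: other_events_def)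
  then show ?thesis using G arrival_events_sets sets.sets_into_space by (auto simp: Int_absorb2)
qed

lemma others_S: "S k n \<in> measurable (others c) (count_space UNIV)"
  and others_A: "A k n \<in> measurable (others c) (count_space UNIV)"
proof -
  let ?X = "\<lambda>\<omega> (k, n). (S k n \<omega>, A k n \<omega>)" and ?PM = "PiM UNIV (\<lambda>_. count_space UNIV) :: ('k \<times> int \<Rightarrow> nat \<times> nat) measure"
  have *: "?X -` {y \<in> space ?PM. Q (y (k, n))} \<inter> space M \<in> sets (others c)" for Q
  proof (rule others_arrivals)
    have "Measurable.pred ?PM (\<lambda>y. Q (y (k, n)))" by measurable
    then show "?X -` {y \<in> space ?PM. Q (y (k, n))} \<inter> space M \<in> arrival_events"
      unfolding arrival_events_def by (intro in_vimage_algebra) (simp add: pred_def)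
  qed
  show "S k n \<in> measurable (others c) (count_space UNIV)"
    using *[of "\<lambda>z. fst z = _"]
    by (intro measurable_count_spaceI) (simp add: vimage_def Int_def space_PiM conj_commute)
  show "A k n \<in> measurable (others c) (count_space UNIV)"
    using *[of "\<lambda>z. snd z = _"]
    by (intro measurable_count_spaceI) (simp add: vimage_def Int_def space_PiM conj_commute)
qed

lemma others_h: "(k, n, i) \<noteq> c \<Longrightarrow> h k n i \<in> measurable (others c) (count_space UNIV)"
proof (rule measurable_count_spaceI)
  fix x assume ne: "(k, n, i) \<noteq> c"
  let ?PM = "PiM (- {c}) (\<lambda>_. count_space UNIV) :: ('k customer \<Rightarrow> nat) measure"
  let ?f = "\<lambda>\<omega>. restrict (\<lambda>d. service_time h d \<omega>) (- {c})"
  have "(k, n, i) \<in> - {c}" using ne by simp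
  then have [measurable]: "(\<lambda>y. y (k, n, i)) \<in> measurable ?PM (count_space UNIV)"
    by (rule measurable_component_singleton)
  have "Measurable.pred ?PM (\<lambda>y. y (k, n, i) = x)" by measurable
  then have "?f -` {y \<in> space ?PM. y (k, n, i) = x} \<inter> space M \<in> sets (vimage_algebra (space M) ?f ?PM)"
    by (intro in_vimage_algebra) (simp add: pred_def)
  moreover have "space M \<in> arrival_events"
    unfolding arrival_events_def
    using sets.top[of "vimage_algebra (space M) (\<lambda>\<omega> (k, n). (S k n \<omega>, A k n \<omega>)) (PiM UNIV (\<lambda>_. count_space UNIV))"]
    by simp
  ultimately have "space M \<inter> (?f -` {y \<in> space ?PM. y (k, n, i) = x} \<inter> space M) \<in> sets (others c)"
    unfolding sets_others other_events_def by (intro sigma_sets.Basic) blast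
  also have "space M \<inter> (?f -` {y \<in> space ?PM. y (k, n, i) = x} \<inter> space M) = {\<omega> \<in> space M. h k n i \<omega> = x}"
    using ne by (auto simp: space_PiM)
  finally show "{\<omega> \<in> space (others c). h k n i \<omega> = x} \<in> sets (others c)" by simp
qed

lemma prob_service: "prob {\<omega> \<in> space M. h k n i \<omega> = x} = pmf (H k) x"
proof -
  have "pmf (H k) x = measure (distr M (count_space UNIV) (h k n i)) {x}"
    unfolding service_law by (simp add: pmf.rep_eq)
  also have "\<dots> = prob (h k n i -` {x} \<inter> space M)" by (rule measure_distr) auto
  also have "h k n i -` {x} \<inter> space M = {\<omega> \<in> space M. h k n i \<omega> = x}" by auto
  finally show ?thesis by simp
qed

text \<open>The counterpart of \<open>Markov_elementary\<close>, with a generator on which independence of the service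
  times is assumed.\<close>

lemma service_independent_elementary:
  assumes V: "V \<in> borel_measurable (others (k, n, i))"
  shows "(\<integral>\<^sup>+\<omega>. V \<omega> * indicator {\<omega>. h k n i \<omega> = x} \<omega> \<partial>M) = (\<integral>\<^sup>+\<omega>. V \<omega> * ennreal (pmf (H k) x) \<partial>M)"
proof (rule nn_integral_eq_on_generated[OF _ other_events_sets])
  define c where "c = (k, n, i)"
  let ?PM = "PiM (- {c}) (\<lambda>_. count_space UNIV) :: ('k customer \<Rightarrow> nat) measure"
  let ?f = "\<lambda>\<omega>. restrict (\<lambda>d. service_time h d \<omega>) (- {c})"
  show "Int_stable (other_events (k, n, i))"
  proof (rule Int_stableI)
    fix a b assume "a \<in> other_events (k, n, i)" "b \<in> other_events (k, n, i)"
    then obtain G D G' D' where ab: "a = G \<inter> D" "b = G' \<inter> D'" and G: "G \<in> arrival_events" "G' \<in> arrival_events"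
      and D: "D \<in> sets (vimage_algebra (space M) ?f ?PM)" "D' \<in> sets (vimage_algebra (space M) ?f ?PM)"
      unfolding other_events_def c_def by blast
    have "a \<inter> b = (G \<inter> G') \<inter> (D \<inter> D')" unfolding ab by auto
    moreover have "G \<inter> G' \<in> arrival_events" using G unfolding arrival_events_def by (rule sets.Int)
    moreover have "D \<inter> D' \<in> sets (vimage_algebra (space M) ?f ?PM)" using D by (rule sets.Int)
    ultimately show "a \<inter> b \<in> other_events (k, n, i)" unfolding other_events_def c_def by blast
  qed
  have top: "space M \<in> arrival_events" "space M \<in> sets (vimage_algebra (space M) ?f ?PM)"
    unfolding arrival_events_def
    using sets.top[of "vimage_algebra (space M) (\<lambda>\<omega> (k, n). (S k n \<omega>, A k n \<omega>)) (PiM UNIV (\<lambda>_. count_space UNIV))"]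
      sets.top[of "vimage_algebra (space M) ?f ?PM"]
    by simp_all
  then show "space M \<in> other_events (k, n, i)" unfolding other_events_def c_def by blast
  have "(\<integral>\<^sup>+\<omega>. indicator {\<omega>. h k n i \<omega> = x} \<omega> \<partial>M) \<le> (\<integral>\<^sup>+\<omega>. 1 \<partial>M)"
    by (intro nn_integral_mono) (auto split: split_indicator)
  then show "(\<integral>\<^sup>+\<omega>. indicator {\<omega>. h k n i \<omega> = x} \<omega> \<partial>M) \<noteq> \<infinity>"
    by (auto simp: emeasure_space_1 top_unique)
  fix b assume b_in: "b \<in> other_events (k, n, i)"
  then obtain G D where b: "b = G \<inter> D" and G: "G \<in> arrival_events" and D: "D \<in> sets (vimage_algebra (space M) ?f ?PM)"
    unfolding other_events_def c_def by blast
  let ?h = "{\<omega> \<in> space M. h k n i \<omega> = x}"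
  have hserv: "?h \<in> service_events"
  proof -
    let ?PN = "PiM UNIV (\<lambda>_. count_space UNIV) :: ('k customer \<Rightarrow> nat) measure"
    have "Measurable.pred ?PN (\<lambda>y. y (k, n, i) = x)" by measurable
    then have "(\<lambda>\<omega> c. service_time h c \<omega>) -` {y \<in> space ?PN. y (k, n, i) = x} \<inter> space M \<in> service_events"
      unfolding service_events_def by (intro in_vimage_algebra) (simp add: pred_def)
    also have "(\<lambda>\<omega> c. service_time h c \<omega>) -` {y \<in> space ?PN. y (k, n, i) = x} \<inter> space M = ?h"
      by (auto simp: space_PiM)
    finally show ?thesis .
  qed
  have f_space: "?f \<in> space M \<rightarrow> space ?PM" by (auto simp: space_PiM)
  obtain B where B: "B \<in> sets ?PM" and DB: "D = ?f -` B \<inter> space M"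
    using D unfolding sets_vimage_algebra2[OF f_space] by blast
  have D_serv: "D \<in> service_events"
  proof -
    let ?PN = "PiM UNIV (\<lambda>_. count_space UNIV) :: ('k customer \<Rightarrow> nat) measure"
    have r: "(\<lambda>y. restrict y (- {c})) \<in> measurable ?PN ?PM" by (rule measurable_restrict_subset) simp
    have "(\<lambda>\<omega> c. service_time h c \<omega>) -` ((\<lambda>y. restrict y (- {c})) -` B \<inter> space ?PN) \<inter> space M \<in> service_events"
      unfolding service_events_def using measurable_sets[OF r B] by (rule in_vimage_algebra)
    also have "(\<lambda>\<omega> c. service_time h c \<omega>) -` ((\<lambda>y. restrict y (- {c})) -` B \<inter> space ?PN) \<inter> space M = D"
      unfolding DB by (auto simp: space_PiM restrict_def)
    finally show ?thesis .
  qed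
  have "prob (D \<inter> ?h) = prob D * pmf (H k) x"
  proof -
    let ?g = "\<lambda>\<omega>. restrict (\<lambda>d. service_time h d \<omega>) {c}"
    have "indep_var ?PM ?f (PiM {c} (\<lambda>_. count_space UNIV)) ?g"
      using services_independent by (rule indep_var_restrict) auto
    then have ind: "indep_set (sigma_sets (space M) {?f -` A \<inter> space M | A. A \<in> sets ?PM})
       (sigma_sets (space M) {?g -` A \<inter> space M | A. A \<in> sets (PiM {c} (\<lambda>_. count_space UNIV))})"
      by (simp add: indep_var_eq)
    have hx: "?h = ?g -` {y \<in> space (PiM {c} (\<lambda>_. count_space UNIV)). y c = x} \<inter> space M"
      by (auto simp: space_PiM c_def)
    have "Measurable.pred (PiM {c} (\<lambda>_. count_space UNIV)) (\<lambda>y. y c = x)" by measurable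
    then have "?h \<in> sigma_sets (space M) {?g -` A \<inter> space M | A. A \<in> sets (PiM {c} (\<lambda>_. count_space UNIV))}"
      unfolding hx pred_def by (intro sigma_sets.Basic) blast
    moreover have "D \<in> sigma_sets (space M) {?f -` A \<inter> space M | A. A \<in> sets ?PM}"
      unfolding DB using B by (intro sigma_sets.Basic) auto
    ultimately have "prob (D \<inter> ?h) = prob D * prob ?h" using ind by (intro indep_setD) auto
    then show ?thesis by (simp add: prob_service)
  qed
  moreover have "prob (G \<inter> (D \<inter> ?h)) = prob G * prob (D \<inter> ?h)" "prob (G \<inter> D) = prob G * prob D"
  proof -
    have "D \<inter> ?h \<in> service_events" using D_serv hserv unfolding service_events_def by (rule sets.Int)
    then show "prob (G \<inter> (D \<inter> ?h)) = prob G * prob (D \<inter> ?h)" "prob (G \<inter> D) = prob G * prob D"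
      using services_independent_of_arrivals G D_serv
      unfolding arrival_events_def service_events_def by (auto intro: indep_setD)
  qed
  ultimately have e: "prob (b \<inter> ?h) = prob b * pmf (H k) x" by (simp add: b Int_assoc)
  have bM[measurable]: "b \<in> sets M" using b_in other_events_sets[of "(k, n, i)"] by blast
  have bhM: "b \<inter> ?h \<in> sets M" by measurable
  have "(\<integral>\<^sup>+\<omega>. indicator {\<omega>. h k n i \<omega> = x} \<omega> * indicator b \<omega> \<partial>M) = (\<integral>\<^sup>+\<omega>. indicator (b \<inter> ?h) \<omega> \<partial>M)"
    by (intro nn_integral_cong) (auto split: split_indicator)
  also have "\<dots> = ennreal (prob (b \<inter> ?h))" using bhM by (simp add: emeasure_eq_measure)
  also have "\<dots> = ennreal (pmf (H k) x) * emeasure M b"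
    unfolding e by (subst mult.commute) (simp add: emeasure_eq_measure ennreal_mult')
  also have "\<dots> = (\<integral>\<^sup>+\<omega>. ennreal (pmf (H k) x) * indicator b \<omega> \<partial>M)"
    by (rule nn_integral_cmult_indicator[OF bM, symmetric])
  finally show "(\<integral>\<^sup>+\<omega>. indicator {\<omega>. h k n i \<omega> = x} \<omega> * indicator b \<omega> \<partial>M) = (\<integral>\<^sup>+\<omega>. ennreal (pmf (H k) x) * indicator b \<omega> \<partial>M)" .
qed (use V in \<open>auto simp: others_def indicator_def\<close>)

lemma service_independent:
  assumes V: "V \<in> borel_measurable (others (k, n, i))"
  shows "(\<integral>\<^sup>+\<omega>. V \<omega> * f (h k n i \<omega>) \<partial>M) = (\<integral>\<^sup>+\<omega>. V \<omega> \<partial>M) * (\<integral>\<^sup>+x. f x \<partial>measure_pmf (H k))"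
proof -
  note [measurable] = others_measurable[OF V]
  have [measurable]: "(\<lambda>\<omega>. indicator {\<omega>. h k n i \<omega> = x} \<omega> :: ennreal) \<in> borel_measurable M" for x
    unfolding indicator_def by measurable
  have "(\<integral>\<^sup>+\<omega>. V \<omega> * f (h k n i \<omega>) \<partial>M) = (\<integral>\<^sup>+\<omega>. (\<Sum>x. (V \<omega> * indicator {\<omega>. h k n i \<omega> = x} \<omega>) * f x) \<partial>M)"
  proof (rule nn_integral_cong)
    fix \<omega>
    show "V \<omega> * f (h k n i \<omega>) = (\<Sum>x. (V \<omega> * indicator {\<omega>. h k n i \<omega> = x} \<omega>) * f x)"
      by (subst suminf_finite[of "{h k n i \<omega>}"]) auto
  qed
  also have "\<dots> = (\<Sum>x. (\<integral>\<^sup>+\<omega>. V \<omega> * ennreal (pmf (H k) x) \<partial>M) * f x)"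
    by (simp add: nn_integral_suminf nn_integral_multc service_independent_elementary[OF V])
  also have "\<dots> = (\<integral>\<^sup>+\<omega>. V \<omega> \<partial>M) * (\<Sum>x. ennreal (pmf (H k) x) * f x)"
    by (simp add: nn_integral_multc mult.assoc)
  also have "(\<Sum>x. ennreal (pmf (H k) x) * f x) = (\<integral>\<^sup>+x. f x \<partial>measure_pmf (H k))"
    by (simp add: nn_integral_measure_pmf nn_integral_count_space_nat)
  finally show ?thesis .
qed

end

lemma time_shift_measurable'[measurable]: "time_shift d \<in> measurable path_space path_space"
proof -
  have eq: "time_shift d = (\<lambda>y i. y (fst i, snd i + d))" by (auto simp: fun_eq_iff time_shift_def)
  show ?thesis unfolding path_space_def eq by (auto intro!: measurable_PiM_single')
qed

lemma time_shift_add[simp]: "time_shift d (time_shift e y) = time_shift (d + e) y"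
  by (auto simp: time_shift_def fun_eq_iff add.assoc)

lemma suminf_ennreal_Suc: "(\<Sum>n. f n :: ennreal) = f 0 + (\<Sum>n. f (Suc n))"
  using suminf_offset[of f 1] by (simp add: summableI add.commute)

section \<open>Expected recurrence times and arrivals\<close>

text \<open>The active period containing slot \<open>0\<close> began in exactly one slot, provided that the stream was idle
  at some time before.\<close>

lemma suminf_period_start:
  fixes s :: "int \<Rightarrow> nat"
  shows "(\<Sum>n. indicator {n. s (- int n - 1) = 0 \<and> stays_active s (- int n - 1) (Suc n)} n :: ennreal)
    = (if s 0 \<noteq> 0 \<and> (\<exists>n. s (- int n) = 0) then 1 else 0)"
proof -
  let ?E = "{n. s (- int n - 1) = 0 \<and> stays_active s (- int n - 1) (Suc n)}"
  have E: "n \<in> ?E \<longleftrightarrow> s (- int (Suc n)) = 0 \<and> (\<forall>i\<le>n. s (- int i) \<noteq> 0)" for n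
  proof -
    have 1: "stays_active s (- int n - 1) (Suc n) \<longleftrightarrow> (\<forall>i\<le>n. s (- int i) \<noteq> 0)"
    proof
      assume st: "stays_active s (- int n - 1) (Suc n)"
      show "\<forall>i\<le>n. s (- int i) \<noteq> 0"
      proof (intro allI impI)
        fix i assume "i \<le> n"
        then have "Suc n - i \<in> {1..Suc n}" "- int n - 1 + int (Suc n - i) = - int i"
          by (auto simp: of_nat_diff)
        then show "s (- int i) \<noteq> 0" using st unfolding stays_active_def by metis
      qed
    next
      assume st: "\<forall>i\<le>n. s (- int i) \<noteq> 0"
      show "stays_active s (- int n - 1) (Suc n)"
        unfolding stays_active_def
      proof
        fix i assume "i \<in> {1..Suc n}"
        then have "Suc n - i \<le> n" "- int n - 1 + int i = - int (Suc n - i)"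
          by (auto simp: of_nat_diff)
        then show "s (- int n - 1 + int i) \<noteq> 0" using st by metis
      qed
    qed
    have 2: "s (- int n - 1) = s (- int (Suc n))" by (rule arg_cong[where f = s]) simp
    show ?thesis by (simp only: mem_Collect_eq 1 2)
  qed
  show ?thesis
  proof (cases "s 0 \<noteq> 0 \<and> (\<exists>n. s (- int n) = 0)")
    case True
    define q where "q = (LEAST n. s (- int n) = 0)"
    have q: "s (- int q) = 0" unfolding q_def using True by (metis (mono_tags) LeastI)
    have q': "s (- int i) \<noteq> 0" if "i < q" for i using that not_less_Least unfolding q_def by blast
    have "q \<noteq> 0" using True q by (intro notI) simp
    then obtain r where r: "q = Suc r" using not0_implies_Suc by blast
    have "?E = {r}"
    proof (intro equalityI subsetI)
      fix n assume "n \<in> ?E"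
      then have n: "s (- int (Suc n)) = 0" "\<forall>i\<le>n. s (- int i) \<noteq> 0" using E by auto
      have "q \<le> Suc n" unfolding q_def using n(1) by (rule Least_le)
      moreover have "\<not> q \<le> n" using n(2) q by blast
      ultimately show "n \<in> {r}" using r by simp
    next
      fix n assume "n \<in> {r}"
      then have "n = r" by simp
      have "s (- int (Suc r)) = 0" using q r by simp
      moreover have "\<forall>i\<le>r. s (- int i) \<noteq> 0" using q' r by simp
      ultimately show "n \<in> ?E" unfolding E \<open>n = r\<close> by blast
    qed
    moreover have "(\<Sum>n. indicator {r} n :: ennreal) = 1" by (subst suminf_finite[of "{r}"]) auto
    ultimately show ?thesis using True by simp
  next
    case False
    have "?E = {}"
    proof (rule equals0I)
      fix n assume "n \<in> ?E"
      then have "s (- int (Suc n)) = 0" and "s (- int 0) \<noteq> 0" unfolding E by blast+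
      from this(2) have "s 0 \<noteq> 0" by simp
      with \<open>s (- int (Suc n)) = 0\<close> show False using False by blast
    qed
    then show ?thesis using False by auto
  qed
qed

context
  fixes s a :: "int \<Rightarrow> nat"
  assumes hits: "\<And>n. \<exists>c. s (n + 1 + int c) = 0"
begin

lemma period_sum_induct:
  fixes f :: "int \<Rightarrow> nat"
  assumes "s (n + 1) \<noteq> 0"
  shows "(\<Sum>i<recurrence_time s n. f (n + 1 + int i))
    = f (n + 1) + (\<Sum>i<recurrence_time s (n + 1). f (n + 1 + 1 + int i))"
  unfolding recurrence_time_active[of s, OF hits assms] by (subst sum.lessThan_Suc_shift) (simp add: add.assoc)

text \<open>Expanding a product of two sums over an active period and grouping the terms by the earlier
  slot leaves, for each slot, what is still to come in the period. This is how second moments of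
  active periods become means of recurrence times and of the arrivals in them.\<close>

lemma
  shows period_sum_arrivals:
      "(\<Sum>i<recurrence_time s n. a (n + 1 + int i)) = recurrence_arrivals s a n"
    and period_sum_recurrence_time:
      "(\<Sum>i<recurrence_time s n. 1 + recurrence_time s (n + 1 + int i))
       = recurrence_time s n + (recurrence_time s n choose 2)"
    and period_sum_square:
      "(\<Sum>i<recurrence_time s n. a (n + 1 + int i) * (a (n + 1 + int i) + 2 * recurrence_arrivals s a (n + 1 + int i)))
       = (recurrence_arrivals s a n)\<^sup>2"
    and period_sum_product:
      "(\<Sum>i<recurrence_time s n. a (n + 1 + int i) * (1 + recurrence_time s (n + 1 + int i))
          + recurrence_arrivals s a (n + 1 + int i))
       = recurrence_time s n * recurrence_arrivals s a n"
proof (induction "recurrence_time s n" arbitrary: n)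
  case 0
  { case 1 show ?case using 0 by (simp add: recurrence_arrivals_def) }
  { case 2 show ?case using 0 by simp }
  { case 3 show ?case using 0 by (simp add: recurrence_arrivals_def) }
  { case 4 show ?case using 0 by simp }
next
  case (Suc c)
  have act: "s (n + 1) \<noteq> 0"
    using Suc.hyps(5) recurrence_time_inactive[of s n, OF hits] by auto
  note rt = recurrence_time_active[of s, OF hits act] and ra = recurrence_arrivals_active[of s, OF hits act, of a]
  have c: "c = recurrence_time s (n + 1)" using Suc.hyps(5) rt by simp
  note IH = Suc.hyps(1-4)[OF c]
  { case 1 show ?case unfolding period_sum_induct[OF act, of a] IH(1) ra .. }
  { case 2 show ?case unfolding period_sum_induct[OF act, of "\<lambda>i. 1 + recurrence_time s i"] IH(2)
      unfolding rt by (simp add: numeral_2_eq_2) }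
  { case 3 show ?case unfolding period_sum_induct[OF act, of "\<lambda>i. a i * (a i + 2 * recurrence_arrivals s a i)"] IH(3) unfolding ra
      by (simp add: power2_eq_square algebra_simps) }
  { case 4 show ?case unfolding period_sum_induct[OF act, of "\<lambda>i. a i * (1 + recurrence_time s i) + recurrence_arrivals s a i"] IH(4) unfolding ra rt by (simp add: algebra_simps) }
qed

end

context stationary_queue
begin

text \<open>The transition matrix of stream \<open>k\<close> killed upon leaving the active phases, and the mean
  size of the next batch.\<close>

definition killed :: "'k \<Rightarrow> (nat \<Rightarrow> ennreal) \<Rightarrow> nat \<Rightarrow> ennreal" where
  "killed k f x = (\<Sum>j = 1..m k. ennreal (Ptr k x j) * f j)"

definition batch_mean :: "'k \<Rightarrow> nat \<Rightarrow> ennreal" where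
  "batch_mean k x = killed k (\<lambda>j. \<integral>\<^sup>+l. of_nat l \<partial>measure_pmf (a k x j)) x"

text \<open>The mean number of slots up to the next idle one, given the present phase, and the mean number
  of customers that arrive meanwhile. The \<open>n\<close>-th terms belong to the event that the stream stays active
  for \<open>n\<close> more slots.\<close>

definition expected_time :: "'k \<Rightarrow> nat \<Rightarrow> ennreal" where
  "expected_time k x = (\<Sum>n. (killed k ^^ n) (\<lambda>_. 1) x)"

definition expected_arrivals :: "'k \<Rightarrow> nat \<Rightarrow> ennreal" where
  "expected_arrivals k x = (\<Sum>n. (killed k ^^ n) (batch_mean k) x)"

lemma killed_suminf: "killed k (\<lambda>x. \<Sum>n. f n x) x = (\<Sum>n. killed k (f n) x)"
  unfolding killed_def by (simp add: suminf_sum summableI)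

text \<open>First step decompositions; they yield the Poisson equation for \<open>excess\<close>.\<close>

lemma expected_time_eq: "expected_time k x = 1 + killed k (expected_time k) x"
proof -
  have "expected_time k x = 1 + (\<Sum>n. (killed k ^^ Suc n) (\<lambda>_. 1) x)"
    unfolding expected_time_def by (subst suminf_ennreal_Suc) simp
  also have "(\<Sum>n. (killed k ^^ Suc n) (\<lambda>_. 1) x) = killed k (expected_time k) x"
    unfolding expected_time_def[abs_def] by (simp add: killed_suminf)
  finally show ?thesis .
qed

lemma expected_arrivals_eq: "expected_arrivals k x = batch_mean k x + killed k (expected_arrivals k) x"
proof -
  have "expected_arrivals k x = batch_mean k x + (\<Sum>n. (killed k ^^ Suc n) (batch_mean k) x)"
    unfolding expected_arrivals_def by (subst suminf_ennreal_Suc) simp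
  also have "(\<Sum>n. (killed k ^^ Suc n) (batch_mean k) x) = killed k (expected_arrivals k) x"
    unfolding expected_arrivals_def[abs_def] by (simp add: killed_suminf)
  finally show ?thesis .
qed

lemma transition_nonneg: "x \<le> m k \<Longrightarrow> j \<le> m k \<Longrightarrow> 0 \<le> Ptr k x j"
  using stream_parameters[of k] unfolding stream_parameters_def transition_matrix_def by auto

lemma step_operator_eq:
  assumes "x \<le> m k"
  shows "step_operator k f x
    = (\<Sum>j\<le>m k. ennreal (Ptr k x j) * (\<integral>\<^sup>+l. f j l \<partial>measure_pmf (a k x j)))"
  unfolding step_operator_def
proof (rule sum.cong)
  fix j assume "j \<in> {..m k}"
  then have "(\<Sum>l. ennreal (transition_law k x j l) * f j l)
      = (\<Sum>l. ennreal (Ptr k x j) * (ennreal (pmf (a k x j) l) * f j l))"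
    using assms transition_nonneg[of x k j]
    by (intro arg_cong[where f = suminf] ext) (simp add: transition_law_def ennreal_mult mult.assoc)
  also have "\<dots> = ennreal (Ptr k x j) * (\<integral>\<^sup>+l. f j l \<partial>measure_pmf (a k x j))"
    by (simp add: nn_integral_measure_pmf nn_integral_count_space_nat)
  finally show "(\<Sum>l. ennreal (transition_law k x j l) * f j l)
      = ennreal (Ptr k x j) * (\<integral>\<^sup>+l. f j l \<partial>measure_pmf (a k x j))" .
qed simp

lemma sum_atMost_active:
  fixes g :: "nat \<Rightarrow> ennreal"
  shows "(\<Sum>j\<le>n. if j = 0 then 0 else g j) = (\<Sum>j = 1..n. g j)"
proof -
  have "{..n} = insert 0 {1..n}" by auto
  then have "(\<Sum>j\<le>n. if j = 0 then 0 else g j) = (\<Sum>j\<in>insert 0 {1..n}. if j = 0 then 0 else g j)" by simp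
  also have "\<dots> = (\<Sum>j = 1..n. g j)" by (subst sum.insert) (auto intro!: sum.cong)
  finally show ?thesis .
qed

lemma step_operator_killed:
  assumes "x \<le> m k"
  shows "step_operator k (\<lambda>j l. if j = 0 then 0 else f j) x = killed k f x"
proof -
  have "step_operator k (\<lambda>j l. if j = 0 then 0 else f j) x
      = (\<Sum>j\<le>m k. if j = 0 then 0 else ennreal (Ptr k x j) * f j)"
    unfolding step_operator_eq[OF assms]
    by (intro sum.cong) (auto simp: measure_pmf.emeasure_space_1[simplified])
  then show ?thesis unfolding killed_def sum_atMost_active .
qed

lemma step_operator_batch_mean:
  assumes "x \<le> m k"
  shows "step_operator k (\<lambda>j l. if j = 0 then 0 else of_nat l) x = batch_mean k x"
proof -
  have "step_operator k (\<lambda>j l. if j = 0 then 0 else of_nat l) x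
      = (\<Sum>j\<le>m k. if j = 0 then 0 else ennreal (Ptr k x j) * (\<integral>\<^sup>+l. of_nat l \<partial>measure_pmf (a k x j)))"
    unfolding step_operator_eq[OF assms] by (intro sum.cong) auto
  then show ?thesis unfolding batch_mean_def killed_def sum_atMost_active .
qed

lemma Markov_killed:
  assumes "V \<in> borel_measurable (past k n)"
  shows "(\<integral>\<^sup>+\<omega>. V \<omega> * (if S k (n + 1) \<omega> = 0 then 0 else f (S k (n + 1) \<omega>)) \<partial>M)
    = (\<integral>\<^sup>+\<omega>. V \<omega> * killed k f (S k n \<omega>) \<partial>M)"
proof -
  have "(\<integral>\<^sup>+\<omega>. V \<omega> * (if S k (n + 1) \<omega> = 0 then 0 else f (S k (n + 1) \<omega>)) \<partial>M)
      = (\<integral>\<^sup>+\<omega>. V \<omega> * step_operator k (\<lambda>j l. if j = 0 then 0 else f j) (S k n \<omega>) \<partial>M)"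
    by (rule Markov_property[OF assms])
  also have "\<dots> = (\<integral>\<^sup>+\<omega>. V \<omega> * killed k f (S k n \<omega>) \<partial>M)"
    using AE_streams by (intro nn_integral_cong_AE) (auto simp: step_operator_killed elim!: eventually_mono)
  finally show ?thesis .
qed

lemma Markov_batch_mean:
  assumes "V \<in> borel_measurable (past k n)"
  shows "(\<integral>\<^sup>+\<omega>. V \<omega> * of_nat (A k (n + 1) \<omega>) \<partial>M) = (\<integral>\<^sup>+\<omega>. V \<omega> * batch_mean k (S k n \<omega>) \<partial>M)"
proof -
  have "(\<integral>\<^sup>+\<omega>. V \<omega> * of_nat (A k (n + 1) \<omega>) \<partial>M)
      = (\<integral>\<^sup>+\<omega>. V \<omega> * (if S k (n + 1) \<omega> = 0 then 0 else of_nat (A k (n + 1) \<omega>)) \<partial>M)"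
    using AE_streams by (intro nn_integral_cong_AE) (auto elim!: eventually_mono)
  also have "\<dots> = (\<integral>\<^sup>+\<omega>. V \<omega> * step_operator k (\<lambda>j l. if j = 0 then 0 else of_nat l) (S k n \<omega>) \<partial>M)"
    by (rule Markov_property[OF assms])
  also have "\<dots> = (\<integral>\<^sup>+\<omega>. V \<omega> * batch_mean k (S k n \<omega>) \<partial>M)"
    using AE_streams by (intro nn_integral_cong_AE) (auto simp: step_operator_batch_mean elim!: eventually_mono)
  finally show ?thesis .
qed

abbreviation stays :: "'k \<Rightarrow> int \<Rightarrow> nat \<Rightarrow> 'a \<Rightarrow> bool" where
  "stays k n l \<omega> \<equiv> stays_active (\<lambda>i. S k i \<omega>) n l"

lemma stays_measurable[measurable]: "Measurable.pred M (\<lambda>\<omega>. stays k n l \<omega>)"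
  unfolding stays_active_def by measurable

lemma past_stays: "Measurable.pred (past k (n + int l)) (\<lambda>\<omega>. stays k n l \<omega>)"
proof -
  have "Measurable.pred (past k (n + int l)) (\<lambda>\<omega>. \<forall>i\<in>{1..l}. S k (n + int i) \<omega> \<noteq> 0)"
  proof (intro pred_intros_finite(3))
    fix i assume "i \<in> {1..l}"
    then have [measurable]: "S k (n + int i) \<in> measurable (past k (n + int l)) (count_space UNIV)"
      by (intro past_S) auto
    show "Measurable.pred (past k (n + int l)) (\<lambda>\<omega>. S k (n + int i) \<omega> \<noteq> 0)" by measurable
  qed simp
  then show ?thesis by (simp add: stays_active_def)
qed

lemma past_mono: "n \<le> n' \<Longrightarrow> sets (past k n) \<subseteq> sets (past k n')"
proof -
  assume le: "n \<le> n'"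
  have UN: "UNIV \<in> histories n'" by (simp add: histories_def)
  have "past_events k n \<subseteq> sets (past k n')"
  proof
    fix G assume "G \<in> past_events k n"
    then obtain b D where G: "G = (\<Inter>k'. stream_path k' -` b k' \<inter> space M) \<inter> D"
      and bk: "b k \<in> histories n" and b: "\<And>k'. b k' \<in> sets stream_space" and D: "D \<in> service_events"
      unfolding past_events_def by blast
    have "stream_path k -` b k \<inter> space M \<in> sets (past k n')"
    proof -
      consider "b k = {}" | "b k = UNIV" | r s c where "b k = history n r s c"
        using bk unfolding histories_def by blast
      then show ?thesis
      proof cases
        case (3 r s c)
        have [measurable]: "S k (n - int i) \<in> measurable (past k n') (count_space UNIV)"
          "A k (n - int i) \<in> measurable (past k n') (count_space UNIV)" for i
          using le by (auto intro!: past_S past_A)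
        have "Measurable.pred (past k n') (\<lambda>\<omega>. (\<forall>i\<le>r. S k (n - int i) \<omega> = s i) \<and> (\<forall>i<r. A k (n - int i) \<omega> = c i))"
          by measurable
        moreover have "stream_path k -` history n r s c \<inter> space M = {\<omega> \<in> space (past k n').
            (\<forall>i\<le>r. S k (n - int i) \<omega> = s i) \<and> (\<forall>i<r. A k (n - int i) \<omega> = c i)}"
          by (auto simp: history_def stream_path_def)
        ultimately show ?thesis unfolding 3 pred_def by (simp only:)
      qed (use sets.top[of "past k n'"] in auto)
    qed
    moreover have "(\<Inter>k'. stream_path k' -` (b(k := UNIV)) k' \<inter> space M) \<inter> D \<in> sets (past k n')"
      by (rule past_eventsI) (use b D UN sets.top[of stream_space] in simp_all)
    ultimately have "(\<Inter>k'. stream_path k' -` (b(k := UNIV)) k' \<inter> space M) \<inter> D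
        \<inter> (stream_path k -` b k \<inter> space M) \<in> sets (past k n')"
      by - (rule sets.Int)
    also have "(\<Inter>k'. stream_path k' -` (b(k := UNIV)) k' \<inter> space M) \<inter> D
        \<inter> (stream_path k -` b k \<inter> space M) = G"
      unfolding G by (auto split: if_splits)
    finally show "G \<in> sets (past k n')" .
  qed
  then show "sets (past k n) \<subseteq> sets (past k n')"
    unfolding sets_past[of k n] using sets.sigma_sets_subset[of _ "past k n'"] by simp
qed

lemma past_measurable_mono:
  assumes "f \<in> measurable (past k n) N" "n \<le> n'"
  shows "f \<in> measurable (past k n') N"
proof (rule measurable_from_subalg[OF _ assms(1)])
  show "subalgebra (past k n') (past k n)"
    using past_mono assms(2) by (auto simp: subalgebra_def)
qed

lemma past_indicator_stays:
  assumes "V \<in> borel_measurable (past k n)"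
  shows "(\<lambda>\<omega>. V \<omega> * indicator {\<omega>. stays k n l \<omega>} \<omega> :: ennreal) \<in> borel_measurable (past k (n + int l))"
proof -
  have [measurable]: "V \<in> borel_measurable (past k (n + int l))"
    using assms by (rule past_measurable_mono) simp
  note [measurable] = past_stays[of k n l]
  show ?thesis unfolding indicator_def by measurable
qed

text \<open>Iterating the killed chain follows the stream as long as it stays active.\<close>

lemma Markov_stays:
  assumes "V \<in> borel_measurable (past k n)"
  shows "(\<integral>\<^sup>+\<omega>. V \<omega> * indicator {\<omega>. stays k n l \<omega>} \<omega> * f (S k (n + int l) \<omega>) \<partial>M)
    = (\<integral>\<^sup>+\<omega>. V \<omega> * (killed k ^^ l) f (S k n \<omega>) \<partial>M)"
proof (induction l arbitrary: f)
  case (Suc l)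
  have e: "n + int (Suc l) = n + int l + 1" by simp
  have "(\<integral>\<^sup>+\<omega>. V \<omega> * indicator {\<omega>. stays k n (Suc l) \<omega>} \<omega> * f (S k (n + int (Suc l)) \<omega>) \<partial>M)
      = (\<integral>\<^sup>+\<omega>. V \<omega> * indicator {\<omega>. stays k n l \<omega>} \<omega>
          * (if S k (n + int l + 1) \<omega> = 0 then 0 else f (S k (n + int l + 1) \<omega>)) \<partial>M)"
    unfolding e stays_active_Suc by (intro nn_integral_cong) (auto split: split_indicator)
  also have "\<dots> = (\<integral>\<^sup>+\<omega>. V \<omega> * indicator {\<omega>. stays k n l \<omega>} \<omega> * killed k f (S k (n + int l) \<omega>) \<partial>M)"
    by (rule Markov_killed[OF past_indicator_stays[OF assms]])
  also have "\<dots> = (\<integral>\<^sup>+\<omega>. V \<omega> * (killed k ^^ l) (killed k f) (S k n \<omega>) \<partial>M)" by (rule Suc)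
  finally show ?case by (simp add: funpow_swap1)
qed simp

lemma expected_time_stays:
  assumes "V \<in> borel_measurable (past k n)"
  shows "(\<integral>\<^sup>+\<omega>. V \<omega> * (\<Sum>l. indicator {\<omega>. stays k n l \<omega>} \<omega>) \<partial>M) = (\<integral>\<^sup>+\<omega>. V \<omega> * expected_time k (S k n \<omega>) \<partial>M)"
proof -
  note [measurable] = past_measurable[OF assms]
  have [measurable]: "(\<lambda>\<omega>. indicator {\<omega>. stays k n l \<omega>} \<omega> :: ennreal) \<in> borel_measurable M" for l
    unfolding indicator_def by measurable
  have "(\<integral>\<^sup>+\<omega>. V \<omega> * (\<Sum>l. indicator {\<omega>. stays k n l \<omega>} \<omega>) \<partial>M)
      = (\<Sum>l. \<integral>\<^sup>+\<omega>. V \<omega> * indicator {\<omega>. stays k n l \<omega>} \<omega> \<partial>M)"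
    by (simp flip: ennreal_suminf_cmult add: nn_integral_suminf)
  also have "\<dots> = (\<Sum>l. \<integral>\<^sup>+\<omega>. V \<omega> * (killed k ^^ l) (\<lambda>_. 1) (S k n \<omega>) \<partial>M)"
    using Markov_stays[OF assms, of _ "\<lambda>_. 1"] by simp
  also have "\<dots> = (\<integral>\<^sup>+\<omega>. V \<omega> * expected_time k (S k n \<omega>) \<partial>M)"
    unfolding expected_time_def by (simp flip: ennreal_suminf_cmult add: nn_integral_suminf)
  finally show ?thesis .
qed

lemma expected_arrivals_stays:
  assumes "V \<in> borel_measurable (past k n)"
  shows "(\<integral>\<^sup>+\<omega>. V \<omega> * (\<Sum>l. indicator {\<omega>. stays k n (Suc l) \<omega>} \<omega> * of_nat (A k (n + int l + 1) \<omega>)) \<partial>M)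
    = (\<integral>\<^sup>+\<omega>. V \<omega> * expected_arrivals k (S k n \<omega>) \<partial>M)"
proof -
  note [measurable] = past_measurable[OF assms]
  have [measurable]: "(\<lambda>\<omega>. indicator {\<omega>. stays k n l \<omega>} \<omega> :: ennreal) \<in> borel_measurable M" for l
    unfolding indicator_def by measurable
  have "(\<integral>\<^sup>+\<omega>. V \<omega> * (\<Sum>l. indicator {\<omega>. stays k n (Suc l) \<omega>} \<omega> * of_nat (A k (n + int l + 1) \<omega>)) \<partial>M)
      = (\<Sum>l. \<integral>\<^sup>+\<omega>. V \<omega> * (indicator {\<omega>. stays k n (Suc l) \<omega>} \<omega> * of_nat (A k (n + int l + 1) \<omega>)) \<partial>M)"
    by (simp flip: ennreal_suminf_cmult add: nn_integral_suminf)
  also have "\<dots> = (\<Sum>l. \<integral>\<^sup>+\<omega>. V \<omega> * (killed k ^^ l) (batch_mean k) (S k n \<omega>) \<partial>M)"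
  proof (intro arg_cong[where f = suminf] ext)
    fix l
    have "(\<integral>\<^sup>+\<omega>. V \<omega> * (indicator {\<omega>. stays k n (Suc l) \<omega>} \<omega> * of_nat (A k (n + int l + 1) \<omega>)) \<partial>M)
        = (\<integral>\<^sup>+\<omega>. V \<omega> * indicator {\<omega>. stays k n l \<omega>} \<omega> * of_nat (A k (n + int l + 1) \<omega>) \<partial>M)"
    proof (intro nn_integral_cong_AE)
      have e: "n + int (Suc l) = n + int l + 1" by simp
      show "AE \<omega> in M. V \<omega> * (indicator {\<omega>. stays k n (Suc l) \<omega>} \<omega> * of_nat (A k (n + int l + 1) \<omega>))
          = V \<omega> * indicator {\<omega>. stays k n l \<omega>} \<omega> * of_nat (A k (n + int l + 1) \<omega>)"
        using AE_streams unfolding stays_active_Suc e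
        by eventually_elim (auto split: split_indicator)
    qed
    also have "\<dots> = (\<integral>\<^sup>+\<omega>. V \<omega> * indicator {\<omega>. stays k n l \<omega>} \<omega> * batch_mean k (S k (n + int l) \<omega>) \<partial>M)"
      by (rule Markov_batch_mean[OF past_indicator_stays[OF assms]])
    also have "\<dots> = (\<integral>\<^sup>+\<omega>. V \<omega> * (killed k ^^ l) (batch_mean k) (S k n \<omega>) \<partial>M)"
      by (rule Markov_stays[OF assms])
    finally show "(\<integral>\<^sup>+\<omega>. V \<omega> * (indicator {\<omega>. stays k n (Suc l) \<omega>} \<omega> * of_nat (A k (n + int l + 1) \<omega>)) \<partial>M)
        = (\<integral>\<^sup>+\<omega>. V \<omega> * (killed k ^^ l) (batch_mean k) (S k n \<omega>) \<partial>M)" .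
  qed
  also have "\<dots> = (\<integral>\<^sup>+\<omega>. V \<omega> * expected_arrivals k (S k n \<omega>) \<partial>M)"
    unfolding expected_arrivals_def by (simp flip: ennreal_suminf_cmult add: nn_integral_suminf)
  finally show ?thesis .
qed

subsection \<open>Positivity and finiteness\<close>

lemma prob_phase_stationary: "prob {\<omega> \<in> space M. S k n \<omega> = j} = prob {\<omega> \<in> space M. S k 0 \<omega> = j}"
proof -
  have "(\<integral>\<^sup>+\<omega>. indicator {\<omega>. S k n \<omega> = j} \<omega> \<partial>M) = (\<integral>\<^sup>+\<omega>. indicator {\<omega>. S k 0 \<omega> = j} \<omega> \<partial>M)"
    by (rule nn_integral_stationary[where \<phi> = "\<lambda>y. indicator {y. y (Phase k, 0) = j} y" and d = n and e = 0])
       (auto simp: indicator_def)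
  moreover have "(\<integral>\<^sup>+\<omega>. indicator {\<omega>. S k n \<omega> = j} \<omega> \<partial>M) = ennreal (prob {\<omega> \<in> space M. S k n \<omega> = j})" for n
  proof -
    have "(\<integral>\<^sup>+\<omega>. indicator {\<omega>. S k n \<omega> = j} \<omega> \<partial>M) = (\<integral>\<^sup>+\<omega>. indicator {\<omega> \<in> space M. S k n \<omega> = j} \<omega> \<partial>M)"
      by (intro nn_integral_cong) (auto split: split_indicator)
    then show ?thesis by (simp add: emeasure_eq_measure)
  qed
  ultimately show ?thesis by (simp add: ennreal_inj)
qed

text \<open>A stationary law that charges a phase charges its successors, so by irreducibility every phase
  in the state space.\<close>

lemma prob_idle_pos: "0 < prob {\<omega> \<in> space M. S k n \<omega> = 0}"
proof -
  let ?\<pi> = "\<lambda>j. prob {\<omega> \<in> space M. S k 0 \<omega> = j}"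
  have step: "0 < ?\<pi> j" if "0 < ?\<pi> i" "i \<le> m k" "j \<le> m k" "0 < Ptr k i j" for i j
  proof -
    have V: "(\<lambda>\<omega>. indicator {\<omega>. S k 0 \<omega> = i} \<omega> :: ennreal) \<in> borel_measurable (past k 0)"
    proof -
      note [measurable] = past_S[of 0 0 k]
      show ?thesis unfolding indicator_def by measurable
    qed
    have nn: "(\<integral>\<^sup>+\<omega>. indicator {\<omega>. S k n \<omega> = j} \<omega> \<partial>M) = ennreal (?\<pi> j)" for n j
    proof -
      have "(\<integral>\<^sup>+\<omega>. indicator {\<omega>. S k n \<omega> = j} \<omega> \<partial>M) = (\<integral>\<^sup>+\<omega>. indicator {\<omega> \<in> space M. S k n \<omega> = j} \<omega> \<partial>M)"
        by (intro nn_integral_cong) (auto split: split_indicator)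
      then show ?thesis by (simp add: emeasure_eq_measure prob_phase_stationary[of k n j])
    qed
    have 1: "ennreal (?\<pi> i) * ennreal (Ptr k i j) \<le> ennreal (?\<pi> j)"
    proof -
      have "ennreal (Ptr k i j) \<le> step_operator k (\<lambda>j' l. indicator {j} j') i"
      proof -
        have "ennreal (Ptr k i j) * 1
            \<le> (\<Sum>j'\<le>m k. ennreal (Ptr k i j') * (\<integral>\<^sup>+l. indicator {j} j' \<partial>measure_pmf (a k i j')))"
          using that(3) by (intro order_trans[OF _ member_le_sum[of j]]) (auto simp: measure_pmf.emeasure_space_1[simplified])
        then show ?thesis unfolding step_operator_eq[OF that(2)] by simp
      qed
      then have "ennreal (?\<pi> i) * ennreal (Ptr k i j)
          \<le> (\<integral>\<^sup>+\<omega>. indicator {\<omega>. S k 0 \<omega> = i} \<omega> \<partial>M) * step_operator k (\<lambda>j' l. indicator {j} j') i"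
        unfolding nn by (rule mult_left_mono) simp
      also have "\<dots> = (\<integral>\<^sup>+\<omega>. indicator {\<omega>. S k 0 \<omega> = i} \<omega> * step_operator k (\<lambda>j' l. indicator {j} j') i \<partial>M)"
        by (rule nn_integral_multc[symmetric, OF past_measurable[OF V]])
      also have "\<dots> = (\<integral>\<^sup>+\<omega>. indicator {\<omega>. S k 0 \<omega> = i} \<omega> * step_operator k (\<lambda>j' l. indicator {j} j') (S k 0 \<omega>) \<partial>M)"
        by (intro nn_integral_cong) (auto split: split_indicator)
      also have "\<dots> = (\<integral>\<^sup>+\<omega>. indicator {\<omega>. S k 0 \<omega> = i} \<omega> * indicator {j} (S k (0 + 1) \<omega>) \<partial>M)"
        by (rule Markov_property[OF V, symmetric])
      also have "\<dots> \<le> (\<integral>\<^sup>+\<omega>. indicator {\<omega>. S k 1 \<omega> = j} \<omega> \<partial>M)"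
        by (intro nn_integral_mono) (auto split: split_indicator)
      finally show ?thesis unfolding nn .
    qed
    have 2: "0 < ennreal (?\<pi> i) * ennreal (Ptr k i j)"
      using that by (simp add: ennreal_zero_less_mult_iff)
    from less_le_trans[OF 2 1] show ?thesis by simp
  qed
  obtain i where i: "i \<le> m k" "0 < ?\<pi> i"
  proof -
    have "(\<Sum>i\<le>m k. ?\<pi> i) = prob (\<Union>i\<le>m k. {\<omega> \<in> space M. S k 0 \<omega> = i})"
      by (intro finite_measure_finite_Union[symmetric]) (auto simp: disjoint_family_on_def)
    also have "\<dots> = 1"
      using AE_streams by (subst prob_eq_1) (auto elim!: eventually_mono)
    finally have "(\<Sum>i\<le>m k. ?\<pi> i) = 1" .
    moreover have "(\<Sum>i\<le>m k. ?\<pi> i) = 0" if "\<not> (\<exists>i\<in>{..m k}. ?\<pi> i \<noteq> 0)"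
      using that by (intro sum.neutral) blast
    ultimately have "\<exists>i\<in>{..m k}. ?\<pi> i \<noteq> 0" by fastforce
    then show ?thesis using that by (auto simp: zero_less_measure_iff)
  qed
  have "(i, 0) \<in> {(u, v). u \<le> m k \<and> v \<le> m k \<and> Ptr k u v > 0}\<^sup>*"
    using stream_parameters[of k] i unfolding stream_parameters_def irreducible_on_def by simp
  then have "0 < ?\<pi> 0"
    using i by (induction rule: rtrancl_induct) (auto intro: step)
  then show ?thesis by (simp add: prob_phase_stationary[of k n])
qed

end

lemma suminf_one: "(\<Sum>n::nat. 1 :: ennreal) = top"
  by (subst nn_integral_count_space_nat[symmetric]) (simp add: emeasure_count_space_infinite)

context stationary_queue
begin

abbreviation mean_batch :: "'k \<Rightarrow> ennreal" where
  "mean_batch k \<equiv> \<integral>\<^sup>+\<omega>. of_nat (A k 0 \<omega>) \<partial>M"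

abbreviation idle :: "'k \<Rightarrow> int \<Rightarrow> 'a \<Rightarrow> ennreal" where
  "idle k n \<omega> \<equiv> indicator {\<omega>. S k n \<omega> = 0} \<omega>"

abbreviation active :: "'k \<Rightarrow> int \<Rightarrow> 'a \<Rightarrow> ennreal" where
  "active k n \<omega> \<equiv> indicator {\<omega>. S k n \<omega> \<noteq> 0} \<omega>"

abbreviation started :: "'k \<Rightarrow> nat \<Rightarrow> 'a \<Rightarrow> bool" where
  "started k n \<omega> \<equiv> S k (- int n - 1) \<omega> = 0 \<and> stays k (- int n - 1) (Suc n) \<omega>"

lemma indicator_measurable[measurable]:
  "(\<lambda>\<omega>. idle k n \<omega>) \<in> borel_measurable M" "(\<lambda>\<omega>. active k n \<omega>) \<in> borel_measurable M"
  "(\<lambda>\<omega>. indicator {\<omega>. stays k n l \<omega>} \<omega> :: ennreal) \<in> borel_measurable M"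
  "(\<lambda>\<omega>. indicator {\<omega>. started k q \<omega>} \<omega> :: ennreal) \<in> borel_measurable M"
  unfolding indicator_def by measurable

lemma past_idle: "n' \<le> n \<Longrightarrow> (\<lambda>\<omega>. idle k n' \<omega>) \<in> borel_measurable (past k n)"
  and past_active: "n' \<le> n \<Longrightarrow> (\<lambda>\<omega>. active k n' \<omega>) \<in> borel_measurable (past k n)"
proof -
  assume "n' \<le> n"
  then have [measurable]: "S k n' \<in> measurable (past k n) (count_space UNIV)" by (rule past_S)
  show "(\<lambda>\<omega>. idle k n' \<omega>) \<in> borel_measurable (past k n)"
    "(\<lambda>\<omega>. active k n' \<omega>) \<in> borel_measurable (past k n)"
    unfolding indicator_def by measurable
qed

text \<open>Mass transport: summing over the slots of an active period that begins in slot \<open>0\<close> amounts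
  to summing over all possible beginnings of the active period that contains slot \<open>0\<close>.\<close>

lemma period_transport:
  assumes \<phi>[measurable]: "\<phi> \<in> borel_measurable path_space"
    and \<Phi>: "\<And>n \<omega>. \<Phi> n \<omega> = \<phi> (time_shift n (sample_path \<omega>))"
  shows "(\<integral>\<^sup>+\<omega>. idle k (- 1) \<omega> * (\<Sum>n. indicator {\<omega>. stays k (- 1) (Suc n) \<omega>} \<omega> * \<Phi> (int n) \<omega>) \<partial>M)
    = (\<integral>\<^sup>+\<omega>. (\<Sum>n. indicator {n. started k n \<omega>} n) * \<Phi> 0 \<omega> \<partial>M)"
proof -
  have [measurable]: "\<Phi> n \<in> borel_measurable M" for n
  proof -
    have "\<Phi> n = (\<lambda>\<omega>. \<phi> (time_shift n (sample_path \<omega>)))" using \<Phi> by auto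
    then show ?thesis by simp
  qed
  have [measurable]: "(\<lambda>\<omega>. indicator {n. started k n \<omega>} n :: ennreal) \<in> borel_measurable M" for n
    unfolding indicator_def by measurable
  have "(\<integral>\<^sup>+\<omega>. idle k (- 1) \<omega> * (\<Sum>n. indicator {\<omega>. stays k (- 1) (Suc n) \<omega>} \<omega> * \<Phi> (int n) \<omega>) \<partial>M)
      = (\<Sum>n. \<integral>\<^sup>+\<omega>. idle k (- 1) \<omega> * (indicator {\<omega>. stays k (- 1) (Suc n) \<omega>} \<omega> * \<Phi> (int n) \<omega>) \<partial>M)"
    by (simp flip: ennreal_suminf_cmult add: nn_integral_suminf)
  also have "\<dots> = (\<Sum>n. \<integral>\<^sup>+\<omega>. indicator {n. started k n \<omega>} n * \<Phi> 0 \<omega> \<partial>M)"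
  proof (intro arg_cong[where f = suminf] ext)
    fix n
    show "(\<integral>\<^sup>+\<omega>. idle k (- 1) \<omega> * (indicator {\<omega>. stays k (- 1) (Suc n) \<omega>} \<omega> * \<Phi> (int n) \<omega>) \<partial>M)
        = (\<integral>\<^sup>+\<omega>. indicator {n. started k n \<omega>} n * \<Phi> 0 \<omega> \<partial>M)"
    proof (rule nn_integral_stationary[where d = 0 and e = "- int n"])
      let ?\<psi> = "\<lambda>y :: 'k observable \<times> int \<Rightarrow> nat.
          (if y (Phase k, - 1) = 0 \<and> (\<forall>i\<in>{1..Suc n}. y (Phase k, - 1 + int i) \<noteq> 0)
           then \<phi> (time_shift (int n) y) else 0)"
      show "?\<psi> \<in> borel_measurable path_space" by measurable
      show "idle k (- 1) \<omega> * (indicator {\<omega>. stays k (- 1) (Suc n) \<omega>} \<omega> * \<Phi> (int n) \<omega>)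
          = ?\<psi> (time_shift 0 (sample_path \<omega>))" for \<omega>
        by (auto simp: \<Phi> stays_active_def)
      have e: "- 1 + int i + - int n = - int n - 1 + int i" "- 1 + - int n = - int n - 1" for i by simp_all
      show "indicator {n. started k n \<omega>} n * \<Phi> 0 \<omega> = ?\<psi> (time_shift (- int n) (sample_path \<omega>))" for \<omega>
        unfolding time_shift_sample_path e time_shift_add \<Phi> stays_active_def by simp
    qed
  qed
  also have "\<dots> = (\<integral>\<^sup>+\<omega>. (\<Sum>n. indicator {n. started k n \<omega>} n) * \<Phi> 0 \<omega> \<partial>M)"
    by (simp flip: ennreal_suminf_multc add: nn_integral_suminf)
  finally show ?thesis .
qed

lemma idle_mult: "(\<integral>\<^sup>+\<omega>. idle k n \<omega> * f (S k n \<omega>) \<partial>M) = ennreal (prob {\<omega> \<in> space M. S k 0 \<omega> = 0}) * f 0"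
proof -
  have "(\<integral>\<^sup>+\<omega>. idle k n \<omega> * f (S k n \<omega>) \<partial>M) = (\<integral>\<^sup>+\<omega>. f 0 * indicator {\<omega> \<in> space M. S k n \<omega> = 0} \<omega> \<partial>M)"
    by (intro nn_integral_cong) (auto split: split_indicator)
  also have "\<dots> = f 0 * emeasure M {\<omega> \<in> space M. S k n \<omega> = 0}"
    by (rule nn_integral_cmult_indicator) measurable
  finally show ?thesis
    by (simp add: emeasure_eq_measure prob_phase_stationary[of k n] mult.commute)
qed

text \<open>A function that does not increase in the mean under the killed chain cannot be infinite at a
  successor of a phase where it is finite; by irreducibility, finiteness spreads from the idle phase.\<close>

lemma propagate_finite:
  assumes f: "\<And>x. killed k f x \<le> f x" and 0: "f 0 < top" and j: "j \<le> m k"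
  shows "f j < top"
proof -
  have "(0, j) \<in> {(u, v). u \<le> m k \<and> v \<le> m k \<and> Ptr k u v > 0}\<^sup>*"
    using stream_parameters[of k] j unfolding stream_parameters_def irreducible_on_def by simp
  then show ?thesis
  proof (induction rule: rtrancl_induct)
    case (step i j)
    show ?case
    proof (cases "j = 0")
      case False
      have "ennreal (Ptr k i j) * f j \<le> killed k f i"
        unfolding killed_def using step.hyps(2) False by (intro member_le_sum) auto
      also have "\<dots> \<le> f i" by (rule f)
      finally have "ennreal (Ptr k i j) * f j < top" using step.IH by (rule le_less_trans)
      then show ?thesis using step.hyps(2) by (auto simp: ennreal_mult_less_top)
    qed (simp add: 0)
  qed (rule 0)
qed

abbreviation idle_prob :: "'k \<Rightarrow> real" where
  "idle_prob k \<equiv> prob {\<omega> \<in> space M. S k 0 \<omega> = 0}"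

lemma idle_prob_pos: "0 < idle_prob k"
  by (rule prob_idle_pos)

lemma suminf_started_le: "(\<Sum>n. indicator {n. started k n \<omega>} n :: ennreal) \<le> 1"
  using suminf_period_start[of "\<lambda>i. S k i \<omega>"] by simp

text \<open>By mass transport, the mean return time of the idle phase, weighted by the probability of this
  phase, counts the slots in which the active period containing slot \<open>0\<close> can have begun. There is at most
  one, which bounds the mean return time without any estimate of its tail.\<close>

lemma idle_times_expected_time:
  "ennreal (idle_prob k) * expected_time k 0
    = ennreal (idle_prob k) + (\<integral>\<^sup>+\<omega>. (\<Sum>n. indicator {n. started k n \<omega>} n) \<partial>M)"
proof -
  have "ennreal (idle_prob k) * expected_time k 0 = (\<integral>\<^sup>+\<omega>. idle k (- 1) \<omega> * expected_time k (S k (- 1) \<omega>) \<partial>M)"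
    by (rule idle_mult[symmetric])
  also have "\<dots> = (\<integral>\<^sup>+\<omega>. idle k (- 1) \<omega> * (\<Sum>l. indicator {\<omega>. stays k (- 1) l \<omega>} \<omega>) \<partial>M)"
    by (rule expected_time_stays[OF past_idle, symmetric]) simp
  also have "\<dots> = (\<integral>\<^sup>+\<omega>. idle k (- 1) \<omega> + idle k (- 1) \<omega> * (\<Sum>n. indicator {\<omega>. stays k (- 1) (Suc n) \<omega>} \<omega> * 1) \<partial>M)"
    by (subst suminf_ennreal_Suc) (simp add: distrib_left)
  also have "\<dots> = (\<integral>\<^sup>+\<omega>. idle k (- 1) \<omega> \<partial>M)
      + (\<integral>\<^sup>+\<omega>. idle k (- 1) \<omega> * (\<Sum>n. indicator {\<omega>. stays k (- 1) (Suc n) \<omega>} \<omega> * 1) \<partial>M)"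
    by (rule nn_integral_add) measurable
  also have "(\<integral>\<^sup>+\<omega>. idle k (- 1) \<omega> \<partial>M) = ennreal (idle_prob k)"
    using idle_mult[of k "- 1" "\<lambda>_. 1"] by simp
  also have "(\<integral>\<^sup>+\<omega>. idle k (- 1) \<omega> * (\<Sum>n. indicator {\<omega>. stays k (- 1) (Suc n) \<omega>} \<omega> * 1) \<partial>M)
      = (\<integral>\<^sup>+\<omega>. (\<Sum>n. indicator {n. started k n \<omega>} n) * 1 \<partial>M)"
    by (rule period_transport[where \<phi> = "\<lambda>_. 1"]) auto
  finally show ?thesis by simp
qed

lemma expected_time_finite:
  assumes "x \<le> m k" shows "expected_time k x < top"
proof (rule propagate_finite[OF _ _ assms])
  show "killed k (expected_time k) x \<le> expected_time k x" for x
    by (subst expected_time_eq[of k x]) simp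
  have "(\<integral>\<^sup>+\<omega>. (\<Sum>n. indicator {n. started k n \<omega>} n) \<partial>M) \<le> (\<integral>\<^sup>+\<omega>. 1 \<partial>M)"
    by (intro nn_integral_mono suminf_started_le)
  then have "(\<integral>\<^sup>+\<omega>. (\<Sum>n. indicator {n. started k n \<omega>} n :: ennreal) \<partial>M) < top"
    by (simp add: emeasure_space_1 le_less_trans)
  then have "ennreal (idle_prob k) * expected_time k 0 < top"
    unfolding idle_times_expected_time by simp
  then show "expected_time k 0 < top" using idle_prob_pos[of k] by (auto simp: ennreal_mult_less_top)
qed

lemma expected_time_integral_finite: "(\<integral>\<^sup>+\<omega>. expected_time k (S k n \<omega>) \<partial>M) < top"
proof -
  have "(\<integral>\<^sup>+\<omega>. expected_time k (S k n \<omega>) \<partial>M) \<le> (\<integral>\<^sup>+\<omega>. (\<Sum>x\<le>m k. expected_time k x) \<partial>M)"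
  proof (rule nn_integral_mono_AE)
    show "AE \<omega> in M. expected_time k (S k n \<omega>) \<le> (\<Sum>x\<le>m k. expected_time k x)"
      using AE_streams by eventually_elim (auto intro!: member_le_sum)
  qed
  also have "\<dots> < top" using expected_time_finite by (simp add: emeasure_space_1)
  finally show ?thesis .
qed

lemma AE_returns: "AE \<omega> in M. \<forall>k n. \<exists>c. S k (n + 1 + int c) \<omega> = 0"
  unfolding AE_all_countable
proof (intro allI)
  fix k n
  have "(\<integral>\<^sup>+\<omega>. (\<Sum>l. indicator {\<omega>. stays k n l \<omega>} \<omega> :: ennreal) \<partial>M) < top"
    using expected_time_stays[of "\<lambda>_. 1" k n] expected_time_integral_finite[of k n] by simp
  then have "AE \<omega> in M. (\<Sum>l. indicator {\<omega>. stays k n l \<omega>} \<omega> :: ennreal) \<noteq> \<infinity>"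
    by (intro nn_integral_noteq_infinite) auto
  then show "AE \<omega> in M. \<exists>c. S k (n + 1 + int c) \<omega> = 0"
  proof eventually_elim
    case (elim \<omega>)
    show ?case
    proof (rule ccontr)
      assume no: "\<not> ?thesis"
      have "stays k n l \<omega>" for l
        unfolding stays_active_def
      proof
        fix i assume "i \<in> {1..l}"
        then have "n + int i = n + 1 + int (i - 1)" by auto
        then show "S k (n + int i) \<omega> \<noteq> 0" using no by metis
      qed
      then have "(\<Sum>l. indicator {\<omega>. stays k n l \<omega>} \<omega> :: ennreal) = (\<Sum>l. 1)" by simp
      also have "\<dots> = \<infinity>"
        by (simp add: suminf_one)
      finally show False using elim by simp
    qed
  qed
qed

text \<open>Stationarity replaces a reversal of time: having been active for \<open>l\<close> slots and staying active for
  \<open>l\<close> slots are equally likely.\<close>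

lemma AE_idle_before: "AE \<omega> in M. \<exists>c. S k (- int c) \<omega> = 0"
proof -
  have [measurable]: "(\<lambda>\<omega>. indicator {\<omega>. \<forall>i\<le>l. S k (- int i) \<omega> \<noteq> 0} \<omega> :: ennreal) \<in> borel_measurable M" for l
    unfolding indicator_def by measurable
  have "(\<integral>\<^sup>+\<omega>. (\<Sum>l. indicator {\<omega>. \<forall>i\<le>l. S k (- int i) \<omega> \<noteq> 0} \<omega> :: ennreal) \<partial>M)
      = (\<Sum>l. \<integral>\<^sup>+\<omega>. indicator {\<omega>. \<forall>i\<le>l. S k (- int i) \<omega> \<noteq> 0} \<omega> \<partial>M)"
    by (intro nn_integral_suminf) auto
  also have "\<dots> = (\<Sum>l. \<integral>\<^sup>+\<omega>. indicator {\<omega>. stays k 0 (Suc l) \<omega>} \<omega> \<partial>M)"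
  proof (intro arg_cong[where f = suminf] ext)
    fix l
    show "(\<integral>\<^sup>+\<omega>. indicator {\<omega>. \<forall>i\<le>l. S k (- int i) \<omega> \<noteq> 0} \<omega> \<partial>M) = (\<integral>\<^sup>+\<omega>. indicator {\<omega>. stays k 0 (Suc l) \<omega>} \<omega> \<partial>M)"
    proof (rule nn_integral_stationary[where d = 0 and e = "1 + int l"])
      show "(\<lambda>y :: 'k observable \<times> int \<Rightarrow> nat. indicator {y. \<forall>i\<le>l. y (Phase k, - int i) \<noteq> 0} y :: ennreal) \<in> borel_measurable path_space"
        unfolding indicator_def by measurable
      fix \<omega>
      have "stays k 0 (Suc l) \<omega> \<longleftrightarrow> (\<forall>i\<le>l. S k (- int i + (1 + int l)) \<omega> \<noteq> 0)"
      proof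
        assume st: "stays k 0 (Suc l) \<omega>"
        show "\<forall>i\<le>l. S k (- int i + (1 + int l)) \<omega> \<noteq> 0"
        proof (intro allI impI)
          fix i assume "i \<le> l"
          then have "Suc l - i \<in> {1..Suc l}" "0 + int (Suc l - i) = - int i + (1 + int l)"
            by (auto simp: of_nat_diff)
          then show "S k (- int i + (1 + int l)) \<omega> \<noteq> 0" using st unfolding stays_active_def by metis
        qed
      next
        assume st: "\<forall>i\<le>l. S k (- int i + (1 + int l)) \<omega> \<noteq> 0"
        show "stays k 0 (Suc l) \<omega>" unfolding stays_active_def
        proof
          fix i assume "i \<in> {1..Suc l}"
          then have "Suc l - i \<le> l" "0 + int i = - int (Suc l - i) + (1 + int l)"
            by (auto simp: of_nat_diff)
          then show "S k (0 + int i) \<omega> \<noteq> 0" using st by metis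
        qed
      qed
      then show "indicator {\<omega>. stays k 0 (Suc l) \<omega>} \<omega>
        = (indicator {y. \<forall>i\<le>l. y (Phase k, - int i) \<noteq> 0} (time_shift (1 + int l) (sample_path \<omega>)) :: ennreal)"
        by (simp add: indicator_def)
    qed (simp add: indicator_def)
  qed
  also have "\<dots> \<le> (\<Sum>l. \<integral>\<^sup>+\<omega>. indicator {\<omega>. stays k 0 l \<omega>} \<omega> \<partial>M)"
    by (subst (2) suminf_ennreal_Suc) simp
  also have "\<dots> = (\<integral>\<^sup>+\<omega>. (\<Sum>l. indicator {\<omega>. stays k 0 l \<omega>} \<omega>) \<partial>M)"
    by (intro nn_integral_suminf[symmetric]) auto
  also have "\<dots> < top"
    using expected_time_stays[of "\<lambda>_. 1" k 0] expected_time_integral_finite[of k 0] by simp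
  finally have "AE \<omega> in M. (\<Sum>l. indicator {\<omega>. \<forall>i\<le>l. S k (- int i) \<omega> \<noteq> 0} \<omega> :: ennreal) \<noteq> \<infinity>"
    by (intro nn_integral_noteq_infinite) auto
  then show ?thesis
  proof eventually_elim
    case (elim \<omega>)
    show ?case
    proof (rule ccontr)
      assume no: "\<not> ?thesis"
      then have "(\<Sum>l. indicator {\<omega>. \<forall>i\<le>l. S k (- int i) \<omega> \<noteq> 0} \<omega> :: ennreal) = (\<Sum>l. 1)" by simp
      also have "\<dots> = \<infinity>"
        by (simp add: suminf_one)
      finally show False using elim by simp
    qed
  qed
qed

lemma AE_suminf_started: "AE \<omega> in M. (\<Sum>n. indicator {n. started k n \<omega>} n) = active k 0 \<omega>"
  using AE_idle_before[of k]
proof eventually_elim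
  case (elim \<omega>)
  then show ?case
    using suminf_period_start[of "\<lambda>i. S k i \<omega>"] by (auto simp: indicator_def)
qed

text \<open>The left-hand side sums over a period that begins in slot \<open>0\<close>, as seen from a random active
  period; the right-hand side is the view from a random active slot.\<close>

lemma Palm_inversion:
  assumes "\<phi> \<in> borel_measurable path_space" "\<And>n \<omega>. \<Phi> n \<omega> = \<phi> (time_shift n (sample_path \<omega>))"
  shows "(\<integral>\<^sup>+\<omega>. idle k (- 1) \<omega> * (\<Sum>n. indicator {\<omega>. stays k (- 1) (Suc n) \<omega>} \<omega> * \<Phi> (int n) \<omega>) \<partial>M)
    = (\<integral>\<^sup>+\<omega>. active k 0 \<omega> * \<Phi> 0 \<omega> \<partial>M)"
  unfolding period_transport[of \<phi> \<Phi> k, OF assms]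
  using AE_suminf_started[of k] by (intro nn_integral_cong_AE) (auto elim!: eventually_mono)

text \<open>Kac's formula: between two consecutive idle slots the mean time is the reciprocal of the
  probability of the idle phase, and the mean number of arrivals is the same multiple of the mean
  batch size per slot.\<close>

lemma idle_expected_time: "ennreal (idle_prob k) * expected_time k 0 = 1"
proof -
  have "ennreal (idle_prob k) * expected_time k 0 = ennreal (idle_prob k) + (\<integral>\<^sup>+\<omega>. active k 0 \<omega> \<partial>M)"
    unfolding idle_times_expected_time
    using nn_integral_cong_AE[OF AE_suminf_started[of k]] by simp
  also have "\<dots> = (\<integral>\<^sup>+\<omega>. idle k 0 \<omega> \<partial>M) + (\<integral>\<^sup>+\<omega>. active k 0 \<omega> \<partial>M)"
    using idle_mult[of k 0 "\<lambda>_. 1"] by simp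
  also have "\<dots> = (\<integral>\<^sup>+\<omega>. idle k 0 \<omega> + active k 0 \<omega> \<partial>M)"
    by (rule nn_integral_add[symmetric]) auto
  also have "\<dots> = (\<integral>\<^sup>+\<omega>. 1 \<partial>M)" by (intro nn_integral_cong) (auto split: split_indicator)
  finally show ?thesis by (simp add: emeasure_space_1)
qed

lemma active_times_batch: "(\<integral>\<^sup>+\<omega>. active k 0 \<omega> * (of_nat (A k 0 \<omega>) * f \<omega>) \<partial>M) = (\<integral>\<^sup>+\<omega>. of_nat (A k 0 \<omega>) * f \<omega> \<partial>M)"
  using AE_streams by (intro nn_integral_cong_AE) (auto split: split_indicator elim!: eventually_mono)

lemma idle_expected_arrivals: "ennreal (idle_prob k) * expected_arrivals k 0 = mean_batch k"
proof -
  have "ennreal (idle_prob k) * expected_arrivals k 0 = (\<integral>\<^sup>+\<omega>. idle k (- 1) \<omega> * expected_arrivals k (S k (- 1) \<omega>) \<partial>M)"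
    by (rule idle_mult[symmetric])
  also have "\<dots> = (\<integral>\<^sup>+\<omega>. idle k (- 1) \<omega> * (\<Sum>l. indicator {\<omega>. stays k (- 1) (Suc l) \<omega>} \<omega> * of_nat (A k (- 1 + int l + 1) \<omega>)) \<partial>M)"
    by (rule expected_arrivals_stays[OF past_idle, symmetric]) simp
  also have "\<dots> = (\<integral>\<^sup>+\<omega>. idle k (- 1) \<omega> * (\<Sum>l. indicator {\<omega>. stays k (- 1) (Suc l) \<omega>} \<omega> * of_nat (A k (int l) \<omega>)) \<partial>M)"
    by simp
  also have "\<dots> = (\<integral>\<^sup>+\<omega>. active k 0 \<omega> * of_nat (A k 0 \<omega>) \<partial>M)"
    by (rule Palm_inversion[where \<phi> = "\<lambda>y. of_nat (y (Batch k, 0))"]) auto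
  also have "\<dots> = mean_batch k" using active_times_batch[of k "\<lambda>_. 1"] by simp
  finally show ?thesis .
qed

lemma expected_arrivals_finite:
  assumes "mean_batch k < top" "x \<le> m k" shows "expected_arrivals k x < top"
proof (rule propagate_finite[OF _ _ assms(2)])
  show "killed k (expected_arrivals k) x \<le> expected_arrivals k x" for x
    by (subst expected_arrivals_eq[of k x]) simp
  have "ennreal (idle_prob k) * expected_arrivals k 0 < top"
    unfolding idle_expected_arrivals using assms by simp
  then show "expected_arrivals k 0 < top" using idle_prob_pos[of k] by (auto simp: ennreal_mult_less_top)
qed

subsection \<open>Active periods\<close>

abbreviation rtime :: "'k \<Rightarrow> int \<Rightarrow> 'a \<Rightarrow> nat" where
  "rtime k n \<omega> \<equiv> recurrence_time (\<lambda>i. S k i \<omega>) n"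

abbreviation rarrivals :: "'k \<Rightarrow> int \<Rightarrow> 'a \<Rightarrow> nat" where
  "rarrivals k n \<omega> \<equiv> recurrence_arrivals (\<lambda>i. S k i \<omega>) (\<lambda>i. A k i \<omega>) n"

lemma recurrence_time_measurable:
  assumes [measurable]: "\<And>i. (\<lambda>\<omega>. s \<omega> i) \<in> measurable N (count_space UNIV)"
  shows "(\<lambda>\<omega>. recurrence_time (s \<omega>) n) \<in> measurable N (count_space UNIV)"
  unfolding recurrence_time_def by measurable

lemma recurrence_arrivals_measurable:
  assumes s: "\<And>i. (\<lambda>\<omega>. s \<omega> i) \<in> measurable N (count_space UNIV)"
    and [measurable]: "\<And>i. (\<lambda>\<omega>. b \<omega> i) \<in> measurable N (count_space UNIV)"
  shows "(\<lambda>\<omega>. recurrence_arrivals (s \<omega>) (b \<omega>) n) \<in> measurable N (count_space UNIV)"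
proof -
  have "(\<lambda>\<omega>. \<Sum>i = 1..c. b \<omega> (n + int i)) \<in> measurable N (count_space UNIV)" for c
    by measurable
  then show ?thesis
    unfolding recurrence_arrivals_def
    by (rule measurable_compose_countable) (rule recurrence_time_measurable[OF s])
qed

lemma recurrence_path_measurable[measurable]:
  "(\<lambda>y. recurrence_time (\<lambda>i. y (Phase k, i)) n) \<in> measurable path_space (count_space UNIV)"
  "(\<lambda>y. recurrence_arrivals (\<lambda>i. y (Phase k, i)) (\<lambda>i. y (Batch k, i)) n) \<in> measurable path_space (count_space UNIV)"
  "(\<lambda>\<omega>. rtime k n \<omega>) \<in> measurable M (count_space UNIV)"
  "(\<lambda>\<omega>. rarrivals k n \<omega>) \<in> measurable M (count_space UNIV)"
  by (auto intro!: recurrence_time_measurable recurrence_arrivals_measurable)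

lemma recurrence_time_shift: "recurrence_time (\<lambda>i. s (i + d)) n = recurrence_time s (n + d)"
  by (simp add: recurrence_time_def algebra_simps)

lemma recurrence_arrivals_shift:
  "recurrence_arrivals (\<lambda>i. s (i + d)) (\<lambda>i. b (i + d)) n = recurrence_arrivals s b (n + d)"
  by (simp add: recurrence_arrivals_def recurrence_time_shift algebra_simps)

lemma Markov_recurrence_time:
  assumes "V \<in> borel_measurable (past k n)"
  shows "(\<integral>\<^sup>+\<omega>. V \<omega> * of_nat (1 + rtime k n \<omega>) \<partial>M) = (\<integral>\<^sup>+\<omega>. V \<omega> * expected_time k (S k n \<omega>) \<partial>M)"
proof -
  have "(\<integral>\<^sup>+\<omega>. V \<omega> * of_nat (1 + rtime k n \<omega>) \<partial>M) = (\<integral>\<^sup>+\<omega>. V \<omega> * (\<Sum>l. indicator {\<omega>. stays k n l \<omega>} \<omega>) \<partial>M)"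
    using AE_returns
  proof (intro nn_integral_cong_AE, eventually_elim)
    case (elim \<omega>)
    have "of_nat (1 + rtime k n \<omega>) = (1 :: ennreal) + (\<Sum>l. indicator {l. stays k n (Suc l) \<omega>} l)"
      using recurrence_time_eq_suminf[of "\<lambda>i. S k i \<omega>" n] elim by (simp add: ennreal_of_nat_eq_real_of_nat)
    also have "\<dots> = (\<Sum>l. indicator {\<omega>. stays k n l \<omega>} \<omega>)"
      by (subst (2) suminf_ennreal_Suc) (simp add: indicator_def[abs_def])
    finally show ?case by simp
  qed
  then show ?thesis using expected_time_stays[OF assms] by simp
qed

lemma Markov_recurrence_arrivals:
  assumes "V \<in> borel_measurable (past k n)"
  shows "(\<integral>\<^sup>+\<omega>. V \<omega> * of_nat (rarrivals k n \<omega>) \<partial>M) = (\<integral>\<^sup>+\<omega>. V \<omega> * expected_arrivals k (S k n \<omega>) \<partial>M)"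
proof -
  have "(\<integral>\<^sup>+\<omega>. V \<omega> * of_nat (rarrivals k n \<omega>) \<partial>M)
      = (\<integral>\<^sup>+\<omega>. V \<omega> * (\<Sum>l. indicator {\<omega>. stays k n (Suc l) \<omega>} \<omega> * of_nat (A k (n + int l + 1) \<omega>)) \<partial>M)"
    using AE_returns
  proof (intro nn_integral_cong_AE, eventually_elim)
    case (elim \<omega>)
    then have hits: "\<exists>c. S k (n + 1 + int c) \<omega> = 0" for n by blast
    have "(\<Sum>l. indicator {\<omega>. stays k n (Suc l) \<omega>} \<omega> * of_nat (A k (n + int l + 1) \<omega>) :: ennreal)
        = (\<Sum>l<rtime k n \<omega>. indicator {\<omega>. stays k n (Suc l) \<omega>} \<omega> * of_nat (A k (n + int l + 1) \<omega>))"
      by (rule suminf_finite) (auto simp: less_recurrence_time_iff[OF hits, symmetric])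
    also have "\<dots> = (\<Sum>l<rtime k n \<omega>. of_nat (A k (n + 1 + int l) \<omega>))"
    proof (rule sum.cong)
      fix l assume "l \<in> {..<rtime k n \<omega>}"
      moreover have "A k (n + int l + 1) \<omega> = A k (n + 1 + int l) \<omega>"
        by (rule arg_cong[where f = "\<lambda>i. A k i \<omega>"]) simp
      ultimately show "indicator {\<omega>. stays k n (Suc l) \<omega>} \<omega> * of_nat (A k (n + int l + 1) \<omega>)
          = (of_nat (A k (n + 1 + int l) \<omega>) :: ennreal)"
        by (auto simp: less_recurrence_time_iff[OF hits])
    qed simp
    also have "\<dots> = of_nat (rarrivals k n \<omega>)"
      using period_sum_arrivals[where s = "\<lambda>i. S k i \<omega>" and n = n and a = "\<lambda>i. A k i \<omega>", OF hits] by (simp flip: of_nat_sum)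
    finally show ?case by simp
  qed
  then show ?thesis using expected_arrivals_stays[OF assms] by simp
qed

text \<open>The expectation of a sum over the slots of the active period beginning in slot \<open>0\<close>.\<close>

lemma Palm_period:
  fixes f :: "(int \<Rightarrow> nat) \<Rightarrow> (int \<Rightarrow> nat) \<Rightarrow> int \<Rightarrow> nat"
  assumes [measurable]: "(\<lambda>y. f (\<lambda>i. y (Phase k, i)) (\<lambda>i. y (Batch k, i)) 0) \<in> measurable path_space (count_space UNIV)"
    and shift: "\<And>s b d n. f (\<lambda>i. s (i + d)) (\<lambda>i. b (i + d)) n = f s b (n + d)"
    and g: "\<And>\<omega>. \<forall>n. \<exists>c. S k (n + 1 + int c) \<omega> = 0 \<Longrightarrow>
        (\<Sum>i<rtime k (- 1) \<omega>. f (\<lambda>i. S k i \<omega>) (\<lambda>i. A k i \<omega>) (- 1 + 1 + int i)) = g \<omega>"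
  shows "(\<integral>\<^sup>+\<omega>. of_nat (g \<omega>) * idle k (- 1) \<omega> \<partial>M)
    = (\<integral>\<^sup>+\<omega>. active k 0 \<omega> * of_nat (f (\<lambda>i. S k i \<omega>) (\<lambda>i. A k i \<omega>) 0) \<partial>M)"
proof -
  let ?f = "\<lambda>n \<omega>. f (\<lambda>i. S k i \<omega>) (\<lambda>i. A k i \<omega>) n"
  have "(\<integral>\<^sup>+\<omega>. of_nat (g \<omega>) * idle k (- 1) \<omega> \<partial>M)
      = (\<integral>\<^sup>+\<omega>. idle k (- 1) \<omega> * (\<Sum>n. indicator {\<omega>. stays k (- 1) (Suc n) \<omega>} \<omega> * of_nat (?f (int n) \<omega>)) \<partial>M)"
    using AE_returns
  proof (intro nn_integral_cong_AE, eventually_elim)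
    case (elim \<omega>)
    then have hits: "\<exists>c. S k (n + 1 + int c) \<omega> = 0" for n by blast
    have "(\<Sum>n. indicator {\<omega>. stays k (- 1) (Suc n) \<omega>} \<omega> * of_nat (?f (int n) \<omega>) :: ennreal)
        = (\<Sum>n<rtime k (- 1) \<omega>. indicator {\<omega>. stays k (- 1) (Suc n) \<omega>} \<omega> * of_nat (?f (int n) \<omega>))"
      by (rule suminf_finite) (auto simp: less_recurrence_time_iff[OF hits, symmetric])
    also have "\<dots> = (\<Sum>n<rtime k (- 1) \<omega>. of_nat (?f (int n) \<omega>))"
      by (rule sum.cong) (auto simp: less_recurrence_time_iff[OF hits])
    also have "\<dots> = of_nat (g \<omega>)" using g[of \<omega>] hits by (simp flip: of_nat_sum)
    finally show ?case by (simp add: mult.commute)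
  qed
  also have "\<dots> = (\<integral>\<^sup>+\<omega>. active k 0 \<omega> * of_nat (?f 0 \<omega>) \<partial>M)"
  proof (rule Palm_inversion)
    show "(\<lambda>y. of_nat (f (\<lambda>i. y (Phase k, i)) (\<lambda>i. y (Batch k, i)) 0) :: ennreal) \<in> borel_measurable path_space"
      by measurable
    show "of_nat (?f n \<omega>) = (of_nat (f (\<lambda>i. time_shift n (sample_path \<omega>) (Phase k, i))
        (\<lambda>i. time_shift n (sample_path \<omega>) (Batch k, i)) 0) :: ennreal)" for n \<omega>
      using shift[of "\<lambda>i. S k i \<omega>" n "\<lambda>i. A k i \<omega>" 0] by simp
  qed
  finally show ?thesis .
qed

lemma Palm_length: "(\<integral>\<^sup>+\<omega>. of_nat (rtime k (- 1) \<omega>) * idle k (- 1) \<omega> \<partial>M) = (\<integral>\<^sup>+\<omega>. active k 0 \<omega> \<partial>M)"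
  using Palm_period[of "\<lambda>s b n. 1" k "\<lambda>\<omega>. rtime k (- 1) \<omega>"] by simp

lemma Palm_arrivals: "(\<integral>\<^sup>+\<omega>. of_nat (rarrivals k (- 1) \<omega>) * idle k (- 1) \<omega> \<partial>M) = mean_batch k"
proof -
  have "(\<integral>\<^sup>+\<omega>. of_nat (rarrivals k (- 1) \<omega>) * idle k (- 1) \<omega> \<partial>M) = (\<integral>\<^sup>+\<omega>. active k 0 \<omega> * of_nat (A k 0 \<omega>) \<partial>M)"
  proof (rule Palm_period)
    fix \<omega> assume "\<forall>n. \<exists>c. S k (n + 1 + int c) \<omega> = 0"
    then show "(\<Sum>i<rtime k (- 1) \<omega>. A k (- 1 + 1 + int i) \<omega>) = rarrivals k (- 1) \<omega>"
      by (intro period_sum_arrivals) blast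
  qed auto
  then show ?thesis using active_times_batch[of k "\<lambda>_. 1"] by simp
qed

lemma Palm_length_choose:
  "(\<integral>\<^sup>+\<omega>. of_nat (rtime k (- 1) \<omega> + (rtime k (- 1) \<omega> choose 2)) * idle k (- 1) \<omega> \<partial>M)
    = (\<integral>\<^sup>+\<omega>. active k 0 \<omega> * expected_time k (S k 0 \<omega>) \<partial>M)"
proof -
  have "(\<integral>\<^sup>+\<omega>. of_nat (rtime k (- 1) \<omega> + (rtime k (- 1) \<omega> choose 2)) * idle k (- 1) \<omega> \<partial>M)
      = (\<integral>\<^sup>+\<omega>. active k 0 \<omega> * of_nat (1 + rtime k 0 \<omega>) \<partial>M)"
  proof (rule Palm_period)
    fix \<omega> assume "\<forall>n. \<exists>c. S k (n + 1 + int c) \<omega> = 0"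
    then show "(\<Sum>i<rtime k (- 1) \<omega>. 1 + rtime k (- 1 + 1 + int i) \<omega>)
        = rtime k (- 1) \<omega> + (rtime k (- 1) \<omega> choose 2)"
      by (intro period_sum_recurrence_time) blast
  qed (measurable, simp_all add: recurrence_time_shift)
  then show ?thesis using Markov_recurrence_time[OF past_active[OF order_refl, of k 0]] by simp
qed

lemma past_batch:
  assumes "n' \<le> n" shows "(\<lambda>\<omega>. of_nat (A k n' \<omega>) :: ennreal) \<in> borel_measurable (past k n)"
proof -
  note [measurable] = past_A[OF assms]
  show ?thesis by measurable
qed

lemma Palm_arrivals_square:
  "(\<integral>\<^sup>+\<omega>. of_nat ((rarrivals k (- 1) \<omega>)\<^sup>2) * idle k (- 1) \<omega> \<partial>M)
    = (\<integral>\<^sup>+\<omega>. of_nat ((A k 0 \<omega>)\<^sup>2) \<partial>M) + 2 * (\<integral>\<^sup>+\<omega>. of_nat (A k 0 \<omega>) * expected_arrivals k (S k 0 \<omega>) \<partial>M)"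
proof -
  have "(\<integral>\<^sup>+\<omega>. of_nat ((rarrivals k (- 1) \<omega>)\<^sup>2) * idle k (- 1) \<omega> \<partial>M)
      = (\<integral>\<^sup>+\<omega>. active k 0 \<omega> * of_nat (A k 0 \<omega> * (A k 0 \<omega> + 2 * rarrivals k 0 \<omega>)) \<partial>M)"
  proof (rule Palm_period)
    fix \<omega> assume "\<forall>n. \<exists>c. S k (n + 1 + int c) \<omega> = 0"
    then show "(\<Sum>i<rtime k (- 1) \<omega>. A k (- 1 + 1 + int i) \<omega> * (A k (- 1 + 1 + int i) \<omega> + 2 * rarrivals k (- 1 + 1 + int i) \<omega>))
        = (rarrivals k (- 1) \<omega>)\<^sup>2"
      by (intro period_sum_square) blast
  qed (measurable, simp_all add: recurrence_arrivals_shift)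
  also have "\<dots> = (\<integral>\<^sup>+\<omega>. of_nat (A k 0 \<omega>) * of_nat (A k 0 \<omega> + 2 * rarrivals k 0 \<omega>) \<partial>M)"
    using active_times_batch[of k "\<lambda>\<omega>. of_nat (A k 0 \<omega> + 2 * rarrivals k 0 \<omega>)"] by (simp add: mult.assoc)
  also have "\<dots> = (\<integral>\<^sup>+\<omega>. of_nat ((A k 0 \<omega>)\<^sup>2) + 2 * (of_nat (A k 0 \<omega>) * of_nat (rarrivals k 0 \<omega>)) \<partial>M)"
    by (intro nn_integral_cong) (simp add: power2_eq_square distrib_left mult.left_commute)
  also have "\<dots> = (\<integral>\<^sup>+\<omega>. of_nat ((A k 0 \<omega>)\<^sup>2) \<partial>M) + 2 * (\<integral>\<^sup>+\<omega>. of_nat (A k 0 \<omega>) * of_nat (rarrivals k 0 \<omega>) \<partial>M)"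
    by (subst nn_integral_add) (auto simp: nn_integral_cmult)
  finally show ?thesis using Markov_recurrence_arrivals[OF past_batch[OF order_refl, of k 0]] by simp
qed

lemma Palm_product:
  "(\<integral>\<^sup>+\<omega>. of_nat (rtime k (- 1) \<omega> * rarrivals k (- 1) \<omega>) * idle k (- 1) \<omega> \<partial>M)
    = (\<integral>\<^sup>+\<omega>. of_nat (A k 0 \<omega>) * expected_time k (S k 0 \<omega>) \<partial>M)
      + (\<integral>\<^sup>+\<omega>. active k 0 \<omega> * expected_arrivals k (S k 0 \<omega>) \<partial>M)"
proof -
  have "(\<integral>\<^sup>+\<omega>. of_nat (rtime k (- 1) \<omega> * rarrivals k (- 1) \<omega>) * idle k (- 1) \<omega> \<partial>M)
      = (\<integral>\<^sup>+\<omega>. active k 0 \<omega> * of_nat (A k 0 \<omega> * (1 + rtime k 0 \<omega>) + rarrivals k 0 \<omega>) \<partial>M)"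
  proof (rule Palm_period)
    fix \<omega> assume "\<forall>n. \<exists>c. S k (n + 1 + int c) \<omega> = 0"
    then show "(\<Sum>i<rtime k (- 1) \<omega>. A k (- 1 + 1 + int i) \<omega> * (1 + rtime k (- 1 + 1 + int i) \<omega>) + rarrivals k (- 1 + 1 + int i) \<omega>)
        = rtime k (- 1) \<omega> * rarrivals k (- 1) \<omega>"
      by (intro period_sum_product) blast
  qed (measurable, simp_all add: recurrence_arrivals_shift recurrence_time_shift)
  also have "\<dots> = (\<integral>\<^sup>+\<omega>. active k 0 \<omega> * (of_nat (A k 0 \<omega>) * of_nat (1 + rtime k 0 \<omega>)) + active k 0 \<omega> * of_nat (rarrivals k 0 \<omega>) \<partial>M)"
    by (intro nn_integral_cong) (simp add: distrib_left)
  also have "\<dots> = (\<integral>\<^sup>+\<omega>. active k 0 \<omega> * (of_nat (A k 0 \<omega>) * of_nat (1 + rtime k 0 \<omega>)) \<partial>M)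
      + (\<integral>\<^sup>+\<omega>. active k 0 \<omega> * of_nat (rarrivals k 0 \<omega>) \<partial>M)"
    by (rule nn_integral_add) measurable
  also have "(\<integral>\<^sup>+\<omega>. active k 0 \<omega> * (of_nat (A k 0 \<omega>) * of_nat (1 + rtime k 0 \<omega>)) \<partial>M)
      = (\<integral>\<^sup>+\<omega>. of_nat (A k 0 \<omega>) * of_nat (1 + rtime k 0 \<omega>) \<partial>M)"
    by (rule active_times_batch)
  finally show ?thesis
    using Markov_recurrence_time[OF past_batch[OF order_refl, of k 0]]
      Markov_recurrence_arrivals[OF past_active[OF order_refl, of k 0]] by simp
qed

section \<open>Arriving work\<close>

abbreviation mean_service :: "'k \<Rightarrow> ennreal" where
  "mean_service k \<equiv> \<integral>\<^sup>+x. of_nat x \<partial>measure_pmf (H k)"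

definition class_work :: "'k \<Rightarrow> int \<Rightarrow> 'a \<Rightarrow> nat" where
  "class_work k n \<omega> = (\<Sum>i < A k n \<omega>. h k n i \<omega>)"

lemma work_arriving_eq: "work_arriving A h n \<omega> = (\<Sum>k\<in>UNIV. class_work k n \<omega>)"
  by (simp add: work_arriving_def class_work_def)

lemma sum_lessThan_measurable:
  fixes f :: "nat \<Rightarrow> 'b \<Rightarrow> nat"
  assumes [measurable]: "c \<in> measurable N (count_space UNIV)" "\<And>i. f i \<in> measurable N (count_space UNIV)"
  shows "(\<lambda>\<omega>. \<Sum>i<c \<omega>. f i \<omega>) \<in> measurable N (count_space UNIV)"
proof -
  have "(\<lambda>\<omega>. \<Sum>i<n. f i \<omega>) \<in> measurable N (count_space UNIV)" for n by measurable
  then show ?thesis by (rule measurable_compose_countable) simp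
qed

lemma class_work_measurable_gen:
  assumes "A k n \<in> measurable N (count_space UNIV)" "\<And>i. h k n i \<in> measurable N (count_space UNIV)"
  shows "class_work k n \<in> measurable N (count_space UNIV)"
  unfolding class_work_def[abs_def] using assms by (rule sum_lessThan_measurable)

lemma class_work_measurable[measurable]: "class_work k n \<in> measurable M (count_space UNIV)"
  by (rule class_work_measurable_gen) auto

lemma class_work_suminf:
  "(of_nat (class_work k n \<omega>) :: ennreal) = (\<Sum>i. indicator {i. i < A k n \<omega>} i * of_nat (h k n i \<omega>))"
proof -
  have "(\<Sum>i. indicator {i. i < A k n \<omega>} i * of_nat (h k n i \<omega>) :: ennreal)
      = (\<Sum>i<A k n \<omega>. indicator {i. i < A k n \<omega>} i * of_nat (h k n i \<omega>))"
    by (rule suminf_finite) auto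
  also have "\<dots> = (\<Sum>i<A k n \<omega>. of_nat (h k n i \<omega>))" by (rule sum.cong) auto
  finally show ?thesis by (simp add: class_work_def)
qed

lemma suminf_indicator_lessThan: "(\<Sum>i. indicator {i. i < n} i :: ennreal) = of_nat n"
proof -
  have "(\<Sum>i. indicator {i. i < n} i :: ennreal) = (\<Sum>i<n. indicator {i. i < n} i)"
    by (rule suminf_finite) auto
  also have "\<dots> = (\<Sum>i<n. 1)" by (rule sum.cong) auto
  finally show ?thesis by simp
qed

lemma others_present: "(\<lambda>\<omega>. indicator {i. i < A k n \<omega>} i :: ennreal) \<in> borel_measurable (others c)"
proof -
  note [measurable] = others_A[of k n c]
  show ?thesis unfolding indicator_def by measurable
qed

lemma mean_class_work:
  assumes V: "\<And>i. V \<in> borel_measurable (others (k, n, i))"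
  shows "(\<integral>\<^sup>+\<omega>. V \<omega> * of_nat (class_work k n \<omega>) \<partial>M) = mean_service k * (\<integral>\<^sup>+\<omega>. V \<omega> * of_nat (A k n \<omega>) \<partial>M)"
proof -
  note [measurable] = others_measurable[OF V] others_measurable[OF others_present]
  have "(\<integral>\<^sup>+\<omega>. V \<omega> * of_nat (class_work k n \<omega>) \<partial>M)
      = (\<Sum>i. \<integral>\<^sup>+\<omega>. V \<omega> * (indicator {i. i < A k n \<omega>} i * of_nat (h k n i \<omega>)) \<partial>M)"
    unfolding class_work_suminf by (simp flip: ennreal_suminf_cmult add: nn_integral_suminf)
  also have "\<dots> = (\<Sum>i. (\<integral>\<^sup>+\<omega>. V \<omega> * indicator {i. i < A k n \<omega>} i \<partial>M) * mean_service k)"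
  proof (intro arg_cong[where f = suminf] ext)
    fix i
    note [measurable] = V[of i] others_present[where k = k and n = n and i = i and c = "(k, n, i)"]
    have "(\<lambda>\<omega>. V \<omega> * indicator {i. i < A k n \<omega>} i) \<in> borel_measurable (others (k, n, i))" by measurable
    from service_independent[OF this, where f = of_nat]
    show "(\<integral>\<^sup>+\<omega>. V \<omega> * (indicator {i. i < A k n \<omega>} i * of_nat (h k n i \<omega>)) \<partial>M)
        = (\<integral>\<^sup>+\<omega>. V \<omega> * indicator {i. i < A k n \<omega>} i \<partial>M) * mean_service k" by (simp add: mult.assoc)
  qed
  also have "\<dots> = mean_service k * (\<Sum>i. \<integral>\<^sup>+\<omega>. V \<omega> * indicator {i. i < A k n \<omega>} i \<partial>M)"
    by (simp add: mult.commute)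
  also have "(\<Sum>i. \<integral>\<^sup>+\<omega>. V \<omega> * indicator {i. i < A k n \<omega>} i \<partial>M) = (\<integral>\<^sup>+\<omega>. V \<omega> * of_nat (A k n \<omega>) \<partial>M)"
    by (subst suminf_indicator_lessThan[symmetric])
       (simp flip: ennreal_suminf_cmult add: nn_integral_suminf)
  finally show ?thesis .
qed

text \<open>The diagonal terms of the square involve one service time, the others two independent ones.\<close>

lemma mean_square_class_work:
  "(\<integral>\<^sup>+\<omega>. of_nat ((class_work k 0 \<omega>)\<^sup>2) \<partial>M)
    = mean_batch k * (\<integral>\<^sup>+x. of_nat (x\<^sup>2) \<partial>measure_pmf (H k))
      + mean_service k * mean_service k * (\<integral>\<^sup>+\<omega>. of_nat (2 * (A k 0 \<omega> choose 2)) \<partial>M)"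
proof -
  let ?I = "\<lambda>i \<omega>. indicator {i. i < A k 0 \<omega>} i :: ennreal"
  let ?h = "\<lambda>i \<omega>. of_nat (h k 0 i \<omega>) :: ennreal"
  let ?c = "\<lambda>i j. if i = j then \<integral>\<^sup>+x. of_nat (x\<^sup>2) \<partial>measure_pmf (H k) else mean_service k * mean_service k"
  note [measurable] = others_measurable[OF others_present]
  have term_eq: "(\<integral>\<^sup>+\<omega>. (?I i \<omega> * ?h i \<omega>) * (?I j \<omega> * ?h j \<omega>) \<partial>M) = (\<integral>\<^sup>+\<omega>. ?I i \<omega> * ?I j \<omega> * ?c i j \<partial>M)" for i j
  proof -
    have VV: "(\<lambda>\<omega>. ?I i \<omega> * ?I j \<omega>) \<in> borel_measurable (others c)" for c
    proof -
      note [measurable] = others_present[where k = k and n = 0 and i = i and c = c] others_present[where k = k and n = 0 and i = j and c = c]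
      show ?thesis by measurable
    qed
    show ?thesis
    proof (cases "i = j")
      case True
      have "(\<integral>\<^sup>+\<omega>. (?I i \<omega> * ?h i \<omega>) * (?I j \<omega> * ?h j \<omega>) \<partial>M)
          = (\<integral>\<^sup>+\<omega>. (?I i \<omega> * ?I j \<omega>) * of_nat ((h k 0 i \<omega>)\<^sup>2) \<partial>M)"
        unfolding True by (intro nn_integral_cong) (simp add: power2_eq_square mult_ac)
      also have "\<dots> = (\<integral>\<^sup>+\<omega>. ?I i \<omega> * ?I j \<omega> \<partial>M) * (\<integral>\<^sup>+x. of_nat (x\<^sup>2) \<partial>measure_pmf (H k))"
        by (rule service_independent[OF VV, where f = "\<lambda>x. of_nat (x\<^sup>2)"])
      finally show ?thesis using True by (simp add: nn_integral_multc)
    next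
      case False
      have "(\<lambda>\<omega>. ?I i \<omega> * ?I j \<omega> * ?h j \<omega>) \<in> borel_measurable (others (k, 0, i))"
      proof -
        have [measurable]: "h k 0 j \<in> measurable (others (k, 0, i)) (count_space UNIV)"
          using False by (intro others_h) auto
        have "(\<lambda>\<omega>. ?h j \<omega>) \<in> borel_measurable (others (k, 0, i))" by measurable
        then show ?thesis by (rule borel_measurable_times_ennreal[OF VV])
      qed
      from service_independent[OF this, where f = of_nat]
      have "(\<integral>\<^sup>+\<omega>. (?I i \<omega> * ?h i \<omega>) * (?I j \<omega> * ?h j \<omega>) \<partial>M)
          = (\<integral>\<^sup>+\<omega>. ?I i \<omega> * ?I j \<omega> * ?h j \<omega> \<partial>M) * mean_service k"
        by (simp add: mult_ac)
      also have "(\<integral>\<^sup>+\<omega>. ?I i \<omega> * ?I j \<omega> * ?h j \<omega> \<partial>M) = (\<integral>\<^sup>+\<omega>. ?I i \<omega> * ?I j \<omega> \<partial>M) * mean_service k"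
        by (rule service_independent[OF VV, where f = of_nat])
      finally have "(\<integral>\<^sup>+\<omega>. (?I i \<omega> * ?h i \<omega>) * (?I j \<omega> * ?h j \<omega>) \<partial>M)
          = (\<integral>\<^sup>+\<omega>. ?I i \<omega> * ?I j \<omega> \<partial>M) * (mean_service k * mean_service k)" by (simp only: mult.assoc)
      moreover have "(\<integral>\<^sup>+\<omega>. ?I i \<omega> * ?I j \<omega> * (mean_service k * mean_service k) \<partial>M)
          = (\<integral>\<^sup>+\<omega>. ?I i \<omega> * ?I j \<omega> \<partial>M) * (mean_service k * mean_service k)"
        by (rule nn_integral_multc) measurable
      ultimately show ?thesis by (simp only: if_not_P[OF False])
    qed
  qed
  have "(\<integral>\<^sup>+\<omega>. of_nat ((class_work k 0 \<omega>)\<^sup>2) \<partial>M)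
      = (\<integral>\<^sup>+\<omega>. (\<Sum>i. \<Sum>j. (?I i \<omega> * ?h i \<omega>) * (?I j \<omega> * ?h j \<omega>)) \<partial>M)"
    by (simp add: power2_eq_square class_work_suminf)
  also have "\<dots> = (\<Sum>i. \<Sum>j. \<integral>\<^sup>+\<omega>. (?I i \<omega> * ?h i \<omega>) * (?I j \<omega> * ?h j \<omega>) \<partial>M)"
    by (simp add: nn_integral_suminf del: ennreal_suminf_cmult ennreal_suminf_multc)
  also have "\<dots> = (\<Sum>i. \<Sum>j. \<integral>\<^sup>+\<omega>. ?I i \<omega> * ?I j \<omega> * ?c i j \<partial>M)" by (simp only: term_eq)
  also have "\<dots> = (\<integral>\<^sup>+\<omega>. (\<Sum>i. \<Sum>j. ?I i \<omega> * ?I j \<omega> * ?c i j) \<partial>M)"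
    by (simp add: nn_integral_suminf del: ennreal_suminf_cmult ennreal_suminf_multc)
  also have "\<dots> = (\<integral>\<^sup>+\<omega>. of_nat (A k 0 \<omega>) * (\<integral>\<^sup>+x. of_nat (x\<^sup>2) \<partial>measure_pmf (H k))
        + mean_service k * mean_service k * of_nat (2 * (A k 0 \<omega> choose 2)) \<partial>M)"
  proof (rule nn_integral_cong)
    fix \<omega>
    define n where "n = A k 0 \<omega>"
    have "(\<Sum>i. \<Sum>j. ?I i \<omega> * ?I j \<omega> * ?c i j) = (\<Sum>i<n. \<Sum>j. ?I i \<omega> * ?I j \<omega> * ?c i j)"
      by (rule suminf_finite) (auto simp: n_def)
    also have "\<dots> = (\<Sum>i<n. \<Sum>j<n. ?I i \<omega> * ?I j \<omega> * ?c i j)"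
      by (rule sum.cong[OF refl], rule suminf_finite) (auto simp: n_def)
    also have "\<dots> = (\<Sum>i<n. \<Sum>j<n. ?c i j)" by (intro sum.cong) (auto simp: n_def)
    also have "\<dots> = (\<Sum>i<n. (\<integral>\<^sup>+x. of_nat (x\<^sup>2) \<partial>measure_pmf (H k)) + of_nat (n - 1) * (mean_service k * mean_service k))"
    proof (rule sum.cong)
      fix i assume "i \<in> {..<n}"
      then have "(\<Sum>j<n. ?c i j) = ?c i i + (\<Sum>j\<in>{..<n} - {i}. ?c i j)" by (intro sum.remove) auto
      also have "(\<Sum>j\<in>{..<n} - {i}. ?c i j) = (\<Sum>j\<in>{..<n} - {i}. mean_service k * mean_service k)"
        by (intro sum.cong) auto
      finally show "(\<Sum>j<n. ?c i j) = (\<integral>\<^sup>+x. of_nat (x\<^sup>2) \<partial>measure_pmf (H k)) + of_nat (n - 1) * (mean_service k * mean_service k)"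
        using \<open>i \<in> {..<n}\<close> by simp
    qed simp
    also have "\<dots> = of_nat n * (\<integral>\<^sup>+x. of_nat (x\<^sup>2) \<partial>measure_pmf (H k)) + mean_service k * mean_service k * of_nat (n * (n - 1))"
      by (simp add: distrib_left mult_ac)
    also have "n * (n - 1) = 2 * (n choose 2)" using times_binomial_minus1_eq[of 2 n] by simp
    finally show "(\<Sum>i. \<Sum>j. ?I i \<omega> * ?I j \<omega> * ?c i j) = of_nat (A k 0 \<omega>) * (\<integral>\<^sup>+x. of_nat (x\<^sup>2) \<partial>measure_pmf (H k))
        + mean_service k * mean_service k * of_nat (2 * (A k 0 \<omega> choose 2))" unfolding n_def .
  qed
  finally show ?thesis by (simp add: nn_integral_add nn_integral_multc nn_integral_cmult)
qed

lemma start_probability: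
  "(\<integral>\<^sup>+\<omega>. idle k (- 1) \<omega> * active k 0 \<omega> \<partial>M) = ennreal (idle_prob k * (1 - p k))"
proof -
  have sp: "p k < 1" "\<And>j. j \<in> {1..m k} \<Longrightarrow> 0 \<le> \<alpha> k j" "(\<Sum>j = 1..m k. \<alpha> k j) = 1"
    using stream_parameters[of k] by (auto simp: stream_parameters_def)
  have "killed k (\<lambda>_. 1) 0 = (\<Sum>j = 1..m k. ennreal ((1 - p k) * \<alpha> k j))"
    unfolding killed_def transition_matrix_def by (intro sum.cong) auto
  also have "\<dots> = ennreal (\<Sum>j = 1..m k. (1 - p k) * \<alpha> k j)"
    using sp by (intro sum_ennreal) auto
  finally have k1: "killed k (\<lambda>_. 1) 0 = ennreal (1 - p k)" using sp(3) by (simp flip: sum_distrib_left)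
  have "(\<integral>\<^sup>+\<omega>. idle k (- 1) \<omega> * active k 0 \<omega> \<partial>M) = (\<integral>\<^sup>+\<omega>. idle k (- 1) \<omega> * (if S k (- 1 + 1) \<omega> = 0 then 0 else 1) \<partial>M)"
    by (intro nn_integral_cong) (auto split: split_indicator)
  also have "\<dots> = (\<integral>\<^sup>+\<omega>. idle k (- 1) \<omega> * killed k (\<lambda>_. 1) (S k (- 1) \<omega>) \<partial>M)"
    by (rule Markov_killed[OF past_idle[OF order_refl]])
  also have "\<dots> = ennreal (idle_prob k * (1 - p k))"
    unfolding idle_mult k1 using sp(1) by (simp add: ennreal_mult)
  finally show ?thesis .
qed

lemma start_probability_pos: "0 < idle_prob k * (1 - p k)"
  using idle_prob_pos[of k] stream_parameters[of k] by (simp add: stream_parameters_def)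

lemma mean_batch_pos: "0 < mean_batch k"
proof -
  have "mean_batch k \<noteq> 0"
  proof
    assume "mean_batch k = 0"
    then have "AE \<omega> in M. A k 0 \<omega> = 0"
      by (subst (asm) nn_integral_0_iff_AE) auto
    then have "AE \<omega> in M. idle k (- 1) \<omega> * active k 0 \<omega> = 0" using AE_streams by eventually_elim auto
    then have "(\<integral>\<^sup>+\<omega>. idle k (- 1) \<omega> * active k 0 \<omega> \<partial>M) = (\<integral>\<^sup>+\<omega>. 0 \<partial>M)" by (rule nn_integral_cong_AE)
    then have "ennreal (idle_prob k * (1 - p k)) = 0" unfolding start_probability by simp
    then show False using start_probability_pos[of k] by (simp add: ennreal_eq_0_iff)
  qed
  then show ?thesis by (simp add: zero_less_iff_neq_zero)
qed

lemma mean_service_ge_1: "1 \<le> mean_service k"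
proof -
  have "(\<integral>\<^sup>+x. 1 \<partial>measure_pmf (H k)) \<le> mean_service k"
  proof (rule nn_integral_mono_AE)
    have "1 \<le> (of_nat x :: ennreal)" if "x \<in> set_pmf (H k)" for x
    proof -
      have "x \<noteq> 0" using that service_positive[of k] by metis
      then have "1 \<le> x" by simp
      then show ?thesis by (metis of_nat_1 of_nat_le_iff)
    qed
    then show "AE x in measure_pmf (H k). 1 \<le> (of_nat x :: ennreal)" by (intro AE_pmfI)
  qed
  then show ?thesis by (simp add: measure_pmf.emeasure_space_1[simplified])
qed

end

locale stable_queue = stationary_queue M m p \<alpha> T a H S A h W F
  for M :: "'a measure" and m :: "'k::finite \<Rightarrow> nat" and p \<alpha> T a H S A h W F +
  assumes stable: "(\<Sum>k\<in>UNIV. mean_batch k * mean_service k) < 1"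
begin

text \<open>Both factors of each summand of the load are positive, so that a finite load makes them finite.\<close>

lemma mean_batch_finite: "mean_batch k < top" and mean_service_finite: "mean_service k < top"
proof -
  have "mean_batch k * mean_service k \<le> (\<Sum>k\<in>UNIV. mean_batch k * mean_service k)"
    by (intro member_le_sum) auto
  then have "mean_batch k * mean_service k < top" using stable by (meson ennreal_one_less_top le_less_trans less_trans)
  moreover have "mean_batch k \<noteq> 0" "mean_service k \<noteq> 0"
    using mean_batch_pos[of k] mean_service_ge_1[of k] by auto
  ultimately show "mean_batch k < top" "mean_service k < top" by (auto simp: ennreal_mult_less_top)
qed

definition rate :: "'k \<Rightarrow> real" where "rate k = enn2real (mean_batch k)"
definition service_mean :: "'k \<Rightarrow> real" where "service_mean k = enn2real (mean_service k)"
definition class_load :: "'k \<Rightarrow> real" where "class_load k = rate k * service_mean k"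
definition total_load :: real where "total_load = (\<Sum>k\<in>UNIV. class_load k)"

lemma mean_batch_eq: "mean_batch k = ennreal (rate k)" and rate_pos: "0 < rate k"
  using mean_batch_finite[of k] mean_batch_pos[of k]
  by (auto simp: rate_def enn2real_positive_iff)

lemma mean_service_eq: "mean_service k = ennreal (service_mean k)" and service_mean_ge_1: "1 \<le> service_mean k"
proof -
  show "mean_service k = ennreal (service_mean k)"
    using mean_service_finite[of k] by (simp add: service_mean_def)
  then show "1 \<le> service_mean k" using mean_service_ge_1[of k] by simp
qed

lemma class_load_pos: "0 < class_load k"
  unfolding class_load_def using rate_pos[of k] service_mean_ge_1[of k] by (intro mult_pos_pos) auto

lemma total_load_pos: "0 < total_load" and total_load_less_1: "total_load < 1"
proof -
  show "0 < total_load" unfolding total_load_def using class_load_pos by (intro sum_pos) auto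
  have "(\<Sum>k\<in>UNIV. mean_batch k * mean_service k) = (\<Sum>k\<in>UNIV. ennreal (class_load k))"
    unfolding mean_batch_eq mean_service_eq class_load_def
    using rate_pos service_mean_ge_1 by (intro sum.cong) (auto simp: ennreal_mult' less_imp_le)
  also have "\<dots> = ennreal total_load"
    unfolding total_load_def using class_load_pos by (intro sum_ennreal) (simp add: less_imp_le)
  finally show "total_load < 1" using stable by simp
qed

text \<open>The real-valued versions of the expected recurrence time and arrivals.\<close>

definition \<psi> :: "'k \<Rightarrow> nat \<Rightarrow> real" where "\<psi> k x = (if x \<le> m k then enn2real (expected_time k x) else 0)"
definition \<phi> :: "'k \<Rightarrow> nat \<Rightarrow> real" where "\<phi> k x = (if x \<le> m k then enn2real (expected_arrivals k x) else 0)"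

lemma \<psi>_nonneg: "0 \<le> \<psi> k x" and \<phi>_nonneg: "0 \<le> \<phi> k x"
  by (simp_all add: \<psi>_def \<phi>_def)

lemma expected_time_\<psi>: "x \<le> m k \<Longrightarrow> expected_time k x = ennreal (\<psi> k x)"
  and expected_arrivals_\<phi>: "x \<le> m k \<Longrightarrow> expected_arrivals k x = ennreal (\<phi> k x)"
  using expected_time_finite[of x k] expected_arrivals_finite[OF mean_batch_finite, of x k]
  by (simp_all add: \<psi>_def \<phi>_def)

lemma bounded_\<psi>_\<phi>: "\<exists>c. \<forall>x. \<psi> k x \<le> c \<and> \<phi> k x \<le> c"
proof -
  have "\<psi> k x \<le> (\<Sum>x\<le>m k. \<psi> k x + \<phi> k x)" "\<phi> k x \<le> (\<Sum>x\<le>m k. \<psi> k x + \<phi> k x)" for x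
  proof -
    have "\<psi> k x + \<phi> k x \<le> (\<Sum>x\<le>m k. \<psi> k x + \<phi> k x)"
    proof (cases "x \<le> m k")
      case True
      then show ?thesis using \<psi>_nonneg \<phi>_nonneg by (intro member_le_sum[of x "{..m k}" "\<lambda>x. \<psi> k x + \<phi> k x"]) auto
    next
      case False
      then show ?thesis using \<psi>_nonneg \<phi>_nonneg by (auto simp: \<psi>_def \<phi>_def intro!: sum_nonneg add_nonneg_nonneg)
    qed
    then show "\<psi> k x \<le> (\<Sum>x\<le>m k. \<psi> k x + \<phi> k x)" "\<phi> k x \<le> (\<Sum>x\<le>m k. \<psi> k x + \<phi> k x)"
      using \<psi>_nonneg[of k x] \<phi>_nonneg[of k x] by linarith+
  qed
  then show ?thesis by blast
qed

lemma idle_\<psi>: "idle_prob k * \<psi> k 0 = 1" and idle_\<phi>: "idle_prob k * \<phi> k 0 = rate k"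
proof -
  have "ennreal (idle_prob k * \<psi> k 0) = 1"
    using idle_expected_time[of k] \<psi>_nonneg[of k 0] by (simp add: expected_time_\<psi> ennreal_mult)
  then show "idle_prob k * \<psi> k 0 = 1" by simp
  have "ennreal (idle_prob k * \<phi> k 0) = ennreal (rate k)"
    using idle_expected_arrivals[of k] \<phi>_nonneg[of k 0]
    by (simp add: expected_arrivals_\<phi> ennreal_mult mean_batch_eq)
  then show "idle_prob k * \<phi> k 0 = rate k"
    using \<phi>_nonneg[of k 0] rate_pos[of k] by (subst (asm) ennreal_inj) auto
qed

text \<open>The solution of the Poisson equation for the work of class \<open>k\<close>: the expected work that arrives up
  to the next idle slot of the stream, less its long-run mean during this time. Over a full return
  time of the idle phase the two balance.\<close>

definition excess :: "'k \<Rightarrow> nat \<Rightarrow> real" where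
  "excess k x = service_mean k * \<phi> k x - class_load k * \<psi> k x"

lemma excess_idle[simp]: "excess k 0 = 0"
proof -
  have "idle_prob k * excess k 0 = service_mean k * (idle_prob k * \<phi> k 0) - class_load k * (idle_prob k * \<psi> k 0)"
    by (simp add: excess_def algebra_simps)
  also have "\<dots> = 0" unfolding idle_\<psi> idle_\<phi> by (simp add: class_load_def)
  finally show ?thesis using idle_prob_pos[of k] by simp
qed

lemma bounded_excess: "\<exists>c. \<forall>x. \<bar>excess k x\<bar> \<le> c"
proof -
  obtain c where c: "\<And>x. \<psi> k x \<le> c" "\<And>x. \<phi> k x \<le> c" using bounded_\<psi>_\<phi> by blast
  have "\<bar>excess k x\<bar> \<le> service_mean k * c + class_load k * c" for x
  proof -
    have "service_mean k * \<phi> k x \<le> service_mean k * c" "class_load k * \<psi> k x \<le> class_load k * c"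
      using c service_mean_ge_1[of k] class_load_pos[of k] by (auto intro!: mult_left_mono)
    moreover have "0 \<le> service_mean k * \<phi> k x" "0 \<le> class_load k * \<psi> k x"
      using \<psi>_nonneg \<phi>_nonneg service_mean_ge_1[of k] class_load_pos[of k] by (auto intro!: mult_nonneg_nonneg)
    ultimately show ?thesis unfolding excess_def by linarith
  qed
  then show ?thesis by blast
qed

text \<open>Work plus excess of slot \<open>1\<close>, minus the conditional mean of this sum given the past.\<close>

definition innovation :: "'k \<Rightarrow> 'a \<Rightarrow> real" where
  "innovation k \<omega> = real (class_work k 1 \<omega>) + excess k (S k 1 \<omega>) - excess k (S k 0 \<omega>) - class_load k"

text \<open>Such variables are uninformative about the next step of stream \<open>k\<close> and about the service times of
  the customers that it brings in slot \<open>1\<close>, but may depend on the whole of the other streams.\<close>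

definition known :: "'k \<Rightarrow> ('a \<Rightarrow> real) \<Rightarrow> bool" where
  "known k V \<longleftrightarrow> V \<in> borel_measurable (past k 0) \<and> (\<forall>i. V \<in> borel_measurable (others (k, 1, i)))"

lemma known_measurable: "known k V \<Longrightarrow> V \<in> borel_measurable M"
  unfolding known_def using past_measurable by blast

lemma known_compose: "known k V \<Longrightarrow> f \<in> borel_measurable borel \<Longrightarrow> known k (\<lambda>\<omega>. f (V \<omega>))"
  unfolding known_def by (auto intro: measurable_compose)

lemma innovation_measurable[measurable]: "innovation k \<in> borel_measurable M"
  unfolding innovation_def[abs_def] by measurable

lemma work_integrable: "integrable M (\<lambda>\<omega>. real (class_work k n \<omega>))"
proof (rule integrableI_bounded)
  have "(\<integral>\<^sup>+\<omega>. of_nat (A k n \<omega>) \<partial>M) = mean_batch k"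
    by (rule nn_integral_stationary[where \<phi> = "\<lambda>y. of_nat (y (Batch k, 0))" and d = n and e = 0]) auto
  then have "(\<integral>\<^sup>+\<omega>. of_nat (class_work k n \<omega>) \<partial>M) < top"
    using mean_class_work[of "\<lambda>_. 1" k n] mean_batch_finite[of k] mean_service_finite[of k]
    by (simp add: ennreal_mult_less_top)
  then show "(\<integral>\<^sup>+\<omega>. ennreal (norm (real (class_work k n \<omega>))) \<partial>M) < \<infinity>"
    by (simp add: ennreal_of_nat_eq_real_of_nat)
qed simp

lemma integrable_bounded_mult:
  assumes "integrable M V" "\<And>\<omega>. \<bar>f \<omega>\<bar> \<le> c" "f \<in> borel_measurable M"
  shows "integrable M (\<lambda>\<omega>. V \<omega> * f \<omega> :: real)"
proof (rule Bochner_Integration.integrable_bound[of M "\<lambda>\<omega>. c * V \<omega>"])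
  show "AE \<omega> in M. norm (V \<omega> * f \<omega>) \<le> norm (c * V \<omega>)"
  proof (intro AE_I2)
    fix \<omega>
    have "\<bar>f \<omega>\<bar> \<le> \<bar>c\<bar>" using assms(2)[of \<omega>] by linarith
    then show "norm (V \<omega> * f \<omega>) \<le> norm (c * V \<omega>)"
      using mult_left_mono[of "\<bar>f \<omega>\<bar>" "\<bar>c\<bar>" "\<bar>V \<omega>\<bar>"] by (simp add: abs_mult mult.commute)
  qed
qed (use assms in auto)

text \<open>The Poisson equation makes the innovations a martingale difference sequence with respect to a
  past that includes the other streams.\<close>

lemma innovation_orthogonal_nonneg:
  assumes V: "known k V" and int: "integrable M V" and nonneg: "\<And>\<omega>. 0 \<le> V \<omega>"
  shows "integrable M (\<lambda>\<omega>. V \<omega> * innovation k \<omega>) \<and> expectation (\<lambda>\<omega>. V \<omega> * innovation k \<omega>) = 0"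
proof -
  let ?V = "\<lambda>\<omega>. ennreal (V \<omega>)"
  have Vp: "?V \<in> borel_measurable (past k 0)" and Vo: "?V \<in> borel_measurable (others (k, 1, i))" for i
    using V unfolding known_def by (auto intro: measurable_compose[OF _ measurable_ennreal])
  note [measurable] = known_measurable[OF V]
  define sm where "sm = service_mean k"
  have sm: "0 \<le> sm" using service_mean_ge_1[of k] by (simp add: sm_def)
  obtain c where c: "\<And>x. \<psi> k x \<le> c" "\<And>x. \<phi> k x \<le> c" using bounded_\<psi>_\<phi> by blast
  have int\<psi>: "integrable M (\<lambda>\<omega>. V \<omega> * \<psi> k (S k n \<omega>))" "integrable M (\<lambda>\<omega>. V \<omega> * \<phi> k (S k n \<omega>))" for n
    using c \<psi>_nonneg \<phi>_nonneg by (auto intro!: integrable_bounded_mult[OF int, of _ c])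
  have int\<psi>': "integrable M (\<lambda>\<omega>. V \<omega> * (if S k 1 \<omega> = 0 then 0 else \<psi> k (S k 1 \<omega>)))"
    "integrable M (\<lambda>\<omega>. V \<omega> * (if S k 1 \<omega> = 0 then 0 else \<phi> k (S k 1 \<omega>)))"
    using c \<psi>_nonneg \<phi>_nonneg order_trans[OF \<psi>_nonneg c(1)]
    by (auto intro!: integrable_bounded_mult[OF int, of _ c])
  have AEm: "AE \<omega> in M. \<forall>n. S k n \<omega> \<le> m k" using AE_streams by (auto elim!: eventually_mono)
  have m1: "S k 1 \<in> measurable M (count_space UNIV)" by simp
  have Vkill: "(\<integral>\<^sup>+\<omega>. ?V \<omega> * killed k f (S k 0 \<omega>) \<partial>M) = (\<integral>\<^sup>+\<omega>. ennreal (V \<omega> * (if S k 1 \<omega> = 0 then 0 else g (S k 1 \<omega>))) \<partial>M)"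
    if "\<And>x. x \<le> m k \<Longrightarrow> f x = ennreal (g x)" for f g
  proof -
    have "(\<integral>\<^sup>+\<omega>. ?V \<omega> * killed k f (S k 0 \<omega>) \<partial>M) = (\<integral>\<^sup>+\<omega>. ?V \<omega> * (if S k 1 \<omega> = 0 then 0 else f (S k 1 \<omega>)) \<partial>M)"
      using Markov_killed[OF Vp, of f] by (simp cong: if_cong)
    also have "\<dots> = (\<integral>\<^sup>+\<omega>. ennreal (V \<omega> * (if S k 1 \<omega> = 0 then 0 else g (S k 1 \<omega>))) \<partial>M)"
      using AEm nonneg that by (intro nn_integral_cong_AE) (auto simp: ennreal_mult' elim!: eventually_mono)
    finally show ?thesis .
  qed
  have work: "(\<integral>\<^sup>+\<omega>. ennreal (V \<omega> * real (class_work k 1 \<omega>)) \<partial>M) = ennreal sm * (\<integral>\<^sup>+\<omega>. ?V \<omega> * batch_mean k (S k 0 \<omega>) \<partial>M)"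
  proof -
    have "(\<integral>\<^sup>+\<omega>. ennreal (V \<omega> * real (class_work k 1 \<omega>)) \<partial>M) = (\<integral>\<^sup>+\<omega>. ?V \<omega> * of_nat (class_work k 1 \<omega>) \<partial>M)"
      using nonneg by (simp add: ennreal_mult' ennreal_of_nat_eq_real_of_nat)
    also have "\<dots> = mean_service k * (\<integral>\<^sup>+\<omega>. ?V \<omega> * of_nat (A k (0 + 1) \<omega>) \<partial>M)"
      using mean_class_work[of ?V k 1, OF Vo] by simp
    finally show ?thesis unfolding Markov_batch_mean[OF Vp] mean_service_eq sm_def .
  qed
  have sum1: "(\<integral>\<^sup>+\<omega>. ennreal (V \<omega> * real (class_work k 1 \<omega>)) \<partial>M)
      + ennreal sm * (\<integral>\<^sup>+\<omega>. ennreal (V \<omega> * (if S k 1 \<omega> = 0 then 0 else \<phi> k (S k 1 \<omega>))) \<partial>M)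
      = ennreal sm * (\<integral>\<^sup>+\<omega>. ennreal (V \<omega> * \<phi> k (S k 0 \<omega>)) \<partial>M)"
  proof -
    have "(\<integral>\<^sup>+\<omega>. ennreal (V \<omega> * \<phi> k (S k 0 \<omega>)) \<partial>M) = (\<integral>\<^sup>+\<omega>. ?V \<omega> * expected_arrivals k (S k 0 \<omega>) \<partial>M)"
      using AEm nonneg \<phi>_nonneg
      by (intro nn_integral_cong_AE) (auto simp: ennreal_mult' expected_arrivals_\<phi> elim!: eventually_mono)
    also have "\<dots> = (\<integral>\<^sup>+\<omega>. ?V \<omega> * batch_mean k (S k 0 \<omega>) + ?V \<omega> * killed k (expected_arrivals k) (S k 0 \<omega>) \<partial>M)"
      by (subst expected_arrivals_eq) (simp add: distrib_left)
    also have "\<dots> = (\<integral>\<^sup>+\<omega>. ?V \<omega> * batch_mean k (S k 0 \<omega>) \<partial>M) + (\<integral>\<^sup>+\<omega>. ?V \<omega> * killed k (expected_arrivals k) (S k 0 \<omega>) \<partial>M)"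
      by (rule nn_integral_add) auto
    finally show ?thesis
      by (simp only: work Vkill[of "expected_arrivals k" "\<phi> k", OF expected_arrivals_\<phi>] distrib_left)
  qed
  have sum2: "(\<integral>\<^sup>+\<omega>. ?V \<omega> \<partial>M) + (\<integral>\<^sup>+\<omega>. ennreal (V \<omega> * (if S k 1 \<omega> = 0 then 0 else \<psi> k (S k 1 \<omega>))) \<partial>M)
      = (\<integral>\<^sup>+\<omega>. ennreal (V \<omega> * \<psi> k (S k 0 \<omega>)) \<partial>M)"
  proof -
    have "(\<integral>\<^sup>+\<omega>. ennreal (V \<omega> * \<psi> k (S k 0 \<omega>)) \<partial>M) = (\<integral>\<^sup>+\<omega>. ?V \<omega> * expected_time k (S k 0 \<omega>) \<partial>M)"
      using AEm nonneg \<psi>_nonneg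
      by (intro nn_integral_cong_AE) (auto simp: ennreal_mult' expected_time_\<psi> elim!: eventually_mono)
    also have "\<dots> = (\<integral>\<^sup>+\<omega>. ?V \<omega> + ?V \<omega> * killed k (expected_time k) (S k 0 \<omega>) \<partial>M)"
      by (subst expected_time_eq) (simp add: distrib_left)
    also have "\<dots> = (\<integral>\<^sup>+\<omega>. ?V \<omega> \<partial>M) + (\<integral>\<^sup>+\<omega>. ?V \<omega> * killed k (expected_time k) (S k 0 \<omega>) \<partial>M)"
      by (rule nn_integral_add) auto
    finally show ?thesis by (simp only: Vkill[of "expected_time k" "\<psi> k", OF expected_time_\<psi>])
  qed
  have nn: "(\<integral>\<^sup>+\<omega>. ennreal (f \<omega>) \<partial>M) = ennreal (expectation f)" if "integrable M f" "\<And>\<omega>. 0 \<le> f \<omega>" for f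
    using that by (intro nn_integral_eq_integral) auto
  have pos: "0 \<le> V \<omega> * \<psi> k x" "0 \<le> V \<omega> * \<phi> k x" for \<omega> x using nonneg \<psi>_nonneg \<phi>_nonneg by auto
  have pos': "0 \<le> V \<omega> * (if S k 1 \<omega> = 0 then 0 else \<psi> k (S k 1 \<omega>))"
    "0 \<le> V \<omega> * (if S k 1 \<omega> = 0 then 0 else \<phi> k (S k 1 \<omega>))" for \<omega> using pos by auto
  have Vw: "integrable M (\<lambda>\<omega>. V \<omega> * real (class_work k 1 \<omega>))"
  proof (rule integrableI_bounded)
    have "(\<integral>\<^sup>+\<omega>. ennreal (V \<omega> * real (class_work k 1 \<omega>)) \<partial>M)
        \<le> ennreal sm * (\<integral>\<^sup>+\<omega>. ennreal (V \<omega> * \<phi> k (S k 0 \<omega>)) \<partial>M)"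
      unfolding sum1[symmetric] by simp
    also have "\<dots> < top" unfolding nn[OF int\<psi>(2) pos(2)] by (simp add: ennreal_mult_less_top)
    finally show "(\<integral>\<^sup>+\<omega>. ennreal (norm (V \<omega> * real (class_work k 1 \<omega>))) \<partial>M) < \<infinity>"
      using nonneg by (simp add: abs_mult)
  qed simp
  have Vwpos: "0 \<le> V \<omega> * real (class_work k 1 \<omega>)" for \<omega> using nonneg by auto
  have E1: "expectation (\<lambda>\<omega>. V \<omega> * real (class_work k 1 \<omega>))
      + sm * expectation (\<lambda>\<omega>. V \<omega> * (if S k 1 \<omega> = 0 then 0 else \<phi> k (S k 1 \<omega>)))
      = sm * expectation (\<lambda>\<omega>. V \<omega> * \<phi> k (S k 0 \<omega>))"
  proof -
    let ?a = "expectation (\<lambda>\<omega>. V \<omega> * real (class_work k 1 \<omega>))"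
    let ?b = "expectation (\<lambda>\<omega>. V \<omega> * (if S k 1 \<omega> = 0 then 0 else \<phi> k (S k 1 \<omega>)))"
    let ?c = "expectation (\<lambda>\<omega>. V \<omega> * \<phi> k (S k 0 \<omega>))"
    have p: "0 \<le> ?a" "0 \<le> ?b" "0 \<le> ?c" using Vwpos pos' pos by (auto intro!: Bochner_Integration.integral_nonneg)
    have "ennreal ?a + ennreal sm * ennreal ?b = ennreal sm * ennreal ?c"
      using sum1 unfolding nn[OF Vw Vwpos] nn[OF int\<psi>'(2) pos'(2)] nn[OF int\<psi>(2) pos(2)] .
    then have "ennreal (?a + sm * ?b) = ennreal (sm * ?c)" using p sm by (simp add: ennreal_mult)
    then show ?thesis using p sm by (subst (asm) ennreal_inj) auto
  qed
  have E2: "expectation V + expectation (\<lambda>\<omega>. V \<omega> * (if S k 1 \<omega> = 0 then 0 else \<psi> k (S k 1 \<omega>)))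
      = expectation (\<lambda>\<omega>. V \<omega> * \<psi> k (S k 0 \<omega>))"
  proof -
    let ?b = "expectation (\<lambda>\<omega>. V \<omega> * (if S k 1 \<omega> = 0 then 0 else \<psi> k (S k 1 \<omega>)))"
    let ?c = "expectation (\<lambda>\<omega>. V \<omega> * \<psi> k (S k 0 \<omega>))"
    have p: "0 \<le> expectation V" "0 \<le> ?b" "0 \<le> ?c" using nonneg pos' pos by (auto intro!: Bochner_Integration.integral_nonneg)
    have "ennreal (expectation V) + ennreal ?b = ennreal ?c"
      using sum2 unfolding nn[OF int nonneg] nn[OF int\<psi>'(1) pos'(1)] nn[OF int\<psi>(1) pos(1)] .
    then have "ennreal (expectation V + ?b) = ennreal ?c" using p by simp
    then show ?thesis using p by (subst (asm) ennreal_inj) auto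
  qed
  have eq: "V \<omega> * innovation k \<omega> = V \<omega> * real (class_work k 1 \<omega>)
      + sm * (V \<omega> * (if S k 1 \<omega> = 0 then 0 else \<phi> k (S k 1 \<omega>)))
      - class_load k * (V \<omega> * (if S k 1 \<omega> = 0 then 0 else \<psi> k (S k 1 \<omega>)))
      - sm * (V \<omega> * \<phi> k (S k 0 \<omega>)) + class_load k * (V \<omega> * \<psi> k (S k 0 \<omega>)) - class_load k * V \<omega>" for \<omega>
  proof -
    have "excess k (S k 1 \<omega>) = sm * (if S k 1 \<omega> = 0 then 0 else \<phi> k (S k 1 \<omega>))
        - class_load k * (if S k 1 \<omega> = 0 then 0 else \<psi> k (S k 1 \<omega>))"
      by (cases "S k 1 \<omega> = 0", simp, simp add: excess_def sm_def)
    moreover have "v * (w + (s * a - l * b) - (s * c - l * d) - l)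
        = v * w + s * (v * a) - l * (v * b) - s * (v * c) + l * (v * d) - l * v" for v w s a b c d l :: real
      by (simp add: algebra_simps)
    ultimately show ?thesis unfolding innovation_def excess_def[of k "S k 0 \<omega>"] sm_def by simp
  qed
  have "class_load k * expectation (\<lambda>\<omega>. V \<omega> * \<psi> k (S k 0 \<omega>)) = class_load k * expectation V
      + class_load k * expectation (\<lambda>\<omega>. V \<omega> * (if S k 1 \<omega> = 0 then 0 else \<psi> k (S k 1 \<omega>)))"
    unfolding E2[symmetric] by (rule distrib_left)
  moreover have "expectation (\<lambda>\<omega>. V \<omega> * innovation k \<omega>)
      = expectation (\<lambda>\<omega>. V \<omega> * real (class_work k 1 \<omega>))
        + sm * expectation (\<lambda>\<omega>. V \<omega> * (if S k 1 \<omega> = 0 then 0 else \<phi> k (S k 1 \<omega>)))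
        - class_load k * expectation (\<lambda>\<omega>. V \<omega> * (if S k 1 \<omega> = 0 then 0 else \<psi> k (S k 1 \<omega>)))
        - sm * expectation (\<lambda>\<omega>. V \<omega> * \<phi> k (S k 0 \<omega>))
        + class_load k * expectation (\<lambda>\<omega>. V \<omega> * \<psi> k (S k 0 \<omega>)) - class_load k * expectation V"
    unfolding eq using Vw int\<psi> int\<psi>' int by simp
  moreover have "integrable M (\<lambda>\<omega>. V \<omega> * innovation k \<omega>)"
    unfolding eq using Vw int\<psi> int\<psi>' int by simp
  ultimately show ?thesis using E1 by simp
qed

lemma
  assumes V: "known k V" and int: "integrable M V"
  shows innovation_mult_integrable: "integrable M (\<lambda>\<omega>. V \<omega> * innovation k \<omega>)"
    and innovation_mult_expectation: "expectation (\<lambda>\<omega>. V \<omega> * innovation k \<omega>) = 0"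
proof -
  have k: "known k (\<lambda>\<omega>. max (V \<omega>) 0)" "known k (\<lambda>\<omega>. max (- V \<omega>) 0)"
    using V by (auto intro: known_compose[where f = "\<lambda>x. max x 0"] known_compose[where f = "\<lambda>x. max (- x) 0"])
  have i: "integrable M (\<lambda>\<omega>. max (V \<omega>) 0)" "integrable M (\<lambda>\<omega>. max (- V \<omega>) 0)"
    using int by auto
  note 1 = innovation_orthogonal_nonneg[OF k(1) i(1)] and 2 = innovation_orthogonal_nonneg[OF k(2) i(2)]
  have eq: "V \<omega> * innovation k \<omega> = max (V \<omega>) 0 * innovation k \<omega> - max (- V \<omega>) 0 * innovation k \<omega>" for \<omega>
    by (auto simp: max_def)
  show "integrable M (\<lambda>\<omega>. V \<omega> * innovation k \<omega>)" "expectation (\<lambda>\<omega>. V \<omega> * innovation k \<omega>) = 0"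
    unfolding eq using 1 2 by auto
qed

end

section \<open>The unfinished work\<close>

lemma measurable_card_countable:
  fixes R :: "'b \<Rightarrow> 'c::countable set"
  assumes [measurable]: "\<And>c. Measurable.pred N (\<lambda>x. c \<in> R x)"
  shows "(\<lambda>x. card (R x)) \<in> measurable N (count_space UNIV)"
proof -
  have "(\<lambda>x. card (to_nat ` R x)) \<in> measurable N (count_space UNIV)"
  proof (rule measurable_card)
    fix i
    have "Measurable.pred N (\<lambda>x. \<exists>c. to_nat c = i \<and> c \<in> R x)" by measurable
    moreover have "{x \<in> space N. i \<in> to_nat ` R x} = {x \<in> space N. \<exists>c. to_nat c = i \<and> c \<in> R x}" by auto
    ultimately show "{x \<in> space N. i \<in> to_nat ` R x} \<in> sets N" by (simp add: pred_def)
  qed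
  then show ?thesis by (simp add: card_image)
qed

context stationary_queue
begin

lemma expectation_stationary:
  assumes \<phi>[measurable]: "\<phi> \<in> borel_measurable path_space"
    and "\<And>\<omega>. f \<omega> = \<phi> (time_shift d (sample_path \<omega>))" "\<And>\<omega>. g \<omega> = \<phi> (time_shift e (sample_path \<omega>))"
  shows "expectation f = (expectation g :: real)"
proof -
  have "f = (\<lambda>\<omega>. \<phi> (time_shift d (sample_path \<omega>)))" "g = (\<lambda>\<omega>. \<phi> (time_shift e (sample_path \<omega>)))"
    using assms by auto
  then have m: "f \<in> borel_measurable M" "g \<in> borel_measurable M" by simp_all
  have "expectation f = integral\<^sup>L (distr M borel f) (\<lambda>x. x)" "expectation g = integral\<^sup>L (distr M borel g) (\<lambda>x. x)"
    using m by (simp_all add: integral_distr)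
  then show ?thesis using distr_stationary[OF \<phi>, of f d g e] assms by simp
qed

abbreviation work :: "int \<Rightarrow> 'a \<Rightarrow> nat" where "work n \<omega> \<equiv> work_arriving A h n \<omega>"

definition backlog :: "int \<Rightarrow> 'a \<Rightarrow> nat" where
  "backlog n \<omega> = card (unfinished A h W n \<omega>)"

text \<open>The unfinished work of slot \<open>0\<close> as a function of the path of observables alone.\<close>

definition path_unfinished :: "('k observable \<times> int \<Rightarrow> nat) \<Rightarrow> ('k customer \<times> nat) set" where
  "path_unfinished y = {((k, l, i), j). i < y (Batch k, l) \<and> l \<le> 0 \<and> j < y (Service k i, l) \<and> 0 \<le> l + int (y (Waiting k i, l)) + int j}"

lemma backlog_path: "backlog n \<omega> = card (path_unfinished (time_shift n (sample_path \<omega>)))"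
proof -
  let ?s = "\<lambda>(c :: 'k customer, j :: nat). ((fst c, fst (snd c) + n, snd (snd c)), j)"
  have "inj_on ?s X" for X by (auto simp: inj_on_def)
  moreover have "unfinished A h W n \<omega> = ?s ` path_unfinished (time_shift n (sample_path \<omega>))"
  proof (intro equalityI subsetI)
    fix x assume "x \<in> unfinished A h W n \<omega>"
    then obtain k l i j where x: "x = ((k, l, i), j)" and u: "i < A k l \<omega>" "l \<le> n" "j < h k l i \<omega>" "n \<le> l + int (W k l i \<omega>) + int j"
      by (auto simp: unfinished_def)
    then have "((k, l - n, i), j) \<in> path_unfinished (time_shift n (sample_path \<omega>))"
      by (auto simp: path_unfinished_def)
    then show "x \<in> ?s ` path_unfinished (time_shift n (sample_path \<omega>))"
      unfolding x by (rule rev_image_eqI) simp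
  qed (auto simp: path_unfinished_def unfinished_def split: if_splits)
  ultimately show ?thesis unfolding backlog_def by (simp add: card_image)
qed

lemma card_path_unfinished_measurable[measurable]:
  "(\<lambda>y. card (path_unfinished y)) \<in> measurable path_space (count_space UNIV)"
proof (rule measurable_card_countable)
  fix c :: "'k customer \<times> nat"
  obtain k l i j where c: "c = ((k, l, i), j)" by (metis prod.collapse)
  have pc: "Measurable.pred path_space (\<lambda>y :: 'k observable \<times> int \<Rightarrow> nat. Q (y q))" for Q q
    by (rule measurable_compose[OF measurable_path_space]) simp
  note [measurable] = pc[of "\<lambda>v. i < v"] pc[of "\<lambda>v. j < v"] pc[of "\<lambda>v. 0 \<le> l + int v + int j"]
  show "Measurable.pred path_space (\<lambda>y. c \<in> path_unfinished y)"
    unfolding c path_unfinished_def by simp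
qed

lemma backlog_measurable[measurable]: "backlog n \<in> measurable M (count_space UNIV)"
proof -
  have "backlog n = (\<lambda>\<omega>. card (path_unfinished (time_shift n (sample_path \<omega>))))" using backlog_path by auto
  then show ?thesis by simp
qed

lemma AE_backlog: "AE \<omega> in M. \<forall>n. finite (unfinished A h W n \<omega>) \<and> backlog n \<omega> = (backlog (n - 1) \<omega> - 1) + work n \<omega>"
  using work_conserving unfolding work_conserving_def backlog_def .

definition path_work :: "('k observable \<times> int \<Rightarrow> nat) \<Rightarrow> int \<Rightarrow> nat" where
  "path_work y n = (\<Sum>k\<in>UNIV. \<Sum>i<y (Batch k, n). y (Service k i, n))"

lemma work_path: "work (n + d) \<omega> = path_work (time_shift d (sample_path \<omega>)) n"
  by (simp add: work_arriving_def path_work_def)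

lemma path_work_measurable[measurable]: "(\<lambda>y. path_work y n) \<in> measurable path_space (count_space UNIV)"
proof -
  have [measurable]: "(\<lambda>y. \<Sum>i<y (Batch k, n). y (Service k i, n)) \<in> measurable path_space (count_space UNIV)" for k :: 'k
    by (rule sum_lessThan_measurable) measurable
  show ?thesis unfolding path_work_def by measurable
qed

lemma loynes_measurable:
  assumes b: "\<And>i. i \<le> n \<Longrightarrow> (\<lambda>x. b x i) \<in> measurable N (count_space UNIV)"
  shows "(\<lambda>x. loynes (b x) n) \<in> measurable N (count_space UNIV)"
proof -
  have *: "(\<lambda>x. lindley (b x) i q) \<in> measurable N (count_space UNIV)" if "i \<le> n" for i q
    using that
  proof (induction q arbitrary: i)
    case (Suc q)
    have [measurable]: "(\<lambda>x. lindley (b x) (i - 1) q) \<in> measurable N (count_space UNIV)" using Suc by simp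
    have [measurable]: "(\<lambda>x. b x i) \<in> measurable N (count_space UNIV)" using Suc.prems b by simp
    show ?case unfolding lindley.simps by measurable
  qed simp
  note [measurable] = *[OF order_refl]
  show ?thesis unfolding loynes_def image_def by measurable
qed

text \<open>The order of service may bring outside randomness into \<open>backlog\<close>. This solution depends only on
  the arrivals and service times of the past.\<close>

definition loynes_work :: "int \<Rightarrow> 'a \<Rightarrow> nat" where
  "loynes_work n \<omega> = loynes (\<lambda>i. work i \<omega>) n"

lemma loynes_work_path': "loynes_work (i + n) \<omega> = loynes (path_work (time_shift n (sample_path \<omega>))) i"
proof -
  have "(\<lambda>i. work (i + n) \<omega>) = path_work (time_shift n (sample_path \<omega>))" using work_path by auto
  then show ?thesis unfolding loynes_work_def using loynes_shift[of "\<lambda>i. work i \<omega>" n i] by simp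
qed

lemma loynes_work_path: "loynes_work n \<omega> = loynes (path_work (time_shift n (sample_path \<omega>))) 0"
  using loynes_work_path'[of 0 n] by simp

lemma loynes_path_measurable[measurable]: "(\<lambda>y. loynes (path_work y) n) \<in> measurable path_space (count_space UNIV)"
  by (rule loynes_measurable) simp

lemma work_measurable[measurable]: "work n \<in> measurable M (count_space UNIV)"
  unfolding work_arriving_eq[abs_def] by measurable

lemma loynes_work_measurable[measurable]: "loynes_work n \<in> measurable M (count_space UNIV)"
  unfolding loynes_work_def[abs_def] by (rule loynes_measurable) simp

lemma AE_loynes_work:
  "AE \<omega> in M. \<forall>n. loynes_work n \<omega> \<le> backlog n \<omega> \<and> loynes_work n \<omega> = (loynes_work (n - 1) \<omega> - 1) + work n \<omega>"
  using AE_backlog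
proof eventually_elim
  case (elim \<omega>)
  then have x: "\<And>n. backlog n \<omega> = (backlog (n - 1) \<omega> - 1) + work n \<omega>" by blast
  show ?case
    unfolding loynes_work_def
    using loynes_le_solution[of "\<lambda>n. backlog n \<omega>" "\<lambda>n. work n \<omega>", OF x]
      loynes_recursion[of "\<lambda>n. backlog n \<omega>" "\<lambda>n. work n \<omega>", OF x] by blast
qed

lemma AE_loynes_le: "AE \<omega> in M. loynes_work n \<omega> \<le> backlog n \<omega>"
  and AE_loynes_step: "AE \<omega> in M. loynes_work n \<omega> = (loynes_work (n - 1) \<omega> - 1) + work n \<omega>"
  using AE_loynes_work by (eventually_elim, blast)+

lemma AE_backlog_step: "AE \<omega> in M. backlog n \<omega> = (backlog (n - 1) \<omega> - 1) + work n \<omega>"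
  using AE_backlog by eventually_elim blast

end

context stable_queue
begin

lemma work_integrable': "integrable M (\<lambda>\<omega>. real (work n \<omega>))"
  unfolding work_arriving_eq of_nat_sum using work_integrable by simp

lemma expectation_class_work: "expectation (\<lambda>\<omega>. real (class_work k n \<omega>)) = class_load k"
proof -
  have "(\<integral>\<^sup>+\<omega>. of_nat (A k n \<omega>) \<partial>M) = mean_batch k"
    by (rule nn_integral_stationary[where \<phi> = "\<lambda>y. of_nat (y (Batch k, 0))" and d = n and e = 0]) auto
  then have "(\<integral>\<^sup>+\<omega>. of_nat (class_work k n \<omega>) \<partial>M) = ennreal (class_load k)"
    using mean_class_work[of "\<lambda>_. 1" k n] rate_pos[of k] service_mean_ge_1[of k]
    by (simp add: mean_batch_eq mean_service_eq class_load_def ennreal_mult mult.commute)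
  then have "(\<integral>\<^sup>+\<omega>. ennreal (real (class_work k n \<omega>)) \<partial>M) = ennreal (class_load k)"
    by (simp add: ennreal_of_nat_eq_real_of_nat)
  then show ?thesis using class_load_pos[of k] by (intro nn_integral_eq_integrable[THEN iffD1, THEN conjunct2]) auto
qed

lemma expectation_work: "expectation (\<lambda>\<omega>. real (work n \<omega>)) = total_load"
  unfolding work_arriving_eq of_nat_sum total_load_def
  using work_integrable expectation_class_work by (subst Bochner_Integration.integral_sum) auto

text \<open>In a stationary regime the work served per slot balances the work arriving, although the
  unfinished work itself may have an infinite mean. As this holds for every stationary solution of the
  recursion, all of them are positive with the same probability.\<close>

lemma busy_probability:
  assumes f[measurable]: "f \<in> measurable path_space (count_space UNIV)"
    and x: "\<And>n \<omega>. x n \<omega> = (f (time_shift n (sample_path \<omega>)) :: nat)"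
    and rec: "AE \<omega> in M. x 1 \<omega> = (x 0 \<omega> - 1) + work 1 \<omega>"
  shows "prob {\<omega> \<in> space M. 0 < x 0 \<omega>} = total_load"
proof -
  have x_eq: "x n = (\<lambda>\<omega>. f (time_shift n (sample_path \<omega>)))" for n using x by auto
  have [measurable]: "x n \<in> measurable M (count_space UNIV)" for n unfolding x_eq by measurable
  have int: "integrable M (\<lambda>\<omega>. real (work 1 \<omega>) - indicator {\<omega> \<in> space M. 0 < x 0 \<omega>} \<omega>)"
    using work_integrable' by (intro Bochner_Integration.integrable_diff integrable_real_indicator) (auto simp: emeasure_eq_measure)
  have AE: "AE \<omega> in M. real (x 1 \<omega>) - real (x 0 \<omega>) = real (work 1 \<omega>) - indicator {\<omega> \<in> space M. 0 < x 0 \<omega>} \<omega>"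
    using rec AE_space by eventually_elim (auto simp: indicator_def of_nat_diff)
  have "expectation (\<lambda>\<omega>. real (x 1 \<omega>) - real (x 0 \<omega>)) = 0"
  proof (rule expectation_stationary_increment)
    show "distr M borel (\<lambda>\<omega>. real (x 1 \<omega>)) = distr M borel (\<lambda>\<omega>. real (x 0 \<omega>))"
      by (rule distr_stationary[where \<phi> = "\<lambda>y. real (f y)" and d = 1 and e = 0]) (auto simp: x)
    show "integrable M (\<lambda>\<omega>. real (x 1 \<omega>) - real (x 0 \<omega>))"
      using int AE by (subst integrable_cong_AE) auto
  qed auto
  moreover have "expectation (\<lambda>\<omega>. real (x 1 \<omega>) - real (x 0 \<omega>))
      = expectation (\<lambda>\<omega>. real (work 1 \<omega>) - indicator {\<omega> \<in> space M. 0 < x 0 \<omega>} \<omega>)"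
    using AE by (intro integral_cong_AE) auto
  also have "\<dots> = total_load - prob {\<omega> \<in> space M. 0 < x 0 \<omega>}"
    using work_integrable'[of 1]
    by (subst Bochner_Integration.integral_diff) (auto simp: expectation_work emeasure_eq_measure)
  ultimately show ?thesis by simp
qed

lemma busy_probability_backlog: "prob {\<omega> \<in> space M. 0 < backlog n \<omega>} = total_load"
  and busy_probability_loynes: "prob {\<omega> \<in> space M. 0 < loynes_work n \<omega>} = total_load"
proof -
  have eq: "prob {\<omega> \<in> space M. 0 < x n \<omega>} = prob {\<omega> \<in> space M. 0 < x 0 \<omega>}"
    if [measurable]: "f \<in> measurable path_space (count_space UNIV)" and x: "\<And>n \<omega>. x n \<omega> = (f (time_shift n (sample_path \<omega>)) :: nat)" for x f
  proof -
    have x_eq: "x n = (\<lambda>\<omega>. f (time_shift n (sample_path \<omega>)))" for n using x by auto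
    have xm[measurable]: "x n \<in> measurable M (count_space UNIV)" for n unfolding x_eq by measurable
    have "distr M (count_space UNIV) (x n) = distr M (count_space UNIV) (x 0)"
      using that(1) by (rule distr_stationary) (rule x)+
    then have "measure (distr M (count_space UNIV) (x n)) {0<..} = measure (distr M (count_space UNIV) (x 0)) {0<..}"
      by (rule arg_cong)
    moreover have "measure (distr M (count_space UNIV) (x n)) {0<..} = prob {\<omega> \<in> space M. 0 < x n \<omega>}" for n
      by (subst measure_distr) (auto intro!: arg_cong[where f = prob])
    ultimately show ?thesis by simp
  qed
  have "prob {\<omega> \<in> space M. 0 < backlog 0 \<omega>} = total_load"
  proof (rule busy_probability[OF card_path_unfinished_measurable backlog_path])
    show "AE \<omega> in M. backlog 1 \<omega> = (backlog 0 \<omega> - 1) + work 1 \<omega>"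
      using AE_backlog_step[of 1] by simp
  qed
  then show "prob {\<omega> \<in> space M. 0 < backlog n \<omega>} = total_load"
    using eq[OF card_path_unfinished_measurable backlog_path] by simp
  have "prob {\<omega> \<in> space M. 0 < loynes_work 0 \<omega>} = total_load"
  proof (rule busy_probability[OF loynes_path_measurable loynes_work_path])
    show "AE \<omega> in M. loynes_work 1 \<omega> = (loynes_work 0 \<omega> - 1) + work 1 \<omega>"
      using AE_loynes_step[of 1] by simp
  qed
  then show "prob {\<omega> \<in> space M. 0 < loynes_work n \<omega>} = total_load"
    using eq[OF loynes_path_measurable loynes_work_path] by simp
qed

text \<open>One solution lies below the other, and they vanish with the same probability.\<close>

lemma AE_same_zeros: "AE \<omega> in M. \<forall>n. loynes_work n \<omega> = 0 \<longleftrightarrow> backlog n \<omega> = 0"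
  unfolding AE_all_countable
proof
  fix n
  let ?X = "{\<omega> \<in> space M. 0 < backlog n \<omega>}" and ?U = "{\<omega> \<in> space M. 0 < loynes_work n \<omega>}"
  have "AE \<omega> in M. \<omega> \<in> ?U \<longrightarrow> \<omega> \<in> ?X"
    using AE_loynes_le[of n] AE_space by eventually_elim auto
  then have "AE \<omega> in M. \<omega> \<in> ?U \<longleftrightarrow> \<omega> \<in> ?X \<inter> ?U" by eventually_elim auto
  then have "prob ?U = prob (?X \<inter> ?U)" by (intro finite_measure_eq_AE) auto
  then have "prob (?X - ?U) = 0"
    using busy_probability_backlog[of n] busy_probability_loynes[of n] by (subst finite_measure_Diff') (auto simp: Int_commute)
  then have "AE \<omega> in M. \<omega> \<notin> ?X - ?U" by (subst (asm) prob_eq_0) auto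
  then show "AE \<omega> in M. loynes_work n \<omega> = 0 \<longleftrightarrow> backlog n \<omega> = 0"
    using AE_loynes_le[of n] AE_space by eventually_elim auto
qed

text \<open>What is determined by the arrivals and services up to slot \<open>0\<close> and by the other streams is known.
  The quantification over \<open>N\<close> treats both sigma-algebras of \<open>known\<close> at once.\<close>

lemma knownI:
  assumes "\<And>N. (\<And>k' i. i \<le> 0 \<Longrightarrow> S k' i \<in> measurable N (count_space UNIV)) \<Longrightarrow>
      (\<And>k' i. i \<le> 0 \<Longrightarrow> A k' i \<in> measurable N (count_space UNIV)) \<Longrightarrow>
      (\<And>k' i j. i \<le> 0 \<Longrightarrow> h k' i j \<in> measurable N (count_space UNIV)) \<Longrightarrow>
      (\<And>k' i. k' \<noteq> k \<Longrightarrow> S k' i \<in> measurable N (count_space UNIV)) \<Longrightarrow>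
      (\<And>k' i. k' \<noteq> k \<Longrightarrow> A k' i \<in> measurable N (count_space UNIV)) \<Longrightarrow>
      (\<And>k' i j. k' \<noteq> k \<Longrightarrow> h k' i j \<in> measurable N (count_space UNIV)) \<Longrightarrow> V \<in> borel_measurable N"
  shows "known k V"
  unfolding known_def
proof (intro conjI allI)
  have S: "S k' i \<in> measurable (past k 0) (count_space UNIV)" if "i \<le> 0" for k' i
    using past_S[of i 0 k] past_other_S[of k' k] that by (cases "k' = k") auto
  have A: "A k' i \<in> measurable (past k 0) (count_space UNIV)" if "i \<le> 0" for k' i
    using past_A[of i 0 k] past_other_A[of k' k] that by (cases "k' = k") auto
  show "V \<in> borel_measurable (past k 0)"
    by (rule assms) (auto intro: S A past_h past_other_S past_other_A)
  show "V \<in> borel_measurable (others (k, 1, i))" for i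
    by (rule assms) (auto intro: others_S others_A others_h)
qed

lemma work_known:
  assumes "\<And>k. A k n \<in> measurable N (count_space UNIV)" "\<And>k i. h k n i \<in> measurable N (count_space UNIV)"
  shows "work n \<in> measurable N (count_space UNIV)"
proof -
  note [measurable] = class_work_measurable_gen[OF assms]
  show ?thesis unfolding work_arriving_eq[abs_def] by measurable
qed

lemma loynes_known:
  assumes "\<And>k i. i \<le> 0 \<Longrightarrow> A k i \<in> measurable N (count_space UNIV)"
    "\<And>k i j. i \<le> 0 \<Longrightarrow> h k i j \<in> measurable N (count_space UNIV)" "n \<le> 0"
  shows "loynes_work n \<in> measurable N (count_space UNIV)"
  unfolding loynes_work_def[abs_def] using assms by (intro loynes_measurable work_known) auto

definition total_excess :: "int \<Rightarrow> 'a \<Rightarrow> real" where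
  "total_excess n \<omega> = (\<Sum>k\<in>UNIV. excess k (S k n \<omega>))"

lemma total_excess_measurable[measurable]: "total_excess n \<in> borel_measurable M"
  unfolding total_excess_def[abs_def] by measurable

lemma bounded_total_excess: "\<exists>c\<ge>0. \<forall>n \<omega>. \<bar>total_excess n \<omega>\<bar> \<le> c"
proof -
  obtain b where b: "\<And>k x. \<bar>excess k x\<bar> \<le> b k" using bounded_excess by metis
  have "\<bar>total_excess n \<omega>\<bar> \<le> (\<Sum>k\<in>UNIV. b k)" for n \<omega>
    unfolding total_excess_def using b by (intro order_trans[OF sum_abs] sum_mono)
  moreover from this[of undefined undefined] have "0 \<le> (\<Sum>k\<in>UNIV. b k)" by linarith
  ultimately show ?thesis by blast
qed

lemma sum_innovation:
  "(\<Sum>k\<in>UNIV. innovation k \<omega>) = real (work 1 \<omega>) + total_excess 1 \<omega> - total_excess 0 \<omega> - total_load"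
  by (simp add: innovation_def work_arriving_eq total_excess_def total_load_def sum.distrib sum_subtractf)

lemma expectation_known_innovation:
  assumes "\<And>k. known k V" "integrable M V"
  shows "integrable M (\<lambda>\<omega>. V \<omega> * (\<Sum>k\<in>UNIV. innovation k \<omega>))"
    and "expectation (\<lambda>\<omega>. V \<omega> * (\<Sum>k\<in>UNIV. innovation k \<omega>)) = 0"
proof -
  have eq: "V \<omega> * (\<Sum>k\<in>UNIV. innovation k \<omega>) = (\<Sum>k\<in>UNIV. V \<omega> * innovation k \<omega>)" for \<omega>
    by (rule sum_distrib_left)
  note i = innovation_mult_integrable[OF assms] and e = innovation_mult_expectation[OF assms]
  show "integrable M (\<lambda>\<omega>. V \<omega> * (\<Sum>k\<in>UNIV. innovation k \<omega>))"
    unfolding eq using i by (intro Bochner_Integration.integrable_sum)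
  show "expectation (\<lambda>\<omega>. V \<omega> * (\<Sum>k\<in>UNIV. innovation k \<omega>)) = 0"
    unfolding eq using i e by (subst Bochner_Integration.integral_sum) auto
qed

text \<open>The event that the queue has never been empty is shift invariant up to a null set and known in
  slot \<open>0\<close>. On it, one unit of work is served per slot, so one unit arrives per slot in the mean; but the
  innovations have mean zero on it, so that \<open>total_load\<close> units arrive in the mean. Hence it is null.\<close>

lemma AE_loynes_hits: "AE \<omega> in M. \<exists>q. loynes_work (- int q) \<omega> = 0"
proof -
  define pos where "pos n \<omega> \<longleftrightarrow> (\<forall>q. 0 < loynes_work (n - int q) \<omega>)" for n \<omega>
  define V :: "int \<Rightarrow> 'a \<Rightarrow> real" where "V n \<omega> = indicator {\<omega>. pos n \<omega>} \<omega>" for n \<omega>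
  define fpos where "fpos y \<longleftrightarrow> (\<forall>q. 0 < loynes (path_work y) (- int q))" for y :: "'k observable \<times> int \<Rightarrow> nat"
  have pos_path: "pos n \<omega> \<longleftrightarrow> fpos (time_shift n (sample_path \<omega>))" for n \<omega>
    unfolding pos_def fpos_def loynes_work_path'[symmetric] by (simp add: algebra_simps)
  have [measurable]: "Measurable.pred path_space fpos" unfolding fpos_def by measurable
  have [measurable]: "Measurable.pred M (pos n)" for n unfolding pos_def by measurable
  have [measurable]: "V n \<in> borel_measurable M" for n unfolding V_def indicator_def by measurable
  have V01: "0 \<le> V n \<omega>" "V n \<omega> \<le> 1" "\<bar>V n \<omega>\<bar> \<le> 1" for n \<omega> by (auto simp: V_def indicator_def)
  have intV: "integrable M (V n)" for n
    by (rule integrable_const_bound[where B = 1]) (use V01 in auto)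
  have kn: "known k (V 0)" for k
  proof (rule knownI)
    fix N assume "\<And>k' i. i \<le> 0 \<Longrightarrow> A k' i \<in> measurable N (count_space UNIV)"
      "\<And>k' i j. i \<le> 0 \<Longrightarrow> h k' i j \<in> measurable N (count_space UNIV)"
    then have [measurable]: "loynes_work (0 - int q) \<in> measurable N (count_space UNIV)" for q
      by (intro loynes_known) auto
    show "V 0 \<in> borel_measurable N" unfolding V_def[abs_def] indicator_def pos_def by measurable
  qed
  have V_same: "expectation (V 1) = expectation (V 0)"
    by (rule expectation_stationary[where \<phi> = "\<lambda>y. if fpos y then 1 else 0" and d = 1 and e = 0])
       (auto simp: V_def pos_path indicator_def)
  have V_le: "V 1 \<omega> \<le> V 0 \<omega>" for \<omega>
  proof -
    have "pos 0 \<omega>" if "pos 1 \<omega>" unfolding pos_def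
    proof
      fix q
      have "0 < loynes_work (1 - int (Suc q)) \<omega>" using that unfolding pos_def by blast
      then show "0 < loynes_work (0 - int q) \<omega>" by simp
    qed
    then show ?thesis by (auto simp: V_def indicator_def)
  qed
  \<comment> \<open>a decreasing sequence of events with equal probabilities\<close>
  have VAE: "AE \<omega> in M. V 1 \<omega> = V 0 \<omega>"
  proof -
    have "expectation (\<lambda>\<omega>. V 0 \<omega> - V 1 \<omega>) = 0" using intV V_same by simp
    then have "AE \<omega> in M. V 0 \<omega> - V 1 \<omega> = 0"
      using V_le intV by (subst (asm) integral_nonneg_eq_0_iff_AE) auto
    then show ?thesis by eventually_elim simp
  qed
  obtain c where c: "0 \<le> c" "\<And>n \<omega>. \<bar>total_excess n \<omega>\<bar> \<le> c" using bounded_total_excess by blast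
  have iT: "integrable M (\<lambda>\<omega>. V n \<omega> * total_excess n' \<omega>)" for n n'
    using c(2) by (intro integrable_bounded_mult[OF intV]) auto
  have iW: "integrable M (\<lambda>\<omega>. V 0 \<omega> * real (work 1 \<omega>))"
    by (subst mult.commute, rule integrable_bounded_mult[OF work_integrable', where c = 1]) (use V01 in auto)
  have 1: "expectation (\<lambda>\<omega>. V 0 \<omega> * total_excess 1 \<omega>) = expectation (\<lambda>\<omega>. V 0 \<omega> * total_excess 0 \<omega>)"
  proof -
    have "expectation (\<lambda>\<omega>. V 0 \<omega> * total_excess 1 \<omega>) = expectation (\<lambda>\<omega>. V 1 \<omega> * total_excess 1 \<omega>)"
      using VAE by (intro integral_cong_AE) auto
    also have "\<dots> = expectation (\<lambda>\<omega>. V 0 \<omega> * total_excess 0 \<omega>)"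
      by (rule expectation_stationary[where \<phi> = "\<lambda>y. (if fpos y then 1 else 0) * (\<Sum>k\<in>UNIV. excess k (y (Phase k, 0)))" and d = 1 and e = 0])
         (auto simp: V_def pos_path indicator_def total_excess_def)
    finally show ?thesis .
  qed
  have 2: "expectation (\<lambda>\<omega>. V 0 \<omega> * real (work 1 \<omega>)) = expectation (V 0)"
  proof -
    have AEd: "AE \<omega> in M. V 1 \<omega> * real (loynes_work 1 \<omega>) - V 0 \<omega> * real (loynes_work 0 \<omega>)
        = V 0 \<omega> * real (work 1 \<omega>) - V 0 \<omega>"
      using VAE AE_loynes_step[of 1]
    proof eventually_elim
      case (elim \<omega>)
      show ?case
      proof (cases "pos 0 \<omega>")
        case True
        have "0 < loynes_work (0 - int 0) \<omega>" using True unfolding pos_def by blast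
        then show ?thesis using elim True by (simp add: V_def of_nat_diff)
      qed (use elim in \<open>simp add: V_def\<close>)
    qed
    have "expectation (\<lambda>\<omega>. V 1 \<omega> * real (loynes_work 1 \<omega>) - V 0 \<omega> * real (loynes_work 0 \<omega>)) = 0"
    proof (rule expectation_stationary_increment)
      show "distr M borel (\<lambda>\<omega>. V 1 \<omega> * real (loynes_work 1 \<omega>)) = distr M borel (\<lambda>\<omega>. V 0 \<omega> * real (loynes_work 0 \<omega>))"
        by (rule distr_stationary[where \<phi> = "\<lambda>y. (if fpos y then 1 else 0) * real (loynes (path_work y) 0)" and d = 1 and e = 0])
           (auto simp: V_def pos_path indicator_def loynes_work_path)
      have "integrable M (\<lambda>\<omega>. V 0 \<omega> * real (work 1 \<omega>) - V 0 \<omega>)" using iW intV by simp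
      then show "integrable M (\<lambda>\<omega>. V 1 \<omega> * real (loynes_work 1 \<omega>) - V 0 \<omega> * real (loynes_work 0 \<omega>))"
        using AEd by (subst integrable_cong_AE) auto
    qed auto
    moreover have "expectation (\<lambda>\<omega>. V 1 \<omega> * real (loynes_work 1 \<omega>) - V 0 \<omega> * real (loynes_work 0 \<omega>))
        = expectation (\<lambda>\<omega>. V 0 \<omega> * real (work 1 \<omega>) - V 0 \<omega>)"
      using AEd by (intro integral_cong_AE) auto
    ultimately show ?thesis using iW intV by simp
  qed
  have "V 0 \<omega> * (\<Sum>k\<in>UNIV. innovation k \<omega>) = V 0 \<omega> * real (work 1 \<omega>) + V 0 \<omega> * total_excess 1 \<omega>
      - V 0 \<omega> * total_excess 0 \<omega> - V 0 \<omega> * total_load" for \<omega>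
    unfolding sum_innovation by (simp add: algebra_simps)
  then have "0 = expectation (\<lambda>\<omega>. V 0 \<omega> * real (work 1 \<omega>) + V 0 \<omega> * total_excess 1 \<omega>
      - V 0 \<omega> * total_excess 0 \<omega> - V 0 \<omega> * total_load)"
    using expectation_known_innovation(2)[OF kn intV] by simp
  also have "\<dots> = expectation (V 0) * (1 - total_load)"
    using iW iT intV 1 2 by (simp add: algebra_simps)
  finally have "expectation (V 0) = 0" using total_load_less_1 by simp
  then have "AE \<omega> in M. V 0 \<omega> = 0"
    using V01 intV by (subst (asm) integral_nonneg_eq_0_iff_AE) auto
  then show ?thesis
    by eventually_elim (auto simp: V_def pos_def indicator_def)
qed

lemma AE_backlog_loynes: "AE \<omega> in M. backlog 0 \<omega> = loynes_work 0 \<omega>"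
  using AE_loynes_hits AE_same_zeros AE_loynes_work AE_backlog
proof eventually_elim
  case (elim \<omega>)
  then obtain q where q: "loynes_work (- int q) \<omega> = 0" by blast
  then have q': "backlog (- int q) \<omega> = loynes_work (- int q) \<omega>" using elim(2) by simp
  have x: "backlog n \<omega> = (backlog (n - 1) \<omega> - 1) + work n \<omega>"
    "loynes_work n \<omega> = (loynes_work (n - 1) \<omega> - 1) + work n \<omega>" for n
    using elim(3,4) by blast+
  have "- int q \<le> 0" by simp
  with x q' show ?case
    by (rule lindley_solutions_agree[of "\<lambda>n. backlog n \<omega>" "\<lambda>n. work n \<omega>" "\<lambda>n. loynes_work n \<omega>" "- int q"])
qed

lemma mean_backlog_loynes: "(\<integral>\<^sup>+\<omega>. of_nat (backlog 0 \<omega>) \<partial>M) = (\<integral>\<^sup>+\<omega>. of_nat (loynes_work 0 \<omega>) \<partial>M)"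
  using AE_backlog_loynes by (intro nn_integral_cong_AE) (auto elim!: eventually_mono)

text \<open>A queue that is empty just after the arrivals of a slot has received no customers in this slot,
  so that every stream is in the idle phase, where its excess vanishes.\<close>

lemma AE_empty_idle: "AE \<omega> in M. loynes_work 0 \<omega> = 0 \<longrightarrow> total_excess 0 \<omega> = 0"
  using AE_loynes_step[of 0] AE_streams AE_service_positive
proof eventually_elim
  case (elim \<omega>)
  show ?case
  proof
    assume "loynes_work 0 \<omega> = 0"
    then have "work 0 \<omega> = 0" using elim(1) by simp
    then have 0: "class_work k 0 \<omega> = 0" for k by (simp add: work_arriving_eq)
    have "A k 0 \<omega> = 0" for k
    proof (rule ccontr)
      assume "A k 0 \<omega> \<noteq> 0"
      then have "h k 0 0 \<omega> = 0" using 0[of k] by (simp add: class_work_def)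
      then show False using elim(3) by (metis less_irrefl)
    qed
    then have "S k 0 \<omega> = 0" for k using elim(2) by blast
    then show "total_excess 0 \<omega> = 0" by (simp add: total_excess_def)
  qed
qed

section \<open>The mean unfinished work\<close>

text \<open>A Lyapunov function: given the past, its mean increment depends only on whether the server is
  busy.\<close>

definition potential :: "int \<Rightarrow> 'a \<Rightarrow> real" where
  "potential n \<omega> = real (loynes_work n \<omega>) + total_excess n \<omega>"

lemma potential_measurable[measurable]: "potential n \<in> borel_measurable M"
  unfolding potential_def[abs_def] by measurable

definition busy :: "'a \<Rightarrow> real" where "busy \<omega> = indicator {\<omega>. 0 < loynes_work 0 \<omega>} \<omega>"

lemma busy_measurable[measurable]: "busy \<in> borel_measurable M"
  unfolding busy_def[abs_def] indicator_def by measurable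

lemma busy_bounds: "0 \<le> busy \<omega>" "busy \<omega> \<le> 1" "\<bar>total_load - busy \<omega>\<bar> \<le> 1"
  using total_load_pos total_load_less_1 by (auto simp: busy_def indicator_def)

lemma busy_integrable: "integrable M busy"
  by (rule integrable_const_bound[where B = 1]) (use busy_bounds in auto)

lemma expectation_busy: "expectation busy = total_load"
proof -
  have "expectation busy = expectation (indicator {\<omega> \<in> space M. 0 < loynes_work 0 \<omega>})"
    by (intro Bochner_Integration.integral_cong) (auto simp: busy_def indicator_def)
  then show ?thesis using busy_probability_loynes[of 0] by simp
qed

lemma AE_potential_step:
  "AE \<omega> in M. potential 1 \<omega> - potential 0 \<omega> = (\<Sum>k\<in>UNIV. innovation k \<omega>) + (total_load - busy \<omega>)"
  using AE_loynes_step[of 1]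
  by eventually_elim (auto simp: potential_def sum_innovation busy_def indicator_def of_nat_diff)

end

text \<open>A convex function that is quadratic below \<open>L\<close> and linear above, and the error of its first
  order Taylor expansion.\<close>

definition cut_square :: "real \<Rightarrow> real \<Rightarrow> real" where
  "cut_square L y = (min y L)\<^sup>2 + 2 * L * (y - min y L)"

definition cut_error :: "real \<Rightarrow> real \<Rightarrow> real \<Rightarrow> real" where
  "cut_error L y z = cut_square L z - cut_square L y - 2 * min y L * (z - y)"

lemma cut_error_bounds: "0 \<le> cut_error L y z" "cut_error L y z \<le> (z - y)\<^sup>2"
proof -
  consider "y \<le> L" "z \<le> L" | "y \<le> L" "L < z" | "L < y" "z \<le> L" | "L < y" "L < z" by linarith
  then have "0 \<le> cut_error L y z \<and> cut_error L y z \<le> (z - y)\<^sup>2"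
  proof cases
    case 1
    then have "cut_error L y z = (z - y)\<^sup>2"
      by (simp add: cut_error_def cut_square_def power2_eq_square algebra_simps)
    then show ?thesis by simp
  next
    case 2
    then have e: "cut_error L y z = (z - y)\<^sup>2 - (z - L)\<^sup>2"
      by (simp add: cut_error_def cut_square_def power2_eq_square algebra_simps)
    have "(z - L)\<^sup>2 \<le> (z - y)\<^sup>2" using 2 by (intro power_mono) auto
    then show ?thesis unfolding e by simp
  next
    case 3
    then have e: "cut_error L y z = (L - z)\<^sup>2"
      by (simp add: cut_error_def cut_square_def power2_eq_square algebra_simps)
    have "(L - z)\<^sup>2 \<le> (y - z)\<^sup>2" using 3 by (intro power_mono) auto
    then show ?thesis unfolding e by (simp add: power2_commute)
  next
    case 4
    then have "cut_error L y z = 0"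
      by (simp add: cut_error_def cut_square_def power2_eq_square algebra_simps)
    then show ?thesis by simp
  qed
  then show "0 \<le> cut_error L y z" "cut_error L y z \<le> (z - y)\<^sup>2" by blast+
qed

lemma cut_error_eq: "y \<le> L \<Longrightarrow> z \<le> L \<Longrightarrow> cut_error L y z = (z - y)\<^sup>2"
  by (simp add: cut_error_def cut_square_def power2_eq_square algebra_simps)

lemma cut_square_Lipschitz:
  assumes "- L \<le> y" "- L \<le> z" "0 \<le> L"
  shows "\<bar>cut_square L z - cut_square L y\<bar> \<le> 2 * L * \<bar>z - y\<bar>"
proof -
  let ?my = "min y L" and ?mz = "min z L"
  have e: "cut_square L z - cut_square L y = (?mz - ?my) * (?mz + ?my) + 2 * L * ((z - ?mz) - (y - ?my))"
    by (simp add: cut_square_def power2_eq_square algebra_simps)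
  have "\<bar>cut_square L z - cut_square L y\<bar>
      \<le> \<bar>(?mz - ?my) * (?mz + ?my)\<bar> + \<bar>2 * L * ((z - ?mz) - (y - ?my))\<bar>"
    unfolding e by (rule abs_triangle_ineq)
  also have "\<dots> \<le> \<bar>?mz - ?my\<bar> * (2 * L) + 2 * L * \<bar>(z - ?mz) - (y - ?my)\<bar>"
    unfolding abs_mult using assms by (intro add_mono mult_left_mono) auto
  also have "\<dots> = 2 * L * (\<bar>?mz - ?my\<bar> + \<bar>(z - ?mz) - (y - ?my)\<bar>)"
    by (simp only: distrib_left mult.commute)
  also have "\<bar>?mz - ?my\<bar> + \<bar>(z - ?mz) - (y - ?my)\<bar> = \<bar>z - y\<bar>" by (auto simp: min_def)
  finally show ?thesis .
qed

context stable_queue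
begin

lemma innovation_integrable: "integrable M (\<lambda>\<omega>. \<Sum>k\<in>UNIV. innovation k \<omega>)"
proof -
  have "integrable M (\<lambda>\<omega>. 1 * (\<Sum>k\<in>UNIV. innovation k \<omega>))"
    by (rule expectation_known_innovation(1)) (auto intro: knownI)
  then show ?thesis by simp
qed

lemma total_excess_known:
  assumes "\<And>k'. S k' 0 \<in> measurable N (count_space UNIV)"
  shows "total_excess 0 \<in> borel_measurable N"
proof -
  note [measurable] = assms
  show ?thesis unfolding total_excess_def[abs_def] by measurable
qed

lemma known_function:
  assumes [measurable]: "f \<in> borel_measurable (borel \<Otimes>\<^sub>M borel)"
  shows "known k (\<lambda>\<omega>. f (real (loynes_work 0 \<omega>), total_excess 0 \<omega>))"
proof (rule knownI)
  fix N assume "\<And>k' i. i \<le> 0 \<Longrightarrow> S k' i \<in> measurable N (count_space UNIV)"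
    "\<And>k' i. i \<le> 0 \<Longrightarrow> A k' i \<in> measurable N (count_space UNIV)"
    "\<And>k' i j. i \<le> 0 \<Longrightarrow> h k' i j \<in> measurable N (count_space UNIV)"
  then have [measurable]: "loynes_work 0 \<in> measurable N (count_space UNIV)" "total_excess 0 \<in> borel_measurable N"
    by (auto intro: loynes_known total_excess_known)
  show "(\<lambda>\<omega>. f (real (loynes_work 0 \<omega>), total_excess 0 \<omega>)) \<in> borel_measurable N" by measurable
qed

text \<open>The truncated square of the potential is stationary, so that its increment has mean zero. The
  first order part of the increment contributes \<open>- 2 * (1 - total_load)\<close> times the mean truncated
  potential, because the potential vanishes whenever the server is idle; the remainder is
  \<open>cut_error\<close>.\<close>

lemma truncated_mean_potential:
  assumes c: "0 \<le> c" "\<And>n \<omega>. \<bar>total_excess n \<omega>\<bar> \<le> c" and L: "c \<le> L"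
  shows "integrable M (\<lambda>\<omega>. min (potential 0 \<omega>) L)"
    and "integrable M (\<lambda>\<omega>. cut_error L (potential 0 \<omega>) (potential 1 \<omega>))"
    and "2 * (1 - total_load) * expectation (\<lambda>\<omega>. min (potential 0 \<omega>) L)
      = expectation (\<lambda>\<omega>. cut_error L (potential 0 \<omega>) (potential 1 \<omega>))"
proof -
  let ?D = "\<lambda>\<omega>. \<Sum>k\<in>UNIV. innovation k \<omega>"
  let ?m = "\<lambda>\<omega>. min (potential 0 \<omega>) L" and ?d = "\<lambda>\<omega>. potential 1 \<omega> - potential 0 \<omega>"
  let ?q = "\<lambda>\<omega>. cut_square L (potential 1 \<omega>) - cut_square L (potential 0 \<omega>)"
  have ge: "- L \<le> potential n \<omega>" for n \<omega>
    using c(2)[of n \<omega>] L by (simp add: potential_def abs_le_iff)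
  have [measurable]: "cut_square L \<in> borel_measurable borel" unfolding cut_square_def[abs_def] by measurable
  have bm: "\<bar>?m \<omega>\<bar> \<le> L" for \<omega> using ge[of 0 \<omega>] c(1) L by auto
  show im: "integrable M ?m"
    by (rule integrable_const_bound[where B = L]) (use bm in auto)
  have AEd: "AE \<omega> in M. ?d \<omega> = ?D \<omega> + (total_load - busy \<omega>)" by (rule AE_potential_step)
  have "integrable M (\<lambda>\<omega>. ?D \<omega> + (total_load - busy \<omega>))"
    using innovation_integrable busy_integrable by simp
  then have id: "integrable M ?d"
    by (rule integrable_cong_AE_imp) (use AEd in \<open>auto elim!: eventually_mono\<close>)
  have iq: "integrable M ?q"
  proof (rule Bochner_Integration.integrable_bound[of M "\<lambda>\<omega>. 2 * L * ?d \<omega>"])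
    show "AE \<omega> in M. norm (?q \<omega>) \<le> norm (2 * L * ?d \<omega>)"
    proof (intro AE_I2)
      fix \<omega>
      show "norm (?q \<omega>) \<le> norm (2 * L * ?d \<omega>)"
        using cut_square_Lipschitz[OF ge[of 0 \<omega>] ge[of 1 \<omega>]] c(1) L by (simp add: abs_mult)
    qed
  qed (use id in auto)
  have q0: "expectation ?q = 0"
  proof (rule expectation_stationary_increment)
    show "distr M borel (\<lambda>\<omega>. cut_square L (potential 1 \<omega>)) = distr M borel (\<lambda>\<omega>. cut_square L (potential 0 \<omega>))"
      by (rule distr_stationary[where d = 1 and e = 0 and \<phi> = "\<lambda>y. cut_square L (real (loynes (path_work y) 0) + (\<Sum>k\<in>UNIV. excess k (y (Phase k, 0))))"])
         (auto simp: potential_def total_excess_def loynes_work_path)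
  qed (use iq in auto)
  have imd: "integrable M (\<lambda>\<omega>. ?d \<omega> * ?m \<omega>)" by (rule integrable_bounded_mult[OF id bm]) auto
  have e: "cut_error L (potential 0 \<omega>) (potential 1 \<omega>) = ?q \<omega> - 2 * (?d \<omega> * ?m \<omega>)" for \<omega>
    by (simp add: cut_error_def)
  show "integrable M (\<lambda>\<omega>. cut_error L (potential 0 \<omega>) (potential 1 \<omega>))"
    unfolding e using iq imd by simp
  have kn: "known k ?m" for k
    using known_function[of "\<lambda>(u, t). min (u + t) L" k] by (simp add: potential_def)
  have D0: "integrable M (\<lambda>\<omega>. ?m \<omega> * ?D \<omega>)" "expectation (\<lambda>\<omega>. ?m \<omega> * ?D \<omega>) = 0"
    using expectation_known_innovation[OF kn im] by auto
  have "AE \<omega> in M. ?d \<omega> * ?m \<omega> = ?m \<omega> * ?D \<omega> - (1 - total_load) * ?m \<omega>"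
    using AEd AE_empty_idle
  proof eventually_elim
    case (elim \<omega>)
    have "?m \<omega> = 0" if "loynes_work 0 \<omega> = 0" using elim(2) that c(1) L by (simp add: potential_def)
    then have "busy \<omega> * ?m \<omega> = ?m \<omega>" by (cases "loynes_work 0 \<omega> = 0") (auto simp: busy_def)
    then show ?case unfolding elim(1) by (simp add: algebra_simps)
  qed
  then have "expectation (\<lambda>\<omega>. ?d \<omega> * ?m \<omega>) = expectation (\<lambda>\<omega>. ?m \<omega> * ?D \<omega> - (1 - total_load) * ?m \<omega>)"
    using D0 im by (intro integral_cong_AE) auto
  also have "\<dots> = - ((1 - total_load) * expectation ?m)" using D0 im by simp
  finally show "2 * (1 - total_load) * expectation ?m
      = expectation (\<lambda>\<omega>. cut_error L (potential 0 \<omega>) (potential 1 \<omega>))"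
    unfolding e using iq imd q0 by simp
qed

abbreviation increment :: "'a \<Rightarrow> real" where "increment \<omega> \<equiv> potential 1 \<omega> - potential 0 \<omega>"

text \<open>As the truncation level grows, dominated convergence applies to the error terms and monotone
  convergence to the truncated potentials.\<close>

lemma mean_potential_finite:
  assumes sq: "integrable M (\<lambda>\<omega>. (increment \<omega>)\<^sup>2)"
  shows "integrable M (potential 0)"
    and "2 * (1 - total_load) * expectation (potential 0) = expectation (\<lambda>\<omega>. (increment \<omega>)\<^sup>2)"
proof -
  obtain c where c: "0 \<le> c" "\<And>n \<omega>. \<bar>total_excess n \<omega>\<bar> \<le> c" using bounded_total_excess by blast
  define f where "f n \<omega> = min (potential 0 \<omega>) (c + real n)" for n \<omega>
  define r where "r n \<omega> = cut_error (c + real n) (potential 0 \<omega>) (potential 1 \<omega>)" for n \<omega>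
  have L: "c \<le> c + real n" for n by simp
  note T = truncated_mean_potential[OF c L]
  have evL: "\<forall>\<^sub>F n in sequentially. x \<le> c + real n" for x :: real
  proof -
    obtain N :: nat where "x - c \<le> real N" using real_arch_simple by blast
    then show ?thesis by (intro eventually_sequentiallyI[of N]) (simp add: algebra_simps)
  qed
  have [measurable]: "r n \<in> borel_measurable M" for n
    unfolding r_def[abs_def] using T(2)[of n] by (rule borel_measurable_integrable)
  have "(\<lambda>n. expectation (r n)) \<longlonglongrightarrow> expectation (\<lambda>\<omega>. (increment \<omega>)\<^sup>2)"
  proof (rule integral_dominated_convergence[where w = "\<lambda>\<omega>. (increment \<omega>)\<^sup>2"])
    show "AE \<omega> in M. (\<lambda>n. r n \<omega>) \<longlonglongrightarrow> (increment \<omega>)\<^sup>2"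
    proof (intro AE_I2 tendsto_eventually)
      fix \<omega>
      show "\<forall>\<^sub>F n in sequentially. r n \<omega> = (increment \<omega>)\<^sup>2"
        using evL[of "potential 0 \<omega>"] evL[of "potential 1 \<omega>"]
        by eventually_elim (simp add: r_def cut_error_eq)
    qed
    show "AE \<omega> in M. norm (r n \<omega>) \<le> (increment \<omega>)\<^sup>2" for n
      using cut_error_bounds by (auto simp: r_def)
  qed (use sq in auto)
  moreover have rf: "expectation (r n) = 2 * (1 - total_load) * expectation (f n)" for n
    unfolding r_def f_def T(3) ..
  ultimately have "(\<lambda>n. 2 * (1 - total_load) * expectation (f n) / (2 * (1 - total_load)))
      \<longlonglongrightarrow> expectation (\<lambda>\<omega>. (increment \<omega>)\<^sup>2) / (2 * (1 - total_load))"
    using total_load_less_1 by (intro tendsto_divide) auto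
  then have lim: "(\<lambda>n. expectation (f n)) \<longlonglongrightarrow> expectation (\<lambda>\<omega>. (increment \<omega>)\<^sup>2) / (2 * (1 - total_load))"
    using total_load_less_1 by simp
  have "has_bochner_integral M (potential 0) (expectation (\<lambda>\<omega>. (increment \<omega>)\<^sup>2) / (2 * (1 - total_load)))"
  proof (rule has_bochner_integral_monotone_convergence[OF _ _ _ lim])
    show "integrable M (f n)" for n unfolding f_def by (rule T(1))
    show "AE \<omega> in M. mono (\<lambda>n. f n \<omega>)" by (auto simp: f_def mono_def)
    show "AE \<omega> in M. (\<lambda>n. f n \<omega>) \<longlonglongrightarrow> potential 0 \<omega>"
    proof (intro AE_I2 tendsto_eventually)
      fix \<omega>
      show "\<forall>\<^sub>F n in sequentially. f n \<omega> = potential 0 \<omega>"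
        using evL[of "potential 0 \<omega>"] by eventually_elim (simp add: f_def)
    qed
  qed auto
  then show "integrable M (potential 0)"
    "2 * (1 - total_load) * expectation (potential 0) = expectation (\<lambda>\<omega>. (increment \<omega>)\<^sup>2)"
    using total_load_less_1 by (auto simp: has_bochner_integral_iff)
qed

text \<open>The converse follows from Fatou's lemma, as the truncated potentials lie below the potential.\<close>

lemma mean_potential_infinite:
  assumes int: "integrable M (potential 0)"
  shows "integrable M (\<lambda>\<omega>. (increment \<omega>)\<^sup>2)"
proof (rule integrableI_bounded)
  obtain c where c: "0 \<le> c" "\<And>n \<omega>. \<bar>total_excess n \<omega>\<bar> \<le> c" using bounded_total_excess by blast
  define r where "r n \<omega> = cut_error (c + real n) (potential 0 \<omega>) (potential 1 \<omega>)" for n \<omega>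
  have L: "c \<le> c + real n" for n by simp
  note T = truncated_mean_potential[OF c L]
  have [measurable]: "r n \<in> borel_measurable M" for n
    unfolding r_def[abs_def] using T(2)[of n] by (rule borel_measurable_integrable)
  let ?K = "2 * (1 - total_load) * expectation (potential 0)"
  have bound: "(\<integral>\<^sup>+\<omega>. ennreal (r n \<omega>) \<partial>M) \<le> ennreal ?K" for n
  proof -
    have e: "(\<integral>\<^sup>+\<omega>. ennreal (r n \<omega>) \<partial>M) = ennreal (expectation (r n))"
      unfolding r_def[abs_def] using T(2) cut_error_bounds(1) by (intro nn_integral_eq_integral) auto
    have "expectation (r n) = 2 * (1 - total_load) * expectation (\<lambda>\<omega>. min (potential 0 \<omega>) (c + real n))"
      unfolding r_def T(3) ..
    also have "\<dots> \<le> ?K"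
    proof (rule mult_left_mono)
      show "expectation (\<lambda>\<omega>. min (potential 0 \<omega>) (c + real n)) \<le> expectation (potential 0)"
        by (rule integral_mono[OF T(1) int]) simp
      show "0 \<le> 2 * (1 - total_load)" using total_load_less_1 by simp
    qed
    finally show ?thesis unfolding e by (rule ennreal_leI)
  qed
  have "(\<integral>\<^sup>+\<omega>. ennreal ((increment \<omega>)\<^sup>2) \<partial>M) \<le> (\<integral>\<^sup>+\<omega>. liminf (\<lambda>n. ennreal (r n \<omega>)) \<partial>M)"
  proof (rule nn_integral_mono)
    fix \<omega>
    obtain N :: nat where N: "max (potential 0 \<omega>) (potential 1 \<omega>) - c \<le> real N" using real_arch_simple by blast
    have "\<forall>\<^sub>F n in sequentially. ennreal (r n \<omega>) = ennreal ((increment \<omega>)\<^sup>2)"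
    proof (rule eventually_sequentiallyI[of N])
      fix n assume "N \<le> n"
      then have "potential 0 \<omega> \<le> c + real n" "potential 1 \<omega> \<le> c + real n" using N by auto
      then show "ennreal (r n \<omega>) = ennreal ((increment \<omega>)\<^sup>2)" by (simp add: r_def cut_error_eq)
    qed
    then have "(\<lambda>n. ennreal (r n \<omega>)) \<longlonglongrightarrow> ennreal ((increment \<omega>)\<^sup>2)" by (rule tendsto_eventually)
    then have "liminf (\<lambda>n. ennreal (r n \<omega>)) = ennreal ((increment \<omega>)\<^sup>2)" by (intro lim_imp_Liminf) auto
    then show "ennreal ((increment \<omega>)\<^sup>2) \<le> liminf (\<lambda>n. ennreal (r n \<omega>))" by simp
  qed
  also have "\<dots> \<le> liminf (\<lambda>n. \<integral>\<^sup>+\<omega>. ennreal (r n \<omega>) \<partial>M)" by (rule nn_integral_liminf) auto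
  also have "\<dots> \<le> liminf (\<lambda>n. ennreal ?K)" using bound by (intro Liminf_mono) auto
  also have "\<dots> = ennreal ?K" by (rule Liminf_const) simp
  finally show "(\<integral>\<^sup>+\<omega>. ennreal (norm ((increment \<omega>)\<^sup>2)) \<partial>M) < \<infinity>"
    by (simp add: le_less_trans)
qed auto

subsection \<open>The second moment of the increments\<close>

lemma class_work_stationary:
  "(\<integral>\<^sup>+\<omega>. f (class_work k n \<omega>) (S k n \<omega>) \<partial>M) = (\<integral>\<^sup>+\<omega>. f (class_work k 0 \<omega>) (S k 0 \<omega>) \<partial>M)" for f :: "nat \<Rightarrow> nat \<Rightarrow> ennreal"
proof (rule nn_integral_stationary[where d = n and e = 0])
  let ?w = "\<lambda>y :: 'k observable \<times> int \<Rightarrow> nat. \<Sum>i<y (Batch k, 0). y (Service k i, 0)"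
  have [measurable]: "?w \<in> measurable path_space (count_space UNIV)"
    by (rule sum_lessThan_measurable) measurable
  have "(\<lambda>y. (\<lambda>u. \<lambda>v. f v (y (Phase k, 0))) y (?w y)) \<in> borel_measurable path_space"
    by (rule measurable_compose_countable[OF measurable_compose[OF measurable_path_space]]) auto
  then show "(\<lambda>y. f (?w y) (y (Phase k, 0))) \<in> borel_measurable path_space" by simp
qed (simp_all add: class_work_def)

lemma class_work_stationary_real:
  fixes f :: "nat \<Rightarrow> nat \<Rightarrow> real"
  shows "expectation (\<lambda>\<omega>. f (class_work k n \<omega>) (S k n \<omega>)) = expectation (\<lambda>\<omega>. f (class_work k 0 \<omega>) (S k 0 \<omega>))"
    and "integrable M (\<lambda>\<omega>. f (class_work k n \<omega>) (S k n \<omega>)) \<longleftrightarrow> integrable M (\<lambda>\<omega>. f (class_work k 0 \<omega>) (S k 0 \<omega>))"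
proof -
  let ?w = "\<lambda>y :: 'k observable \<times> int \<Rightarrow> nat. \<Sum>i<y (Batch k, 0). y (Service k i, 0)"
  have [measurable]: "?w \<in> measurable path_space (count_space UNIV)"
    by (rule sum_lessThan_measurable) measurable
  have m: "(\<lambda>y. f (?w y) (y (Phase k, 0))) \<in> borel_measurable path_space"
    by (rule measurable_compose_countable[where f = "\<lambda>v y. f v (y (Phase k, 0))", OF measurable_compose[OF measurable_path_space]]) auto
  show "expectation (\<lambda>\<omega>. f (class_work k n \<omega>) (S k n \<omega>)) = expectation (\<lambda>\<omega>. f (class_work k 0 \<omega>) (S k 0 \<omega>))"
    by (rule expectation_stationary[OF m, where d = n and e = 0]) (simp_all add: class_work_def)
  have mm: "(\<lambda>\<omega>. f (class_work k n \<omega>) (S k n \<omega>)) \<in> borel_measurable M" for n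
    by (rule measurable_compose_countable[where f = "\<lambda>v y. f v (S k n y)", OF measurable_compose[OF S_measurable]]) auto
  show "integrable M (\<lambda>\<omega>. f (class_work k n \<omega>) (S k n \<omega>)) \<longleftrightarrow> integrable M (\<lambda>\<omega>. f (class_work k 0 \<omega>) (S k 0 \<omega>))"
    using class_work_stationary[of "\<lambda>v s. ennreal (norm (f v s))" k n] mm
    by (simp add: integrable_iff_bounded)
qed

abbreviation work_square :: "'k \<Rightarrow> ennreal" where
  "work_square k \<equiv> \<integral>\<^sup>+\<omega>. of_nat ((class_work k 0 \<omega>)\<^sup>2) \<partial>M"

lemma work_square_integrable_iff:
  "integrable M (\<lambda>\<omega>. (real (class_work k n \<omega>))\<^sup>2) \<longleftrightarrow> work_square k < top"
proof -
  have "integrable M (\<lambda>\<omega>. (real (class_work k n \<omega>))\<^sup>2) \<longleftrightarrow> integrable M (\<lambda>\<omega>. (real (class_work k 0 \<omega>))\<^sup>2)"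
    using class_work_stationary_real(2)[of "\<lambda>v s. (real v)\<^sup>2" k n] .
  also have "\<dots> \<longleftrightarrow> work_square k < top"
    by (simp add: integrable_iff_bounded ennreal_of_nat_eq_real_of_nat flip: of_nat_power)
  finally show ?thesis .
qed

lemma integrable_square_sum:
  fixes f g :: "'a \<Rightarrow> real"
  assumes "integrable M (\<lambda>\<omega>. (f \<omega>)\<^sup>2)" "integrable M (\<lambda>\<omega>. (g \<omega>)\<^sup>2)"
    and [measurable]: "f \<in> borel_measurable M" "g \<in> borel_measurable M"
  shows "integrable M (\<lambda>\<omega>. (f \<omega> + g \<omega>)\<^sup>2)" "integrable M (\<lambda>\<omega>. f \<omega> * g \<omega>)"
proof -
  have i: "integrable M (\<lambda>\<omega>. 2 * ((f \<omega>)\<^sup>2 + (g \<omega>)\<^sup>2))" using assms by simp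
  have b: "\<bar>(x + y)\<^sup>2\<bar> \<le> \<bar>2 * (x\<^sup>2 + y\<^sup>2)\<bar>" "\<bar>x * y\<bar> \<le> \<bar>2 * (x\<^sup>2 + y\<^sup>2)\<bar>" for x y :: real
  proof -
    have 1: "0 \<le> (x - y)\<^sup>2" "0 \<le> (x + y)\<^sup>2" by simp_all
    then show "\<bar>(x + y)\<^sup>2\<bar> \<le> \<bar>2 * (x\<^sup>2 + y\<^sup>2)\<bar>" by (simp add: power2_eq_square algebra_simps)
    have "0 \<le> x\<^sup>2" "0 \<le> y\<^sup>2" by simp_all
    moreover have "2 * (x * y) \<le> x\<^sup>2 + y\<^sup>2" "- (2 * (x * y)) \<le> x\<^sup>2 + y\<^sup>2"
      using 1 by (simp_all add: power2_diff power2_sum mult.assoc)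
    ultimately have "\<bar>x * y\<bar> \<le> x\<^sup>2 + y\<^sup>2 \<and> x\<^sup>2 + y\<^sup>2 \<le> \<bar>2 * (x\<^sup>2 + y\<^sup>2)\<bar>"
      by (simp add: abs_le_iff)
    then show "\<bar>x * y\<bar> \<le> \<bar>2 * (x\<^sup>2 + y\<^sup>2)\<bar>" by linarith
  qed
  show "integrable M (\<lambda>\<omega>. (f \<omega> + g \<omega>)\<^sup>2)"
    by (rule Bochner_Integration.integrable_bound[OF i]) (use b(1) in auto)
  show "integrable M (\<lambda>\<omega>. f \<omega> * g \<omega>)"
    by (rule Bochner_Integration.integrable_bound[OF i]) (use b(2) in auto)
qed

lemma integrable_square_bounded:
  fixes f :: "'a \<Rightarrow> real"
  assumes [measurable]: "f \<in> borel_measurable M" and "\<And>\<omega>. \<bar>f \<omega>\<bar> \<le> c"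
  shows "integrable M (\<lambda>\<omega>. (f \<omega>)\<^sup>2)"
proof (rule integrable_const_bound[where B = "c\<^sup>2"])
  show "AE \<omega> in M. norm ((f \<omega>)\<^sup>2) \<le> c\<^sup>2"
  proof (intro AE_I2)
    fix \<omega>
    have "\<bar>f \<omega>\<bar> \<le> \<bar>c\<bar>" using assms(2)[of \<omega>] by linarith
    then show "norm ((f \<omega>)\<^sup>2) \<le> c\<^sup>2" by (simp add: abs_le_square_iff)
  qed
qed simp

text \<open>Up to bounded terms, the increment of the potential dominates the work of each class.\<close>

lemma work_square_infinite:
  assumes inf: "work_square k = top"
  shows "(\<integral>\<^sup>+\<omega>. of_nat (loynes_work 0 \<omega>) \<partial>M) = top"
proof (rule ccontr)
  assume "(\<integral>\<^sup>+\<omega>. of_nat (loynes_work 0 \<omega>) \<partial>M) \<noteq> top"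
  then have "integrable M (\<lambda>\<omega>. real (loynes_work 0 \<omega>))"
    by (simp add: integrable_iff_bounded ennreal_of_nat_eq_real_of_nat top.not_eq_extremum)
  moreover obtain c where c: "0 \<le> c" "\<And>n \<omega>. \<bar>total_excess n \<omega>\<bar> \<le> c" using bounded_total_excess by blast
  then have "integrable M (total_excess 0)" by (intro integrable_const_bound[where B = c]) auto
  ultimately have "integrable M (potential 0)" unfolding potential_def[abs_def] by simp
  then have sq: "integrable M (\<lambda>\<omega>. (increment \<omega>)\<^sup>2)" by (rule mean_potential_infinite)
  have "integrable M (\<lambda>\<omega>. (real (class_work k 1 \<omega>))\<^sup>2)"
  proof (rule Bochner_Integration.integrable_bound[of M "\<lambda>\<omega>. 2 * (increment \<omega>)\<^sup>2 + 2 * (2 * c + 1)\<^sup>2"])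
    show "AE \<omega> in M. norm ((real (class_work k 1 \<omega>))\<^sup>2) \<le> norm (2 * (increment \<omega>)\<^sup>2 + 2 * (2 * c + 1)\<^sup>2)"
      using AE_potential_step
    proof eventually_elim
      case (elim \<omega>)
      have "class_work k 1 \<omega> \<le> work 1 \<omega>" unfolding work_arriving_eq by (intro member_le_sum) auto
      then have "real (class_work k 1 \<omega>) \<le> increment \<omega> + (2 * c + 1)"
        using elim c(2)[of 1 \<omega>] c(2)[of 0 \<omega>] busy_bounds[of \<omega>] total_load_pos unfolding sum_innovation abs_le_iff by linarith
      also have "\<dots> \<le> \<bar>increment \<omega>\<bar> + (2 * c + 1)" by simp
      finally have "(real (class_work k 1 \<omega>))\<^sup>2 \<le> (\<bar>increment \<omega>\<bar> + (2 * c + 1))\<^sup>2" by (intro power_mono) auto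
      also have "\<dots> \<le> 2 * (increment \<omega>)\<^sup>2 + 2 * (2 * c + 1)\<^sup>2"
      proof -
        have "(x + y)\<^sup>2 \<le> 2 * x\<^sup>2 + 2 * y\<^sup>2" for x y :: real
          using zero_le_power2[of "x - y"] unfolding power2_diff power2_sum by linarith
        from this[of "\<bar>increment \<omega>\<bar>" "2 * c + 1"] show ?thesis by simp
      qed
      finally show ?case by simp
    qed
  qed (use sq in auto)
  then show False using inf work_square_integrable_iff[of k 1] by simp
qed

lemma innovation_square_integrable:
  assumes "work_square k < top"
  shows "integrable M (\<lambda>\<omega>. (innovation k \<omega>)\<^sup>2)"
proof -
  obtain c where c: "\<And>x. \<bar>excess k x\<bar> \<le> c" using bounded_excess by blast
  have "integrable M (\<lambda>\<omega>. (real (class_work k 1 \<omega>) + (excess k (S k 1 \<omega>) - excess k (S k 0 \<omega>) - class_load k))\<^sup>2)"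
  proof (rule integrable_square_sum(1))
    show "integrable M (\<lambda>\<omega>. (real (class_work k 1 \<omega>))\<^sup>2)" using assms work_square_integrable_iff by blast
    show "integrable M (\<lambda>\<omega>. (excess k (S k 1 \<omega>) - excess k (S k 0 \<omega>) - class_load k)\<^sup>2)"
    proof (rule integrable_square_bounded)
      show "\<bar>excess k (S k 1 \<omega>) - excess k (S k 0 \<omega>) - class_load k\<bar> \<le> 2 * c + class_load k" for \<omega>
        using c[of "S k 1 \<omega>"] c[of "S k 0 \<omega>"] class_load_pos[of k] by linarith
    qed simp
  qed auto
  then show ?thesis by (simp add: innovation_def add_diff_eq)
qed

lemma innovation_measurable_known:
  assumes "k' \<noteq> k" shows "known k (innovation k')"
proof (rule knownI)
  fix N assume "\<And>k' i. k' \<noteq> k \<Longrightarrow> S k' i \<in> measurable N (count_space UNIV)"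
    "\<And>k' i. k' \<noteq> k \<Longrightarrow> A k' i \<in> measurable N (count_space UNIV)"
    "\<And>k' i j. k' \<noteq> k \<Longrightarrow> h k' i j \<in> measurable N (count_space UNIV)"
  then have [measurable]: "S k' i \<in> measurable N (count_space UNIV)" "class_work k' i \<in> measurable N (count_space UNIV)" for i
    using assms by (auto intro: class_work_measurable_gen)
  show "innovation k' \<in> borel_measurable N" unfolding innovation_def[abs_def] by measurable
qed

text \<open>Innovations of different streams are uncorrelated with each other and with the state of the
  server.\<close>

lemma increment_second_moment:
  assumes sq: "\<And>k. work_square k < top"
  shows "integrable M (\<lambda>\<omega>. (increment \<omega>)\<^sup>2)"
    and "expectation (\<lambda>\<omega>. (increment \<omega>)\<^sup>2)
      = total_load * (1 - total_load) + (\<Sum>k\<in>UNIV. expectation (\<lambda>\<omega>. (innovation k \<omega>)\<^sup>2))"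
proof -
  let ?D = "\<lambda>\<omega>. \<Sum>k\<in>UNIV. innovation k \<omega>"
  let ?b = "\<lambda>\<omega>. total_load - busy \<omega>"
  note sqi = innovation_square_integrable[OF sq]
  have iprod: "integrable M (\<lambda>\<omega>. innovation k \<omega> * innovation k' \<omega>)" for k k'
    by (rule integrable_square_sum(2)[OF sqi sqi]) auto
  have i1: "integrable M (innovation k)" for k
  proof -
    have "known k (\<lambda>_. 1)" by (rule knownI) simp
    then have "integrable M (\<lambda>\<omega>. 1 * innovation k \<omega>)" by (rule innovation_mult_integrable) simp
    then show ?thesis by simp
  qed
  \<comment> \<open>the innovation of one stream is known to every other stream\<close>
  have cross: "expectation (\<lambda>\<omega>. innovation k \<omega> * innovation k' \<omega>) = 0" if "k \<noteq> k'" for k k'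
    using innovation_mult_expectation[OF innovation_measurable_known[OF that] i1] .
  have Dsq: "(?D \<omega>)\<^sup>2 = (\<Sum>k\<in>UNIV. \<Sum>k'\<in>UNIV. innovation k \<omega> * innovation k' \<omega>)" for \<omega>
    by (simp add: power2_eq_square sum_product)
  have iD: "integrable M (\<lambda>\<omega>. (?D \<omega>)\<^sup>2)" unfolding Dsq using iprod by simp
  have eD: "expectation (\<lambda>\<omega>. (?D \<omega>)\<^sup>2) = (\<Sum>k\<in>UNIV. expectation (\<lambda>\<omega>. (innovation k \<omega>)\<^sup>2))"
  proof -
    have "expectation (\<lambda>\<omega>. (?D \<omega>)\<^sup>2) = (\<Sum>k\<in>UNIV. \<Sum>k'\<in>UNIV. expectation (\<lambda>\<omega>. innovation k \<omega> * innovation k' \<omega>))"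
      unfolding Dsq using iprod by (simp add: Bochner_Integration.integral_sum)
    also have "\<dots> = (\<Sum>k\<in>UNIV. expectation (\<lambda>\<omega>. (innovation k \<omega>)\<^sup>2))"
    proof (rule sum.cong)
      fix k
      have "(\<Sum>k'\<in>UNIV. expectation (\<lambda>\<omega>. innovation k \<omega> * innovation k' \<omega>))
          = expectation (\<lambda>\<omega>. innovation k \<omega> * innovation k \<omega>)
            + (\<Sum>k'\<in>UNIV - {k}. expectation (\<lambda>\<omega>. innovation k \<omega> * innovation k' \<omega>))"
        by (rule sum.remove) auto
      also have "(\<Sum>k'\<in>UNIV - {k}. expectation (\<lambda>\<omega>. innovation k \<omega> * innovation k' \<omega>)) = 0"
        by (rule sum.neutral) (auto intro!: cross)
      finally show "(\<Sum>k'\<in>UNIV. expectation (\<lambda>\<omega>. innovation k \<omega> * innovation k' \<omega>)) = expectation (\<lambda>\<omega>. (innovation k \<omega>)\<^sup>2)"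
        by (simp add: power2_eq_square)
    qed simp
    finally show ?thesis .
  qed
  have kb: "known k ?b" for k
  proof -
    have "?b = (\<lambda>\<omega>. (\<lambda>(u, t). total_load - (if 0 < u then 1 else 0)) (real (loynes_work 0 \<omega>), total_excess 0 \<omega>))"
      by (auto simp: busy_def indicator_def)
    then show ?thesis using known_function[of "\<lambda>(u, t). total_load - (if 0 < u then 1 else 0)" k] by simp
  qed
  have ib: "integrable M ?b" using busy_integrable by simp
  have b0: "integrable M (\<lambda>\<omega>. ?b \<omega> * ?D \<omega>)" "expectation (\<lambda>\<omega>. ?b \<omega> * ?D \<omega>) = 0"
    using expectation_known_innovation[OF kb ib] by auto
  have bb: "(?b \<omega>)\<^sup>2 = total_load\<^sup>2 - 2 * total_load * busy \<omega> + busy \<omega>" for \<omega>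
    by (auto simp: busy_def indicator_def power2_eq_square algebra_simps)
  have ibb: "integrable M (\<lambda>\<omega>. (?b \<omega>)\<^sup>2)" unfolding bb using busy_integrable by simp
  have ebb: "expectation (\<lambda>\<omega>. (?b \<omega>)\<^sup>2) = total_load * (1 - total_load)"
    unfolding bb using busy_integrable prob_space by (simp add: expectation_busy power2_eq_square algebra_simps)
  have e: "AE \<omega> in M. (?D \<omega>)\<^sup>2 + 2 * (?b \<omega> * ?D \<omega>) + (?b \<omega>)\<^sup>2 = (increment \<omega>)\<^sup>2"
    using AE_potential_step
  proof eventually_elim
    case (elim \<omega>)
    show ?case unfolding elim by (simp add: power2_eq_square algebra_simps)
  qed
  have isum: "integrable M (\<lambda>\<omega>. (?D \<omega>)\<^sup>2 + 2 * (?b \<omega> * ?D \<omega>) + (?b \<omega>)\<^sup>2)" using iD b0(1) ibb by simp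
  show "integrable M (\<lambda>\<omega>. (increment \<omega>)\<^sup>2)"
    by (rule integrable_cong_AE_imp[OF isum _ e]) measurable
  have "expectation (\<lambda>\<omega>. (increment \<omega>)\<^sup>2) = expectation (\<lambda>\<omega>. (?D \<omega>)\<^sup>2 + 2 * (?b \<omega> * ?D \<omega>) + (?b \<omega>)\<^sup>2)"
    using e by (intro integral_cong_AE) (auto elim!: eventually_mono)
  also have "\<dots> = expectation (\<lambda>\<omega>. (?D \<omega>)\<^sup>2) + 2 * expectation (\<lambda>\<omega>. ?b \<omega> * ?D \<omega>) + expectation (\<lambda>\<omega>. (?b \<omega>)\<^sup>2)"
    using iD b0(1) ibb by simp
  finally show "expectation (\<lambda>\<omega>. (increment \<omega>)\<^sup>2)
      = total_load * (1 - total_load) + (\<Sum>k\<in>UNIV. expectation (\<lambda>\<omega>. (innovation k \<omega>)\<^sup>2))"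
    unfolding eD b0(2) ebb by simp
qed

definition act :: "'k \<Rightarrow> 'a \<Rightarrow> real" where "act k \<omega> = (if S k 0 \<omega> = 0 then 0 else 1)"

text \<open>Means of the recurrence time of the idle phase and of the arrivals in it, seen from slot \<open>0\<close>. Through
  the Palm identities they give the second and mixed moments of active periods.\<close>

definition active_time :: "'k \<Rightarrow> real" where
  "active_time k = expectation (\<lambda>\<omega>. act k \<omega> * \<psi> k (S k 0 \<omega>))"
definition active_arrivals :: "'k \<Rightarrow> real" where
  "active_arrivals k = expectation (\<lambda>\<omega>. act k \<omega> * \<phi> k (S k 0 \<omega>))"
definition batch_time :: "'k \<Rightarrow> real" where
  "batch_time k = expectation (\<lambda>\<omega>. real (A k 0 \<omega>) * \<psi> k (S k 0 \<omega>))"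
definition batch_arrivals :: "'k \<Rightarrow> real" where
  "batch_arrivals k = expectation (\<lambda>\<omega>. real (A k 0 \<omega>) * \<phi> k (S k 0 \<omega>))"

lemma batch_integrable: "integrable M (\<lambda>\<omega>. real (A k 0 \<omega>))"
  using mean_batch_finite[of k]
  by (simp add: integrable_iff_bounded ennreal_of_nat_eq_real_of_nat)

lemma phase_function_integrable:
  "integrable M (\<lambda>\<omega>. act k \<omega> * \<psi> k (S k 0 \<omega>))" "integrable M (\<lambda>\<omega>. act k \<omega> * \<phi> k (S k 0 \<omega>))"
  "integrable M (\<lambda>\<omega>. real (A k 0 \<omega>) * \<psi> k (S k 0 \<omega>))" "integrable M (\<lambda>\<omega>. real (A k 0 \<omega>) * \<phi> k (S k 0 \<omega>))"
proof -
  obtain c where c: "\<And>x. \<psi> k x \<le> c" "\<And>x. \<phi> k x \<le> c" using bounded_\<psi>_\<phi> by blast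
  have b: "\<bar>\<psi> k x\<bar> \<le> c" "\<bar>\<phi> k x\<bar> \<le> c" for x
    using c \<psi>_nonneg \<phi>_nonneg by simp_all
  have "act k \<in> borel_measurable M" unfolding act_def[abs_def] by measurable
  then have ia: "integrable M (act k)"
    by (intro integrable_const_bound[where B = 1]) (auto simp: act_def)
  show "integrable M (\<lambda>\<omega>. act k \<omega> * \<psi> k (S k 0 \<omega>))"
    by (rule integrable_bounded_mult[OF ia b(1)]) simp
  show "integrable M (\<lambda>\<omega>. act k \<omega> * \<phi> k (S k 0 \<omega>))"
    by (rule integrable_bounded_mult[OF ia b(2)]) simp
  show "integrable M (\<lambda>\<omega>. real (A k 0 \<omega>) * \<psi> k (S k 0 \<omega>))"
    by (rule integrable_bounded_mult[OF batch_integrable b(1)]) simp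
  show "integrable M (\<lambda>\<omega>. real (A k 0 \<omega>) * \<phi> k (S k 0 \<omega>))"
    by (rule integrable_bounded_mult[OF batch_integrable b(2)]) simp
qed

lemma
  shows nn_active_time: "(\<integral>\<^sup>+\<omega>. active k 0 \<omega> * expected_time k (S k 0 \<omega>) \<partial>M) = ennreal (active_time k)"
    and nn_active_arrivals: "(\<integral>\<^sup>+\<omega>. active k 0 \<omega> * expected_arrivals k (S k 0 \<omega>) \<partial>M) = ennreal (active_arrivals k)"
    and nn_batch_time: "(\<integral>\<^sup>+\<omega>. of_nat (A k 0 \<omega>) * expected_time k (S k 0 \<omega>) \<partial>M) = ennreal (batch_time k)"
    and nn_batch_arrivals: "(\<integral>\<^sup>+\<omega>. of_nat (A k 0 \<omega>) * expected_arrivals k (S k 0 \<omega>) \<partial>M) = ennreal (batch_arrivals k)"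
proof -
  have nn: "(\<integral>\<^sup>+\<omega>. f \<omega> \<partial>M) = ennreal (expectation g)"
    if "integrable M g" "\<And>\<omega>. 0 \<le> g \<omega>" "\<And>\<omega>. S k 0 \<omega> \<le> m k \<Longrightarrow> f \<omega> = ennreal (g \<omega>)" for f g
  proof -
    have "(\<integral>\<^sup>+\<omega>. f \<omega> \<partial>M) = (\<integral>\<^sup>+\<omega>. ennreal (g \<omega>) \<partial>M)"
      using AE_streams that(3) by (intro nn_integral_cong_AE) (auto elim!: eventually_mono)
    also have "\<dots> = ennreal (expectation g)" using that by (intro nn_integral_eq_integral) auto
    finally show ?thesis .
  qed
  note facts = expected_time_\<psi> expected_arrivals_\<phi> \<psi>_nonneg \<phi>_nonneg act_def ennreal_mult' ennreal_of_nat_eq_real_of_nat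
  show "(\<integral>\<^sup>+\<omega>. active k 0 \<omega> * expected_time k (S k 0 \<omega>) \<partial>M) = ennreal (active_time k)"
    unfolding active_time_def by (rule nn[OF phase_function_integrable(1)]) (auto simp: facts)
  show "(\<integral>\<^sup>+\<omega>. active k 0 \<omega> * expected_arrivals k (S k 0 \<omega>) \<partial>M) = ennreal (active_arrivals k)"
    unfolding active_arrivals_def by (rule nn[OF phase_function_integrable(2)]) (auto simp: facts)
  show "(\<integral>\<^sup>+\<omega>. of_nat (A k 0 \<omega>) * expected_time k (S k 0 \<omega>) \<partial>M) = ennreal (batch_time k)"
    unfolding batch_time_def by (rule nn[OF phase_function_integrable(3)]) (auto simp: facts)
  show "(\<integral>\<^sup>+\<omega>. of_nat (A k 0 \<omega>) * expected_arrivals k (S k 0 \<omega>) \<partial>M) = ennreal (batch_arrivals k)"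
    unfolding batch_arrivals_def by (rule nn[OF phase_function_integrable(4)]) (auto simp: facts)
qed

lemma phase_means_nonneg: "0 \<le> active_time k" "0 \<le> active_arrivals k" "0 \<le> batch_time k" "0 \<le> batch_arrivals k"
  unfolding active_time_def active_arrivals_def batch_time_def batch_arrivals_def
  by (auto intro!: Bochner_Integration.integral_nonneg mult_nonneg_nonneg \<psi>_nonneg \<phi>_nonneg simp: act_def)

lemma expectation_work_phase:
  assumes int: "integrable M (\<lambda>\<omega>. real (A k 0 \<omega>) * f (S k 0 \<omega>))" and nonneg: "\<And>x. 0 \<le> f x"
  shows "integrable M (\<lambda>\<omega>. real (class_work k 0 \<omega>) * f (S k 0 \<omega>))"
    and "expectation (\<lambda>\<omega>. real (class_work k 0 \<omega>) * f (S k 0 \<omega>))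
      = service_mean k * expectation (\<lambda>\<omega>. real (A k 0 \<omega>) * f (S k 0 \<omega>))"
proof -
  let ?E = "expectation (\<lambda>\<omega>. real (A k 0 \<omega>) * f (S k 0 \<omega>))"
  have V: "(\<lambda>\<omega>. ennreal (f (S k 0 \<omega>))) \<in> borel_measurable (others (k, 0, i))" for i
    by (rule measurable_compose[OF others_S]) simp
  have s: "0 \<le> service_mean k" using service_mean_ge_1[of k] by simp
  have p: "0 \<le> ?E" using nonneg by (intro Bochner_Integration.integral_nonneg) auto
  have "(\<integral>\<^sup>+\<omega>. ennreal (real (class_work k 0 \<omega>) * f (S k 0 \<omega>)) \<partial>M)
      = (\<integral>\<^sup>+\<omega>. ennreal (f (S k 0 \<omega>)) * of_nat (class_work k 0 \<omega>) \<partial>M)"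
    using nonneg by (intro nn_integral_cong) (simp add: ennreal_mult ennreal_of_nat_eq_real_of_nat mult.commute)
  also have "\<dots> = mean_service k * (\<integral>\<^sup>+\<omega>. ennreal (f (S k 0 \<omega>)) * of_nat (A k 0 \<omega>) \<partial>M)"
    by (rule mean_class_work[OF V])
  also have "(\<integral>\<^sup>+\<omega>. ennreal (f (S k 0 \<omega>)) * of_nat (A k 0 \<omega>) \<partial>M) = (\<integral>\<^sup>+\<omega>. ennreal (real (A k 0 \<omega>) * f (S k 0 \<omega>)) \<partial>M)"
    using nonneg by (intro nn_integral_cong) (simp add: ennreal_mult ennreal_of_nat_eq_real_of_nat mult.commute)
  also have "\<dots> = ennreal ?E" using int nonneg by (intro nn_integral_eq_integral) auto
  also have "mean_service k * ennreal ?E = ennreal (service_mean k * ?E)"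
    unfolding mean_service_eq using s p by (simp add: ennreal_mult)
  finally have "(\<integral>\<^sup>+\<omega>. ennreal (real (class_work k 0 \<omega>) * f (S k 0 \<omega>)) \<partial>M) = ennreal (service_mean k * ?E)" .
  then have "integrable M (\<lambda>\<omega>. real (class_work k 0 \<omega>) * f (S k 0 \<omega>))
    \<and> expectation (\<lambda>\<omega>. real (class_work k 0 \<omega>) * f (S k 0 \<omega>)) = service_mean k * ?E"
    using nonneg s p by (intro nn_integral_eq_integrable[THEN iffD1]) auto
  then show "integrable M (\<lambda>\<omega>. real (class_work k 0 \<omega>) * f (S k 0 \<omega>))"
    "expectation (\<lambda>\<omega>. real (class_work k 0 \<omega>) * f (S k 0 \<omega>)) = service_mean k * ?E" by auto
qed

lemma expectation_excess:
  "integrable M (\<lambda>\<omega>. excess k (S k 0 \<omega>))"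
  "expectation (\<lambda>\<omega>. excess k (S k 0 \<omega>)) = service_mean k * active_arrivals k - class_load k * active_time k"
proof -
  have e: "excess k (S k 0 \<omega>) = service_mean k * (act k \<omega> * \<phi> k (S k 0 \<omega>)) - class_load k * (act k \<omega> * \<psi> k (S k 0 \<omega>))" for \<omega>
    by (cases "S k 0 \<omega> = 0") (simp_all add: act_def, simp add: excess_def)
  show "integrable M (\<lambda>\<omega>. excess k (S k 0 \<omega>))"
    "expectation (\<lambda>\<omega>. excess k (S k 0 \<omega>)) = service_mean k * active_arrivals k - class_load k * active_time k"
    unfolding e active_arrivals_def active_time_def using phase_function_integrable by simp_all
qed

text \<open>The innovation is work plus excess minus its conditional mean, hence its second moment is the
  difference of the second moments of these two. By stationarity both are taken in slot \<open>0\<close>, where the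
  squares of the excess cancel.\<close>

lemma innovation_second_moment:
  assumes sq: "work_square k < top"
  shows "expectation (\<lambda>\<omega>. (innovation k \<omega>)\<^sup>2)
    = enn2real (work_square k) + 2 * service_mean k * (service_mean k * batch_arrivals k - class_load k * batch_time k)
      - 2 * class_load k * (service_mean k * active_arrivals k - class_load k * active_time k) - (class_load k)\<^sup>2"
proof -
  let ?B = "\<lambda>n \<omega>. real (class_work k n \<omega>)" and ?g = "\<lambda>n \<omega>. excess k (S k n \<omega>)"
  let ?v = "\<lambda>\<omega>. ?g 0 \<omega> + class_load k"
  obtain c where c: "\<And>x. \<bar>excess k x\<bar> \<le> c" using bounded_excess by blast
  have iB: "integrable M (\<lambda>\<omega>. (?B n \<omega>)\<^sup>2)" for n using sq work_square_integrable_iff by blast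
  have ig: "integrable M (\<lambda>\<omega>. (?g n \<omega>)\<^sup>2)" for n
    by (rule integrable_square_bounded[where c = c]) (use c in auto)
  have iv: "integrable M (\<lambda>\<omega>. (?v \<omega>)\<^sup>2)"
  proof (rule integrable_square_bounded[where c = "c + class_load k"])
    show "\<bar>?v \<omega>\<bar> \<le> c + class_load k" for \<omega> using c[of "S k 0 \<omega>"] class_load_pos[of k] by linarith
  qed simp
  have iBg: "integrable M (\<lambda>\<omega>. (?B n \<omega> + ?g n \<omega>)\<^sup>2)" "integrable M (\<lambda>\<omega>. ?B n \<omega> * ?g n \<omega>)" for n
    by (rule integrable_square_sum[OF iB ig]; simp)+
  have iBgv: "integrable M (\<lambda>\<omega>. (?B 1 \<omega> + ?g 1 \<omega>) * ?v \<omega>)"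
    by (rule integrable_square_sum(2)[OF iBg(1) iv]) auto
  have inn: "innovation k \<omega> = (?B 1 \<omega> + ?g 1 \<omega>) - ?v \<omega>" for \<omega> by (simp add: innovation_def)
  have iv1: "integrable M ?v" using expectation_excess(1)[of k] by simp
  have "known k ?v"
  proof (rule knownI)
    fix N assume "\<And>k' i. i \<le> 0 \<Longrightarrow> S k' i \<in> measurable N (count_space UNIV)"
    then have [measurable]: "S k 0 \<in> measurable N (count_space UNIV)" by simp
    show "?v \<in> borel_measurable N" by measurable
  qed
  then have "expectation (\<lambda>\<omega>. ?v \<omega> * innovation k \<omega>) = 0" using iv1 by (rule innovation_mult_expectation)
  also have "(\<lambda>\<omega>. ?v \<omega> * innovation k \<omega>) = (\<lambda>\<omega>. (?B 1 \<omega> + ?g 1 \<omega>) * ?v \<omega> - (?v \<omega>)\<^sup>2)"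
    unfolding inn by (simp add: fun_eq_iff power2_eq_square algebra_simps)
  finally have cr: "expectation (\<lambda>\<omega>. (?B 1 \<omega> + ?g 1 \<omega>) * ?v \<omega>) = expectation (\<lambda>\<omega>. (?v \<omega>)\<^sup>2)"
    using iBgv iv by simp
  have "(\<lambda>\<omega>. (innovation k \<omega>)\<^sup>2) = (\<lambda>\<omega>. (?B 1 \<omega> + ?g 1 \<omega>)\<^sup>2 - 2 * ((?B 1 \<omega> + ?g 1 \<omega>) * ?v \<omega>) + (?v \<omega>)\<^sup>2)"
    unfolding inn by (simp add: fun_eq_iff power2_eq_square algebra_simps)
  then have "expectation (\<lambda>\<omega>. (innovation k \<omega>)\<^sup>2)
      = expectation (\<lambda>\<omega>. (?B 1 \<omega> + ?g 1 \<omega>)\<^sup>2) - expectation (\<lambda>\<omega>. (?v \<omega>)\<^sup>2)"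
    using iBg(1) iBgv iv cr by simp
  also have "expectation (\<lambda>\<omega>. (?B 1 \<omega> + ?g 1 \<omega>)\<^sup>2) = expectation (\<lambda>\<omega>. (?B 0 \<omega> + ?g 0 \<omega>)\<^sup>2)"
    by (rule class_work_stationary_real(1)[of "\<lambda>v s. (real v + excess k s)\<^sup>2"])
  also have "(\<lambda>\<omega>. (?B 0 \<omega> + ?g 0 \<omega>)\<^sup>2) = (\<lambda>\<omega>. (?B 0 \<omega>)\<^sup>2 + 2 * (?B 0 \<omega> * ?g 0 \<omega>) + (?g 0 \<omega>)\<^sup>2)"
    by (simp add: fun_eq_iff power2_eq_square algebra_simps)
  also have "expectation (\<lambda>\<omega>. (?B 0 \<omega>)\<^sup>2 + 2 * (?B 0 \<omega> * ?g 0 \<omega>) + (?g 0 \<omega>)\<^sup>2)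
      = expectation (\<lambda>\<omega>. (?B 0 \<omega>)\<^sup>2) + 2 * expectation (\<lambda>\<omega>. ?B 0 \<omega> * ?g 0 \<omega>) + expectation (\<lambda>\<omega>. (?g 0 \<omega>)\<^sup>2)"
    using iB iBg(2) ig by simp
  also have "(\<lambda>\<omega>. (?v \<omega>)\<^sup>2) = (\<lambda>\<omega>. (?g 0 \<omega>)\<^sup>2 + 2 * class_load k * ?g 0 \<omega> + (class_load k)\<^sup>2)"
    by (simp add: fun_eq_iff power2_eq_square algebra_simps)
  also have "expectation (\<lambda>\<omega>. (?g 0 \<omega>)\<^sup>2 + 2 * class_load k * ?g 0 \<omega> + (class_load k)\<^sup>2)
      = expectation (\<lambda>\<omega>. (?g 0 \<omega>)\<^sup>2) + 2 * class_load k * expectation (?g 0) + (class_load k)\<^sup>2"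
    using ig expectation_excess(1) prob_space by simp
  also have "expectation (\<lambda>\<omega>. (?B 0 \<omega>)\<^sup>2) = enn2real (work_square k)"
    by (subst integral_eq_nn_integral) (auto simp: ennreal_of_nat_eq_real_of_nat simp flip: of_nat_power)
  also have "expectation (\<lambda>\<omega>. ?B 0 \<omega> * ?g 0 \<omega>) = service_mean k * (service_mean k * batch_arrivals k - class_load k * batch_time k)"
  proof -
    have "(\<lambda>\<omega>. ?B 0 \<omega> * ?g 0 \<omega>) = (\<lambda>\<omega>. service_mean k * (?B 0 \<omega> * \<phi> k (S k 0 \<omega>)) - class_load k * (?B 0 \<omega> * \<psi> k (S k 0 \<omega>)))"
      by (simp add: fun_eq_iff excess_def algebra_simps)
    then show ?thesis
      unfolding batch_arrivals_def batch_time_def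
      using expectation_work_phase[OF phase_function_integrable(3) \<psi>_nonneg]
        expectation_work_phase[OF phase_function_integrable(4) \<phi>_nonneg] by (simp add: algebra_simps)
  qed
  finally show ?thesis unfolding expectation_excess(2) by (simp add: algebra_simps)
qed

lemma mean_backlog_formula:
  assumes sq: "\<And>k. work_square k < top"
  obtains x where "(\<integral>\<^sup>+\<omega>. of_nat (backlog 0 \<omega>) \<partial>M) = ennreal x" "0 \<le> x"
    "2 * (1 - total_load) * x = total_load * (1 - total_load)
      + (\<Sum>k\<in>UNIV. enn2real (work_square k) + 2 * service_mean k * (service_mean k * batch_arrivals k - class_load k * batch_time k)
        - 2 * class_load k * (service_mean k * active_arrivals k - class_load k * active_time k) - (class_load k)\<^sup>2)
      - 2 * (1 - total_load) * (\<Sum>k\<in>UNIV. service_mean k * active_arrivals k - class_load k * active_time k)"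
proof -
  let ?x = "expectation (\<lambda>\<omega>. real (loynes_work 0 \<omega>))"
  note inc = increment_second_moment[OF sq]
  note pot = mean_potential_finite[OF inc(1)]
  have iT: "integrable M (total_excess 0)" unfolding total_excess_def[abs_def] using expectation_excess(1) by simp
  have eT: "expectation (total_excess 0) = (\<Sum>k\<in>UNIV. service_mean k * active_arrivals k - class_load k * active_time k)"
    unfolding total_excess_def[abs_def] using expectation_excess by (subst Bochner_Integration.integral_sum) auto
  have eq: "real (loynes_work 0 \<omega>) = potential 0 \<omega> - total_excess 0 \<omega>" for \<omega> by (simp add: potential_def)
  have iU: "integrable M (\<lambda>\<omega>. real (loynes_work 0 \<omega>))" unfolding eq using pot(1) iT by simp
  have x: "?x = expectation (potential 0) - expectation (total_excess 0)" unfolding eq using pot(1) iT by simp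
  show thesis
  proof (rule that)
    have "(\<integral>\<^sup>+\<omega>. of_nat (loynes_work 0 \<omega>) \<partial>M) = (\<integral>\<^sup>+\<omega>. ennreal (real (loynes_work 0 \<omega>)) \<partial>M)"
      by (simp add: ennreal_of_nat_eq_real_of_nat)
    also have "\<dots> = ennreal ?x" using iU by (intro nn_integral_eq_integral) auto
    finally show "(\<integral>\<^sup>+\<omega>. of_nat (backlog 0 \<omega>) \<partial>M) = ennreal ?x" unfolding mean_backlog_loynes .
    show "0 \<le> ?x" by simp
    show "2 * (1 - total_load) * ?x = total_load * (1 - total_load)
      + (\<Sum>k\<in>UNIV. enn2real (work_square k) + 2 * service_mean k * (service_mean k * batch_arrivals k - class_load k * batch_time k)
        - 2 * class_load k * (service_mean k * active_arrivals k - class_load k * active_time k) - (class_load k)\<^sup>2)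
      - 2 * (1 - total_load) * (\<Sum>k\<in>UNIV. service_mean k * active_arrivals k - class_load k * active_time k)"
    proof -
      have "2 * (1 - total_load) * ?x
          = 2 * (1 - total_load) * expectation (potential 0) - 2 * (1 - total_load) * expectation (total_excess 0)"
        unfolding x by (rule right_diff_distrib)
      then show ?thesis unfolding pot(2) inc(2) eT innovation_second_moment[OF sq] .
    qed
  qed
qed

end

section \<open>Unfinished work and waiting times\<close>

lemma of_nat_card_suminf:
  fixes R :: "(('k::finite \<times> int \<times> nat) \<times> nat) set"
  assumes fin: "finite R" and sub: "\<And>k l i j. ((k, l, i), j) \<in> R \<Longrightarrow> l \<le> 0"
  shows "(of_nat (card R) :: ennreal) = (\<Sum>k\<in>UNIV. \<Sum>l. \<Sum>i. \<Sum>j. indicator R ((k, - int l, i), j))"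
proof -
  let ?f = "\<lambda>(k :: 'k, l :: nat, i :: nat, j :: nat). ((k, - int l, i), j)"
  have inj: "inj_on ?f UNIV" by (auto simp: inj_on_def)
  have img: "R = ?f ` (?f -` R)"
  proof (intro equalityI subsetI)
    fix x assume x: "x \<in> R"
    obtain k l i j where e: "x = ((k, l, i), j)" by (metis prod.collapse)
    have "x = ?f (k, nat (- l), i, j)" using sub x e by simp
    then show "x \<in> ?f ` (?f -` R)" using x by blast
  qed auto
  have fin': "finite (?f -` R)" using fin inj by (simp add: finite_vimageI)
  from img have "card R = card (?f ` (?f -` R))" by (rule arg_cong)
  also have "\<dots> = card (?f -` R)" by (rule card_image) (rule inj_on_subset[OF inj], simp)
  finally have "(of_nat (card R) :: ennreal) = emeasure (count_space UNIV) (?f -` R)"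
    using fin' by (simp add: emeasure_count_space)
  also have "\<dots> = (\<integral>\<^sup>+x. indicator (?f -` R) x \<partial>count_space UNIV)" by simp
  also have "\<dots> = (\<integral>\<^sup>+k. \<integral>\<^sup>+l. \<integral>\<^sup>+i. \<integral>\<^sup>+j. indicator (?f -` R) (k, l, i, j) \<partial>count_space UNIV \<partial>count_space UNIV \<partial>count_space UNIV \<partial>count_space UNIV)"
    by (simp add: nn_integral_fst_count_space[symmetric])
  also have "\<dots> = (\<Sum>k\<in>UNIV. \<Sum>l. \<Sum>i. \<Sum>j. indicator (?f -` R) (k, l, i, j))"
    by (simp add: nn_integral_count_space_nat nn_integral_count_space_finite)
  finally show ?thesis by (simp add: indicator_def)
qed

context stationary_queue
begin

lemma single_server_AE: "AE \<omega> in M. \<forall>t. \<forall>c \<in> in_service A h W t \<omega>. \<forall>d \<in> in_service A h W t \<omega>. c = d"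
  using single_server unfolding single_server_def .

text \<open>Service and waiting time of the customer numbered \<open>i\<close> of class \<open>k\<close> in slot \<open>n\<close>, where present.\<close>

definition customer_value :: "'k \<Rightarrow> int \<Rightarrow> nat \<Rightarrow> (nat \<Rightarrow> nat \<Rightarrow> ennreal) \<Rightarrow> 'a \<Rightarrow> ennreal" where
  "customer_value k n i f \<omega> = (if i < A k n \<omega> then f (h k n i \<omega>) (W k n i \<omega>) else 0)"

lemma customer_path_measurable[measurable]:
  "(\<lambda>y. if i < y (Batch k, n) then f (y (Service k i, n)) (y (Waiting k i, n)) else 0 :: ennreal) \<in> borel_measurable path_space"
proof -
  have pm: "(\<lambda>y. y q :: nat) \<in> measurable path_space (count_space UNIV)" for q by measurable
  have f2: "(\<lambda>y. f (y (Service k i, n)) w) \<in> borel_measurable path_space" for w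
    by (rule measurable_compose[OF pm]) simp
  have [measurable]: "(\<lambda>y. f (y (Service k i, n)) (y (Waiting k i, n))) \<in> borel_measurable path_space"
    by (rule measurable_compose_countable[OF f2 pm])
  have [measurable]: "Measurable.pred path_space (\<lambda>y. i < y (Batch k, n))"
    by (rule measurable_compose[OF pm]) simp
  show ?thesis by measurable
qed

lemma customer_value_path:
  "customer_value k (n + d) i f \<omega> = (\<lambda>y. if i < y (Batch k, n) then f (y (Service k i, n)) (y (Waiting k i, n)) else 0)
     (time_shift d (sample_path \<omega>))"
  by (simp add: customer_value_def)

lemma customer_value_measurable[measurable]: "customer_value k n i f \<in> borel_measurable M"
proof -
  have "customer_value k n i f = (\<lambda>\<omega>. (\<lambda>y. if i < y (Batch k, 0) then f (y (Service k i, 0)) (y (Waiting k i, 0)) else 0)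
     (time_shift n (sample_path \<omega>)))"
    using customer_value_path[of k 0 n i f] by (simp add: fun_eq_iff)
  then show ?thesis by (simp only:) measurable
qed

lemma customer_value_stationary: "(\<integral>\<^sup>+\<omega>. customer_value k n i f \<omega> \<partial>M) = (\<integral>\<^sup>+\<omega>. customer_value k 0 i f \<omega> \<partial>M)"
  by (rule nn_integral_stationary[OF customer_path_measurable, where d = n and e = 0])
     (use customer_value_path[of k 0] in simp_all)

text \<open>The slot in which a service starts is decided without knowing the service time.\<close>

lemma service_waiting_independent:
  "(\<integral>\<^sup>+\<omega>. customer_value k 0 i (\<lambda>x w. f x * g w) \<omega> \<partial>M)
    = (\<integral>\<^sup>+x. f x \<partial>measure_pmf (H k)) * (\<integral>\<^sup>+\<omega>. customer_value k 0 i (\<lambda>x w. g w) \<omega> \<partial>M)"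
proof -
  let ?E = "\<lambda>w. {\<omega> \<in> space M. present A (k, 0, i) \<omega> \<and> start_slot W (k, 0, i) \<omega> = int w}"
  let ?h = "\<lambda>x. {\<omega> \<in> space M. h k 0 i \<omega> = x}"
  note ord = order_independent[unfolded order_independent_of_services_def]
  note ord2 = ord[THEN conjunct2] and ord5 = ord[THEN conjunct2, THEN conjunct2, THEN conjunct2, THEN conjunct2]
  have ord7: "\<forall>t. \<forall>E \<in> sets (F t). \<forall>J x. finite J \<longrightarrow>
        (\<forall>\<omega> \<in> E. \<forall>c \<in> J. \<not> started_before A W t c \<omega>) \<longrightarrow>
        prob {\<omega> \<in> E. \<forall>c \<in> J. service_time h c \<omega> = x c} = prob E * (\<Prod>c \<in> J. pmf (H (fst c)) (x c))"
    by (rule ord5[THEN conjunct2, THEN conjunct2])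
  have EF: "?E w \<in> sets (F (int w))" for w by (rule ord5[THEN conjunct1, THEN spec, THEN spec])
  have "sets (F t) \<subseteq> sets M" for t
    using ord2[THEN conjunct1, THEN spec, of t] by (simp add: subalgebra_def)
  then have EM[measurable]: "?E w \<in> sets M" for w using EF[of w] by (rule subsetD)
  have ind: "prob (?E w \<inter> ?h x) = prob (?E w) * pmf (H k) x" for w x
  proof -
    have ns: "\<forall>\<omega>\<in>?E w. \<forall>c\<in>{(k, 0, i)}. \<not> started_before A W (int w) c \<omega>"
      by (auto simp: started_before_def)
    note L = spec[OF spec[OF bspec[OF spec[OF ord7, of "int w"] EF[of w]], of "{(k, 0, i)}"], of "\<lambda>_. x"]
    have "finite {(k, 0, i)}" by simp
    from mp[OF mp[OF L this] ns]
    have "prob {\<omega> \<in> ?E w. \<forall>c\<in>{(k, 0, i)}. service_time h c \<omega> = x}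
        = prob (?E w) * (\<Prod>c\<in>{(k, 0 :: int, i)}. pmf (H (fst c)) x)" .
    moreover have "{\<omega> \<in> ?E w. \<forall>c\<in>{(k, 0, i)}. service_time h c \<omega> = x} = ?E w \<inter> ?h x" by auto
    ultimately show ?thesis by simp
  qed
  have val: "customer_value k 0 i (\<lambda>x w. f x * g w) \<omega> = (\<Sum>w. \<Sum>x. f x * g w * indicator (?E w \<inter> ?h x) \<omega>)"
    if "\<omega> \<in> space M" for f g \<omega>
  proof (cases "i < A k 0 \<omega>")
    case True
    have ind: "indicator (?E w \<inter> ?h x) \<omega> = (if w = W k 0 i \<omega> \<and> x = h k 0 i \<omega> then 1 else 0 :: ennreal)" for w x
      using that True by (auto simp: indicator_def)
    have "(\<Sum>x. f x * g w * indicator (?E w \<inter> ?h x) \<omega>) = (if w = W k 0 i \<omega> then f (h k 0 i \<omega>) * g w else 0)" for w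
      unfolding ind by (subst suminf_finite[of "{h k 0 i \<omega>}"]) auto
    moreover have "(\<Sum>w. if w = W k 0 i \<omega> then f (h k 0 i \<omega>) * g w else 0) = f (h k 0 i \<omega>) * g (W k 0 i \<omega>)"
      by (subst suminf_finite[of "{W k 0 i \<omega>}"]) auto
    ultimately show ?thesis using True by (simp add: customer_value_def)
  qed (simp add: customer_value_def)
  have int: "(\<integral>\<^sup>+\<omega>. customer_value k 0 i (\<lambda>x w. f x * g w) \<omega> \<partial>M)
      = (\<integral>\<^sup>+x. f x \<partial>measure_pmf (H k)) * (\<Sum>w. g w * ennreal (prob (?E w)))" for f g :: "nat \<Rightarrow> ennreal"
  proof -
    have "(\<integral>\<^sup>+\<omega>. customer_value k 0 i (\<lambda>x w. f x * g w) \<omega> \<partial>M)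
        = (\<integral>\<^sup>+\<omega>. (\<Sum>w. \<Sum>x. f x * g w * indicator (?E w \<inter> ?h x) \<omega>) \<partial>M)"
      by (intro nn_integral_cong val)
    also have "\<dots> = (\<Sum>w. \<integral>\<^sup>+\<omega>. (\<Sum>x. f x * g w * indicator (?E w \<inter> ?h x) \<omega>) \<partial>M)"
      by (rule nn_integral_suminf) measurable
    also have "\<dots> = (\<Sum>w. \<Sum>x. \<integral>\<^sup>+\<omega>. f x * g w * indicator (?E w \<inter> ?h x) \<omega> \<partial>M)"
      by (intro arg_cong[where f = suminf] ext nn_integral_suminf) measurable
    also have "\<dots> = (\<Sum>w. \<Sum>x. f x * g w * ennreal (prob (?E w) * pmf (H k) x))"
    proof (intro arg_cong[where f = suminf] ext)
      fix w x
      have "(\<integral>\<^sup>+\<omega>. f x * g w * indicator (?E w \<inter> ?h x) \<omega> \<partial>M) = f x * g w * emeasure M (?E w \<inter> ?h x)"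
        by (rule nn_integral_cmult_indicator) measurable
      then show "(\<integral>\<^sup>+\<omega>. f x * g w * indicator (?E w \<inter> ?h x) \<omega> \<partial>M) = f x * g w * ennreal (prob (?E w) * pmf (H k) x)"
        unfolding emeasure_eq_measure ind .
    qed
    also have "\<dots> = (\<Sum>w. (g w * ennreal (prob (?E w))) * (\<Sum>x. ennreal (pmf (H k) x) * f x))"
      unfolding ennreal_suminf_cmult[symmetric]
      by (intro arg_cong[where f = suminf] ext) (simp add: ennreal_mult mult_ac)
    also have "(\<Sum>x. ennreal (pmf (H k) x) * f x) = (\<integral>\<^sup>+x. f x \<partial>measure_pmf (H k))"
      by (simp add: nn_integral_measure_pmf nn_integral_count_space_nat)
    finally show ?thesis by (simp add: mult.commute)
  qed
  show ?thesis
    using int[of f g] int[of "\<lambda>_. 1" g] by (simp add: measure_pmf.emeasure_space_1[simplified])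
qed

definition mean_total_wait :: "'k \<Rightarrow> ennreal" where
  "mean_total_wait k = (\<Sum>i. \<integral>\<^sup>+\<omega>. customer_value k 0 i (\<lambda>x w. of_nat w) \<omega> \<partial>M)"

lemma sum_customers:
  "(of_nat (\<Sum>i<A k 0 \<omega>. f (h k 0 i \<omega>) (W k 0 i \<omega>)) :: ennreal) = (\<Sum>i. customer_value k 0 i (\<lambda>x w. of_nat (f x w)) \<omega>)"
proof -
  have "(\<Sum>i. customer_value k 0 i (\<lambda>x w. of_nat (f x w)) \<omega>) = (\<Sum>i<A k 0 \<omega>. customer_value k 0 i (\<lambda>x w. of_nat (f x w)) \<omega>)"
    by (rule suminf_finite) (auto simp: customer_value_def)
  also have "\<dots> = (\<Sum>i<A k 0 \<omega>. of_nat (f (h k 0 i \<omega>) (W k 0 i \<omega>)))"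
    by (rule sum.cong) (auto simp: customer_value_def)
  finally show ?thesis by simp
qed

lemma mean_total_wait_eq: "mean_total_wait k = (\<integral>\<^sup>+\<omega>. of_nat (\<Sum>i<A k 0 \<omega>. W k 0 i \<omega>) \<partial>M)"
  unfolding mean_total_wait_def sum_customers[where f = "\<lambda>x w. w"] by (simp add: nn_integral_suminf)

lemma mean_batch_customers: "(\<Sum>i. \<integral>\<^sup>+\<omega>. customer_value k 0 i (\<lambda>x w. 1) \<omega> \<partial>M) = mean_batch k"
  using sum_customers[of "\<lambda>x w. 1" k] by (simp add: nn_integral_suminf[symmetric])

text \<open>Work conservation for the individual customer: a unit of work that is served \<open>w + j\<close> slots after
  its arrival is found unfinished in \<open>w + j + 1\<close> slots.\<close>

lemma mean_backlog_waiting: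
  "(\<integral>\<^sup>+\<omega>. of_nat (backlog 0 \<omega>) \<partial>M)
    = (\<Sum>k\<in>UNIV. mean_service k * mean_total_wait k
        + mean_batch k * (mean_service k + (\<integral>\<^sup>+x. of_nat (x choose 2) \<partial>measure_pmf (H k))))"
proof -
  let ?r = "\<lambda>l x w. \<Sum>j. indicator {j. j < x \<and> l \<le> w + j} j :: ennreal"
  have r: "(\<Sum>l. ?r l x w) = of_nat (x * w) + of_nat (x + (x choose 2))" for x w
  proof -
    have "(\<Sum>l. ?r l x w) = (\<Sum>l. \<Sum>j<x. indicator {l. l < Suc (w + j)} l)"
      by (intro arg_cong[where f = suminf] ext, subst suminf_finite[of "{..<x}" for x])
         (auto intro!: sum.cong split: split_indicator)
    also have "\<dots> = (\<Sum>j<x. \<Sum>l. indicator {l. l < Suc (w + j)} l)" by (rule suminf_sum) (rule summableI)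
    also have "\<dots> = (\<Sum>j<x. of_nat (Suc (w + j)))" by (simp only: suminf_indicator_lessThan)
    also have "\<dots> = of_nat (\<Sum>j<x. Suc (w + j))" by (rule of_nat_sum[symmetric])
    also have "(\<Sum>j<x. Suc (w + j)) = x * w + (x + (x choose 2))"
      unfolding sum_lessThan_choose[symmetric] by (induction x) simp_all
    finally show ?thesis by simp
  qed
  have "(\<integral>\<^sup>+\<omega>. of_nat (backlog 0 \<omega>) \<partial>M)
      = (\<integral>\<^sup>+\<omega>. (\<Sum>k\<in>UNIV. \<Sum>l. \<Sum>i. customer_value k (- int l) i (?r l) \<omega>) \<partial>M)"
    using AE_backlog
  proof (intro nn_integral_cong_AE, eventually_elim)
    case (elim \<omega>)
    let ?R = "unfinished A h W 0 \<omega>"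
    have "of_nat (backlog 0 \<omega>) = (\<Sum>k\<in>UNIV. \<Sum>l. \<Sum>i. \<Sum>j. indicator ?R ((k, - int l, i), j) :: ennreal)"
      unfolding backlog_def using elim by (intro of_nat_card_suminf) (auto simp: unfinished_def)
    also have "\<dots> = (\<Sum>k\<in>UNIV. \<Sum>l. \<Sum>i. customer_value k (- int l) i (?r l) \<omega>)"
    proof (intro sum.cong refl arg_cong[where f = suminf] ext)
      fix k l i
      have "indicator ?R ((k, - int l, i), j)
          = (if i < A k (- int l) \<omega> then indicator {j. j < h k (- int l) i \<omega> \<and> l \<le> W k (- int l) i \<omega> + j} j else 0 :: ennreal)" for j
        by (auto simp: unfinished_def indicator_def)
      then show "(\<Sum>j. indicator ?R ((k, - int l, i), j)) = customer_value k (- int l) i (?r l) \<omega>"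
        by (simp add: customer_value_def)
    qed
    finally show ?case .
  qed
  also have "\<dots> = (\<Sum>k\<in>UNIV. \<Sum>l. \<Sum>i. \<integral>\<^sup>+\<omega>. customer_value k (- int l) i (?r l) \<omega> \<partial>M)"
    by (simp add: nn_integral_sum nn_integral_suminf)
  also have "\<dots> = (\<Sum>k\<in>UNIV. \<Sum>l. \<Sum>i. \<integral>\<^sup>+\<omega>. customer_value k 0 i (?r l) \<omega> \<partial>M)"
    by (intro sum.cong refl arg_cong[where f = suminf] ext customer_value_stationary)
  also have "\<dots> = (\<Sum>k\<in>UNIV. \<integral>\<^sup>+\<omega>. (\<Sum>l. \<Sum>i. customer_value k 0 i (?r l) \<omega>) \<partial>M)"
    by (simp add: nn_integral_suminf)
  also have "\<dots> = (\<Sum>k\<in>UNIV. \<integral>\<^sup>+\<omega>. (\<Sum>i. customer_value k 0 i (\<lambda>x w. of_nat x * of_nat w) \<omega>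
      + customer_value k 0 i (\<lambda>x w. of_nat (x + (x choose 2)) * 1) \<omega>) \<partial>M)"
  proof (intro sum.cong refl nn_integral_cong)
    fix k \<omega>
    let ?n = "A k 0 \<omega>"
    have z: "customer_value k 0 i f \<omega> = 0" if "i \<notin> {..<?n}" for i f using that by (simp add: customer_value_def)
    have "(\<Sum>l. \<Sum>i. customer_value k 0 i (?r l) \<omega>) = (\<Sum>l. \<Sum>i<?n. customer_value k 0 i (?r l) \<omega>)"
      by (intro arg_cong[where f = suminf] ext suminf_finite z) auto
    also have "\<dots> = (\<Sum>i<?n. \<Sum>l. customer_value k 0 i (?r l) \<omega>)" by (rule suminf_sum) (rule summableI)
    also have "\<dots> = (\<Sum>i<?n. customer_value k 0 i (\<lambda>x w. of_nat x * of_nat w) \<omega>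
      + customer_value k 0 i (\<lambda>x w. of_nat (x + (x choose 2)) * 1) \<omega>)"
      by (rule sum.cong) (auto simp: customer_value_def r)
    also have "\<dots> = (\<Sum>i. customer_value k 0 i (\<lambda>x w. of_nat x * of_nat w) \<omega>
      + customer_value k 0 i (\<lambda>x w. of_nat (x + (x choose 2)) * 1) \<omega>)"
      by (rule suminf_finite[symmetric]) (auto simp: z)
    finally show "(\<Sum>l. \<Sum>i. customer_value k 0 i (?r l) \<omega>) = (\<Sum>i. customer_value k 0 i (\<lambda>x w. of_nat x * of_nat w) \<omega>
      + customer_value k 0 i (\<lambda>x w. of_nat (x + (x choose 2)) * 1) \<omega>)" .
  qed
  also have "\<dots> = (\<Sum>k\<in>UNIV. \<Sum>i. (\<integral>\<^sup>+\<omega>. customer_value k 0 i (\<lambda>x w. of_nat x * of_nat w) \<omega> \<partial>M)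
      + (\<integral>\<^sup>+\<omega>. customer_value k 0 i (\<lambda>x w. of_nat (x + (x choose 2)) * 1) \<omega> \<partial>M))"
    by (intro sum.cong refl, subst nn_integral_suminf) (auto simp: nn_integral_add)
  also have "\<dots> = (\<Sum>k\<in>UNIV. (\<Sum>i. mean_service k * (\<integral>\<^sup>+\<omega>. customer_value k 0 i (\<lambda>x w. of_nat w) \<omega> \<partial>M))
      + (\<Sum>i. (\<integral>\<^sup>+x. of_nat (x + (x choose 2)) \<partial>measure_pmf (H k)) * (\<integral>\<^sup>+\<omega>. customer_value k 0 i (\<lambda>x w. 1) \<omega> \<partial>M)))"
    unfolding service_waiting_independent by (intro sum.cong refl suminf_add[symmetric] summableI)
  also have "\<dots> = (\<Sum>k\<in>UNIV. mean_service k * mean_total_wait k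
        + mean_batch k * (mean_service k + (\<integral>\<^sup>+x. of_nat (x choose 2) \<partial>measure_pmf (H k))))"
    by (simp add: mean_batch_customers mean_total_wait_def nn_integral_add mult.commute)
  finally show ?thesis .
qed

section \<open>Service times with infinite second moment\<close>

lemma prob_idle_run: "prob {\<omega> \<in> space M. \<forall>i\<le>R. S k (n + int i) \<omega> = 0} \<le> p k ^ R"
proof -
  have "prob {\<omega> \<in> space M. \<forall>i\<le>R. S k (n + int i) \<omega> = 0}
      \<le> prob {\<omega> \<in> space M. S k n \<omega> = 0 \<and> (\<forall>i\<in>{1..R}. S k (n + int i) \<omega> = 0 \<and> A k (n + int i) \<omega> = 0)}"
  proof (rule finite_measure_mono_AE)
    show "AE \<omega> in M. \<omega> \<in> {\<omega> \<in> space M. \<forall>i\<le>R. S k (n + int i) \<omega> = 0} \<longrightarrow>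
        \<omega> \<in> {\<omega> \<in> space M. S k n \<omega> = 0 \<and> (\<forall>i\<in>{1..R}. S k (n + int i) \<omega> = 0 \<and> A k (n + int i) \<omega> = 0)}"
      using AE_streams by eventually_elim (auto dest: spec[of _ 0])
  qed measurable
  also have "\<dots> = prob {\<omega> \<in> space M. S k n \<omega> = 0} * (\<Prod>i = 1..R. Ptr k 0 0 * pmf (a k 0 0) 0)"
  proof -
    have "\<forall>n r s b. (\<forall>i \<le> r. s i \<le> m k) \<longrightarrow>
        prob {\<omega> \<in> space M. S k n \<omega> = s 0 \<and> (\<forall>i \<in> {1..r}. S k (n + int i) \<omega> = s i \<and> A k (n + int i) \<omega> = b i)}
        = prob {\<omega> \<in> space M. S k n \<omega> = s 0} * (\<Prod>i = 1..r. Ptr k (s (i - 1)) (s i) * pmf (a k (s (i - 1)) (s i)) (b i))"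
      using streams[of k] unfolding batch_markov_stream_def by blast
    from spec[OF spec[OF spec[OF spec[OF this, of n], of R], of "\<lambda>_. 0"], of "\<lambda>_. 0"] show ?thesis by simp
  qed
  also have "\<dots> \<le> 1 * (\<Prod>i = 1..R. p k)"
  proof (rule mult_mono)
    have p: "0 \<le> p k" using stream_parameters[of k] by (simp add: stream_parameters_def)
    have "0 \<le> Ptr k 0 0 * pmf (a k 0 0) 0 \<and> Ptr k 0 0 * pmf (a k 0 0) 0 \<le> p k"
      using p pmf_le_1[of "a k 0 0" 0] by (simp add: transition_matrix_def mult_left_le)
    then show "(\<Prod>i = 1..R. Ptr k 0 0 * pmf (a k 0 0) 0) \<le> (\<Prod>i = 1..R. p k)"
      "0 \<le> (\<Prod>i = 1..R. Ptr k 0 0 * pmf (a k 0 0) 0)" by (auto intro!: power_mono prod_nonneg)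
  qed auto
  finally show ?thesis by simp
qed

definition active_count :: "'k \<Rightarrow> int \<Rightarrow> nat \<Rightarrow> 'a \<Rightarrow> nat" where
  "active_count k w y \<omega> = card {s \<in> {1..y}. S k (w + int s) \<omega> \<noteq> 0}"

lemma active_count_sum: "active_count k w y \<omega> = (\<Sum>s = 1..y. if S k (w + int s) \<omega> \<noteq> 0 then 1 else 0)"
  unfolding active_count_def by (simp add: sum.If_cases Int_def)

lemma active_count_measurable_gen:
  assumes "\<And>i. S k i \<in> measurable N (count_space UNIV)"
  shows "active_count k w y \<in> measurable N (count_space UNIV)"
proof -
  note [measurable] = assms
  show ?thesis unfolding active_count_sum[abs_def] by measurable
qed

lemma active_count_measurable[measurable]: "active_count k w y \<in> measurable M (count_space UNIV)"
  by (rule active_count_measurable_gen) simp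

text \<open>If few slots of a window are active, then most of its slots begin a long idle run. Long idle
  runs are rare at every slot, so this has small probability uniformly in the window.\<close>

lemma few_active:
  assumes y: "4 * R \<le> y" "1 \<le> y"
  shows "prob {\<omega> \<in> space M. 4 * (R + 1) * active_count k w y \<omega> < y} \<le> 2 * p k ^ R"
proof -
  let ?idle = "\<lambda>s \<omega>. \<forall>i\<le>R. S k (w + int s + int i) \<omega> = 0"
  let ?bad = "{\<omega> \<in> space M. 4 * (R + 1) * active_count k w y \<omega> < y}"
  have path: "y \<le> 2 * card {s \<in> {1..y}. ?idle s \<omega>}" if bad: "4 * (R + 1) * active_count k w y \<omega> < y" for \<omega>
  proof -
    let ?Act = "{s \<in> {1..y}. S k (w + int s) \<omega> \<noteq> 0}" and ?I = "{s \<in> {1..y}. ?idle s \<omega>}"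
    have sub: "{1..y} \<subseteq> ?I \<union> ({y - R<..y} \<union> (\<lambda>(t, i). t - i) ` (?Act \<times> {..R}))"
    proof
      fix s assume s: "s \<in> {1..y}"
      show "s \<in> ?I \<union> ({y - R<..y} \<union> (\<lambda>(t, i). t - i) ` (?Act \<times> {..R}))"
      proof (cases "s \<in> ?I \<or> y - R < s")
        case False
        then obtain i where i: "i \<le> R" "S k (w + int s + int i) \<omega> \<noteq> 0" using s by auto
        have "s + i \<in> ?Act" using s i False by (auto simp: add.assoc)
        moreover have "s = (\<lambda>(t, i). t - i) (s + i, i)" by simp
        ultimately show ?thesis using i(1) by blast
      qed (use s in auto)
    qed
    have "y = card {1..y}" by simp
    also have "\<dots> \<le> card (?I \<union> ({y - R<..y} \<union> (\<lambda>(t, i). t - i) ` (?Act \<times> {..R})))"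
      by (intro card_mono sub) auto
    also have "\<dots> \<le> card ?I + (card {y - R<..y} + card ((\<lambda>(t, i). t - i) ` (?Act \<times> {..R})))"
      by (intro order_trans[OF card_Un_le] add_left_mono card_Un_le)
    also have "card ((\<lambda>(t, i). t - i) ` (?Act \<times> {..R})) \<le> card (?Act \<times> {..R})" by (rule card_image_le) auto
    also have "card (?Act \<times> {..R}) = active_count k w y \<omega> * (R + 1)"
      by (simp add: active_count_def card_cartesian_product)
    also have "card {y - R<..y} \<le> R" by simp
    finally have "y \<le> card ?I + (R + active_count k w y \<omega> * (R + 1))" by simp
    moreover have "4 * (active_count k w y \<omega> * (R + 1)) < y" using bad by (simp add: algebra_simps)
    ultimately show ?thesis using y by linarith
  qed
  have card: "(of_nat (2 * card {s \<in> {1..y}. ?idle s \<omega>}) :: ennreal) = (\<Sum>s = 1..y. 2 * indicator {\<omega> \<in> space M. ?idle s \<omega>} \<omega>)"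
    if "\<omega> \<in> space M" for \<omega>
  proof -
    have "card {s \<in> {1..y}. ?idle s \<omega>} = (\<Sum>s = 1..y. if ?idle s \<omega> then 1 else 0)"
      by (simp add: sum.If_cases Int_def)
    then have "(of_nat (card {s \<in> {1..y}. ?idle s \<omega>}) :: ennreal) = (\<Sum>s = 1..y. of_nat (if ?idle s \<omega> then 1 else 0))" by simp
    also have "\<dots> = (\<Sum>s = 1..y. indicator {\<omega> \<in> space M. ?idle s \<omega>} \<omega>)" using that by (intro sum.cong) (auto simp: indicator_def)
    finally show ?thesis by (simp add: sum_distrib_left)
  qed
  have "ennreal (real y * prob ?bad) = (\<integral>\<^sup>+\<omega>. of_nat y * indicator ?bad \<omega> \<partial>M)"
    by (subst nn_integral_cmult_indicator) (auto simp: emeasure_eq_measure ennreal_mult ennreal_of_nat_eq_real_of_nat)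
  also have "\<dots> \<le> (\<integral>\<^sup>+\<omega>. of_nat (2 * card {s \<in> {1..y}. ?idle s \<omega>}) \<partial>M)"
  proof (rule nn_integral_mono)
    fix \<omega>
    show "of_nat y * indicator ?bad \<omega> \<le> (of_nat (2 * card {s \<in> {1..y}. ?idle s \<omega>}) :: ennreal)"
    proof (cases "\<omega> \<in> ?bad")
      case True
      then have "(of_nat y :: ennreal) \<le> of_nat (2 * card {s \<in> {1..y}. ?idle s \<omega>})"
        by (intro of_nat_mono path) simp
      then show ?thesis using True by simp
    qed simp
  qed
  also have "\<dots> = (\<integral>\<^sup>+\<omega>. (\<Sum>s = 1..y. 2 * indicator {\<omega> \<in> space M. ?idle s \<omega>} \<omega>) \<partial>M)"
    by (intro nn_integral_cong card)
  also have "\<dots> = (\<Sum>s = 1..y. 2 * ennreal (prob {\<omega> \<in> space M. ?idle s \<omega>}))"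
    by (subst nn_integral_sum) (auto simp: nn_integral_cmult_indicator emeasure_eq_measure)
  also have "\<dots> \<le> (\<Sum>s = 1..y. 2 * ennreal (p k ^ R))"
    using prob_idle_run by (intro sum_mono mult_left_mono ennreal_leI) auto
  also have "\<dots> = ennreal (real y * (2 * p k ^ R))"
    using stream_parameters[of k]
    by (simp add: ennreal_mult ennreal_of_nat_eq_real_of_nat stream_parameters_def)
  finally have "real y * prob ?bad \<le> real y * (2 * p k ^ R)"
    using stream_parameters[of k] by (subst (asm) ennreal_le_iff) (auto simp: stream_parameters_def)
  then show ?thesis using y by simp
qed

text \<open>The first class \<open>k\<close> customer of slot \<open>t - d\<close>, if there is one, is still waiting, respectively in
  service, in slot \<open>t\<close>.\<close>

abbreviation waiting :: "'k \<Rightarrow> nat \<Rightarrow> nat \<Rightarrow> 'a \<Rightarrow> ennreal" where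
  "waiting k t d \<equiv> customer_value k (int t - int d) 0 (\<lambda>x w. if d < w then 1 else 0)"

abbreviation serving :: "'k \<Rightarrow> nat \<Rightarrow> nat \<Rightarrow> 'a \<Rightarrow> ennreal" where
  "serving k t d \<equiv> customer_value k (int t - int d) 0 (\<lambda>x w. if w \<le> d \<and> d < w + x then 1 else 0)"

lemma serving_le_1: "AE \<omega> in M. (\<Sum>d<q. serving k 0 d \<omega>) \<le> 1"
  using single_server_AE
proof eventually_elim
  case (elim \<omega>)
  have uniq: "d = d'" if "serving k 0 d \<omega> \<noteq> 0" "serving k 0 d' \<omega> \<noteq> 0" for d d'
  proof -
    have "(k, - int d, 0) \<in> in_service A h W 0 \<omega>" if "serving k 0 d \<omega> \<noteq> 0" for d
      using that by (auto simp: customer_value_def in_service_def split: if_splits)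
    then have "(k, - int d, 0 :: nat) = (k, - int d', 0)" using elim that by blast
    then show ?thesis by simp
  qed
  show ?case
  proof (cases "\<exists>d<q. serving k 0 d \<omega> \<noteq> 0")
    case True
    then obtain d where d: "d < q" "serving k 0 d \<omega> \<noteq> 0" by blast
    have "(\<Sum>d<q. serving k 0 d \<omega>) = serving k 0 d \<omega> + (\<Sum>d\<in>{..<q} - {d}. serving k 0 d \<omega>)"
      using d by (intro sum.remove) auto
    also have "(\<Sum>d\<in>{..<q} - {d}. serving k 0 d \<omega>) = 0" using uniq d(2) by (intro sum.neutral) blast
    finally show ?thesis by (auto simp: customer_value_def)
  next
    case False
    then have "(\<Sum>d<q. serving k 0 d \<omega>) = 0" by (intro sum.neutral) blast
    then show ?thesis by simp
  qed
qed

text \<open>Mass transport: the customers seen waiting during a service are counted at the slot in which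
  they wait, where at most one service is in progress.\<close>

lemma waiting_during_service:
  "(\<integral>\<^sup>+\<omega>. (\<Sum>t<q. \<Sum>d<q. waiting k t d \<omega> * serving k t t \<omega>) \<partial>M) \<le> mean_total_wait k"
proof -
  have "(\<integral>\<^sup>+\<omega>. (\<Sum>t<q. \<Sum>d<q. waiting k t d \<omega> * serving k t t \<omega>) \<partial>M)
      = (\<Sum>t<q. \<Sum>d<q. \<integral>\<^sup>+\<omega>. waiting k t d \<omega> * serving k t t \<omega> \<partial>M)"
    by (simp add: nn_integral_sum)
  also have "\<dots> = (\<Sum>t<q. \<Sum>d<q. \<integral>\<^sup>+\<omega>. waiting k 0 d \<omega> * serving k 0 t \<omega> \<partial>M)"
  proof (intro sum.cong refl)
    fix t d :: nat
    let ?f = "\<lambda>x w :: nat. if d < w then 1 else 0 :: ennreal" and ?g = "\<lambda>x w. if w \<le> t \<and> t < w + x then 1 else 0 :: ennreal"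
    show "(\<integral>\<^sup>+\<omega>. waiting k t d \<omega> * serving k t t \<omega> \<partial>M) = (\<integral>\<^sup>+\<omega>. waiting k 0 d \<omega> * serving k 0 t \<omega> \<partial>M)"
    proof (rule nn_integral_stationary[where d = "int t" and e = 0])
      let ?\<phi> = "\<lambda>y :: 'k observable \<times> int \<Rightarrow> nat. (if 0 < y (Batch k, - int d) then ?f (y (Service k 0, - int d)) (y (Waiting k 0, - int d)) else 0)
         * (if 0 < y (Batch k, - int t) then ?g (y (Service k 0, - int t)) (y (Waiting k 0, - int t)) else 0)"
      show "?\<phi> \<in> borel_measurable path_space"
        by (rule borel_measurable_times_ennreal[OF customer_path_measurable customer_path_measurable])
      show "waiting k t d \<omega> * serving k t t \<omega> = ?\<phi> (time_shift (int t) (sample_path \<omega>))" for \<omega>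
        using customer_value_path[of k "- int d" "int t" 0 ?f \<omega>] customer_value_path[of k "- int t" "int t" 0 ?g \<omega>]
        by simp
      show "waiting k 0 d \<omega> * serving k 0 t \<omega> = ?\<phi> (time_shift 0 (sample_path \<omega>))" for \<omega>
        using customer_value_path[of k "- int d" 0 0 ?f \<omega>] customer_value_path[of k "- int t" 0 0 ?g \<omega>]
        by simp
    qed
  qed
  also have "\<dots> = (\<integral>\<^sup>+\<omega>. (\<Sum>d<q. waiting k 0 d \<omega>) * (\<Sum>t<q. serving k 0 t \<omega>) \<partial>M)"
    by (subst sum.swap) (simp add: nn_integral_sum sum_product)
  also have "\<dots> \<le> (\<integral>\<^sup>+\<omega>. (\<Sum>d<q. waiting k 0 d \<omega>) \<partial>M)"
    using serving_le_1[of k q]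
    by (intro nn_integral_mono_AE) (auto intro: mult_left_le elim!: eventually_mono)
  also have "\<dots> = (\<Sum>d<q. \<integral>\<^sup>+\<omega>. customer_value k 0 0 (\<lambda>x w. if d < w then 1 else 0) \<omega> \<partial>M)"
    by (subst nn_integral_sum) (auto intro!: sum.cong customer_value_stationary)
  also have "\<dots> = (\<integral>\<^sup>+\<omega>. (\<Sum>d<q. customer_value k 0 0 (\<lambda>x w. if d < w then 1 else 0) \<omega>) \<partial>M)"
    by (simp add: nn_integral_sum)
  also have "\<dots> \<le> (\<integral>\<^sup>+\<omega>. customer_value k 0 0 (\<lambda>x w. of_nat w) \<omega> \<partial>M)"
  proof (rule nn_integral_mono)
    fix \<omega>
    have "(\<Sum>d<q. if d < w then 1 else 0 :: ennreal) \<le> of_nat w" for w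
    proof -
      have "(\<Sum>d<q. if d < w then 1 else 0 :: ennreal) = of_nat (card ({..<q} \<inter> {..<w}))"
        by (simp add: sum.If_cases lessThan_def Int_def)
      also have "card ({..<q} \<inter> {..<w}) \<le> w" by (rule order_trans[OF card_mono[of "{..<w}"]]) auto
      finally show ?thesis by (simp add: of_nat_mono)
    qed
    then show "(\<Sum>d<q. customer_value k 0 0 (\<lambda>x w. if d < w then 1 else 0) \<omega>) \<le> customer_value k 0 0 (\<lambda>x w. of_nat w) \<omega>"
      by (simp add: customer_value_def)
  qed
  also have "\<dots> \<le> mean_total_wait k"
    unfolding mean_total_wait_def
    using sum_le_suminf[OF summableI, of "{0}" "\<lambda>i. \<integral>\<^sup>+\<omega>. customer_value k 0 i (\<lambda>x w. of_nat w) \<omega> \<partial>M"] by simp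
  finally show ?thesis .
qed

text \<open>While the first class \<open>k\<close> customer of slot \<open>0\<close> is in service, all customers that arrive after
  the start of this service wait. The bound counts the last \<open>h - (w + y)\<close> slots of a service of length \<open>h\<close>
  and the customers that arrived in the \<open>y\<close> slots after slot \<open>w\<close>.\<close>

lemma waiting_lower_bound:
  "AE \<omega> in M. 0 < A k 0 \<omega> \<and> W k 0 0 \<omega> \<le> w \<and> h k 0 0 \<omega> < q \<longrightarrow>
    of_nat ((h k 0 0 \<omega> - (w + y)) * active_count k (int w) y \<omega>) \<le> (\<Sum>t<q. \<Sum>d<q. waiting k t d \<omega> * serving k t t \<omega>)"
  using single_server_AE AE_streams AE_service_positive
proof eventually_elim
  case (elim \<omega>)
  let ?x = "h k 0 0 \<omega>" and ?Act = "{s \<in> {1..y}. S k (int w + int s) \<omega> \<noteq> 0}"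
  show ?case
  proof
    assume *: "0 < A k 0 \<omega> \<and> W k 0 0 \<omega> \<le> w \<and> ?x < q"
    have serv: "serving k t t \<omega> = 1" if "t \<in> {w + y..<?x}" for t
      using that * by (auto simp: customer_value_def)
    have wait: "of_nat (card ?Act) \<le> (\<Sum>d<q. waiting k t d \<omega>)" if t: "t \<in> {w + y..<?x}" for t
    proof -
      let ?D = "{d \<in> {..<q}. waiting k t d \<omega> = 1}"
      have "(\<lambda>s. t - (w + s)) ` ?Act \<subseteq> ?D"
      proof
        fix d assume "d \<in> (\<lambda>s. t - (w + s)) ` ?Act"
        then obtain s where s: "s \<in> {1..y}" "S k (int w + int s) \<omega> \<noteq> 0" and d: "d = t - (w + s)" by auto
        let ?n = "int w + int s"
        have n: "int t - int d = ?n" using s t d by (auto simp: of_nat_diff)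
        have pres: "0 < A k ?n \<omega>" using elim(2) s(2) by (metis gr0I)
        have "d < W k ?n 0 \<omega>"
        proof (rule ccontr)
          assume "\<not> d < W k ?n 0 \<omega>"
          define u where "u = ?n + int (W k ?n 0 \<omega>)"
          have u: "u \<le> int t" using \<open>\<not> d < W k ?n 0 \<omega>\<close> n unfolding u_def by linarith
          have "0 < h k ?n 0 \<omega>" using elim(3) by blast
          then have "(k, ?n, 0) \<in> in_service A h W u \<omega>" using pres by (simp add: in_service_def u_def)
          moreover have "(k, 0, 0) \<in> in_service A h W u \<omega>"
            using * u t unfolding in_service_def u_def by auto
          ultimately have "(k, ?n, 0 :: nat) = (k, 0, 0)" using elim(1) by blast
          then show False using s(1) by simp
        qed
        then have "waiting k t d \<omega> = 1" using pres by (simp add: customer_value_def n)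
        moreover have "d < q" using d t * by auto
        ultimately show "d \<in> ?D" by simp
      qed
      moreover have "inj_on (\<lambda>s. t - (w + s)) ?Act"
        using t by (auto simp: inj_on_def)
      ultimately have "card ?Act \<le> card ?D" by (intro card_inj_on_le[of "\<lambda>s. t - (w + s)"]) auto
      then have "(of_nat (card ?Act) :: ennreal) \<le> of_nat (card ?D)" by (rule of_nat_mono)
      also have "\<dots> = (\<Sum>d\<in>?D. waiting k t d \<omega>)" by simp
      also have "\<dots> \<le> (\<Sum>d<q. waiting k t d \<omega>)" by (intro sum_mono2) auto
      finally show ?thesis .
    qed
    have "(of_nat ((?x - (w + y)) * active_count k (int w) y \<omega>) :: ennreal) = (\<Sum>t\<in>{w + y..<?x}. of_nat (card ?Act))"
      by (simp add: active_count_def)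
    also have "\<dots> \<le> (\<Sum>t\<in>{w + y..<?x}. \<Sum>d<q. waiting k t d \<omega> * serving k t t \<omega>)"
      using wait serv by (intro sum_mono) simp
    also have "\<dots> \<le> (\<Sum>t<q. \<Sum>d<q. waiting k t d \<omega> * serving k t t \<omega>)"
      using * by (intro sum_mono2) auto
    finally show "of_nat ((?x - (w + y)) * active_count k (int w) y \<omega>) \<le> (\<Sum>t<q. \<Sum>d<q. waiting k t d \<omega> * serving k t t \<omega>)" .
  qed
qed

text \<open>The service time is independent of the waiting time, and it is independent of the arrivals; a
  union bound combines the two.\<close>

lemma long_service_probability:
  assumes y: "4 * R \<le> y" "1 \<le> y"
  shows "pmf (H k) x * (prob {\<omega> \<in> space M. 0 < A k 0 \<omega> \<and> W k 0 0 \<omega> \<le> w} - 2 * p k ^ R)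
    \<le> prob {\<omega> \<in> space M. 0 < A k 0 \<omega> \<and> W k 0 0 \<omega> \<le> w \<and> h k 0 0 \<omega> = x \<and> y \<le> 4 * (R + 1) * active_count k (int w) y \<omega>}"
proof -
  let ?start = "{\<omega> \<in> space M. 0 < A k 0 \<omega> \<and> W k 0 0 \<omega> \<le> w}"
  let ?both = "{\<omega> \<in> space M. 0 < A k 0 \<omega> \<and> W k 0 0 \<omega> \<le> w \<and> h k 0 0 \<omega> = x}"
  let ?bad = "{\<omega> \<in> space M. 4 * (R + 1) * active_count k (int w) y \<omega> < y}"
  let ?badx = "{\<omega> \<in> space M. 4 * (R + 1) * active_count k (int w) y \<omega> < y \<and> h k 0 0 \<omega> = x}"
  have cv: "customer_value k 0 0 f \<omega> = indicator {\<omega> \<in> space M. 0 < A k 0 \<omega> \<and> Q (h k 0 0 \<omega>) (W k 0 0 \<omega>)} \<omega>"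
    if "\<And>x w. f x w = (if Q x w then 1 else 0)" "\<omega> \<in> space M" for f Q \<omega>
    using that by (simp add: customer_value_def indicator_def)
  have sets: "{\<omega> \<in> space M. 0 < A k 0 \<omega> \<and> Q (h k 0 0 \<omega>) (W k 0 0 \<omega>)} \<in> sets M" for Q
  proof -
    let ?f = "\<lambda>x w. if Q x w then 1 else 0 :: ennreal"
    have "{\<omega> \<in> space M. 0 < A k 0 \<omega> \<and> Q (h k 0 0 \<omega>) (W k 0 0 \<omega>)} = {\<omega> \<in> space M. customer_value k 0 0 ?f \<omega> = 1}"
      by (auto simp: customer_value_def)
    also have "\<dots> \<in> sets M" by measurable
    finally show ?thesis .
  qed
  have nn: "(\<integral>\<^sup>+\<omega>. customer_value k 0 0 f \<omega> \<partial>M) = ennreal (prob {\<omega> \<in> space M. 0 < A k 0 \<omega> \<and> Q (h k 0 0 \<omega>) (W k 0 0 \<omega>)})"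
    if f: "\<And>x w. f x w = (if Q x w then 1 else 0)" for f Q
  proof -
    have "(\<integral>\<^sup>+\<omega>. customer_value k 0 0 f \<omega> \<partial>M) = (\<integral>\<^sup>+\<omega>. indicator {\<omega> \<in> space M. 0 < A k 0 \<omega> \<and> Q (h k 0 0 \<omega>) (W k 0 0 \<omega>)} \<omega> \<partial>M)"
      by (intro nn_integral_cong cv[OF f])
    also have "\<dots> = ennreal (prob {\<omega> \<in> space M. 0 < A k 0 \<omega> \<and> Q (h k 0 0 \<omega>) (W k 0 0 \<omega>)})"
      by (subst nn_integral_indicator[OF sets]) (simp add: emeasure_eq_measure)
    finally show ?thesis .
  qed
  have pmf_nn: "(\<integral>\<^sup>+z. (if z = x then 1 else 0) \<partial>measure_pmf (H k)) = ennreal (pmf (H k) x)"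
  proof -
    have "(\<integral>\<^sup>+z. (if z = x then 1 else 0) \<partial>measure_pmf (H k)) = (\<integral>\<^sup>+z. indicator {x} z \<partial>measure_pmf (H k))"
      by (intro nn_integral_cong) auto
    then show ?thesis by (simp add: emeasure_pmf_single)
  qed
  have "ennreal (prob ?both) = (\<integral>\<^sup>+\<omega>. customer_value k 0 0 (\<lambda>z v. (if z = x then 1 else 0) * (if v \<le> w then 1 else 0)) \<omega> \<partial>M)"
    by (subst nn[of _ "\<lambda>z v. v \<le> w \<and> z = x"]) auto
  also have "\<dots> = ennreal (pmf (H k) x) * ennreal (prob ?start)"
    unfolding service_waiting_independent pmf_nn by (subst nn[of _ "\<lambda>z v. v \<le> w"]) auto
  finally have both: "prob ?both = pmf (H k) x * prob ?start"
    by (simp add: ennreal_mult[symmetric])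
  have badx: "prob ?badx = pmf (H k) x * prob ?bad"
  proof -
    let ?V = "\<lambda>\<omega>. indicator {\<omega>. 4 * (R + 1) * active_count k (int w) y \<omega> < y} \<omega> :: ennreal"
    have V: "?V \<in> borel_measurable (others (k, 0, 0))"
    proof -
      have [measurable]: "active_count k (int w) y \<in> measurable (others (k, 0, 0)) (count_space UNIV)"
        by (rule active_count_measurable_gen) (rule others_S)
      show ?thesis unfolding indicator_def by measurable
    qed
    have "ennreal (prob ?badx) = (\<integral>\<^sup>+\<omega>. indicator ?badx \<omega> \<partial>M)" by (simp add: emeasure_eq_measure)
    also have "\<dots> = (\<integral>\<^sup>+\<omega>. ?V \<omega> * (\<lambda>z. if z = x then 1 else 0) (h k 0 0 \<omega>) \<partial>M)"
      by (intro nn_integral_cong) (auto split: split_indicator)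
    also have "\<dots> = (\<integral>\<^sup>+\<omega>. ?V \<omega> \<partial>M) * ennreal (pmf (H k) x)"
      unfolding pmf_nn[symmetric] by (rule service_independent[OF V])
    also have "(\<integral>\<^sup>+\<omega>. ?V \<omega> \<partial>M) = (\<integral>\<^sup>+\<omega>. indicator ?bad \<omega> \<partial>M)"
      by (intro nn_integral_cong) (auto split: split_indicator)
    also have "\<dots> = ennreal (prob ?bad)" by (simp add: emeasure_eq_measure)
    finally show ?thesis by (simp add: ennreal_mult[symmetric] mult.commute)
  qed
  have mb: "?both \<in> sets M" using sets[of "\<lambda>z v. v \<le> w \<and> z = x"] by simp
  have "prob ?both - prob ?badx \<le> prob (?both - ?badx)"
    using finite_measure_Diff'[OF mb, of ?badx] finite_measure_mono[of "?both \<inter> ?badx" ?badx] by simp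
  also have "?both - ?badx = {\<omega> \<in> space M. 0 < A k 0 \<omega> \<and> W k 0 0 \<omega> \<le> w \<and> h k 0 0 \<omega> = x \<and> y \<le> 4 * (R + 1) * active_count k (int w) y \<omega>}"
    by auto
  finally have "pmf (H k) x * prob ?start - pmf (H k) x * prob ?bad
      \<le> prob {\<omega> \<in> space M. 0 < A k 0 \<omega> \<and> W k 0 0 \<omega> \<le> w \<and> h k 0 0 \<omega> = x \<and> y \<le> 4 * (R + 1) * active_count k (int w) y \<omega>}"
    unfolding both badx .
  moreover have "pmf (H k) x * prob ?bad \<le> pmf (H k) x * (2 * p k ^ R)"
    using few_active[OF y, of k "int w"] by (intro mult_left_mono) auto
  ultimately show ?thesis by (simp add: right_diff_distrib)
qed

lemma square_le_quarter_product:
  fixes x w :: nat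
  assumes "4 \<le> x" "4 * w \<le> x"
  shows "x * x \<le> 16 * ((x - (w + x div 4)) * (x div 4))"
proof -
  have d: "x = 4 * (x div 4) + x mod 4" "x mod 4 < 4" by simp_all
  have "1 \<le> x div 4" using assms(1) by (simp add: Suc_le_eq div_greater_zero_iff)
  note d = d this
  have "x \<le> 8 * (x div 4)" using assms d by linarith
  moreover have "x \<le> 2 * (x - (w + x div 4))" using assms d by linarith
  ultimately have "x * x \<le> (2 * (x - (w + x div 4))) * (8 * (x div 4))" by (intro mult_le_mono)
  then show ?thesis by simp
qed

text \<open>A long service keeps a number of arrivals proportional to its length waiting for a time
  proportional to its length. Mean waiting times are hence bounded below by a multiple of the second
  moment of the service times, whatever the order of service.\<close>

lemma mean_total_wait_infinite:
  assumes inf: "(\<integral>\<^sup>+x. of_nat (x choose 2) \<partial>measure_pmf (H k)) = top"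
  shows "mean_total_wait k = top"
proof (rule ccontr)
  assume fin: "mean_total_wait k \<noteq> top"
  let ?start = "\<lambda>w. {\<omega> \<in> space M. 0 < A k 0 \<omega> \<and> W k 0 0 \<omega> \<le> w}"
  have sets: "?start w \<in> sets M" for w
  proof -
    have "?start w = {\<omega> \<in> space M. customer_value k 0 0 (\<lambda>x v. if v \<le> w then 1 else 0) \<omega> = 1}"
      by (auto simp: customer_value_def)
    also have "\<dots> \<in> sets M" by measurable
    finally show ?thesis .
  qed
  obtain w where w: "0 < prob (?start w)"
  proof -
    have "\<exists>w. prob (?start w) \<noteq> 0"
    proof (rule ccontr)
      assume "\<not> ?thesis"
      then have "AE \<omega> in M. \<omega> \<notin> ?start w" for w
        using \<open>\<not> (\<exists>w. prob (?start w) \<noteq> 0)\<close> by (subst prob_eq_0[OF sets, symmetric]) blast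
      then have "AE \<omega> in M. \<forall>w. \<omega> \<notin> ?start w" unfolding AE_all_countable by blast
      then have "AE \<omega> in M. A k 0 \<omega> = 0" using AE_space by eventually_elim auto
      then have "mean_batch k = (\<integral>\<^sup>+\<omega>. 0 \<partial>M)"
        by (intro nn_integral_cong_AE) (auto elim!: eventually_mono)
      then show False using mean_batch_pos[of k] by simp
    qed
    then show ?thesis using that by (auto simp: zero_less_measure_iff)
  qed
  define \<beta> where "\<beta> = prob (?start w)"
  have "(\<lambda>R. p k ^ R) \<longlonglongrightarrow> 0"
    using stream_parameters[of k] by (intro LIMSEQ_realpow_zero) (auto simp: stream_parameters_def)
  then have "\<forall>\<^sub>F R in sequentially. p k ^ R < \<beta> / 4"
    using w by (intro order_tendstoD) (auto simp: \<beta>_def)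
  then obtain R where R: "p k ^ R < \<beta> / 4" by (auto simp: eventually_sequentially)
  \<comment> \<open>idle runs longer than \<open>R\<close> cost at most half of \<open>\<beta>\<close>; from \<open>x0\<close> on, a quarter of the service time is
    long compared with \<open>R\<close> and with \<open>w\<close>\<close>
  define K where "K = 16 * (4 * (R + 1))"
  define x0 where "x0 = 16 * R + 4 * w + 4"
  define E where "E x = {\<omega> \<in> space M. 0 < A k 0 \<omega> \<and> W k 0 0 \<omega> \<le> w \<and> h k 0 0 \<omega> = x \<and> x div 4 \<le> 4 * (R + 1) * active_count k (int w) (x div 4) \<omega>}" for x
  have E_sets: "E x \<in> sets M" for x
  proof -
    have "E x = ?start w \<inter> {\<omega> \<in> space M. h k 0 0 \<omega> = x \<and> x div 4 \<le> 4 * (R + 1) * active_count k (int w) (x div 4) \<omega>}"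
      by (auto simp: E_def)
    also have "\<dots> \<in> sets M" by (rule sets.Int[OF sets]) measurable
    finally show ?thesis .
  qed
  have prob_E: "pmf (H k) x * (\<beta> / 2) \<le> prob (E x)" if "x0 \<le> x" for x
  proof -
    have "4 * R \<le> x div 4" "1 \<le> x div 4" using that unfolding x0_def by linarith+
    from long_service_probability[OF this, of k x w]
    have "pmf (H k) x * (\<beta> - 2 * p k ^ R) \<le> prob (E x)" unfolding E_def \<beta>_def .
    moreover have "pmf (H k) x * (\<beta> / 2) \<le> pmf (H k) x * (\<beta> - 2 * p k ^ R)"
      using R by (intro mult_left_mono) auto
    ultimately show ?thesis by linarith
  qed
  have bound: "(\<Sum>x\<in>{x0..<q}. of_nat (x * x) * ennreal (prob (E x))) \<le> of_nat K * mean_total_wait k" for q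
  proof -
    let ?ws = "\<lambda>\<omega>. \<Sum>t<q. \<Sum>d<q. waiting k t d \<omega> * serving k t t \<omega>"
    have "(\<Sum>x\<in>{x0..<q}. of_nat (x * x) * ennreal (prob (E x))) = (\<integral>\<^sup>+\<omega>. (\<Sum>x\<in>{x0..<q}. of_nat (x * x) * indicator (E x) \<omega>) \<partial>M)"
      using E_sets by (subst nn_integral_sum) (auto simp: nn_integral_cmult_indicator emeasure_eq_measure)
    also have "\<dots> \<le> (\<integral>\<^sup>+\<omega>. of_nat K * ?ws \<omega> \<partial>M)"
    proof (rule nn_integral_mono_AE)
      have "AE \<omega> in M. \<forall>y. 0 < A k 0 \<omega> \<and> W k 0 0 \<omega> \<le> w \<and> h k 0 0 \<omega> < q \<longrightarrow>
          of_nat ((h k 0 0 \<omega> - (w + y)) * active_count k (int w) y \<omega>) \<le> ?ws \<omega>"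
        unfolding AE_all_countable by (intro allI waiting_lower_bound)
      then show "AE \<omega> in M. (\<Sum>x\<in>{x0..<q}. of_nat (x * x) * indicator (E x) \<omega>) \<le> of_nat K * ?ws \<omega>"
      proof eventually_elim
        case (elim \<omega>)
        let ?x = "h k 0 0 \<omega>"
        have z: "indicator (E x) \<omega> = (0 :: ennreal)" if "x \<noteq> ?x" for x using that by (simp add: E_def)
        have s: "(\<Sum>x\<in>{x0..<q}. of_nat (x * x) * indicator (E x) \<omega> :: ennreal)
            = (if ?x \<in> {x0..<q} then of_nat (?x * ?x) * indicator (E ?x) \<omega> else 0)"
        proof -
          have "(\<Sum>x\<in>{x0..<q}. of_nat (x * x) * indicator (E x) \<omega> :: ennreal)
              = (\<Sum>x\<in>{x0..<q}. if x = ?x then of_nat (?x * ?x) * indicator (E ?x) \<omega> else 0)"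
            by (intro sum.cong) (auto simp: z)
          then show ?thesis by (simp only: sum.delta finite_atLeastLessThan)
        qed
        show ?case
        proof (cases "?x \<in> {x0..<q} \<and> \<omega> \<in> E ?x")
          case True
          then have x: "x0 \<le> ?x" "?x < q" and w0: "0 < A k 0 \<omega>" "W k 0 0 \<omega> \<le> w"
            and act: "?x div 4 \<le> 4 * (R + 1) * active_count k (int w) (?x div 4) \<omega>" by (auto simp: E_def)
          let ?n = "active_count k (int w) (?x div 4) \<omega>"
          have "?x * ?x \<le> 16 * ((?x - (w + ?x div 4)) * (?x div 4))"
            using x(1) by (intro square_le_quarter_product) (auto simp: x0_def)
          also have "\<dots> \<le> 16 * ((?x - (w + ?x div 4)) * (4 * (R + 1) * ?n))"
            using act by (intro mult_le_mono2)
          also have "\<dots> = K * ((?x - (w + ?x div 4)) * ?n)" by (simp add: K_def)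
          finally have "(of_nat (?x * ?x) :: ennreal) \<le> of_nat (K * ((?x - (w + ?x div 4)) * ?n))" by (rule of_nat_mono)
          also have "\<dots> = of_nat K * of_nat ((?x - (w + ?x div 4)) * ?n)" by (rule of_nat_mult)
          also have "\<dots> \<le> of_nat K * ?ws \<omega>"
            using elim x(2) w0 by (intro mult_left_mono) auto
          finally show ?thesis unfolding s using True by simp
        next
          case False
          then show ?thesis unfolding s by auto
        qed
      qed
    qed
    also have "\<dots> = of_nat K * (\<integral>\<^sup>+\<omega>. ?ws \<omega> \<partial>M)" by (rule nn_integral_cmult) measurable
    also have "\<dots> \<le> of_nat K * mean_total_wait k"
      by (intro mult_left_mono waiting_during_service) simp
    finally show ?thesis .
  qed
  define g where "g x = (if x0 \<le> x then ennreal (pmf (H k) x) * of_nat (x * x) else 0)" for x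
  have g_bound: "(\<Sum>x<q. g x) * ennreal (\<beta> / 2) \<le> of_nat K * mean_total_wait k" for q
  proof -
    have "(\<Sum>x<q. g x) = (\<Sum>x\<in>{x0..<q}. ennreal (pmf (H k) x) * of_nat (x * x))"
      unfolding g_def by (subst sum.mono_neutral_right[of "{..<q}" "{x0..<q}"]) auto
    then have "(\<Sum>x<q. g x) * ennreal (\<beta> / 2) = (\<Sum>x\<in>{x0..<q}. of_nat (x * x) * ennreal (pmf (H k) x * (\<beta> / 2)))"
    proof (simp only: sum_distrib_right, intro sum.cong refl)
      fix x
      have "ennreal (pmf (H k) x * (\<beta> / 2)) = ennreal (pmf (H k) x) * ennreal (\<beta> / 2)"
        using w by (intro ennreal_mult) (auto simp: \<beta>_def)
      then show "ennreal (pmf (H k) x) * of_nat (x * x) * ennreal (\<beta> / 2) = of_nat (x * x) * ennreal (pmf (H k) x * (\<beta> / 2))"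
        by (simp only: mult_ac)
    qed
    also have "\<dots> \<le> (\<Sum>x\<in>{x0..<q}. of_nat (x * x) * ennreal (prob (E x)))"
      using prob_E by (intro sum_mono mult_left_mono ennreal_leI) auto
    also have "\<dots> \<le> of_nat K * mean_total_wait k" by (rule bound)
    finally show ?thesis .
  qed
  have "(\<Sum>x. g x * ennreal (\<beta> / 2)) \<le> of_nat K * mean_total_wait k"
    using g_bound by (intro suminf_le_const summableI) (simp add: sum_distrib_right)
  moreover have "of_nat K * mean_total_wait k < top"
    using fin by (simp add: ennreal_mult_less_top top.not_eq_extremum of_nat_less_top)
  ultimately have "suminf g * ennreal (\<beta> / 2) < top"
    unfolding ennreal_suminf_multc by (rule le_less_trans)
  then have sg: "suminf g < top" using w by (auto simp: ennreal_mult_less_top \<beta>_def)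
  have "(\<integral>\<^sup>+x. of_nat (x choose 2) \<partial>measure_pmf (H k)) \<le> (\<Sum>x. g x + ennreal (pmf (H k) x) * of_nat (x0 * x0))"
    unfolding nn_integral_measure_pmf nn_integral_count_space_nat
  proof (intro suminf_le summableI)
    fix x :: nat
    have "x * (x - 1) div 2 \<le> x * (x - 1)" by (rule div_le_dividend)
    also have "\<dots> \<le> x * x" by simp
    finally have "x choose 2 \<le> x * x" unfolding choose_two .
    then have le: "ennreal (pmf (H k) x) * of_nat (x choose 2) \<le> ennreal (pmf (H k) x) * of_nat (x * x)"
      by (intro mult_left_mono of_nat_mono) auto
    show "ennreal (pmf (H k) x) * of_nat (x choose 2) \<le> g x + ennreal (pmf (H k) x) * of_nat (x0 * x0)"
    proof (cases "x0 \<le> x")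
      case True
      have "ennreal (pmf (H k) x) * of_nat (x * x) \<le> g x + ennreal (pmf (H k) x) * of_nat (x0 * x0)"
        using True by (simp add: g_def)
      with le show ?thesis by (rule order_trans)
    next
      case False
      then have "ennreal (pmf (H k) x) * of_nat (x * x) \<le> ennreal (pmf (H k) x) * of_nat (x0 * x0)"
        by (intro mult_left_mono of_nat_mono mult_le_mono) auto
      then have "ennreal (pmf (H k) x) * of_nat (x * x) \<le> g x + ennreal (pmf (H k) x) * of_nat (x0 * x0)"
        using False by (simp add: g_def)
      with le show ?thesis by (rule order_trans)
    qed
  qed
  also have "\<dots> = suminf g + (\<Sum>x. ennreal (pmf (H k) x)) * of_nat (x0 * x0)"
    by (simp add: suminf_add[symmetric] summableI)
  also have "(\<Sum>x. ennreal (pmf (H k) x)) = 1"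
    using nn_integral_measure_pmf[of "H k" "\<lambda>_. 1"]
    by (simp add: nn_integral_count_space_nat measure_pmf.emeasure_space_1[simplified])
  also have "suminf g + 1 * of_nat (x0 * x0) < top" using sg by (simp add: of_nat_less_top flip: of_nat_mult)
  finally show False using inf by simp
qed

section \<open>The quantities of the formula\<close>

lemma active_probability_idle: "(\<integral>\<^sup>+\<omega>. active k 0 \<omega> \<partial>M) = ennreal (1 - idle_prob k)"
proof -
  have "(\<integral>\<^sup>+\<omega>. active k 0 \<omega> \<partial>M) = (\<integral>\<^sup>+\<omega>. indicator (space M - {\<omega> \<in> space M. S k 0 \<omega> = 0}) \<omega> \<partial>M)"
    by (intro nn_integral_cong) (auto split: split_indicator)
  also have "\<dots> = ennreal (prob (space M - {\<omega> \<in> space M. S k 0 \<omega> = 0}))"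
    by (subst nn_integral_indicator) (auto simp: emeasure_eq_measure)
  also have "prob (space M - {\<omega> \<in> space M. S k 0 \<omega> = 0}) = 1 - idle_prob k" by (rule prob_compl) measurable
  finally show ?thesis .
qed

lemma active_prob_pos: "0 < 1 - idle_prob k"
proof -
  have "ennreal (idle_prob k * (1 - p k)) \<le> ennreal (1 - idle_prob k)"
    unfolding start_probability[symmetric] active_probability_idle[symmetric]
    by (intro nn_integral_mono) (auto split: split_indicator)
  then have "idle_prob k * (1 - p k) \<le> 1 - idle_prob k" by (subst (asm) ennreal_le_iff) auto
  then show ?thesis using start_probability_pos[of k] by linarith
qed

text \<open>A quantity that vanishes when slot \<open>0\<close> is idle carries the second half of the condition that a
  period begins in slot \<open>0\<close>.\<close>

lemma active_period_integral:
  assumes [measurable]: "f \<in> measurable M (count_space UNIV)"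
    and 0: "\<And>\<omega>. \<forall>n. \<exists>c. S k (n + 1 + int c) \<omega> = 0 \<Longrightarrow> S k 0 \<omega> = 0 \<Longrightarrow> f \<omega> = 0"
  shows "(\<integral>\<^sup>+\<omega>. of_nat (f \<omega>) \<partial>active_period M (S k))
    = (\<integral>\<^sup>+\<omega>. of_nat (f \<omega>) * idle k (- 1) \<omega> \<partial>M) / ennreal (idle_prob k * (1 - p k))"
proof -
  let ?st = "{\<omega> \<in> space M. S k (- 1) \<omega> = 0 \<and> S k 0 \<omega> \<noteq> 0}"
  have "emeasure M ?st = (\<integral>\<^sup>+\<omega>. indicator ?st \<omega> \<partial>M)" by simp
  also have "\<dots> = (\<integral>\<^sup>+\<omega>. idle k (- 1) \<omega> * active k 0 \<omega> \<partial>M)"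
    by (intro nn_integral_cong) (auto split: split_indicator)
  finally have st: "emeasure M ?st = ennreal (idle_prob k * (1 - p k))" unfolding start_probability .
  have "(\<integral>\<^sup>+\<omega>. of_nat (f \<omega>) \<partial>active_period M (S k)) = (\<integral>\<^sup>+\<omega>. of_nat (f \<omega>) * indicator ?st \<omega> \<partial>M) / emeasure M ?st"
    unfolding active_period_def by (rule nn_integral_uniform_measure) measurable
  also have "(\<integral>\<^sup>+\<omega>. of_nat (f \<omega>) * indicator ?st \<omega> \<partial>M) = (\<integral>\<^sup>+\<omega>. of_nat (f \<omega>) * idle k (- 1) \<omega> \<partial>M)"
  proof (rule nn_integral_cong_AE)
    show "AE \<omega> in M. of_nat (f \<omega>) * indicator ?st \<omega> = (of_nat (f \<omega>) * idle k (- 1) \<omega> :: ennreal)"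
      using AE_returns AE_space
    proof eventually_elim
      case (elim \<omega>)
      then have "S k 0 \<omega> = 0 \<Longrightarrow> f \<omega> = 0" using 0 by blast
      then show ?case using elim(2) by (auto split: split_indicator)
    qed
  qed
  finally show ?thesis unfolding st .
qed

lemma period_measurable[measurable]:
  "period_length (S k) \<in> measurable M (count_space UNIV)" "period_arrivals (S k) (A k) \<in> measurable M (count_space UNIV)"
  "forward_arrivals (S k) (A k) \<in> measurable M (count_space UNIV)"
proof -
  have "period_length (S k) = (\<lambda>\<omega>. rtime k (- 1) \<omega>)" "period_arrivals (S k) (A k) = (\<lambda>\<omega>. rarrivals k (- 1) \<omega>)"
    "forward_arrivals (S k) (A k) = (\<lambda>\<omega>. rarrivals k 0 \<omega>)"
    by (auto simp: period_length_eq period_arrivals_eq forward_arrivals_eq)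
  then show "period_length (S k) \<in> measurable M (count_space UNIV)" "period_arrivals (S k) (A k) \<in> measurable M (count_space UNIV)"
    "forward_arrivals (S k) (A k) \<in> measurable M (count_space UNIV)" by simp_all
qed

lemma period_zero:
  assumes "\<forall>n. \<exists>c. S k (n + 1 + int c) \<omega> = 0" "S k 0 \<omega> = 0"
  shows "rtime k (- 1) \<omega> = 0" "rarrivals k (- 1) \<omega> = 0"
proof -
  have "\<exists>c. S k (n + 1 + int c) \<omega> = 0" for n using assms(1) by blast
  from recurrence_time_inactive[of "\<lambda>i. S k i \<omega>" "- 1", OF this] assms(2)
  show "rtime k (- 1) \<omega> = 0" by simp
  then show "rarrivals k (- 1) \<omega> = 0" by (simp add: recurrence_arrivals_def)
qed

lemma mean_period_length:
  "(\<integral>\<^sup>+\<omega>. of_nat (period_length (S k) \<omega>) \<partial>active_period M (S k)) = ennreal ((1 - idle_prob k) / (idle_prob k * (1 - p k)))"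
proof -
  have "(\<integral>\<^sup>+\<omega>. of_nat (period_length (S k) \<omega>) \<partial>active_period M (S k))
      = (\<integral>\<^sup>+\<omega>. of_nat (period_length (S k) \<omega>) * idle k (- 1) \<omega> \<partial>M) / ennreal (idle_prob k * (1 - p k))"
    by (rule active_period_integral) (simp_all add: period_length_eq period_zero)
  also have "(\<integral>\<^sup>+\<omega>. of_nat (period_length (S k) \<omega>) * idle k (- 1) \<omega> \<partial>M) = ennreal (1 - idle_prob k)"
    unfolding period_length_eq Palm_length active_probability_idle ..
  finally show ?thesis using start_probability_pos[of k] active_prob_pos[of k] by (simp add: divide_ennreal)
qed

lemma mean_period_arrivals:
  "(\<integral>\<^sup>+\<omega>. of_nat (period_arrivals (S k) (A k) \<omega>) \<partial>active_period M (S k)) = mean_batch k / ennreal (idle_prob k * (1 - p k))"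
proof -
  have "(\<integral>\<^sup>+\<omega>. of_nat (period_arrivals (S k) (A k) \<omega>) \<partial>active_period M (S k))
      = (\<integral>\<^sup>+\<omega>. of_nat (period_arrivals (S k) (A k) \<omega>) * idle k (- 1) \<omega> \<partial>M) / ennreal (idle_prob k * (1 - p k))"
    by (rule active_period_integral) (simp_all add: period_arrivals_eq period_zero)
  then show ?thesis unfolding period_arrivals_eq Palm_arrivals .
qed

lemma start_factors: "idle_prob k \<noteq> 0" "1 - p k \<noteq> 0"
  using start_probability_pos[of k] by fastforce+

text \<open>The mean length of a cycle of an idle and an active period is the reciprocal of the frequency
  with which active periods begin.\<close>

lemma cycle_length: "1 / (1 - p k) + (1 - idle_prob k) / (idle_prob k * (1 - p k)) = 1 / (idle_prob k * (1 - p k))"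
proof -
  have "1 / (1 - p k) = idle_prob k / (idle_prob k * (1 - p k))" using start_factors(1)[of k] by simp
  then show ?thesis by (simp only: add_divide_distrib[symmetric]) simp
qed

lemma active_probability_eq: "active_probability M (p k) (S k) = ereal (1 - idle_prob k)"
proof -
  have EC: "mean (active_period M (S k)) (period_length (S k)) = ereal ((1 - idle_prob k) / (idle_prob k * (1 - p k)))"
    unfolding mean_def mean_period_length using start_probability_pos[of k] active_prob_pos[of k]
    by (intro enn2ereal_ennreal) auto
  show ?thesis
    unfolding active_probability_def EC plus_ereal.simps(1) cycle_length
    using start_factors[of k] by simp
qed

lemma arrival_rate_eq: "arrival_rate M (p k) (S k) (A k) = enn2ereal (mean_batch k)"
proof -
  have EC: "mean (active_period M (S k)) (period_length (S k)) = ereal ((1 - idle_prob k) / (idle_prob k * (1 - p k)))"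
    unfolding mean_def mean_period_length using start_probability_pos[of k] active_prob_pos[of k]
    by (intro enn2ereal_ennreal) auto
  have EL: "mean (active_period M (S k)) (period_arrivals (S k) (A k)) = enn2ereal (mean_batch k / ennreal (idle_prob k * (1 - p k)))"
    unfolding mean_def mean_period_arrivals ..
  let ?st = "idle_prob k * (1 - p k)"
  have st: "0 < ?st" by (rule start_probability_pos)
  show ?thesis
  proof (cases "mean_batch k")
    case (real r)
    then show ?thesis
      unfolding arrival_rate_def EC EL plus_ereal.simps(1) cycle_length
      using st start_factors[of k] by (simp add: divide_ennreal enn2ereal_ennreal del: times_divide_eq_right)
  next
    case top
    then have "mean_batch k / ennreal ?st = top" using st by (simp add: ennreal_top_divide)
    then show ?thesis
      unfolding arrival_rate_def EC EL plus_ereal.simps(1) cycle_length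
      using st top by (simp add: top_ereal_def divide_ereal_def)
  qed
qed

lemma load_eq: "load M (p k) (H k) (S k) (A k) = enn2ereal (mean_batch k * mean_service k)"
  unfolding load_def arrival_rate_eq mean_def by (simp add: times_ennreal.rep_eq)

end

context stable_queue
begin

abbreviation \<pi>on :: "'k \<Rightarrow> real" where "\<pi>on k \<equiv> 1 - idle_prob k"
abbreviation start :: "'k \<Rightarrow> real" where "start k \<equiv> idle_prob k * (1 - p k)"
abbreviation service_pairs :: "'k \<Rightarrow> ennreal" where
  "service_pairs k \<equiv> \<integral>\<^sup>+x. of_nat (x choose 2) \<partial>measure_pmf (H k)"
abbreviation batch_pairs :: "'k \<Rightarrow> ennreal" where
  "batch_pairs k \<equiv> \<integral>\<^sup>+\<omega>. of_nat (A k 0 \<omega> choose 2) \<partial>M"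

lemma square_choose: "x\<^sup>2 = 2 * (x choose 2) + x" for x :: nat
  using times_binomial_minus1_eq[of 2 x] by (cases x) (auto simp: power2_eq_square algebra_simps)

lemma work_square_eq: "work_square k = ennreal (rate k) * (2 * service_pairs k + ennreal (service_mean k))
    + ennreal ((service_mean k)\<^sup>2) * (2 * batch_pairs k)"
proof -
  have "(\<integral>\<^sup>+x. of_nat (x\<^sup>2) \<partial>measure_pmf (H k)) = (\<integral>\<^sup>+x. 2 * of_nat (x choose 2) + of_nat x \<partial>measure_pmf (H k))"
    by (intro nn_integral_cong) (simp only: square_choose of_nat_add of_nat_mult of_nat_numeral)
  also have "\<dots> = 2 * service_pairs k + mean_service k"
    by (simp add: nn_integral_add nn_integral_cmult)
  finally have 1: "(\<integral>\<^sup>+x. of_nat (x\<^sup>2) \<partial>measure_pmf (H k)) = 2 * service_pairs k + ennreal (service_mean k)"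
    unfolding mean_service_eq .
  have 2: "(\<integral>\<^sup>+\<omega>. of_nat (2 * (A k 0 \<omega> choose 2)) \<partial>M) = 2 * batch_pairs k"
    by (simp add: nn_integral_cmult)
  show ?thesis
    unfolding mean_square_class_work 1 2 mean_batch_eq mean_service_eq
    using service_mean_ge_1[of k] by (simp add: power2_eq_square ennreal_mult)
qed

lemma load_real: "load M (p k) (H k) (S k) (A k) = ereal (class_load k)"
proof -
  have "mean_batch k * mean_service k = ennreal (class_load k)"
    unfolding mean_batch_eq mean_service_eq class_load_def
    using rate_pos[of k] service_mean_ge_1[of k] by (simp add: ennreal_mult)
  then show ?thesis unfolding load_eq using class_load_pos[of k] by (simp add: enn2ereal_ennreal less_imp_le)
qed

lemma mean_service_real: "mean (measure_pmf (H k)) (\<lambda>x. x) = ereal (service_mean k)"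
  unfolding mean_def mean_service_eq using service_mean_ge_1[of k] by (intro enn2ereal_ennreal) simp

lemma equilibrium_service: "equilibrium_mean (measure_pmf (H k)) (\<lambda>x. x) = enn2ereal (service_pairs k / ennreal (service_mean k))"
  by (subst equilibrium_mean_eq) (simp_all add: mean_service_eq)

lemma mean_length_real: "mean (active_period M (S k)) (period_length (S k)) = ereal (\<pi>on k / start k)"
  unfolding mean_def mean_period_length using start_probability_pos[of k] active_prob_pos[of k]
  by (intro enn2ereal_ennreal) auto

lemma equilibrium_length: "equilibrium_mean (active_period M (S k)) (period_length (S k)) = ereal (active_time k / \<pi>on k - 1)"
proof -
  let ?C = "\<lambda>\<omega>. rtime k (- 1) \<omega>"
  let ?c2 = "\<integral>\<^sup>+\<omega>. of_nat (?C \<omega> choose 2) * idle k (- 1) \<omega> \<partial>M"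
  have q: "0 < \<pi>on k" by (rule active_prob_pos)
  have st: "0 < start k" by (rule start_probability_pos)
  have "ennreal (active_time k) = (\<integral>\<^sup>+\<omega>. of_nat (?C \<omega>) * idle k (- 1) \<omega> + of_nat (?C \<omega> choose 2) * idle k (- 1) \<omega> \<partial>M)"
    unfolding nn_active_time[symmetric] Palm_length_choose[symmetric] by (simp add: distrib_right)
  also have "\<dots> = ennreal (\<pi>on k) + ?c2"
    unfolding active_probability_idle[of k, symmetric] Palm_length[symmetric]
    by (rule nn_integral_add) measurable
  finally have e: "ennreal (active_time k) = ennreal (\<pi>on k) + ?c2" .
  obtain r where r: "?c2 = ennreal r" "0 \<le> r"
  proof (cases "?c2")
    case top
    have "ennreal (active_time k) = top" unfolding e top by simp
    then show ?thesis using ennreal_neq_top by blast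
  qed (use that in blast)
  have "ennreal (active_time k) = ennreal (\<pi>on k + r)"
    unfolding e r(1) using r(2) q by (intro ennreal_plus[symmetric]) auto
  then have ar: "active_time k = \<pi>on k + r" using phase_means_nonneg(1)[of k] r(2) q by (subst (asm) ennreal_inj) auto
  have c2: "(\<integral>\<^sup>+\<omega>. of_nat (period_length (S k) \<omega> choose 2) \<partial>active_period M (S k)) = ennreal (r / start k)"
  proof -
    have "(\<integral>\<^sup>+\<omega>. of_nat (period_length (S k) \<omega> choose 2) \<partial>active_period M (S k))
        = (\<integral>\<^sup>+\<omega>. of_nat (period_length (S k) \<omega> choose 2) * idle k (- 1) \<omega> \<partial>M) / ennreal (start k)"
      by (rule active_period_integral) (simp_all add: period_length_eq period_zero)
    also have "\<dots> = ennreal (r / start k)" unfolding period_length_eq r(1) using st r(2) by (simp add: divide_ennreal)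
    finally show ?thesis .
  qed
  have "period_length (S k) \<in> measurable (active_period M (S k)) (count_space UNIV)"
    unfolding active_period_def by simp
  then have "equilibrium_mean (active_period M (S k)) (period_length (S k)) = enn2ereal (ennreal (r / start k) / ennreal (\<pi>on k / start k))"
    by (subst equilibrium_mean_eq) (simp_all only: c2 mean_period_length)
  also have "ennreal (r / start k) / ennreal (\<pi>on k / start k) = ennreal ((r / start k) / (\<pi>on k / start k))"
    using st q r(2) by (intro divide_ennreal) auto
  also have "(r / start k) / (\<pi>on k / start k) = r / \<pi>on k" using start_factors[of k] by simp
  also have "\<dots> = active_time k / \<pi>on k - 1" unfolding ar using q by (simp add: add_divide_distrib)
  finally have "equilibrium_mean (active_period M (S k)) (period_length (S k))
      = enn2ereal (ennreal (active_time k / \<pi>on k - 1))" .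
  moreover have "0 \<le> active_time k / \<pi>on k - 1" unfolding ar using q r(2) by simp
  ultimately show ?thesis by (simp only: enn2ereal_ennreal)
qed

lemma equilibrium_arrivals:
  "equilibrium_mean (active_period M (S k)) (period_arrivals (S k) (A k)) = enn2ereal ((batch_pairs k + ennreal (batch_arrivals k)) / ennreal (rate k))"
proof -
  let ?L = "\<lambda>\<omega>. rarrivals k (- 1) \<omega>"
  let ?l2 = "\<integral>\<^sup>+\<omega>. of_nat (?L \<omega> choose 2) * idle k (- 1) \<omega> \<partial>M"
  have st: "0 < start k" by (rule start_probability_pos)
  have "2 * ?l2 + ennreal (rate k) = (\<integral>\<^sup>+\<omega>. 2 * (of_nat (?L \<omega> choose 2) * idle k (- 1) \<omega>) + of_nat (?L \<omega>) * idle k (- 1) \<omega> \<partial>M)"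
    by (subst nn_integral_add) (auto simp: nn_integral_cmult Palm_arrivals mean_batch_eq)
  also have "\<dots> = (\<integral>\<^sup>+\<omega>. of_nat ((?L \<omega>)\<^sup>2) * idle k (- 1) \<omega> \<partial>M)"
    by (intro nn_integral_cong) (simp only: square_choose of_nat_add of_nat_mult of_nat_numeral distrib_right mult.assoc)
  also have "\<dots> = (\<integral>\<^sup>+\<omega>. of_nat ((A k 0 \<omega>)\<^sup>2) \<partial>M) + 2 * ennreal (batch_arrivals k)"
    unfolding Palm_arrivals_square nn_batch_arrivals ..
  also have "(\<integral>\<^sup>+\<omega>. of_nat ((A k 0 \<omega>)\<^sup>2) \<partial>M) = (\<integral>\<^sup>+\<omega>. 2 * of_nat (A k 0 \<omega> choose 2) + of_nat (A k 0 \<omega>) \<partial>M)"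
    by (intro nn_integral_cong) (simp only: square_choose of_nat_add of_nat_mult of_nat_numeral)
  also have "\<dots> = 2 * batch_pairs k + ennreal (rate k)"
    by (subst nn_integral_add) (auto simp: nn_integral_cmult mean_batch_eq)
  finally have "ennreal (rate k) + 2 * ?l2 = ennreal (rate k) + 2 * (batch_pairs k + ennreal (batch_arrivals k))"
    by (simp add: distrib_left add_ac)
  then have "2 * ?l2 = 2 * (batch_pairs k + ennreal (batch_arrivals k))" by (simp only: ennreal_add_left_cancel) simp
  then have l2: "?l2 = batch_pairs k + ennreal (batch_arrivals k)"
    unfolding ennreal_mult_cancel_left[of 2] by simp
  have c2: "(\<integral>\<^sup>+\<omega>. of_nat (period_arrivals (S k) (A k) \<omega> choose 2) \<partial>active_period M (S k)) = ?l2 / ennreal (start k)"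
  proof -
    have "(\<integral>\<^sup>+\<omega>. of_nat (period_arrivals (S k) (A k) \<omega> choose 2) \<partial>active_period M (S k))
        = (\<integral>\<^sup>+\<omega>. of_nat (period_arrivals (S k) (A k) \<omega> choose 2) * idle k (- 1) \<omega> \<partial>M) / ennreal (start k)"
      by (rule active_period_integral) (simp_all add: period_arrivals_eq period_zero)
    then show ?thesis unfolding period_arrivals_eq .
  qed
  have "period_arrivals (S k) (A k) \<in> measurable (active_period M (S k)) (count_space UNIV)"
    unfolding active_period_def by simp
  then have "equilibrium_mean (active_period M (S k)) (period_arrivals (S k) (A k))
      = enn2ereal ((?l2 / ennreal (start k)) / (ennreal (rate k) / ennreal (start k)))"
    by (subst equilibrium_mean_eq) (simp_all only: c2 mean_period_arrivals mean_batch_eq)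
  also have "(?l2 / ennreal (start k)) / (ennreal (rate k) / ennreal (start k)) = ?l2 / ennreal (rate k)"
  proof (cases "?l2")
    case (real l)
    then show ?thesis using st start_factors[of k] rate_pos[of k] by (simp add: divide_ennreal)
  next
    case top
    then show ?thesis using st start_factors[of k] rate_pos[of k] by (simp add: divide_ennreal ennreal_top_divide)
  qed
  finally show ?thesis unfolding l2 .
qed

lemma mean_product_real:
  "mean (active_period M (S k)) (\<lambda>\<omega>. period_length (S k) \<omega> * period_arrivals (S k) (A k) \<omega>)
    = ereal ((batch_time k + active_arrivals k) / start k)"
proof -
  have "(\<integral>\<^sup>+\<omega>. of_nat (period_length (S k) \<omega> * period_arrivals (S k) (A k) \<omega>) \<partial>active_period M (S k))
      = (\<integral>\<^sup>+\<omega>. of_nat (period_length (S k) \<omega> * period_arrivals (S k) (A k) \<omega>) * idle k (- 1) \<omega> \<partial>M) / ennreal (start k)"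
    by (rule active_period_integral) (simp_all add: period_length_eq period_zero)
  also have "\<dots> = (ennreal (batch_time k) + ennreal (active_arrivals k)) / ennreal (start k)"
    unfolding period_length_eq period_arrivals_eq Palm_product nn_batch_time nn_active_arrivals ..
  also have "\<dots> = ennreal ((batch_time k + active_arrivals k) / start k)"
    using start_probability_pos[of k] phase_means_nonneg[of k] by (simp add: divide_ennreal flip: ennreal_plus)
  finally show ?thesis
    unfolding mean_def using start_probability_pos[of k] phase_means_nonneg[of k]
    by (simp only:) (intro enn2ereal_ennreal divide_nonneg_pos add_nonneg_nonneg)
qed

lemma mean_forward_real: "mean (active_slot M (S k)) (forward_arrivals (S k) (A k)) = ereal (active_arrivals k / \<pi>on k)"
proof -
  let ?a = "{\<omega> \<in> space M. S k 0 \<omega> \<noteq> 0}"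
  have e: "emeasure M ?a = ennreal (\<pi>on k)"
  proof -
    have "emeasure M ?a = (\<integral>\<^sup>+\<omega>. indicator ?a \<omega> \<partial>M)" by simp
    also have "\<dots> = (\<integral>\<^sup>+\<omega>. active k 0 \<omega> \<partial>M)" by (intro nn_integral_cong) (auto split: split_indicator)
    finally show ?thesis unfolding active_probability_idle .
  qed
  have "(\<integral>\<^sup>+\<omega>. of_nat (forward_arrivals (S k) (A k) \<omega>) \<partial>active_slot M (S k))
      = (\<integral>\<^sup>+\<omega>. of_nat (forward_arrivals (S k) (A k) \<omega>) * indicator ?a \<omega> \<partial>M) / emeasure M ?a"
    unfolding active_slot_def by (rule nn_integral_uniform_measure) measurable
  also have "(\<integral>\<^sup>+\<omega>. of_nat (forward_arrivals (S k) (A k) \<omega>) * indicator ?a \<omega> \<partial>M) = (\<integral>\<^sup>+\<omega>. active k 0 \<omega> * of_nat (rarrivals k 0 \<omega>) \<partial>M)"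
    unfolding forward_arrivals_eq by (intro nn_integral_cong) (auto split: split_indicator)
  also have "\<dots> = ennreal (active_arrivals k)"
    using Markov_recurrence_arrivals[OF past_active[OF order_refl, of k 0]] nn_active_arrivals by simp
  also have "ennreal (active_arrivals k) / emeasure M ?a = ennreal (active_arrivals k / \<pi>on k)"
    unfolding e using active_prob_pos[of k] phase_means_nonneg(2)[of k] by (intro divide_ennreal) auto
  finally show ?thesis
    unfolding mean_def using active_prob_pos[of k] phase_means_nonneg(2)[of k]
    by (simp only:) (intro enn2ereal_ennreal divide_nonneg_pos)
qed

lemma mean_waiting_eq: "mean_waiting_time M (A k) (W k) = enn2ereal (mean_total_wait k) / ereal (rate k)"
proof -
  have "mean M (A k 0) = ereal (rate k)"
    unfolding mean_def mean_batch_eq using rate_pos[of k] by (intro enn2ereal_ennreal) simp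
  then have "mean_waiting_time M (A k) (W k) = mean M (\<lambda>\<omega>. \<Sum>i<A k 0 \<omega>. W k 0 i \<omega>) / ereal (rate k)"
    unfolding mean_waiting_time_def by (rule arg_cong)
  then show ?thesis unfolding mean_def mean_total_wait_eq .
qed

section \<open>The mean waiting times\<close>

text \<open>
  With finite second moments, the two expressions for the mean unfinished work are equated. In the
  real numbers that remain, \<open>wt\<close> is the mean total waiting time of the customers that
  arrive in one slot, and \<open>H2\<close> and \<open>A2\<close> count pairs in a service time and in a batch.
\<close>

lemma mean_wait_identity:
  fixes wt H2 A2 :: "'k \<Rightarrow> real"
  assumes wt: "\<And>k. mean_total_wait k = ennreal (wt k)" "\<And>k. 0 \<le> wt k"
    and H2: "\<And>k. service_pairs k = ennreal (H2 k)" "\<And>k. 0 \<le> H2 k"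
    and A2: "\<And>k. batch_pairs k = ennreal (A2 k)" "\<And>k. 0 \<le> A2 k"
  shows "(\<Sum>k\<in>UNIV. service_mean k * wt k)
    = total_load * (\<Sum>k\<in>UNIV. rate k * H2 k) / (1 - total_load)
      + (\<Sum>k\<in>UNIV. class_load k * (total_load - class_load k)) / (2 * (1 - total_load))
      + (\<Sum>k\<in>UNIV. (service_mean k)\<^sup>2 * (A2 k + batch_arrivals k)
          - class_load k * service_mean k * (batch_time k + active_arrivals k)) / (1 - total_load)
      + (\<Sum>k\<in>UNIV. class_load k * (1 + class_load k / (1 - total_load)) * active_time k)
      - (\<Sum>k\<in>UNIV. service_mean k * active_arrivals k)"
proof -
  let ?s = service_mean and ?c = class_load and ?\<rho> = total_load
  note nn = rate_pos service_mean_ge_1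
  have pos: "0 \<le> ?s k * wt k + rate k * (?s k + H2 k)" for k
    using nn[of k] wt(2)[of k] H2(2)[of k] by (intro add_nonneg_nonneg mult_nonneg_nonneg) auto
  have ws: "work_square k = ennreal (rate k * (2 * H2 k + ?s k) + (?s k)\<^sup>2 * (2 * A2 k))" for k
  proof -
    have r: "0 \<le> rate k" and s: "0 \<le> ?s k" using nn[of k] by auto
    have "2 * ennreal (H2 k) + ennreal (?s k) = ennreal (2 * H2 k + ?s k)"
      using H2(2)[of k] s by (simp add: ennreal_mult' ennreal_plus)
    moreover have "2 * ennreal (A2 k) = ennreal (2 * A2 k)" using A2(2)[of k] by (simp add: ennreal_mult')
    ultimately show ?thesis
      unfolding work_square_eq H2(1) A2(1)
      using r s H2(2)[of k] A2(2)[of k] by (simp add: ennreal_mult[symmetric] ennreal_plus[symmetric] del: ennreal_plus)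
  qed
  then have "work_square k < top" for k by simp
  then obtain x where x: "(\<integral>\<^sup>+\<omega>. of_nat (backlog 0 \<omega>) \<partial>M) = ennreal x" "0 \<le> x"
    "2 * (1 - ?\<rho>) * x = ?\<rho> * (1 - ?\<rho>)
      + (\<Sum>k\<in>UNIV. enn2real (work_square k) + 2 * ?s k * (?s k * batch_arrivals k - ?c k * batch_time k)
        - 2 * ?c k * (?s k * active_arrivals k - ?c k * active_time k) - (?c k)\<^sup>2)
      - 2 * (1 - ?\<rho>) * (\<Sum>k\<in>UNIV. ?s k * active_arrivals k - ?c k * active_time k)"
    by (rule mean_backlog_formula)
  have ws': "enn2real (work_square k) = rate k * (2 * H2 k + ?s k) + (?s k)\<^sup>2 * (2 * A2 k)" for k
    unfolding ws using nn[of k] H2(2)[of k] A2(2)[of k] by (intro enn2real_ennreal) auto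
  have "ennreal x = (\<Sum>k\<in>UNIV. ennreal (?s k * wt k + rate k * (?s k + H2 k)))"
    unfolding x(1)[symmetric] mean_backlog_waiting
  proof (intro sum.cong refl)
    fix k
    have r: "0 \<le> rate k" and s: "0 \<le> ?s k" using nn[of k] by auto
    show "mean_service k * mean_total_wait k + mean_batch k * (mean_service k + service_pairs k)
        = ennreal (?s k * wt k + rate k * (?s k + H2 k))"
      unfolding mean_service_eq mean_batch_eq H2(1) wt(1)
      using r s H2(2)[of k] wt(2)[of k] by (simp add: ennreal_mult[symmetric] ennreal_plus[symmetric] del: ennreal_plus)
  qed
  also have "\<dots> = ennreal (\<Sum>k\<in>UNIV. ?s k * wt k + rate k * (?s k + H2 k))"
    using pos by (intro sum_ennreal)
  finally have x': "x = (\<Sum>k\<in>UNIV. ?s k * wt k + rate k * (?s k + H2 k))"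
    using x(2) pos by (subst (asm) ennreal_inj) (auto intro!: sum_nonneg)
  \<comment> \<open>with the sums over the classes as atoms, a polynomial identity remains\<close>
  define X where "X = (\<Sum>k\<in>UNIV. ?s k * wt k)"
  define Q where "Q = (\<Sum>k\<in>UNIV. rate k * H2 k)"
  define G where "G = (\<Sum>k\<in>UNIV. (?s k)\<^sup>2 * (A2 k + batch_arrivals k) - ?c k * ?s k * (batch_time k + active_arrivals k))"
  define C where "C = (\<Sum>k\<in>UNIV. (?c k)\<^sup>2)"
  define V where "V = (\<Sum>k\<in>UNIV. ?c k * active_time k)"
  define V2 where "V2 = (\<Sum>k\<in>UNIV. (?c k)\<^sup>2 * active_time k)"
  define U where "U = (\<Sum>k\<in>UNIV. ?s k * active_arrivals k)"
  have tot: "(\<Sum>k\<in>UNIV. ?c k) = ?\<rho>" by (simp add: total_load_def)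
  have D: "0 < 1 - ?\<rho>" using total_load_less_1 by simp
  have e1: "x = X + ?\<rho> + Q"
    unfolding x' X_def Q_def tot[symmetric] sum.distrib[symmetric]
    by (intro sum.cong refl) (simp add: class_load_def algebra_simps)
  have e2: "(\<Sum>k\<in>UNIV. enn2real (work_square k) + 2 * ?s k * (?s k * batch_arrivals k - ?c k * batch_time k)
        - 2 * ?c k * (?s k * active_arrivals k - ?c k * active_time k) - (?c k)\<^sup>2)
      = 2 * Q + ?\<rho> + 2 * G + 2 * V2 - C"
    unfolding ws' Q_def tot[symmetric] G_def V2_def C_def sum_distrib_left sum.distrib[symmetric] sum_subtractf[symmetric]
    by (intro sum.cong refl) (simp add: class_load_def algebra_simps power2_eq_square)
  have e3: "(\<Sum>k\<in>UNIV. ?s k * active_arrivals k - ?c k * active_time k) = U - V"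
    by (simp add: U_def V_def sum_subtractf)
  have e4: "(\<Sum>k\<in>UNIV. ?c k * (?\<rho> - ?c k)) = ?\<rho> * ?\<rho> - C"
    by (simp add: C_def right_diff_distrib sum_subtractf power2_eq_square flip: sum_distrib_right tot)
  have e5: "(\<Sum>k\<in>UNIV. ?c k * (1 + ?c k / (1 - ?\<rho>)) * active_time k) = V + V2 / (1 - ?\<rho>)"
    unfolding V_def V2_def sum_divide_distrib sum.distrib[symmetric]
    by (intro sum.cong refl) (simp add: algebra_simps power2_eq_square)
  define d where "d = 1 - ?\<rho>"
  then have \<rho>: "?\<rho> = 1 - d" and d: "0 < d" using D by auto
  have main: "2 * d * (X + ?\<rho> + Q) = ?\<rho> * d + (2 * Q + ?\<rho> + 2 * G + 2 * V2 - C) - 2 * d * (U - V)"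
    using x(3) unfolding e1 e2 e3 d_def .
  have "2 * d * X = 2 * d * (?\<rho> * Q / d + (?\<rho> * ?\<rho> - C) / (2 * d) + G / d + (V + V2 / d) - U)"
  proof -
    have "2 * d * (?\<rho> * Q / d + (?\<rho> * ?\<rho> - C) / (2 * d) + G / d + (V + V2 / d) - U)
        = 2 * ?\<rho> * Q + (?\<rho> * ?\<rho> - C) + 2 * G + (2 * d * V + 2 * V2) - 2 * d * U"
      using d by (simp add: field_simps)
    then show ?thesis using main unfolding \<rho> by (simp add: algebra_simps)
  qed
  then have "X = ?\<rho> * Q / d + (?\<rho> * ?\<rho> - C) / (2 * d) + G / d + (V + V2 / d) - U" using d by simp
  then show ?thesis unfolding e4 e5 X_def[symmetric] Q_def[symmetric] G_def[symmetric] U_def[symmetric] d_def .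
qed

text \<open>An infinite second moment of the service times makes customers of the same class wait. An infinite
  second moment of the batches makes the mean unfinished work infinite, and if the service times have
  finite second moments, only waiting times can be responsible.\<close>

lemma mean_total_wait_top:
  assumes "service_pairs k = top \<or> batch_pairs k = top"
  obtains l where "mean_total_wait l = top"
proof (cases "\<exists>l. service_pairs l = top")
  case True
  then show ?thesis using mean_total_wait_infinite that by blast
next
  case False
  then have "batch_pairs k = top" using assms by blast
  moreover have "0 < (service_mean k)\<^sup>2" using service_mean_ge_1[of k] by simp
  ultimately have "work_square k = top"
    unfolding work_square_eq by (simp add: ennreal_mult_top)
  then have "(\<integral>\<^sup>+\<omega>. of_nat (backlog 0 \<omega>) \<partial>M) = top"
    unfolding mean_backlog_loynes by (rule work_square_infinite)
  then obtain l where "mean_service l * mean_total_wait l + mean_batch l * (mean_service l + service_pairs l) = top"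
    unfolding mean_backlog_waiting by (auto simp: ennreal_sum_eq_top)
  then have "mean_total_wait l = top"
    using False unfolding mean_service_eq mean_batch_eq by (auto simp: ennreal_mult_eq_top_iff)
  then show ?thesis using that by blast
qed

lemma mean_total_wait_finite:
  assumes "\<And>k. service_pairs k < top" "\<And>k. batch_pairs k < top"
  shows "mean_total_wait k < top"
proof -
  have "work_square l < top" for l
    unfolding work_square_eq using assms[of l] by (simp add: ennreal_mult_less_top)
  then obtain x where "(\<integral>\<^sup>+\<omega>. of_nat (backlog 0 \<omega>) \<partial>M) = ennreal x" by (rule mean_backlog_formula)
  then have "(\<Sum>k\<in>UNIV. mean_service k * mean_total_wait k + mean_batch k * (mean_service k + service_pairs k)) < top"
    unfolding mean_backlog_waiting[symmetric] by simp
  then have "mean_service k * mean_total_wait k + mean_batch k * (mean_service k + service_pairs k) < top"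
    unfolding top.not_eq_extremum[symmetric] by (auto simp: ennreal_sum_eq_top simp del: ennreal_add_eq_top)
  then have "mean_service k * mean_total_wait k < top" by simp
  then show ?thesis
    using service_mean_ge_1[of k] unfolding mean_service_eq by (auto simp: ennreal_mult_less_top)
qed

text \<open>With finite second moments every term is a real number, and the identity above applies. Otherwise
  some mean waiting time is infinite, and so is the first or the third term on the right-hand side,
  whereas the subtracted sum is always finite.\<close>

lemma weighted_mean_waiting:
  defines "\<rho> \<equiv> \<Sum>k\<in>UNIV. ereal (class_load k)"
  shows "(\<Sum>k\<in>UNIV. ereal (class_load k) * (enn2ereal (mean_total_wait k) / ereal (rate k)))
    = \<rho> * (\<Sum>k\<in>UNIV. ereal (class_load k) * enn2ereal (service_pairs k / ennreal (service_mean k))) / (1 - \<rho>)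
      + (\<Sum>k\<in>UNIV. ereal (class_load k) * (\<rho> - ereal (class_load k))) / (2 * (1 - \<rho>))
      + (\<Sum>k\<in>UNIV. ereal (class_load k) * ereal (service_mean k) *
          (enn2ereal ((batch_pairs k + ennreal (batch_arrivals k)) / ennreal (rate k))
           - ereal (\<pi>on k) * (ereal ((batch_time k + active_arrivals k) / start k) / ereal (\<pi>on k / start k)))) / (1 - \<rho>)
      + (\<Sum>k\<in>UNIV. ereal (\<pi>on k) * ereal (class_load k) * (1 + ereal (class_load k) / (1 - \<rho>))
          * (1 + ereal (active_time k / \<pi>on k - 1)))
      - (\<Sum>k\<in>UNIV. ereal (\<pi>on k) * ereal (service_mean k) * ereal (active_arrivals k / \<pi>on k))"
    (is "?L = \<rho> * ?T1 / (1 - \<rho>) + ?T2 / (2 * (1 - \<rho>)) + ?T3 / (1 - \<rho>) + ?T4 - ?T5")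
proof -
  have \<rho>: "\<rho> = ereal total_load" by (simp add: \<rho>_def total_load_def)
  have \<rho>1: "1 - \<rho> = ereal (1 - total_load)" unfolding \<rho> by (simp add: one_ereal_def)
  have \<rho>2: "2 * (1 - \<rho>) = ereal (2 * (1 - total_load))" 
  proof -
    have "2 = ereal 2" by simp
    then show ?thesis unfolding \<rho>1 by (simp only: times_ereal.simps(1))
  qed
  have r: "0 < rate k" and s: "0 < service_mean k" and c: "0 < class_load k" and q: "0 < \<pi>on k" for k
    using rate_pos[of k] service_mean_ge_1[of k] class_load_pos[of k] active_prob_pos[of k] by auto
  have D: "0 < 1 - total_load" using total_load_less_1 by simp
  have q2: "ereal (\<pi>on k) * (ereal ((batch_time k + active_arrivals k) / start k) / ereal (\<pi>on k / start k))
      = ereal (batch_time k + active_arrivals k)" for k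
    using q[of k] start_factors[of k] by simp
  have T5: "?T5 = ereal (\<Sum>k\<in>UNIV. service_mean k * active_arrivals k)"
  proof -
    have "ereal (\<pi>on k) * ereal (service_mean k) * ereal (active_arrivals k / \<pi>on k) = ereal (service_mean k * active_arrivals k)" for k
      using q[of k] by simp
    then show ?thesis by (simp only: sum_ereal)
  qed
  show ?thesis
  proof (cases "\<forall>k. service_pairs k < top \<and> batch_pairs k < top")
    case True
    define wt H2 A2 where "wt k = enn2real (mean_total_wait k)"
      and "H2 k = enn2real (service_pairs k)" and "A2 k = enn2real (batch_pairs k)" for k
    have wt: "mean_total_wait k = ennreal (wt k)" "0 \<le> wt k" for k
      unfolding wt_def using True mean_total_wait_finite[of k] by auto
    have H2: "service_pairs k = ennreal (H2 k)" "0 \<le> H2 k" for k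
      unfolding H2_def using True by auto
    have A2: "batch_pairs k = ennreal (A2 k)" "0 \<le> A2 k" for k
      unfolding A2_def using True by auto
    have L: "?L = ereal (\<Sum>k\<in>UNIV. service_mean k * wt k)"
    proof -
      have "ereal (class_load k) * (enn2ereal (mean_total_wait k) / ereal (rate k)) = ereal (service_mean k * wt k)" for k
        unfolding wt(1) enn2ereal_ennreal[OF wt(2)] using r[of k] by (simp add: class_load_def)
      then show ?thesis by (simp only: sum_ereal)
    qed
    have T1: "?T1 = ereal (\<Sum>k\<in>UNIV. rate k * H2 k)"
    proof -
      have "ereal (class_load k) * enn2ereal (service_pairs k / ennreal (service_mean k)) = ereal (rate k * H2 k)" for k
        unfolding H2(1) using s[of k] H2(2)[of k] by (simp add: divide_ennreal enn2ereal_ennreal class_load_def)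
      then show ?thesis by (simp only: sum_ereal)
    qed
    have T2: "?T2 = ereal (\<Sum>k\<in>UNIV. class_load k * (total_load - class_load k))"
      unfolding \<rho> by (simp only: ereal_minus(1) times_ereal.simps(1) sum_ereal)
    have T3: "?T3 = ereal (\<Sum>k\<in>UNIV. (service_mean k)\<^sup>2 * (A2 k + batch_arrivals k)
        - class_load k * service_mean k * (batch_time k + active_arrivals k))"
    proof -
      have "ereal (class_load k) * ereal (service_mean k) *
          (enn2ereal ((batch_pairs k + ennreal (batch_arrivals k)) / ennreal (rate k))
           - ereal (\<pi>on k) * (ereal ((batch_time k + active_arrivals k) / start k) / ereal (\<pi>on k / start k)))
        = ereal ((service_mean k)\<^sup>2 * (A2 k + batch_arrivals k)
           - class_load k * service_mean k * (batch_time k + active_arrivals k))" for k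
      proof -
        have "enn2ereal ((batch_pairs k + ennreal (batch_arrivals k)) / ennreal (rate k)) = ereal ((A2 k + batch_arrivals k) / rate k)"
          unfolding A2(1) using r[of k] A2(2)[of k] phase_means_nonneg[of k]
          by (simp add: divide_ennreal enn2ereal_ennreal flip: ennreal_plus)
        then show ?thesis
          unfolding q2 using r[of k] by (simp add: class_load_def power2_eq_square field_simps)
      qed
      then show ?thesis by (simp only: sum_ereal)
    qed
    have T4: "?T4 = ereal (\<Sum>k\<in>UNIV. class_load k * (1 + class_load k / (1 - total_load)) * active_time k)"
    proof -
      have "ereal (\<pi>on k) * ereal (class_load k) * (1 + ereal (class_load k) / (1 - \<rho>)) * (1 + ereal (active_time k / \<pi>on k - 1))
          = ereal (class_load k * (1 + class_load k / (1 - total_load)) * active_time k)" for k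
        unfolding \<rho>1 using q[of k] D by (simp add: one_ereal_def)
      then show ?thesis by (simp only: sum_ereal)
    qed
    show ?thesis
      unfolding L T1 T2 T3 T4 T5 \<rho>2 unfolding \<rho>1 unfolding \<rho> mean_wait_identity[OF wt H2 A2]
      using D by simp
  next
    case False
    then obtain k where k: "service_pairs k = top \<or> batch_pairs k = top"
      unfolding top.not_eq_extremum[symmetric] by blast
    obtain l where "mean_total_wait l = top" by (rule mean_total_wait_top[OF k])
    then have "ereal (class_load l) * (enn2ereal (mean_total_wait l) / ereal (rate l)) = \<infinity>"
      using c[of l] r[of l] by (simp add: top_ereal_def divide_ereal_def)
    then have L: "?L = \<infinity>" unfolding sum_Pinfty by auto
    have top: "\<rho> * ?T1 / (1 - \<rho>) = \<infinity> \<or> ?T3 / (1 - \<rho>) = \<infinity>"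
      using k
    proof
      assume "service_pairs k = top"
      then have "ereal (class_load k) * enn2ereal (service_pairs k / ennreal (service_mean k)) = \<infinity>"
        using c[of k] s[of k] by (simp add: ennreal_top_divide top_ereal_def)
      then have "?T1 = \<infinity>" unfolding sum_Pinfty by auto
      then show ?thesis unfolding \<rho>1 unfolding \<rho> using D total_load_pos by (simp add: divide_ereal_def)
    next
      assume "batch_pairs k = top"
      then have "ereal (class_load k) * ereal (service_mean k) *
          (enn2ereal ((batch_pairs k + ennreal (batch_arrivals k)) / ennreal (rate k))
           - ereal (\<pi>on k) * (ereal ((batch_time k + active_arrivals k) / start k) / ereal (\<pi>on k / start k))) = \<infinity>"
        unfolding q2 using c[of k] s[of k] r[of k] by (simp add: ennreal_top_divide top_ereal_def)
      then have "?T3 = \<infinity>"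
        unfolding sum_Pinfty by (intro conjI bexI[of _ k] finite UNIV_I)
      then show ?thesis unfolding \<rho>1 using D by (simp add: divide_ereal_def)
    qed
    have "\<infinity> = u + v + w + x - ereal y" if "u = \<infinity> \<or> w = \<infinity>" for u v w x :: ereal and y
      using that by auto
    from this[OF top] show ?thesis unfolding L T5 .
  qed
qed

end

theorem theorem7:
  fixes M :: "'a measure"
    and m :: "'k::finite \<Rightarrow> nat"
    and p :: "'k \<Rightarrow> real"
    and \<alpha> :: "'k \<Rightarrow> nat \<Rightarrow> real"
    and T :: "'k \<Rightarrow> nat \<Rightarrow> nat \<Rightarrow> real"
    and a :: "'k \<Rightarrow> nat \<Rightarrow> nat \<Rightarrow> nat pmf"
    and H :: "'k \<Rightarrow> nat pmf"
    and S A :: "'k \<Rightarrow> int \<Rightarrow> 'a \<Rightarrow> nat"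
    and h W :: "'k \<Rightarrow> int \<Rightarrow> nat \<Rightarrow> 'a \<Rightarrow> nat"
    and F :: "int \<Rightarrow> 'a measure"
  assumes queue: "stationary_queue M m p \<alpha> T a H S A h W F"
    and stable: "(\<Sum>k \<in> UNIV. load M (p k) (H k) (S k) (A k)) < 1"
  shows
    "let EW = (\<lambda>k. mean_waiting_time M (A k) (W k));
         \<rho>k = (\<lambda>k. load M (p k) (H k) (S k) (A k));
         \<rho> = (\<Sum>k \<in> UNIV. \<rho>k k);
         \<pi> = (\<lambda>k. active_probability M (p k) (S k));
         EH = (\<lambda>k. mean (measure_pmf (H k)) (\<lambda>x. x));
         EH_eq = (\<lambda>k. equilibrium_mean (measure_pmf (H k)) (\<lambda>x. x));
         EC = (\<lambda>k. mean (active_period M (S k)) (period_length (S k)));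
         EC_eq = (\<lambda>k. equilibrium_mean (active_period M (S k)) (period_length (S k)));
         E\<Lambda>_eq = (\<lambda>k. equilibrium_mean (active_period M (S k)) (period_arrivals (S k) (A k)));
         EC\<Lambda> = (\<lambda>k. mean (active_period M (S k))
                 (\<lambda>\<omega>. period_length (S k) \<omega> * period_arrivals (S k) (A k) \<omega>));
         E\<Lambda>C_eq = (\<lambda>k. mean (active_slot M (S k)) (forward_arrivals (S k) (A k)))
     in (\<Sum>k \<in> UNIV. \<rho>k k * EW k)
        = \<rho> * (\<Sum>k \<in> UNIV. \<rho>k k * EH_eq k) / (1 - \<rho>)
          + (\<Sum>k \<in> UNIV. \<rho>k k * (\<rho> - \<rho>k k)) / (2 * (1 - \<rho>))
          + (\<Sum>k \<in> UNIV. \<rho>k k * EH k * (E\<Lambda>_eq k - \<pi> k * (EC\<Lambda> k / EC k))) / (1 - \<rho>)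
          + (\<Sum>k \<in> UNIV. \<pi> k * \<rho>k k * (1 + \<rho>k k / (1 - \<rho>)) * (1 + EC_eq k))
          - (\<Sum>k \<in> UNIV. \<pi> k * EH k * E\<Lambda>C_eq k)"
proof -
  interpret stationary_queue M m p \<alpha> T a H S A h W F by (rule queue)
  interpret stable_queue M m p \<alpha> T a H S A h W F
  proof unfold_locales
    have "enn2ereal (\<Sum>k\<in>UNIV. mean_batch k * mean_service k) = (\<Sum>k\<in>UNIV. load M (p k) (H k) (S k) (A k))"
      unfolding load_eq by simp
    then show "(\<Sum>k\<in>UNIV. mean_batch k * mean_service k) < 1"
      using stable by (simp add: less_ennreal.rep_eq one_ennreal.rep_eq)
  qed
  show ?thesis
    unfolding Let_def load_real active_probability_eq mean_service_real equilibrium_service mean_length_real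
      equilibrium_length equilibrium_arrivals mean_product_real mean_forward_real mean_waiting_eq
    by (rule weighted_mean_waiting)
qed

end
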